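(* Let $N>4$ be real, let $\ell_1,L_0$ be real-valued real-analytic functions on a neighborhood of $[0,1]$, and let $$\mathcal L=-x(1-x)\frac{d^2}{dx^2}-\Big(\frac52(1-x)-\frac N2x\Big)\frac{d}{dx}+\ell_1(x)\,x(1-x)\frac{d}{dx}+L_0(x).$$ Let $U\subset\mathbb R$ be a neighborhood of $0$ and let $J=J(x,y,z)\in\mathfrak A^0(U^2)$, $H_1=H_1(x,y,z,v)\in\mathfrak A^0(U^3)$, $H_2=H_2(x,y,z,v,w)\in\mathfrak A^2(U^4)$ (classes defined in the context). Suppose: (i) $H_1(x,0,0,0)=J(x,0,0)^{-1}$, and there is a constant $C>1$ such that $\frac1C<J(x,0,0)<C$ for all $x$ in a neighborhood of $[0,1]$; (ii) as $x\to1$ (in the sense defined in the context), $$\partial_zJ\equiv0,\qquad (\partial_zH_1)\mathcal Ly+\partial_zH_2\equiv0,\qquad \partial_wH_2\equiv0 .$$ Let $T>0$. Then there exist a positive number $\delta(T)$ and a number $\mathfrak K$ such that the following holds. Let $y^*,v^*\in C^\infty([0,T]\times[0,1])$ be functions for which $y^*,\ x\partial_xy^*,\ v^*,\ x\partial_xv^*$ take values in $U$ on $[0,T]\times[0,1]$ and $$\max_{j+k\le\mathfrak K}\|\partial_t^j\partial_x^k(y^*,v^* )\|_{L^\infty([0,T]\times[0,1])}\le\delta(T).$$ Then there exist $y,v\in C^\infty([0,T]\times[0,1])$ satisfying, on $[0,T]\times[0,1]$, $$\frac{\partial y}{\partial t}-J(x,y,z)v=0,\qquad \frac{\partial v}{\partial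 t}+H_1(x,y,z,v)\mathcal Ly+H_2(x,y,z,v,w)=0,$$ where $z=x\,\partial y/\partial x$ and $w=x\,\partial v/\partial x$, and such that $y=y^*+\tilde y$, $v=v^*+\tilde v$ with $\tilde y|_{t=0}=0$ and $\tilde v|_{t=0}=0$.
   Context: $\mathfrak A^Q(U^p)$ denotes the set of all real-analytic functions $f(x,y_1,\dots,y_p)$ of $x$ in a neighborhood of $[0,1]$ and $y_1,\dots,y_p\in U$ such that $f(x,y_1,\dots,y_p)=\sum_{k_1+\cdots+k_p\ge Q}a_{k_1\cdots k_p}(x)y_1^{k_1}\cdots y_p^{k_p}$. Meaning of "$\equiv 0$ as $x\to1$": a function $f(x,y_1,\dots,y_p)$ defined and analytic on a neighborhood of $(1,0,\dots,0)$ satisfies $f\equiv0$ as $x\to1$ if there is a function $\Omega$ analytic on a neighborhood of $(1,0,\dots,0)$ with $f(x,y_1,\dots,y_p)=(1-x)\,\Omega(x,y_1,\dots,y_p)$. In hypothesis (ii) the three functions are regarded as functions of the independent variables $x,\,y,\,Dy,\,D^2y,\,v,\,Dv$ (with $D=\partial/\partial x$), by substituting $z=x\,Dy$, $w=x\,Dv$ and $\mathcal Ly=-x(1-x)D^2y-(\frac52(1-x)-\frac N2x)Dy+\ell_1(x)x(1-x)Dy+L_0(x)y$. A solution is understood to have $y,\ z=x\partial_xy,\ v,\ w=x\partial_xv$ taking values in $U$, so that the equations make sense. *)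

theory Defs
  imports "HOL-Analysis.Analysis"
begin

definition multi_indices :: "('a::euclidean_space \<Rightarrow> nat) set" where
  "multi_indices = {k. \<forall>b. b \<notin> Basis \<longrightarrow> k b = 0}"

definition mi_degree :: "('a::euclidean_space \<Rightarrow> nat) \<Rightarrow> nat" where
  "mi_degree k = (\<Sum>b\<in>Basis. k b)"

definition mi_power :: "'a::euclidean_space \<Rightarrow> ('a \<Rightarrow> nat) \<Rightarrow> real" where
  "mi_power h k = (\<Prod>b\<in>Basis. (h \<bullet> b) ^ k b)"

text \<open>
  As the expansion has to hold on a full ball, functions are analytic on a set
  in the sense that they are analytic on some open neighbourhood of it.
\<close>

definition real_analytic_at :: "('a::euclidean_space \<Rightarrow> real) \<Rightarrow> 'a \<Rightarrow> bool" where
  "real_analytic_at f a \<longleftrightarrow>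
     (\<exists>r>0. \<exists>c. \<forall>h. norm h < r \<longrightarrow>
        ((\<lambda>k. c k * mi_power h k) has_sum f (a + h)) multi_indices)"

definition real_analytic_on ::
    "('a::euclidean_space \<Rightarrow> real) \<Rightarrow> 'a set \<Rightarrow> bool" where
  "real_analytic_on f S \<longleftrightarrow> (\<forall>a\<in>S. real_analytic_at f a)"

text \<open>
  A function of \<open>x, y\<^sub>1, \<dots>, y\<^sub>p\<close> is a function on \<open>real \<times> 'a\<close> where \<open>'a\<close> has
  dimension \<open>p\<close>; for \<open>'a = real \<times> \<dots> \<times> real\<close> it is applied to the tuple
  \<open>(x, y\<^sub>1, \<dots>, y\<^sub>p)\<close>.
\<close>

definition cube :: "real set \<Rightarrow> 'a::euclidean_space set" where
  "cube U = {u. \<forall>b\<in>Basis. u \<bullet> b \<in> U}"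

text \<open>
  The class \<open>\<AA>\<^sup>Q(U\<^sup>p)\<close>. Analyticity of the coefficients \<open>a\<^sub>k\<close> need not be required:
  if \<open>U\<close> is a neighbourhood of \<open>0\<close>, they are the Taylor coefficients of \<open>f (x, \<cdot>)\<close> at \<open>0\<close>.
\<close>

definition analytic_class ::
    "nat \<Rightarrow> real set \<Rightarrow> (real \<times> 'a::euclidean_space \<Rightarrow> real) set" where
  "analytic_class Q U =
     {f. \<exists>I. open I \<and> {0..1} \<subseteq> I \<and>
           real_analytic_on f (I \<times> cube U) \<and>
           (\<exists>a. \<forall>x\<in>I. \<forall>u\<in>cube U.
              ((\<lambda>k. a k x * mi_power u k) has_sum f (x, u))
                {k \<in> multi_indices. Q \<le> mi_degree k})}"

definition analytic_near_unit_interval :: "(real \<Rightarrow> real) \<Rightarrow> bool" where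
  "analytic_near_unit_interval f \<longleftrightarrow>
     (\<exists>I. open I \<and> {0..1} \<subseteq> I \<and> real_analytic_on f I)"

definition vanishes_as_x_to_1 :: "(real \<times> 'a::euclidean_space \<Rightarrow> real) \<Rightarrow> bool" where
  "vanishes_as_x_to_1 f \<longleftrightarrow>
     (\<exists>V \<Omega>. open V \<and> (1, 0) \<in> V \<and>
        real_analytic_on f V \<and> real_analytic_on \<Omega> V \<and>
        (\<forall>(x, u)\<in>V. f (x, u) = (1 - x) * \<Omega> (x, u)))"

text \<open>\<open>\<L>y\<close> as a function of independent variables \<open>x, y, Dy, D\<^sup>2y\<close>\<close>

definition L_sym ::
    "real \<Rightarrow> (real \<Rightarrow> real) \<Rightarrow> (real \<Rightarrow> real) \<Rightarrow> real \<Rightarrow> real \<Rightarrow> real \<Rightarrow> real \<Rightarrow> real" where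
  "L_sym N l\<^sub>1 L\<^sub>0 x y Dy D2y =
     - x * (1 - x) * D2y - (5 / 2 * (1 - x) - N / 2 * x) * Dy
     + l\<^sub>1 x * x * (1 - x) * Dy + L\<^sub>0 x * y"

text \<open>
  Derivatives are taken within the set, hence one-sided at the boundary of the rectangle;
  they only depend on the values of the function in the set.
\<close>

definition partial_within ::
    "'a::euclidean_space set \<Rightarrow> 'a \<Rightarrow> ('a \<Rightarrow> real) \<Rightarrow> 'a \<Rightarrow> real" where
  "partial_within S b f = (\<lambda>p. frechet_derivative f (at p within S) b)"

primrec C_diff_on :: "nat \<Rightarrow> 'a::euclidean_space set \<Rightarrow> ('a \<Rightarrow> real) \<Rightarrow> bool" where
  "C_diff_on 0 S f \<longleftrightarrow> continuous_on S f"
| "C_diff_on (Suc n) S f \<longleftrightarrow>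
     f differentiable_on S \<and> (\<forall>b\<in>Basis. C_diff_on n S (partial_within S b f))"

definition C_infinity_on :: "'a::euclidean_space set \<Rightarrow> ('a \<Rightarrow> real) \<Rightarrow> bool" where
  "C_infinity_on S f \<longleftrightarrow> (\<forall>n. C_diff_on n S f)"

definition rect :: "real \<Rightarrow> (real \<times> real) set" where
  "rect T = {0..T} \<times> {0..1}"

definition D_t :: "real \<Rightarrow> (real \<times> real \<Rightarrow> real) \<Rightarrow> real \<times> real \<Rightarrow> real" where
  "D_t T = partial_within (rect T) (1, 0)"

definition D_x :: "real \<Rightarrow> (real \<times> real \<Rightarrow> real) \<Rightarrow> real \<times> real \<Rightarrow> real" where
  "D_x T = partial_within (rect T) (0, 1)"

definition xD_x :: "real \<Rightarrow> (real \<times> real \<Rightarrow> real) \<Rightarrow> real \<times> real \<Rightarrow> real" where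
  "xD_x T f = (\<lambda>(t, x). x * D_x T f (t, x))"

definition L_op ::
    "real \<Rightarrow> (real \<Rightarrow> real) \<Rightarrow> (real \<Rightarrow> real) \<Rightarrow> real \<Rightarrow>
     (real \<times> real \<Rightarrow> real) \<Rightarrow> real \<times> real \<Rightarrow> real" where
  "L_op N l\<^sub>1 L\<^sub>0 T f =
     (\<lambda>(t, x). L_sym N l\<^sub>1 L\<^sub>0 x (f (t, x)) (D_x T f (t, x)) (D_x T (D_x T f) (t, x)))"

definition takes_values_in ::
    "real \<Rightarrow> real set \<Rightarrow> (real \<times> real \<Rightarrow> real) \<Rightarrow> (real \<times> real \<Rightarrow> real) \<Rightarrow> bool" where
  "takes_values_in T U y v \<longleftrightarrow>
     (\<forall>p\<in>rect T. y p \<in> U \<and> xD_x T y p \<in> U \<and> v p \<in> U \<and> xD_x T v p \<in> U)"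

text \<open>
  For continuous functions the \<open>L\<^sup>\<infinity>\<close> norm on the rectangle is the supremum; the pair is
  measured by the larger of the norms of its two components.
\<close>

definition C_norm_le ::
    "real \<Rightarrow> nat \<Rightarrow> (real \<times> real \<Rightarrow> real) \<Rightarrow> (real \<times> real \<Rightarrow> real) \<Rightarrow> real \<Rightarrow> bool" where
  "C_norm_le T K y v d \<longleftrightarrow>
     (\<forall>j k. j + k \<le> K \<longrightarrow> (\<forall>p\<in>rect T.
        \<bar>(D_t T ^^ j) ((D_x T ^^ k) y) p\<bar> \<le> d \<and>
        \<bar>(D_t T ^^ j) ((D_x T ^^ k) v) p\<bar> \<le> d))"

definition solves ::
    "real \<Rightarrow> (real \<Rightarrow> real) \<Rightarrow> (real \<Rightarrow> real) \<Rightarrow> (real \<times> real \<times> real \<Rightarrow> real) \<Rightarrow>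
     (real \<times> real \<times> real \<times> real \<Rightarrow> real) \<Rightarrow>
     (real \<times> real \<times> real \<times> real \<times> real \<Rightarrow> real) \<Rightarrow>
     real \<Rightarrow> (real \<times> real \<Rightarrow> real) \<Rightarrow> (real \<times> real \<Rightarrow> real) \<Rightarrow> bool" where
  "solves N l\<^sub>1 L\<^sub>0 J H\<^sub>1 H\<^sub>2 T y v \<longleftrightarrow>
     (\<forall>(t, x)\<in>rect T.
        let Y = y (t, x); Z = xD_x T y (t, x); V = v (t, x); W = xD_x T v (t, x) in
        D_t T y (t, x) - J (x, Y, Z) * V = 0 \<and>
        D_t T v (t, x) + H\<^sub>1 (x, Y, Z, V) * L_op N l\<^sub>1 L\<^sub>0 T y (t, x) + H\<^sub>2 (x, Y, Z, V, W) = 0)"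

end

theory Submission
  imports Defs "HOL-Complex_Analysis.Great_Picard" "HOL-Library.Diagonal_Subsequence"
begin

text \<open>
  With \<open>u = y\<^sub>t = J v\<close> the system becomes one quasilinear wave equation \<open>u\<^sub>t + G = 0\<close>, where \<open>G\<close> is a
  smooth function of \<open>x, y, Dy, D\<^sup>2y, u, Du\<close>. By hypothesis (ii), the derivatives of \<open>G\<close> with respect
  to \<open>D\<^sup>2y\<close>, \<open>Du\<close> and \<open>Dy\<close> are \<open>-x(1-x)A\<close>, \<open>x(1-x)B\<close> and \<open>-(5/2(1-x) - N/2 x)A + x(1-x)C\<close> with
  smooth \<open>A > 0\<close>, \<open>B\<close>, \<open>C\<close>. This is what makes the weights \<open>w\<^sub>k = x\<^bsup>3/2+k\<^esup>(1-x)\<^bsup>N/2-1+k\<^esup>\<close> fit: differentiating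
  \<open>k\<close> times gives an equation of the same shape for \<open>k + 1\<close>, with a symmetric energy and no loss of
  derivatives, so no Nash--Moser iteration is needed.

  Approximate solutions are polynomials in \<open>x\<close>, obtained by projecting the equation with respect to \<open>w\<^sub>0\<close>.
  Integrating by parts with the weights, the projected equation can be tested with weighted derivatives
  of \<open>u\<^sub>t\<close>, which are again polynomials. The energy of a fixed high order stays small for small data, and
  then every higher energy grows at most exponentially. Weighted Sobolev inequalities turn this into
  uniform bounds of all derivatives, and a diagonal subsequence converges to a smooth solution.
\<close>

section \<open>Smooth functions of several variables\<close>

text \<open>The obstacle is the counting of derivatives near the endpoints. An energy of order
  \<open>k\<close> bounds only about \<open>k / 2\<close> derivatives uniformly; each further one
  costs a factor \<open>x * (1 - x)\<close>. A product of two high-order factors in the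
  \<open>k\<close>-th differentiated equation must therefore be paid for by the weight
  \<open>w k\<close>. This works if \<open>k + 8 \<le> 4 * h\<close>, where \<open>h\<close> is the
  number of derivatives bounded without weight: the square of the singularity is then at most the
  inverse \<open>k\<close>-th power of \<open>x * (1 - x)\<close>.

  The exponents come from \<open>5/2 = 3/2 + 1\<close> and \<open>N/2 = (N/2 - 1) + 1\<close>: the
  singular first-order coefficient times \<open>w 0\<close> is the derivative of
  \<open>x * (1 - x) * w 0\<close>.

  Polynomials form a good Galerkin space because the adjoint of differentiation between consecutive
  weights, \<open>\<phi> \<mapsto> - (d k * \<phi> + x * (1 - x) * \<phi>')\<close>, raises the
  degree by at most one, which is what differentiation takes away.

  The given pair enters only through its values at \<open>t = 0\<close>; the initial value of
  \<open>u\<close> is \<open>J\<close> times that of \<open>v\<close>. All estimates presuppose that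
  the jets stay in a small box; outside it \<open>G\<close> is truncated, and smallness of one
  energy shows that the truncation is never active.\<close>

primrec cdiff :: "nat \<Rightarrow> 'a::euclidean_space set \<Rightarrow> ('a \<Rightarrow> real) \<Rightarrow> bool" where
 "cdiff 0 S f \<longleftrightarrow> continuous_on S f"
| "cdiff (Suc n) S f \<longleftrightarrow>
   (\<exists>g. (\<forall>p\<in>S. (f has_derivative g p) (at p within S)) \<and> (\<forall>b\<in>Basis. cdiff n S (\<lambda>p. g p b)))"

lemma cdiff_cong:
 assumes "cdiff n S f" "\<And>p. p \<in> S \<Longrightarrow> f p = g p"
 shows "cdiff n S g"
proof (cases n)
 case 0
 then show ?thesis using assms by (simp cong: continuous_on_cong)
next
 case (Suc m)
 then obtain D where "\<forall>p\<in>S. (f has_derivative D p) (at p within S)"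
   "\<forall>b\<in>Basis. cdiff m S (\<lambda>p. D p b)"
  using assms by auto
 moreover have "\<forall>p\<in>S. (g has_derivative D p) (at p within S)"
  using calculation(1) assms(2) by (metis has_derivative_transform)
 ultimately show ?thesis using Suc by auto
qed

lemma cdiff_continuous: "cdiff n S f \<Longrightarrow> continuous_on S f"
 by (cases n) (auto simp: continuous_on_eq_continuous_within intro: has_derivative_continuous)

lemma cdiff_SucD: "cdiff (Suc n) S f \<Longrightarrow> cdiff n S f"
proof (induction n arbitrary: f)
 case 0
 then show ?case using cdiff_continuous by (metis cdiff.simps(1))
next
 case (Suc n)
 from Suc.prems obtain g where g: "\<forall>p\<in>S. (f has_derivative g p) (at p within S)"
  "\<forall>b\<in>Basis. cdiff (Suc n) S (\<lambda>p. g p b)" by (auto simp only: cdiff.simps(2))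
 then show ?case using Suc.IH by (auto simp only: cdiff.simps(2))
qed

lemma cdiff_subset: "cdiff n S f \<Longrightarrow> S' \<subseteq> S \<Longrightarrow> cdiff n S' f"
proof (induction n arbitrary: f)
 case 0
 then show ?case using continuous_on_subset by auto
next
 case (Suc n)
 from Suc.prems obtain g where g: "\<forall>p\<in>S. (f has_derivative g p) (at p within S)"
  "\<forall>b\<in>Basis. cdiff n S (\<lambda>p. g p b)" by auto
 have "\<forall>p\<in>S'. (f has_derivative g p) (at p within S')"
  using g(1) Suc.prems(2) has_derivative_subset by blast
 then show ?case using Suc.IH Suc.prems(2) g(2) by auto
qed

lemma cdiff_const [simp]: "cdiff n S (\<lambda>_. c)"
proof (induction n arbitrary: c)
 case (Suc n)
 then show ?case by (auto intro!: exI[of _ "\<lambda>_ _. 0"])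
qed simp

lemma cdiff_linear: "bounded_linear f \<Longrightarrow> cdiff n S f"
proof (cases n)
 case 0
 assume "bounded_linear f" with 0 show ?thesis by (simp add: linear_continuous_on)
next
 case (Suc m)
 assume "bounded_linear f" with Suc show ?thesis
  by (auto intro!: exI[of _ "\<lambda>_. f"] bounded_linear_imp_has_derivative)
qed

lemma cdiff_add: "cdiff n S f \<Longrightarrow> cdiff n S g \<Longrightarrow> cdiff n S (\<lambda>p. f p + g p)"
proof (induction n arbitrary: f g)
 case 0
 then show ?case by (auto intro: continuous_on_add)
next
 case (Suc n)
 from Suc.prems obtain f' g' where
  "\<forall>p\<in>S. (f has_derivative f' p) (at p within S)" "\<forall>b\<in>Basis. cdiff n S (\<lambda>p. f' p b)"
  "\<forall>p\<in>S. (g has_derivative g' p) (at p within S)" "\<forall>b\<in>Basis. cdiff n S (\<lambda>p. g' p b)"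
  by auto
 then show ?case using Suc.IH
  by (auto intro!: exI[of _ "\<lambda>p h. f' p h + g' p h"] has_derivative_add)
qed

lemma cdiff_mult: "cdiff n S f \<Longrightarrow> cdiff n S g \<Longrightarrow> cdiff n S (\<lambda>p. f p * g p)"
proof (induction n arbitrary: f g)
 case 0
 then show ?case by (auto intro: continuous_on_mult)
next
 case (Suc n)
 have "cdiff n S f" "cdiff n S g" using Suc.prems cdiff_SucD by blast+
 moreover from Suc.prems obtain f' g' where
  "\<forall>p\<in>S. (f has_derivative f' p) (at p within S)" "\<forall>b\<in>Basis. cdiff n S (\<lambda>p. f' p b)"
  "\<forall>p\<in>S. (g has_derivative g' p) (at p within S)" "\<forall>b\<in>Basis. cdiff n S (\<lambda>p. g' p b)"
  by auto
 ultimately show ?case using Suc.IH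
  by (auto intro!: exI[of _ "\<lambda>p h. f p * g' p h + f' p h * g p"] has_derivative_mult cdiff_add)
qed

lemma cdiff_minus: "cdiff n S f \<Longrightarrow> cdiff n S (\<lambda>p. - f p)"
 using cdiff_mult[of n S "\<lambda>_. -1" f] by simp

lemma cdiff_diff: "cdiff n S f \<Longrightarrow> cdiff n S g \<Longrightarrow> cdiff n S (\<lambda>p. f p - g p)"
 unfolding diff_conv_add_uminus by (rule cdiff_add[OF _ cdiff_minus])

lemma cdiff_sum: "(\<And>i. i \<in> I \<Longrightarrow> cdiff n S (f i)) \<Longrightarrow> cdiff n S (\<lambda>p. \<Sum>i\<in>I. f i p)"
 by (induction I rule: infinite_finite_induct) (simp_all add: cdiff_add)

lemma cdiff_inverse:
 assumes "cdiff n S f" "\<And>p. p \<in> S \<Longrightarrow> f p \<noteq> 0"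
 shows "cdiff n S (\<lambda>p. inverse (f p))"
 using assms(1)
proof (induction n)
 case 0
 then show ?case using assms(2) by (auto intro: continuous_on_inverse)
next
 case (Suc n)
 have inv: "cdiff n S (\<lambda>p. inverse (f p))" using Suc cdiff_SucD by blast
 from Suc.prems obtain f' where f':
  "\<forall>p\<in>S. (f has_derivative f' p) (at p within S)" "\<forall>b\<in>Basis. cdiff n S (\<lambda>p. f' p b)"
  by auto
 have "\<forall>p\<in>S. ((\<lambda>p. inverse (f p)) has_derivative
   (\<lambda>h. - (inverse (f p) * f' p h * inverse (f p)))) (at p within S)"
  using f'(1) assms(2) by (auto intro!: has_derivative_inverse)
 then show ?case using inv f'(2)
  by (auto intro!: exI[of _ "\<lambda>p h. - (inverse (f p) * f' p h * inverse (f p))"]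
    cdiff_mult cdiff_minus)
qed

text \<open>The partial derivatives of the composition are sums of products
  \<open>g i p b * f' (\<phi> p) i\<close>. The induction on \<open>n\<close> closes because the
  inner components are also known at the lower order (\<open>low\<close>).\<close>

lemma cdiff_compose:
 fixes \<phi> :: "'a::euclidean_space \<Rightarrow> 'b::euclidean_space"
 assumes "cdiff n S' f" "\<phi> ` S \<subseteq> S'" "\<And>i. i \<in> Basis \<Longrightarrow> cdiff n S (\<lambda>p. \<phi> p \<bullet> i)"
 shows "cdiff n S (\<lambda>p. f (\<phi> p))"
 using assms(1,3)
proof (induction n arbitrary: f)
 case 0
 have "continuous_on S \<phi>"
  using 0 by (subst continuous_on_componentwise) auto
 then show ?case using 0 assms(2) by (auto intro: continuous_on_compose2)
next
 case (Suc n)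
 have "\<forall>i\<in>Basis. \<exists>g. (\<forall>p\<in>S. ((\<lambda>p. \<phi> p \<bullet> i) has_derivative g p) (at p within S)) \<and>
   (\<forall>b\<in>Basis. cdiff n S (\<lambda>p. g p b))" using Suc.prems(2) by simp
 then obtain g where g: "\<And>i p. i \<in> Basis \<Longrightarrow> p \<in> S \<Longrightarrow> ((\<lambda>p. \<phi> p \<bullet> i) has_derivative g i p) (at p within S)"
   "\<And>i b. i \<in> Basis \<Longrightarrow> b \<in> Basis \<Longrightarrow> cdiff n S (\<lambda>p. g i p b)" by metis
 obtain f' where f': "\<And>p. p \<in> S' \<Longrightarrow> (f has_derivative f' p) (at p within S')"
   "\<And>b. b \<in> Basis \<Longrightarrow> cdiff n S' (\<lambda>p. f' p b)" using Suc.prems(1) by auto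
 have low: "\<And>i. i \<in> Basis \<Longrightarrow> cdiff n S (\<lambda>p. \<phi> p \<bullet> i)"
  using Suc.prems(2) cdiff_SucD by blast
 define \<phi>' where "\<phi>' p h = (\<Sum>i\<in>Basis. g i p h *\<^sub>R i)" for p h
 have d: "(\<phi> has_derivative \<phi>' p) (at p within S)" if "p \<in> S" for p
 proof (subst has_derivative_componentwise_within, rule ballI)
  fix i :: 'b assume i: "i \<in> Basis"
  have "(\<lambda>h. \<phi>' p h \<bullet> i) = g i p"
   using i by (auto simp: \<phi>'_def inner_sum_left inner_Basis if_distrib cong: if_cong)
  then show "((\<lambda>x. \<phi> x \<bullet> i) has_derivative (\<lambda>x. \<phi>' p x \<bullet> i)) (at p within S)"
   using g(1)[OF i that] by simp
 qed
 have comp: "((\<lambda>p. f (\<phi> p)) has_derivative (\<lambda>h. f' (\<phi> p) (\<phi>' p h))) (at p within S)" if "p \<in> S" for p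
  using has_derivative_in_compose2[of S' f f' \<phi> S p] d that f'(1) assms(2) by auto
 have eq: "f' (\<phi> p) (\<phi>' p b) = (\<Sum>i\<in>Basis. g i p b * f' (\<phi> p) i)" if "p \<in> S" for p b
 proof -
  have "linear (f' (\<phi> p))" using f'(1)[of "\<phi> p"] that assms(2) has_derivative_linear by blast
  then show ?thesis unfolding \<phi>'_def by (simp add: linear_sum linear_cmul)
 qed
 have "cdiff n S (\<lambda>p. f' (\<phi> p) (\<phi>' p b))" if b: "b \<in> Basis" for b
 proof (rule cdiff_cong)
  show "cdiff n S (\<lambda>p. \<Sum>i\<in>Basis. g i p b * f' (\<phi> p) i)"
  proof (rule cdiff_sum)
   fix i :: 'b assume i: "i \<in> Basis"
   show "cdiff n S (\<lambda>p. g i p b * f' (\<phi> p) i)"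
    by (rule cdiff_mult[OF g(2)[OF i b] Suc.IH[OF f'(2)[OF i] low]])
  qed
 qed (simp add: eq)
 then show ?case using comp
  by (auto intro!: exI[of _ "\<lambda>p h. f' (\<phi> p) (\<phi>' p h)"])
qed

text \<open>\<open>cdiff\<close> accepts any witness as derivative, so its closure properties hold
  on arbitrary sets, where the derivative within the set may fail to be unique. Where it is unique,
  the witness is \<open>frechet_derivative\<close> and the notion \<open>C_diff_on\<close>
  results.\<close>

lemma cdiff_imp_C_diff_on:
 assumes uniq: "\<And>(f::'a::euclidean_space \<Rightarrow> real) p f' f''. p \<in> S \<Longrightarrow> (f has_derivative f') (at p within S) \<Longrightarrow>
   (f has_derivative f'') (at p within S) \<Longrightarrow> f' = f''"
 shows "cdiff n S f \<Longrightarrow> C_diff_on n S f"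
proof (induction n arbitrary: f)
 case (Suc n)
 then obtain g where g: "\<And>p. p \<in> S \<Longrightarrow> (f has_derivative g p) (at p within S)"
  "\<And>b. b \<in> Basis \<Longrightarrow> cdiff n S (\<lambda>p. g p b)" by auto
 have d: "f differentiable_on S" using g(1) by (auto simp: differentiable_on_def differentiable_def)
 have "frechet_derivative f (at p within S) = g p" if "p \<in> S" for p
  using uniq[OF that _ g(1)[OF that]] d that
  by (simp add: differentiable_on_def frechet_derivative_works)
 then have "cdiff n S (partial_within S b f)" if "b \<in> Basis" for b
  by (intro cdiff_cong[OF g(2)[OF that]]) (simp add: partial_within_def)
 then show ?case using Suc.IH d by simp
qed simp

definition smooth :: "'a::euclidean_space set \<Rightarrow> ('a \<Rightarrow> real) \<Rightarrow> bool" where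
 "smooth S f \<longleftrightarrow> (\<forall>n. cdiff n S f)"

definition pd :: "'a::euclidean_space \<Rightarrow> ('a \<Rightarrow> real) \<Rightarrow> 'a \<Rightarrow> real" where
 "pd b f p = frechet_derivative f (at p) b"

lemma cdiff_open_derivative:
 assumes "open S" "cdiff (Suc n) S f"
 shows "\<And>p. p \<in> S \<Longrightarrow> (f has_derivative frechet_derivative f (at p)) (at p)"
  and "\<And>b. b \<in> Basis \<Longrightarrow> cdiff n S (pd b f)"
proof -
 obtain g where g: "\<And>p. p \<in> S \<Longrightarrow> (f has_derivative g p) (at p within S)"
  "\<And>b. b \<in> Basis \<Longrightarrow> cdiff n S (\<lambda>p. g p b)" using assms by auto
 have g1: "(f has_derivative g p) (at p)" if "p \<in> S" for p
  using g(1)[OF that] at_within_open[OF that assms(1)] by simp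
 have eq: "frechet_derivative f (at p) = g p" if "p \<in> S" for p
  using g1[OF that] by (metis frechet_derivative_at)
 show "(f has_derivative frechet_derivative f (at p)) (at p)" if "p \<in> S" for p
  using g1[OF that] eq[OF that] by simp
 show "cdiff n S (pd b f)" if "b \<in> Basis" for b
  by (rule cdiff_cong[OF g(2)[OF that]]) (simp add: eq pd_def)
qed

lemma smooth_pd: "open S \<Longrightarrow> smooth S f \<Longrightarrow> b \<in> Basis \<Longrightarrow> smooth S (pd b f)"
 unfolding smooth_def by (metis cdiff_open_derivative(2))

lemma smooth_has_derivative:
 assumes "open S" "smooth S f" "p \<in> S"
 shows "(f has_derivative (\<lambda>h. \<Sum>b\<in>Basis. (h \<bullet> b) * pd b f p)) (at p)"
proof -
 have "cdiff (Suc 0) S f" using assms(2) unfolding smooth_def by blast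
 then have d: "(f has_derivative frechet_derivative f (at p)) (at p)"
  using cdiff_open_derivative(1)[OF assms(1) _ assms(3)] by blast
 have "frechet_derivative f (at p) h = (\<Sum>b\<in>Basis. (h \<bullet> b) * pd b f p)" for h
 proof -
  have "linear (frechet_derivative f (at p))" using d has_derivative_linear by blast
  then have "frechet_derivative f (at p) (\<Sum>b\<in>Basis. (h \<bullet> b) *\<^sub>R b) = (\<Sum>b\<in>Basis. (h \<bullet> b) * pd b f p)"
   by (simp add: linear_sum linear_cmul pd_def)
  then show ?thesis by (simp add: euclidean_representation)
 qed
 then show ?thesis using d by (metis (no_types, lifting) ext)
qed

text \<open>The local witnesses are unrelated a priori, but on open sets each of them equals
  \<open>frechet_derivative f (at p)\<close>, which serves as a global witness.\<close>

lemma cdiff_open_local: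
 assumes "open S" "\<And>p. p \<in> S \<Longrightarrow> \<exists>V. open V \<and> p \<in> V \<and> cdiff n V f"
 shows "cdiff n S f"
 using assms(2)
proof (induction n arbitrary: f)
 case 0
 have "continuous (at p) f" if "p \<in> S" for p
  using 0[OF that] continuous_on_eq_continuous_at by auto
 then show ?case by (simp add: continuous_at_imp_continuous_on)
next
 case (Suc n)
 have 1: "(f has_derivative frechet_derivative f (at p)) (at p)" if "p \<in> S" for p
  using Suc.prems[OF that] cdiff_open_derivative(1) by blast
 have 2: "cdiff n S (pd b f)" if "b \<in> Basis" for b
 proof (rule Suc.IH)
  fix p assume "p \<in> S"
  then obtain V where "open V" "p \<in> V" "cdiff (Suc n) V f" using Suc.prems by blast
  then show "\<exists>V. open V \<and> p \<in> V \<and> cdiff n V (pd b f)"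
   using cdiff_open_derivative(2)[of V n f b] that by blast
 qed
 have "\<forall>p\<in>S. (f has_derivative frechet_derivative f (at p)) (at p within S)"
  using 1 has_derivative_at_withinI by blast
 then show ?case using 2
  by (auto intro!: exI[of _ "\<lambda>p. frechet_derivative f (at p)"] simp: pd_def[abs_def])
qed

lemma smooth_open_local:
 assumes "open S" "\<And>p. p \<in> S \<Longrightarrow> \<exists>V. open V \<and> p \<in> V \<and> smooth V f"
 shows "smooth S f"
 unfolding smooth_def
proof
 fix n show "cdiff n S f"
  using assms(2) unfolding smooth_def by (intro cdiff_open_local[OF assms(1)]) metis
qed

lemma smooth_continuous: "smooth S f \<Longrightarrow> continuous_on S f"
 unfolding smooth_def by (metis cdiff_continuous)

lemma smooth_cong: "smooth S f \<Longrightarrow> (\<And>p. p \<in> S \<Longrightarrow> f p = g p) \<Longrightarrow> smooth S g"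
 unfolding smooth_def by (metis cdiff_cong)

lemma smooth_subset: "smooth S f \<Longrightarrow> S' \<subseteq> S \<Longrightarrow> smooth S' f"
 unfolding smooth_def by (metis cdiff_subset)

lemma smooth_const [simp]: "smooth S (\<lambda>_. c)"
 by (simp add: smooth_def)

lemma smooth_linear: "bounded_linear f \<Longrightarrow> smooth S f"
 by (simp add: smooth_def cdiff_linear)

lemma smooth_add: "smooth S f \<Longrightarrow> smooth S g \<Longrightarrow> smooth S (\<lambda>p. f p + g p)"
 by (simp add: smooth_def cdiff_add)

lemma smooth_diff: "smooth S f \<Longrightarrow> smooth S g \<Longrightarrow> smooth S (\<lambda>p. f p - g p)"
 by (simp add: smooth_def cdiff_diff)

lemma smooth_minus: "smooth S f \<Longrightarrow> smooth S (\<lambda>p. - f p)"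
 by (simp add: smooth_def cdiff_minus)

lemma smooth_mult: "smooth S f \<Longrightarrow> smooth S g \<Longrightarrow> smooth S (\<lambda>p. f p * g p)"
 by (simp add: smooth_def cdiff_mult)

lemma smooth_inverse: "smooth S f \<Longrightarrow> (\<And>p. p \<in> S \<Longrightarrow> f p \<noteq> 0) \<Longrightarrow> smooth S (\<lambda>p. inverse (f p))"
 by (simp add: smooth_def cdiff_inverse)

lemma smooth_divide: "smooth S f \<Longrightarrow> smooth S g \<Longrightarrow> (\<And>p. p \<in> S \<Longrightarrow> g p \<noteq> 0) \<Longrightarrow> smooth S (\<lambda>p. f p / g p)"
 unfolding divide_inverse by (intro smooth_mult smooth_inverse)

lemma smooth_compose:
 fixes \<phi> :: "'a::euclidean_space \<Rightarrow> 'b::euclidean_space"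
 assumes "smooth S' f" "\<phi> ` S \<subseteq> S'" "\<And>i. i \<in> Basis \<Longrightarrow> smooth S (\<lambda>p. \<phi> p \<bullet> i)"
 shows "smooth S (\<lambda>p. f (\<phi> p))"
 unfolding smooth_def
proof
 fix n
 show "cdiff n S (\<lambda>p. f (\<phi> p))"
  by (rule cdiff_compose[of n S' f \<phi> S]) (use assms in \<open>auto simp: smooth_def\<close>)
qed

lemma smooth_partial_DERIV:
 assumes "open S" "smooth S f" "p \<in> S" "b \<in> Basis"
 shows "((\<lambda>s. f (p + s *\<^sub>R b)) has_real_derivative pd b f p) (at 0)"
proof -
 have "cdiff (Suc 0) S f" using assms(2) unfolding smooth_def by blast
 then have d: "(f has_derivative frechet_derivative f (at p)) (at (p + 0 *\<^sub>R b))"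
  using cdiff_open_derivative(1)[OF assms(1) _ assms(3)] by (metis add.right_neutral scaleR_zero_left)
 have "((\<lambda>s. p + s *\<^sub>R b) has_derivative (\<lambda>s. s *\<^sub>R b)) (at 0)"
  by (auto intro!: derivative_eq_intros)
 from has_derivative_compose[OF this d]
 have "((\<lambda>s. f (p + s *\<^sub>R b)) has_derivative (\<lambda>s. frechet_derivative f (at p) (s *\<^sub>R b))) (at 0)" .
 moreover have "frechet_derivative f (at p) (s *\<^sub>R b) = s * pd b f p" for s
  using linear_cmul[OF has_derivative_linear[OF d], of s b] by (simp add: pd_def)
 ultimately show ?thesis by (simp add: has_field_derivative_def mult_commute_abs)
qed

text \<open>Schwarz' theorem, by writing the second difference quotient as a mean value in both orders.\<close>

lemma second_difference_mvt:
 fixes F :: "real \<Rightarrow> real \<Rightarrow> real"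
 assumes d1: "\<And>s t. \<bar>s\<bar> < r \<Longrightarrow> \<bar>t\<bar> < r \<Longrightarrow> ((\<lambda>s. F s t) has_real_derivative F1 s t) (at s)"
  and d2: "\<And>s t. \<bar>s\<bar> < r \<Longrightarrow> \<bar>t\<bar> < r \<Longrightarrow> ((\<lambda>t. F1 s t) has_real_derivative F12 s t) (at t)"
  and h: "0 < h" "h < r"
 obtains s t where "0 < s" "s < h" "0 < t" "t < h"
  "F h h - F h 0 - F 0 h + F 0 0 = h * h * F12 s t"
proof -
 have "\<exists>s. s > 0 \<and> s < h \<and> (F h h - F h 0) - (F 0 h - F 0 0) = (h - 0) * (F1 s h - F1 s 0)"
  by (rule MVT2[of 0 h "\<lambda>s. F s h - F s 0" "\<lambda>s. F1 s h - F1 s 0"])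
    (use h in \<open>auto intro!: DERIV_diff d1\<close>)
 then obtain s where s: "s > 0" "s < h" "(F h h - F h 0) - (F 0 h - F 0 0) = h * (F1 s h - F1 s 0)" by auto
 have "\<exists>t. t > 0 \<and> t < h \<and> F1 s h - F1 s 0 = (h - 0) * F12 s t"
  by (rule MVT2) (use h s in \<open>auto intro!: d2\<close>)
 then obtain t where "t > 0" "t < h" "F1 s h - F1 s 0 = h * F12 s t" by auto
 with s show ?thesis by (intro that[of s t]) auto
qed

lemma pd_commute:
 assumes S: "open S" and f: "smooth S f" and p: "p \<in> S" and b: "b \<in> Basis" "c \<in> Basis"
 shows "pd b (pd c f) p = pd c (pd b f) p"
proof -
 obtain e where "e > 0" "ball p e \<subseteq> S"
  using S p open_contains_ball_eq by blast
 then obtain r where r: "r > 0" "ball p (2 * r) \<subseteq> S"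
  by (intro that[of "e/2"]) auto
 have inS: "p + s *\<^sub>R b + t *\<^sub>R c \<in> S" if "\<bar>s\<bar> < r" "\<bar>t\<bar> < r" for s t
 proof -
  have "norm (s *\<^sub>R b + t *\<^sub>R c) \<le> \<bar>s\<bar> + \<bar>t\<bar>"
   using norm_triangle_ineq[of "s *\<^sub>R b" "t *\<^sub>R c"] b by simp
  moreover have "dist p (p + s *\<^sub>R b + t *\<^sub>R c) = norm (s *\<^sub>R b + t *\<^sub>R c)"
   by (metis add.assoc add_diff_cancel_left' dist_commute dist_norm)
  ultimately have "dist p (p + s *\<^sub>R b + t *\<^sub>R c) < 2 * r" using that by linarith
  then show ?thesis using r by auto
 qed
 have shift: "((\<lambda>s. g (p' + s *\<^sub>R e)) has_real_derivative pd e g (p' + s *\<^sub>R e)) (at s)"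
  if "smooth S g" "p' + s *\<^sub>R e \<in> S" "e \<in> Basis" for g p' s e
 proof -
  have "((\<lambda>x. g ((p' + s *\<^sub>R e) + (x - s) *\<^sub>R e)) has_real_derivative pd e g (p' + s *\<^sub>R e) * 1) (at s)"
   by (rule DERIV_chain2[of "\<lambda>t. g ((p' + s *\<^sub>R e) + t *\<^sub>R e)"])
    (use smooth_partial_DERIV[OF S that(1,2,3)] in \<open>auto intro!: derivative_eq_intros\<close>)
  then show ?thesis by (simp add: algebra_simps)
 qed
 define F where "F s t = f (p + s *\<^sub>R b + t *\<^sub>R c)" for s t
 define Fbc where "Fbc = pd c (pd b f)"
 define Fcb where "Fcb = pd b (pd c f)"
 have sm: "smooth S (pd b f)" "smooth S (pd c f)" "smooth S Fbc" "smooth S Fcb"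
  using smooth_pd[OF S] f b by (auto simp: Fbc_def Fcb_def)
 have mv: "\<exists>q q'. dist p q < e \<and> dist p q' < e \<and> Fbc q = Fcb q'" if e: "e > 0" for e
 proof -
  define h where "h = min (r/2) (e/3)"
  have h: "0 < h" "h < r" "2 * h < e" using r e by (auto simp: h_def)
  have ds: "dist p (p + s *\<^sub>R b + t *\<^sub>R c) < e" if "0 < s" "s < h" "0 < t" "t < h" for s t
  proof -
   have "norm (s *\<^sub>R b + t *\<^sub>R c) \<le> \<bar>s\<bar> + \<bar>t\<bar>"
    using norm_triangle_ineq[of "s *\<^sub>R b" "t *\<^sub>R c"] b by simp
   moreover have "dist p (p + s *\<^sub>R b + t *\<^sub>R c) = norm (s *\<^sub>R b + t *\<^sub>R c)"
    by (metis add.assoc add_diff_cancel_left' dist_commute dist_norm)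
   ultimately show ?thesis using that h by linarith
  qed
  obtain s t where st: "0 < s" "s < h" "0 < t" "t < h"
   "F h h - F h 0 - F 0 h + F 0 0 = h * h * Fbc (p + s *\<^sub>R b + t *\<^sub>R c)"
  proof (rule second_difference_mvt[of r F "\<lambda>s t. pd b f (p + s *\<^sub>R b + t *\<^sub>R c)" "\<lambda>s t. Fbc (p + s *\<^sub>R b + t *\<^sub>R c)" h])
   fix s t :: real assume st: "\<bar>s\<bar> < r" "\<bar>t\<bar> < r"
   show "((\<lambda>s. F s t) has_real_derivative pd b f (p + s *\<^sub>R b + t *\<^sub>R c)) (at s)"
    using shift[OF f, of "p + t *\<^sub>R c" s b] inS[OF st] b by (simp add: F_def algebra_simps)
   show "((\<lambda>t. pd b f (p + s *\<^sub>R b + t *\<^sub>R c)) has_real_derivative Fbc (p + s *\<^sub>R b + t *\<^sub>R c)) (at t)"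
    using shift[OF sm(1), of "p + s *\<^sub>R b" t c] inS[OF st] b by (simp add: Fbc_def)
  qed (use h that in auto)
  obtain t' s' where st': "0 < t'" "t' < h" "0 < s'" "s' < h"
   "F h h - F 0 h - F h 0 + F 0 0 = h * h * Fcb (p + s' *\<^sub>R b + t' *\<^sub>R c)"
  proof (rule second_difference_mvt[of r "\<lambda>t s. F s t" "\<lambda>t s. pd c f (p + s *\<^sub>R b + t *\<^sub>R c)" "\<lambda>t s. Fcb (p + s *\<^sub>R b + t *\<^sub>R c)" h])
   fix t s :: real assume st: "\<bar>t\<bar> < r" "\<bar>s\<bar> < r"
   show "((\<lambda>t. F s t) has_real_derivative pd c f (p + s *\<^sub>R b + t *\<^sub>R c)) (at t)"
    using shift[OF f, of "p + s *\<^sub>R b" t c] inS[OF st(2,1)] b by (simp add: F_def)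
   show "((\<lambda>s. pd c f (p + s *\<^sub>R b + t *\<^sub>R c)) has_real_derivative Fcb (p + s *\<^sub>R b + t *\<^sub>R c)) (at s)"
    using shift[OF sm(2), of "p + t *\<^sub>R c" s b] inS[OF st(2,1)] b by (simp add: Fcb_def algebra_simps)
  qed (use h that in auto)
  have "h * h * Fbc (p + s *\<^sub>R b + t *\<^sub>R c) = h * h * Fcb (p + s' *\<^sub>R b + t' *\<^sub>R c)"
   using st(5) st'(5) by linarith
  then have "Fbc (p + s *\<^sub>R b + t *\<^sub>R c) = Fcb (p + s' *\<^sub>R b + t' *\<^sub>R c)" using h by simp
  then show ?thesis using ds st st' by blast
 qed
 have cont: "isCont Fbc p" "isCont Fcb p"
  using sm(3,4)[THEN smooth_continuous] S p continuous_on_eq_continuous_at by blast+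
 have le: "\<bar>Fbc p - Fcb p\<bar> \<le> 0 + e" if e: "e > 0" for e
 proof -
  have "e/2 > 0" using e by simp
  then obtain d1 where d1: "d1 > 0" "\<And>q. dist q p < d1 \<Longrightarrow> dist (Fbc q) (Fbc p) < e/2"
   using cont(1) unfolding continuous_at_eps_delta by metis
  obtain d2 where d2: "d2 > 0" "\<And>q. dist q p < d2 \<Longrightarrow> dist (Fcb q) (Fcb p) < e/2"
   using cont(2) \<open>e/2 > 0\<close> unfolding continuous_at_eps_delta by metis
  obtain q q' where q: "dist p q < min d1 d2" "dist p q' < min d1 d2" "Fbc q = Fcb q'"
   using mv[of "min d1 d2"] d1 d2 by auto
  have "dist (Fbc q) (Fbc p) < e/2" "dist (Fcb q') (Fcb p) < e/2"
   using d1(2)[of q] d2(2)[of q'] q by (metis dist_commute min_less_iff_conj)+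
  then show ?thesis using q(3) unfolding dist_real_def by linarith
 qed
 have "\<bar>Fbc p - Fcb p\<bar> \<le> 0" by (rule field_le_epsilon) (rule le)
 then show ?thesis by (simp add: Fbc_def Fcb_def)
qed

section \<open>Real-analytic functions\<close>

text \<open>A multi-index vanishes off \<open>Basis\<close> and is determined by its restriction
  there. Countability and infinitude together let the index set be enumerated by \<open>nat\<close>,
  so that unordered sums become series.\<close>

lemma countable_multi_indices: "countable (multi_indices :: ('a::euclidean_space \<Rightarrow> nat) set)"
proof -
 have "inj_on (\<lambda>k. restrict k Basis) (multi_indices :: ('a \<Rightarrow> nat) set)"
 proof (rule inj_onI, rule ext)
  fix k l :: "'a \<Rightarrow> nat" and b
  assume kl: "k \<in> multi_indices" "l \<in> multi_indices" "restrict k Basis = restrict l Basis"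
  show "k b = l b"
  proof (cases "b \<in> Basis")
   case True then show ?thesis using kl(3) by (metis restrict_apply')
  next
   case False then show ?thesis using kl by (simp add: multi_indices_def)
  qed
 qed
 moreover have "(\<lambda>k. restrict k Basis) ` (multi_indices :: ('a \<Rightarrow> nat) set) \<subseteq> Basis \<rightarrow>\<^sub>E UNIV"
  by auto
 moreover have "countable ((Basis :: 'a set) \<rightarrow>\<^sub>E (UNIV :: nat set))"
  by (rule countable_PiE) auto
 ultimately show ?thesis by (meson countable_image_inj_on countable_subset)
qed

lemma infinite_multi_indices: "infinite (multi_indices :: ('a::euclidean_space \<Rightarrow> nat) set)"
proof -
 obtain b :: 'a where b: "b \<in> Basis" using nonempty_Basis by blast
 have "inj (\<lambda>n::nat. (\<lambda>b'. if b' = b then n else 0))"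
  by (rule injI) (metis (full_types))
 then have "infinite (range (\<lambda>n::nat. (\<lambda>b'. if b' = b then n else 0)))"
  using finite_imageD by blast
 moreover have "range (\<lambda>n::nat. (\<lambda>b'. if b' = b then n else 0)) \<subseteq> multi_indices"
  using b by (auto simp: multi_indices_def)
 ultimately show ?thesis using finite_subset by blast
qed

lemma mi_power_le:
 assumes "\<And>b. b \<in> Basis \<Longrightarrow> \<bar>h \<bullet> b\<bar> \<le> s"
 shows "\<bar>mi_power h k\<bar> \<le> s ^ mi_degree k"
proof -
 have "\<bar>mi_power h k\<bar> = (\<Prod>b\<in>Basis. \<bar>h \<bullet> b\<bar> ^ k b)"
  by (simp add: mi_power_def abs_prod power_abs)
 also have "\<dots> \<le> (\<Prod>b\<in>Basis. s ^ k b)"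
  using assms by (intro prod_mono) (auto intro!: power_mono)
 also have "\<dots> = s ^ mi_degree k" by (simp add: mi_degree_def power_sum)
 finally show ?thesis .
qed

lemma mi_degree_dec:
 assumes "b \<in> Basis" "k b > 0"
 shows "Suc (mi_degree (k(b := k b - 1))) = mi_degree k"
proof -
 have "mi_degree k = k b + (\<Sum>b'\<in>Basis - {b}. k b')"
  unfolding mi_degree_def using assms(1) by (simp add: sum.remove)
 moreover have "mi_degree (k(b := k b - 1)) = (k b - 1) + (\<Sum>b'\<in>Basis - {b}. k b')"
  unfolding mi_degree_def using assms(1) by (simp add: sum.remove)
 ultimately show ?thesis using assms(2) by simp
qed

lemma mi_power_has_derivative:
 fixes h :: "'a::euclidean_space"
 shows "((\<lambda>h. mi_power h k) has_derivative
   (\<lambda>v. \<Sum>b\<in>Basis. (v \<bullet> b) * (real (k b) * mi_power h (k(b := k b - 1))))) (at h within S)"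
proof -
 have p: "((\<lambda>h::'a. (h \<bullet> b) ^ k b) has_derivative (\<lambda>v. (v \<bullet> b) * (real (k b) * (h \<bullet> b) ^ (k b - 1)))) (at h within S)" for b
  by (auto intro!: derivative_eq_intros simp: algebra_simps)
 have "((\<lambda>h. mi_power h k) has_derivative
   (\<lambda>v. \<Sum>b\<in>Basis. (v \<bullet> b) * (real (k b) * (h \<bullet> b) ^ (k b - 1)) * (\<Prod>j\<in>Basis - {b}. (h \<bullet> j) ^ k j))) (at h within S)"
  unfolding mi_power_def[abs_def] by (rule has_derivative_prod) (rule p)
 moreover have "(h \<bullet> b) ^ (k b - 1) * (\<Prod>j\<in>Basis - {b}. (h \<bullet> j) ^ k j) = mi_power h (k(b := k b - 1))"
  if "b \<in> Basis" for b
  unfolding mi_power_def using that by (simp add: prod.remove)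
 ultimately show ?thesis
  by (elim has_derivative_eq_rhs) (auto intro!: sum.cong simp: mult.assoc)
qed

text \<open>Termwise differentiation. Summability at one point with equal positive coordinates makes
  \<open>c k * r0 ^ mi_degree k\<close> absolutely summable, since unconditional and absolute
  summability agree on the reals. Halving the radius absorbs the factor \<open>k b\<close> created
  by differentiation, because \<open>n + 1 \<le> 2 ^ (n + 1)\<close>. The series of the partial
  derivatives are returned as well, so that their analyticity can be read off.\<close>

lemma power_series_has_derivative:
 fixes f :: "'a::euclidean_space \<Rightarrow> real"
 assumes r: "r > 0"
  and f0: "\<forall>h. norm h < r \<longrightarrow> ((\<lambda>k. c k * mi_power h k) has_sum f (a + h)) multi_indices"
 shows "\<exists>s>0. \<exists>g. (\<forall>h. norm h < s \<longrightarrow>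
   (f has_derivative (\<lambda>v. \<Sum>b\<in>Basis. (v \<bullet> b) * g b h)) (at (a + h))) \<and>
  (\<forall>h b. norm h < s \<longrightarrow> b \<in> Basis \<longrightarrow>
   ((\<lambda>k. c k * (real (k b) * mi_power h (k(b := k b - 1)))) has_sum g b h) multi_indices)"
proof -
 note f = f0[rule_format]
 \<comment> \<open>The vector with all coordinates \<open>r0\<close> has norm at most
   \<open>r / 2\<close> and thus lies in the ball of convergence.\<close>
 define r0 where "r0 = r / (2 * DIM('a))"
 have r0: "r0 > 0" using r by (simp add: r0_def)
 define H where "H = (\<Sum>b\<in>(Basis::'a set). r0 *\<^sub>R b)"
 have Hb: "H \<bullet> b = r0" if "b \<in> Basis" for b
  using that by (simp add: H_def inner_sum_left inner_Basis if_distrib cong: if_cong)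
 have "norm H \<le> (\<Sum>b\<in>(Basis::'a set). norm (r0 *\<^sub>R b))" unfolding H_def by (rule norm_sum)
 also have "\<dots> = r / 2" using r r0 by (simp add: r0_def)
 finally have "norm H < r" using r by simp
 have "mi_power H k = r0 ^ mi_degree k" for k
  by (simp add: mi_power_def Hb mi_degree_def power_sum)
 with f[OF \<open>norm H < r\<close>] have "(\<lambda>k. c k * r0 ^ mi_degree k) summable_on multi_indices"
  by (simp add: has_sum_imp_summable)
 then have "(\<lambda>k. \<bar>c k * r0 ^ mi_degree k\<bar>) summable_on multi_indices"
  using summable_on_iff_abs_summable_on_real by force
 define M where "M k = \<bar>c k\<bar> * r0 ^ mi_degree k" for k
 have M: "M summable_on multi_indices" "M k \<ge> 0" for k
  using \<open>(\<lambda>k. \<bar>c k * r0 ^ mi_degree k\<bar>) summable_on multi_indices\<close> r0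
  by (auto simp: M_def[abs_def] abs_mult)
 define s where "s = r0 / 2"
 have s: "s > 0" "s < r"
 proof -
  show "s > 0" using r0 by (simp add: s_def)
  have "1 \<le> real DIM('a) * 2" using DIM_positive[where 'a = 'a] by linarith
  then have "r0 \<le> r" using r by (simp add: r0_def field_simps)
  then show "s < r" using r0 by (simp add: s_def)
 qed
 define T where "T k h b = c k * (real (k b) * mi_power h (k(b := k b - 1)))" for k h and b :: 'a
 have Tb: "\<bar>T k h b\<bar> \<le> M k / s" if h: "norm h < s" and b: "b \<in> Basis" for k h b
 proof (cases "k b = 0")
  case True
  then show ?thesis using M(2) s by (simp add: T_def)
 next
  case False
  then have deg: "Suc (mi_degree (k(b := k b - 1))) = mi_degree k" using mi_degree_dec b by blast
  have hb: "\<bar>h \<bullet> b\<bar> \<le> s" if "b \<in> Basis" for b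
   using Basis_le_norm[OF that, of h] h by simp
  define n where "n = mi_degree (k(b := k b - 1))"
  have kb: "k b \<le> Suc n"
  proof -
   have "k b \<le> mi_degree k" unfolding mi_degree_def using b by (intro member_le_sum) auto
   then show ?thesis using deg by (simp add: n_def)
  qed
  have "\<bar>T k h b\<bar> = \<bar>c k\<bar> * (real (k b) * \<bar>mi_power h (k(b := k b - 1))\<bar>)"
   by (simp add: T_def abs_mult)
  also have "\<dots> \<le> \<bar>c k\<bar> * (real (Suc n) * s ^ n)"
   unfolding n_def by (intro mult_left_mono mult_mono mi_power_le hb) (use kb s in \<open>auto simp: n_def\<close>)
  also have "real (Suc n) * s ^ n \<le> 2 ^ Suc n * s ^ n"
   using of_nat_less_two_power[of "Suc n", where 'a = real] s by (intro mult_right_mono) auto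
  also have "2 ^ Suc n * s ^ n = r0 ^ Suc n / s"
   using r0 by (simp add: s_def power_divide field_simps)
  finally have "\<bar>T k h b\<bar> \<le> \<bar>c k\<bar> * (r0 ^ Suc n / s)" by (simp add: mult_left_mono)
  moreover have "M k = \<bar>c k\<bar> * r0 ^ Suc n" by (simp only: M_def n_def deg)
  ultimately show ?thesis by simp
 qed
 define e where "e = from_nat_into (multi_indices :: ('a \<Rightarrow> nat) set)"
 have e: "bij_betw e UNIV multi_indices"
  unfolding e_def by (intro bij_betw_from_nat_into countable_multi_indices infinite_multi_indices)
 have sums_iff: "((\<lambda>n. F (e n)) has_sum l) UNIV \<longleftrightarrow> (F has_sum l) multi_indices" for F and l :: real
  by (rule has_sum_reindex_bij_betw[OF e])
 have SM: "summable (\<lambda>n. M (e n))"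
 proof -
  have "((\<lambda>n. M (e n)) has_sum (infsum M multi_indices)) UNIV"
   using has_sum_infsum[OF M(1)] sums_iff[of M] by simp
  then show ?thesis by (rule sums_summable[OF has_sum_imp_sums])
 qed
 define f' where "f' n h v = (\<Sum>b\<in>Basis. (v \<bullet> b) * T (e n) h b)" for n h and v :: 'a
 define C where "C = real DIM('a) / s"
 have f'b: "\<bar>f' n h v\<bar> \<le> C * M (e n) * norm v" if h: "norm h < s" for n h v
 proof -
  have "\<bar>f' n h v\<bar> \<le> (\<Sum>b\<in>Basis. \<bar>(v \<bullet> b) * T (e n) h b\<bar>)"
   unfolding f'_def by (rule sum_abs)
  also have "\<dots> \<le> (\<Sum>b\<in>(Basis::'a set). norm v * (M (e n) / s))"
   unfolding abs_mult by (intro sum_mono mult_mono Basis_le_norm Tb h) auto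
  finally show ?thesis by (simp add: C_def field_simps)
 qed
 have Sf': "summable (\<lambda>n. f' n h v)" if h: "norm h < s" for h v
  by (rule summable_comparison_test'[of "\<lambda>n. C * M (e n) * norm v" 0])
   (use f'b[OF h] SM in \<open>auto intro: summable_mult summable_mult2\<close>)
 define g' where "g' h v = (\<Sum>n. f' n h v)" for h v
 have C0: "C \<ge> 0" using s by (simp add: C_def)
 have "\<exists>F. \<forall>x\<in>ball 0 s. (\<lambda>n. c (e n) * mi_power x (e n)) sums F x \<and> (F has_derivative g' x) (at x within ball 0 s)"
 proof (rule has_derivative_series[where f' = f'])
  show "((\<lambda>h. c (e n) * mi_power h (e n)) has_derivative f' n h) (at h within ball 0 s)"
   if "h \<in> ball 0 s" for n h
   by (rule has_derivative_eq_rhs[OF has_derivative_mult_right[OF mi_power_has_derivative]])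
    (auto simp: f'_def T_def sum_distrib_left algebra_simps)
  show "\<forall>\<^sub>F n in sequentially. \<forall>x\<in>ball 0 s. \<forall>h. norm (sum (\<lambda>i. f' i x h) {..<n} - g' x h) \<le> \<epsilon> * norm h"
   if \<epsilon>: "\<epsilon> > 0" for \<epsilon>
  proof -
   have "(\<lambda>n. C * (\<Sum>i. M (e (i + n)))) \<longlonglongrightarrow> C * 0"
    by (intro tendsto_mult tendsto_const suminf_exist_split2 SM)
   then have "\<forall>\<^sub>F n in sequentially. C * (\<Sum>i. M (e (i + n))) < \<epsilon>"
    using \<epsilon> by (simp add: order_tendstoD)
   then show ?thesis
   proof (rule eventually_mono, intro ballI allI)
    fix n and x h :: 'a assume n: "C * (\<Sum>i. M (e (i + n))) < \<epsilon>" and x: "x \<in> ball 0 s"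
    then have x: "norm x < s" by simp
    have SMn: "summable (\<lambda>i. M (e (i + n)))" by (rule summable_ignore_initial_segment[OF SM])
    have "g' x h - sum (\<lambda>i. f' i x h) {..<n} = (\<Sum>i. f' (i + n) x h)"
     unfolding g'_def using suminf_minus_initial_segment[OF Sf'[OF x]] by simp
    moreover have "\<bar>\<Sum>i. f' (i + n) x h\<bar> \<le> (\<Sum>i. C * M (e (i + n)) * norm h)"
    proof (rule order_trans[OF summable_rabs suminf_le])
     show "summable (\<lambda>i. C * M (e (i + n)) * norm h)"
      by (intro summable_mult summable_mult2 summable_ignore_initial_segment SM)
     then show sm: "summable (\<lambda>i. \<bar>f' (i + n) x h\<bar>)"
      by (rule summable_comparison_test'[of _ 0]) (use f'b[OF x] in auto)
     then show "summable (\<lambda>i. \<bar>f' (i + n) x h\<bar>)" .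
    qed (use f'b[OF x] in auto)
    moreover have "(\<Sum>i. C * M (e (i + n)) * norm h) = C * (\<Sum>i. M (e (i + n))) * norm h"
     using suminf_mult[OF SMn] suminf_mult2[OF summable_mult[OF SMn]] by simp
    moreover have "\<dots> \<le> \<epsilon> * norm h" using n by (intro mult_right_mono) auto
    ultimately show "norm (sum (\<lambda>i. f' i x h) {..<n} - g' x h) \<le> \<epsilon> * norm h"
     by (simp add: abs_minus_commute)
   qed
  qed
  have "((\<lambda>n. c (e n) * mi_power 0 (e n)) has_sum f (a + 0)) UNIV"
   using f[of 0] r sums_iff[of "\<lambda>k. c k * mi_power 0 k"] by simp
  then show "(\<lambda>n. c (e n) * mi_power 0 (e n)) sums f (a + 0)" by (rule has_sum_imp_sums)
 qed (use s in auto)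
 then obtain F where F0: "\<forall>x\<in>ball 0 s. (\<lambda>n. c (e n) * mi_power x (e n)) sums F x \<and> (F has_derivative g' x) (at x within ball 0 s)"
  by blast
 have F: "(\<lambda>n. c (e n) * mi_power x (e n)) sums F x" "(F has_derivative g' x) (at x within ball 0 s)"
  if "norm x < s" for x
  using F0 that by simp_all
 have Feq: "F x = f (a + x)" if "norm x < s" for x
 proof -
  have "norm x < r" using that s by simp
  then have "((\<lambda>n. c (e n) * mi_power x (e n)) has_sum f (a + x)) UNIV"
   using f[of x] sums_iff[of "\<lambda>k. c k * mi_power x k"] by simp
  then show ?thesis using F(1)[OF that] has_sum_imp_sums sums_unique2 by blast
 qed
 have Tsum: "(\<lambda>k. T k h b) summable_on multi_indices" if "norm h < s" "b \<in> Basis" for h b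
 proof -
  have "(\<lambda>k. M k / s) summable_on multi_indices"
   using M(1) summable_on_cmult_left[of M multi_indices "1/s"] by simp
  then have "(\<lambda>k. norm (T k h b)) summable_on multi_indices"
   by (rule summable_on_comparison_test) (use Tb[OF that] in auto)
  then show ?thesis using summable_on_iff_abs_summable_on_real by blast
 qed
 define g where "g b h = infsum (\<lambda>k. T k h b) multi_indices" for b h
 have gT: "((\<lambda>k. T k h b) has_sum g b h) multi_indices" if "norm h < s" "b \<in> Basis" for h b
  unfolding g_def by (rule has_sum_infsum[OF Tsum[OF that]])
 have g'eq: "g' h v = (\<Sum>b\<in>Basis. (v \<bullet> b) * g b h)" if h: "norm h < s" for h v
 proof -
  have "(\<lambda>n. f' n h v) sums (\<Sum>b\<in>Basis. (v \<bullet> b) * g b h)"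
   unfolding f'_def
  proof (intro sums_sum sums_mult)
   fix b :: 'a assume "b \<in> Basis"
   then have "((\<lambda>n. T (e n) h b) has_sum g b h) UNIV"
    using gT[OF h] sums_iff[of "\<lambda>k. T k h b"] by simp
   then show "(\<lambda>n. T (e n) h b) sums g b h" by (rule has_sum_imp_sums)
  qed
  then show ?thesis unfolding g'_def by (metis sums_unique)
 qed
 show ?thesis
 proof (intro exI[of _ s] exI[of _ g] conjI allI impI)
  show "s > 0" by (rule s)
  show "(f has_derivative (\<lambda>v. \<Sum>b\<in>Basis. (v \<bullet> b) * g b h)) (at (a + h))" if h: "norm h < s" for h
  proof -
   have "(F has_derivative g' h) (at h)"
    using F(2)[OF h] h at_within_open[of h "ball 0 s"] by simp
   then have "((\<lambda>x. f (a + x)) has_derivative g' h) (at h)"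
    by (rule has_derivative_transform_within_open[of _ _ _ _ "ball 0 s"]) (use h Feq in auto)
   moreover have "g' h = (\<lambda>v. \<Sum>b\<in>Basis. (v \<bullet> b) * g b h)" using g'eq[OF h] by auto
   ultimately have d: "((\<lambda>x. f (a + x)) has_derivative (\<lambda>v. \<Sum>b\<in>Basis. (v \<bullet> b) * g b h)) (at ((a + h) - a))" by simp
   have "((\<lambda>x. x - a) has_derivative (\<lambda>v. v)) (at (a + h))"
    by (auto intro!: derivative_eq_intros)
   from has_derivative_compose[OF this d] show ?thesis by simp
  qed
  show "((\<lambda>k. c k * (real (k b) * mi_power h (k(b := k b - 1)))) has_sum g b h) multi_indices"
   if "norm h < s" "b \<in> Basis" for h b
   using gT[OF that] by (simp add: T_def)
 qed
qed

text \<open>The derivative in direction \<open>b\<close> as a power series in standard form: the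
  terms with \<open>k b = 0\<close> vanish, and raising the entry at \<open>b\<close> by one is a
  bijection onto the remaining indices.\<close>

lemma shifted_series_has_sum:
 fixes h :: "'a::euclidean_space"
 assumes b: "b \<in> Basis"
  and g: "((\<lambda>k. c k * (real (k b) * mi_power h (k(b := k b - 1)))) has_sum l) multi_indices"
 shows "((\<lambda>k. c (k(b := Suc (k b))) * real (Suc (k b)) * mi_power h k) has_sum l) multi_indices"
proof -
 let ?S = "{k \<in> multi_indices. k b > 0}" and ?up = "\<lambda>k::'a \<Rightarrow> nat. k(b := Suc (k b))"
 have "((\<lambda>k. c k * (real (k b) * mi_power h (k(b := k b - 1)))) has_sum l) ?S"
  using g by (rule has_sum_cong_neutral[THEN iffD1, rotated -1]) auto
 moreover have "bij_betw ?up multi_indices ?S"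
  by (rule bij_betw_byWitness[where f' = "\<lambda>k. k(b := k b - 1)"])
   (use b in \<open>auto simp: multi_indices_def fun_eq_iff\<close>)
 ultimately have "((\<lambda>k. c (?up k) * (real (?up k b) * mi_power h ((?up k)(b := ?up k b - 1)))) has_sum l) multi_indices"
  using has_sum_reindex_bij_betw[of ?up multi_indices ?S "\<lambda>k. c k * (real (k b) * mi_power h (k(b := k b - 1)))" l] by simp
 then show ?thesis by (simp add: mult.assoc)
qed

text \<open>The expansion at \<open>a\<close> holds on a whole ball, so the derivative is known near
  \<open>a\<close>, and its components are given there by power series centred at
  \<open>a\<close>.\<close>

lemma real_analytic_on_derivative:
 fixes f :: "'a::euclidean_space \<Rightarrow> real"
 assumes "real_analytic_on f S"
 shows "\<And>a. a \<in> S \<Longrightarrow> (f has_derivative frechet_derivative f (at a)) (at a)"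
  "\<And>b. b \<in> Basis \<Longrightarrow> real_analytic_on (pd b f) S"
proof -
 have main: "(f has_derivative frechet_derivative f (at a)) (at a) \<and>
   (\<forall>b\<in>Basis. real_analytic_at (\<lambda>a. frechet_derivative f (at a) b) a)" if "a \<in> S" for a
 proof -
  have "real_analytic_at f a" using assms that by (simp add: real_analytic_on_def)
  then obtain r c where rc: "r > 0" "\<forall>h. norm h < r \<longrightarrow> ((\<lambda>k. c k * mi_power h k) has_sum f (a + h)) multi_indices"
   unfolding real_analytic_at_def by (elim exE conjE)
  obtain s g where s: "s > 0" and g0: "\<forall>h. norm h < s \<longrightarrow>
   (f has_derivative (\<lambda>v. \<Sum>b\<in>Basis. (v \<bullet> b) * g b h)) (at (a + h))"
  "\<forall>h b. norm h < s \<longrightarrow> b \<in> Basis \<longrightarrow>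
   ((\<lambda>k. c k * (real (k b) * mi_power h (k(b := k b - 1)))) has_sum g b h) multi_indices"
   using power_series_has_derivative[OF rc] by (elim exE conjE)
  note g = g0[rule_format]
  have fd: "frechet_derivative f (at (a + h)) b = g b h" if "norm h < s" "b \<in> Basis" for h b
  proof -
   have "frechet_derivative f (at (a + h)) = (\<lambda>v. \<Sum>b\<in>Basis. (v \<bullet> b) * g b h)"
    using g(1)[OF that(1)] by (metis frechet_derivative_at)
   then show ?thesis using that(2) by (simp add: inner_Basis if_distrib[of "\<lambda>x. x * _"] cong: if_cong)
  qed
  have "f differentiable at a" using g(1)[of 0] s by (auto simp: differentiable_def)
  then have "(f has_derivative frechet_derivative f (at a)) (at a)"
   by (simp add: frechet_derivative_works)
  moreover have "real_analytic_at (\<lambda>a. frechet_derivative f (at a) b) a" if b: "b \<in> Basis" for b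
  proof -
   have "\<forall>h. norm h < s \<longrightarrow> ((\<lambda>k. c (k(b := Suc (k b))) * real (Suc (k b)) * mi_power h k) has_sum
     frechet_derivative f (at (a + h)) b) multi_indices"
    using fd b shifted_series_has_sum[OF b g(2)[OF _ b]] by simp
   then show ?thesis unfolding real_analytic_at_def
    by (intro exI[of _ s] conjI s exI[of _ "\<lambda>k. c (k(b := Suc (k b))) * real (Suc (k b))"])
  qed
  ultimately show ?thesis by blast
 qed
 show "(f has_derivative frechet_derivative f (at a)) (at a)" if "a \<in> S" for a using main[OF that] by blast
 show "real_analytic_on (pd b f) S" if "b \<in> Basis" for b
  using main that by (auto simp: real_analytic_on_def pd_def[abs_def])
qed

text \<open>Partial derivatives of analytic functions are analytic, so the induction on the order of
  differentiability runs over all analytic functions at once.\<close>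

lemma real_analytic_on_imp_smooth:
 fixes f :: "'a::euclidean_space \<Rightarrow> real"
 assumes "real_analytic_on f S"
 shows "smooth S f"
proof -
 have "cdiff n S f" for n
  using assms
 proof (induction n arbitrary: f)
  case 0
  have "\<forall>a\<in>S. isCont f a"
   using real_analytic_on_derivative(1)[OF 0] has_derivative_continuous by blast
  then show ?case by (simp add: continuous_at_imp_continuous_on)
 next
  case (Suc n)
  have "\<forall>a\<in>S. (f has_derivative frechet_derivative f (at a)) (at a within S)"
   using real_analytic_on_derivative(1)[OF Suc.prems] has_derivative_at_withinI by blast
  moreover have "\<forall>b\<in>Basis. cdiff n S (\<lambda>a. frechet_derivative f (at a) b)"
   using real_analytic_on_derivative(2)[OF Suc.prems] Suc.IH unfolding pd_def[abs_def] by blast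
  ultimately show ?case unfolding cdiff.simps
   by (intro exI[of _ "\<lambda>a. frechet_derivative f (at a)"] conjI)
 qed
 then show ?thesis by (simp add: smooth_def)
qed

text \<open>The set \<open>T\<close> admits one-sided derivatives, for curves parametrised by closed
  intervals of \<open>t\<close> or \<open>x\<close>.\<close>

lemma smooth_chain:
 fixes f :: "'a::euclidean_space \<Rightarrow> real"
 assumes S: "open S" "smooth S f" "\<gamma> s \<in> S" and g: "(\<gamma> has_vector_derivative \<gamma>') (at s within T)"
 shows "((\<lambda>s. f (\<gamma> s)) has_real_derivative (\<Sum>b\<in>Basis. (\<gamma>' \<bullet> b) * pd b f (\<gamma> s))) (at s within T)"
proof -
 have "(\<gamma> has_derivative (\<lambda>h. h *\<^sub>R \<gamma>')) (at s within T)"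
  using g by (simp add: has_vector_derivative_def)
 from has_derivative_compose[OF this smooth_has_derivative[OF S]]
 have "((\<lambda>s. f (\<gamma> s)) has_derivative (\<lambda>h. (\<Sum>b\<in>Basis. (\<gamma>' \<bullet> b) * pd b f (\<gamma> s)) * h)) (at s within T)"
  by (rule has_derivative_eq_rhs) (auto simp: sum_distrib_left sum_distrib_right mult_ac)
 then show ?thesis by (simp add: has_field_derivative_def)
qed

lemma sum_Basis_prod:
 fixes f :: "'a::euclidean_space \<times> 'b::euclidean_space \<Rightarrow> real"
 shows "(\<Sum>b\<in>Basis. f b) = (\<Sum>i\<in>Basis. f (i, 0)) + (\<Sum>i\<in>Basis. f (0, i))"
proof -
 have "inj_on (\<lambda>i::'a. (i, 0::'b)) Basis" "inj_on (\<lambda>i::'b. (0::'a, i)) Basis"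
  by (auto intro!: inj_onI)
 moreover have "(\<lambda>i::'a. (i, 0::'b)) ` Basis \<inter> (\<lambda>i. (0, i)) ` Basis = {}"
  by auto
 ultimately show ?thesis
  unfolding Basis_prod_def by (subst sum.union_disjoint) (auto simp: sum.reindex)
qed

lemmas tuple_basis_sum = sum_Basis_prod inner_prod_def

lemma smooth_chain3:
 assumes "open S" "smooth S f" "(a1 s, a2 s, a3 s) \<in> S"
  "(a1 has_real_derivative d1) (at s within T)" "(a2 has_real_derivative d2) (at s within T)"
  "(a3 has_real_derivative d3) (at s within T)"
 shows "((\<lambda>s. f (a1 s, a2 s, a3 s)) has_real_derivative
   d1 * pd (1,0) f (a1 s, a2 s, a3 s) + d2 * pd (0,1,0) f (a1 s, a2 s, a3 s)
   + d3 * pd (0,0,1) f (a1 s, a2 s, a3 s)) (at s within T)"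
 by (rule smooth_chain[where \<gamma> = "\<lambda>s. (a1 s, a2 s, a3 s)" and \<gamma>' = "(d1, d2, d3)" and S = S, THEN DERIV_cong])
  (use assms in \<open>auto intro!: has_vector_derivative_Pair simp: tuple_basis_sum has_real_derivative_iff_has_vector_derivative zero_prod_def\<close>)

lemma smooth_chain4:
 assumes "open S" "smooth S f" "(a1 s, a2 s, a3 s, a4 s) \<in> S"
  "(a1 has_real_derivative d1) (at s within T)" "(a2 has_real_derivative d2) (at s within T)"
  "(a3 has_real_derivative d3) (at s within T)" "(a4 has_real_derivative d4) (at s within T)"
 shows "((\<lambda>s. f (a1 s, a2 s, a3 s, a4 s)) has_real_derivative
   d1 * pd (1,0) f (a1 s, a2 s, a3 s, a4 s) + d2 * pd (0,1,0) f (a1 s, a2 s, a3 s, a4 s)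
   + d3 * pd (0,0,1,0) f (a1 s, a2 s, a3 s, a4 s) + d4 * pd (0,0,0,1) f (a1 s, a2 s, a3 s, a4 s)) (at s within T)"
 by (rule smooth_chain[where \<gamma> = "\<lambda>s. (a1 s, a2 s, a3 s, a4 s)" and \<gamma>' = "(d1, d2, d3, d4)" and S = S, THEN DERIV_cong])
  (use assms in \<open>auto intro!: has_vector_derivative_Pair simp: tuple_basis_sum has_real_derivative_iff_has_vector_derivative zero_prod_def\<close>)

lemma smooth_chain5:
 assumes "open S" "smooth S f" "(a1 s, a2 s, a3 s, a4 s, a5 s) \<in> S"
  "(a1 has_real_derivative d1) (at s within T)" "(a2 has_real_derivative d2) (at s within T)"
  "(a3 has_real_derivative d3) (at s within T)" "(a4 has_real_derivative d4) (at s within T)"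
  "(a5 has_real_derivative d5) (at s within T)"
 shows "((\<lambda>s. f (a1 s, a2 s, a3 s, a4 s, a5 s)) has_real_derivative
   d1 * pd (1,0) f (a1 s, a2 s, a3 s, a4 s, a5 s) + d2 * pd (0,1,0) f (a1 s, a2 s, a3 s, a4 s, a5 s)
   + d3 * pd (0,0,1,0) f (a1 s, a2 s, a3 s, a4 s, a5 s) + d4 * pd (0,0,0,1,0) f (a1 s, a2 s, a3 s, a4 s, a5 s)
   + d5 * pd (0,0,0,0,1) f (a1 s, a2 s, a3 s, a4 s, a5 s)) (at s within T)"
 by (rule smooth_chain[where \<gamma> = "\<lambda>s. (a1 s, a2 s, a3 s, a4 s, a5 s)" and \<gamma>' = "(d1, d2, d3, d4, d5)" and S = S, THEN DERIV_cong])
  (use assms in \<open>auto intro!: has_vector_derivative_Pair simp: tuple_basis_sum has_real_derivative_iff_has_vector_derivative zero_prod_def\<close>)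

lemma smooth_chain6:
 assumes "open S" "smooth S f" "(a1 s, a2 s, a3 s, a4 s, a5 s, a6 s) \<in> S"
  "(a1 has_real_derivative d1) (at s within T)" "(a2 has_real_derivative d2) (at s within T)"
  "(a3 has_real_derivative d3) (at s within T)" "(a4 has_real_derivative d4) (at s within T)"
  "(a5 has_real_derivative d5) (at s within T)" "(a6 has_real_derivative d6) (at s within T)"
 shows "((\<lambda>s. f (a1 s, a2 s, a3 s, a4 s, a5 s, a6 s)) has_real_derivative
   d1 * pd (1,0) f (a1 s, a2 s, a3 s, a4 s, a5 s, a6 s) + d2 * pd (0,1,0) f (a1 s, a2 s, a3 s, a4 s, a5 s, a6 s)
   + d3 * pd (0,0,1,0) f (a1 s, a2 s, a3 s, a4 s, a5 s, a6 s) + d4 * pd (0,0,0,1,0) f (a1 s, a2 s, a3 s, a4 s, a5 s, a6 s)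
   + d5 * pd (0,0,0,0,1,0) f (a1 s, a2 s, a3 s, a4 s, a5 s, a6 s)
   + d6 * pd (0,0,0,0,0,1) f (a1 s, a2 s, a3 s, a4 s, a5 s, a6 s)) (at s within T)"
 by (rule smooth_chain[where \<gamma> = "\<lambda>s. (a1 s, a2 s, a3 s, a4 s, a5 s, a6 s)" and \<gamma>' = "(d1, d2, d3, d4, d5, d6)" and S = S, THEN DERIV_cong])
  (use assms in \<open>auto intro!: has_vector_derivative_Pair simp: tuple_basis_sum has_real_derivative_iff_has_vector_derivative zero_prod_def\<close>)

lemma smooth_tuple3:
 assumes "smooth S' f" "\<And>p. p \<in> S \<Longrightarrow> (a1 p, a2 p, a3 p) \<in> S'" "smooth S a1" "smooth S a2" "smooth S a3"
 shows "smooth S (\<lambda>p. f (a1 p, a2 p, a3 p))"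
 by (rule smooth_compose[OF assms(1)]) (use assms in \<open>auto simp: Basis_prod_def\<close>)

lemma smooth_tuple4:
 assumes "smooth S' f" "\<And>p. p \<in> S \<Longrightarrow> (a1 p, a2 p, a3 p, a4 p) \<in> S'" "smooth S a1" "smooth S a2" "smooth S a3" "smooth S a4"
 shows "smooth S (\<lambda>p. f (a1 p, a2 p, a3 p, a4 p))"
 by (rule smooth_compose[OF assms(1)]) (use assms in \<open>auto simp: Basis_prod_def\<close>)

lemma smooth_tuple5:
 assumes "smooth S' f" "\<And>p. p \<in> S \<Longrightarrow> (a1 p, a2 p, a3 p, a4 p, a5 p) \<in> S'"
  "smooth S a1" "smooth S a2" "smooth S a3" "smooth S a4" "smooth S a5"
 shows "smooth S (\<lambda>p. f (a1 p, a2 p, a3 p, a4 p, a5 p))"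
 by (rule smooth_compose[OF assms(1)]) (use assms in \<open>auto simp: Basis_prod_def\<close>)

lemma smooth_real:
 assumes "smooth S' f" "\<And>p. p \<in> S \<Longrightarrow> a p \<in> S'" "smooth S a"
 shows "smooth S (\<lambda>p. f (a p :: real))"
 by (rule smooth_compose[OF assms(1)]) (use assms in auto)

lemma open_preimage_smooth: "open S \<Longrightarrow> smooth S f \<Longrightarrow> open T \<Longrightarrow> open {p \<in> S. f p \<in> T}"
 using continuous_open_preimage[OF smooth_continuous, of S f T] by (simp add: Int_def vimage_def)

lemma pd_DERIV_eq:
 assumes "open S" "smooth S f" "p \<in> S" "b \<in> Basis" "((\<lambda>s. f (p + s *\<^sub>R b)) has_real_derivative D) (at 0)"
 shows "pd b f p = D"
 using smooth_partial_DERIV[OF assms(1-4)] assms(5) DERIV_unique by blast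

section \<open>Reduction to a wave equation\<close>

type_synonym jet = "real \<times> real \<times> real \<times> real \<times> real \<times> real"

definition px :: "jet \<Rightarrow> real" where "px p = fst p"
definition py :: "jet \<Rightarrow> real" where "py p = fst (snd p)"
definition py1 :: "jet \<Rightarrow> real" where "py1 p = fst (snd (snd p))"
definition py2 :: "jet \<Rightarrow> real" where "py2 p = fst (snd (snd (snd p)))"
definition pu :: "jet \<Rightarrow> real" where "pu p = fst (snd (snd (snd (snd p))))"
definition pu1 :: "jet \<Rightarrow> real" where "pu1 p = snd (snd (snd (snd (snd p))))"

lemma jet_proj [simp]:
 "px (x, y, y1, y2, u, u1) = x" "py (x, y, y1, y2, u, u1) = y" "py1 (x, y, y1, y2, u, u1) = y1"
 "py2 (x, y, y1, y2, u, u1) = y2" "pu (x, y, y1, y2, u, u1) = u" "pu1 (x, y, y1, y2, u, u1) = u1"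
 by (auto simp: px_def py_def py1_def py2_def pu_def pu1_def)

lemma smooth_proj: "smooth S px" "smooth S py" "smooth S py1" "smooth S py2" "smooth S pu" "smooth S pu1"
 unfolding px_def[abs_def] py_def[abs_def] py1_def[abs_def] py2_def[abs_def] pu_def[abs_def] pu1_def[abs_def]
 by (auto intro!: smooth_linear bounded_linear_intros)

lemmas smooth_intros = smooth_proj smooth_const smooth_add smooth_diff smooth_minus smooth_mult

lemma jet_Basis: "(1,0) \<in> (Basis :: jet set)" "(0,1,0) \<in> (Basis :: jet set)" "(0,0,1,0) \<in> (Basis :: jet set)"
  "(0,0,0,1,0) \<in> (Basis :: jet set)" "(0,0,0,0,1,0) \<in> (Basis :: jet set)" "(0,0,0,0,0,1) \<in> (Basis :: jet set)"
 by (auto simp: Basis_prod_def zero_prod_def)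

text \<open>Of the analytic hypotheses only smoothness is kept, together with the signs of
  \<open>J\<close> and \<open>H1\<close> and the vanishing of \<open>H2\<close> at zero arguments.
  The quotients of hypothesis (ii) are available only near the zero jet at \<open>x = 1\<close>, and
  their last two arguments are \<open>v\<close> and \<open>Dv\<close>, not \<open>u\<close> and
  \<open>Du\<close>.\<close>

locale reduction =
 fixes N :: real and l1 L0 :: "real \<Rightarrow> real" and I U :: "real set"
  and J :: "real \<times> real \<times> real \<Rightarrow> real"
  and H1 :: "real \<times> real \<times> real \<times> real \<Rightarrow> real"
  and H2 :: "real \<times> real \<times> real \<times> real \<times> real \<Rightarrow> real"
  and V :: "jet set" and \<Omega>\<^sub>J \<Omega>\<^sub>H \<Omega>\<^sub>w :: "jet \<Rightarrow> real"
 assumes I: "open I" "{0..1} \<subseteq> I" and U: "open U" "0 \<in> U"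
  and sm_l: "smooth I l1" "smooth I L0"
  and sm_J: "smooth (I \<times> U \<times> U) J" and sm_H1: "smooth (I \<times> U \<times> U \<times> U) H1"
  and sm_H2: "smooth (I \<times> U \<times> U \<times> U \<times> U) H2"
  and H2_0: "\<And>x. x \<in> I \<Longrightarrow> H2 (x, 0, 0, 0, 0) = 0"
  and J_0: "\<And>x. x \<in> I \<Longrightarrow> J (x, 0, 0) > 0"
  and H1_0: "\<And>x. x \<in> I \<Longrightarrow> H1 (x, 0, 0, 0) > 0"
  and V: "open V" "(1, 0) \<in> V" and sm_\<Omega>: "smooth V \<Omega>\<^sub>J" "smooth V \<Omega>\<^sub>H" "smooth V \<Omega>\<^sub>w"
  and \<Omega>\<^sub>J: "\<And>x y y1 y2 v v1. (x, y, y1, y2, v, v1) \<in> V \<Longrightarrow> x \<in> I \<Longrightarrow> y \<in> U \<Longrightarrow> x * y1 \<in> U \<Longrightarrow>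
   pd (0,0,1) J (x, y, x * y1) = (1 - x) * \<Omega>\<^sub>J (x, y, y1, y2, v, v1)"
  and \<Omega>\<^sub>H: "\<And>x y y1 y2 v v1. (x, y, y1, y2, v, v1) \<in> V \<Longrightarrow> x \<in> I \<Longrightarrow> y \<in> U \<Longrightarrow> x * y1 \<in> U \<Longrightarrow>
   v \<in> U \<Longrightarrow> x * v1 \<in> U \<Longrightarrow>
   pd (0,0,1,0) H1 (x, y, x * y1, v) * L_sym N l1 L0 x y y1 y2 + pd (0,0,1,0) H2 (x, y, x * y1, v, x * v1)
    = (1 - x) * \<Omega>\<^sub>H (x, y, y1, y2, v, v1)"
  and \<Omega>\<^sub>w: "\<And>x y y1 y2 v v1. (x, y, y1, y2, v, v1) \<in> V \<Longrightarrow> x \<in> I \<Longrightarrow> y \<in> U \<Longrightarrow> x * y1 \<in> U \<Longrightarrow>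
   v \<in> U \<Longrightarrow> x * v1 \<in> U \<Longrightarrow>
   pd (0,0,0,0,1) H2 (x, y, x * y1, v, x * v1) = (1 - x) * \<Omega>\<^sub>w (x, y, y1, y2, v, v1)"
begin

definition zz where "zz p = px p * py1 p"
definition Jp where "Jp p = J (px p, py p, zz p)"
definition Jx where "Jx p = pd (1,0) J (px p, py p, zz p)"
definition Jy where "Jy p = pd (0,1,0) J (px p, py p, zz p)"
definition Jz where "Jz p = pd (0,0,1) J (px p, py p, zz p)"
text \<open>With \<open>ka = 1 / J\<close>, \<open>vv\<close> is the old unknown
  \<open>v = u / J\<close>. \<open>Dka\<close> and \<open>vv1\<close> are total derivatives in
  \<open>x\<close> written as functions of the jet, so that \<open>vv1\<close> is \<open>Dv\<close>
  and \<open>ww\<close> is \<open>w = x Dv\<close>.\<close>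

definition ka where "ka p = inverse (Jp p)"
definition vv where "vv p = ka p * pu p"
definition Dka where "Dka p = - (ka p * ka p * (Jx p + Jy p * py1 p + Jz p * (py1 p + px p * py2 p)))"
definition vv1 where "vv1 p = ka p * pu1 p + pu p * Dka p"
definition ww where "ww p = px p * vv1 p"
definition Lp where "Lp p = L_sym N l1 L0 (px p) (py p) (py1 p) (py2 p)"
definition H1p where "H1p p = H1 (px p, py p, zz p, vv p)"
definition H2p where "H2p p = H2 (px p, py p, zz p, vv p, ww p)"
text \<open>Translates a jet in \<open>u\<close> into the jet in \<open>v\<close> in which
  hypothesis (ii) is expressed.\<close>

definition \<psi> :: "jet \<Rightarrow> jet" where "\<psi> p = (px p, py p, py1 p, py2 p, vv p, vv1 p)"
definition M where "M p = (if \<psi> p \<in> V then \<Omega>\<^sub>J (\<psi> p) else Jz p / (1 - px p))"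
definition H2w where "H2w p = pd (0,0,0,0,1) H2 (px p, py p, zz p, vv p, ww p)"
definition W where "W p = (if \<psi> p \<in> V then \<Omega>\<^sub>w (\<psi> p) else H2w p / (1 - px p))"
definition Hz where "Hz p = pd (0,0,1,0) H1 (px p, py p, zz p, vv p) * Lp p + pd (0,0,1,0) H2 (px p, py p, zz p, vv p, ww p)"
definition \<Omega> where "\<Omega> p = (if \<psi> p \<in> V then \<Omega>\<^sub>H (\<psi> p) else Hz p / (1 - px p))"
definition H1v where "H1v p = pd (0,0,0,1) H1 (px p, py p, zz p, vv p)"
definition H2v where "H2v p = pd (0,0,0,1,0) H2 (px p, py p, zz p, vv p, ww p)"

text \<open>Besides \<open>J H1\<close>, which comes from the second-order term of
  \<open>Lp\<close>, there is a contribution of \<open>H2\<close>: its argument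
  \<open>w = x Dv\<close> contains the second derivative of \<open>y\<close> through the derivative
  of \<open>1 / J\<close>.\<close>

definition A where "A p = Jp p * H1p p + px p * W p * pu p * ka p * Jz p"
definition B where "B p = W p - ka p * pu p * M p"
text \<open>From \<open>u_t = J v_t + J_t v\<close>, where \<open>J_t = J_y u + J_z x Du\<close>
  because \<open>y_t = u\<close>, and \<open>v_t\<close> is taken from the second equation of the
  system.\<close>

definition G where
 "G p = Jp p * H1p p * Lp p + Jp p * H2p p - ka p * pu p * (Jy p * pu p + Jz p * px p * pu1 p)"

text \<open>Nested sets: each new condition involves functions whose smoothness is known on the
  preceding set, which is how openness is obtained. On \<open>O5\<close> the division by
  \<open>1 - x\<close> makes sense; on \<open>dom\<close> the wave equation is moreover
  hyperbolic.\<close>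

definition O1 where "O1 = {p. px p \<in> I \<and> py p \<in> U \<and> zz p \<in> U}"
definition O2 where "O2 = {p \<in> O1. Jp p \<in> {0<..}}"
definition O3 where "O3 = {p \<in> O2. vv p \<in> U}"
definition O4 where "O4 = {p \<in> O3. ww p \<in> U}"
definition O5 where "O5 = {p \<in> O4. \<psi> p \<in> V} \<union> {p \<in> O4. px p \<in> - {1}}"
definition dom where "dom = {p \<in> O5. A p \<in> {0<..}}"

lemma open_prods: "open (I \<times> U \<times> U)" "open (I \<times> U \<times> U \<times> U)" "open (I \<times> U \<times> U \<times> U \<times> U)"
 using I U by (auto intro!: open_Times)

lemma sm_zz: "smooth S zz"
 unfolding zz_def[abs_def] by (intro smooth_intros)

lemma open_O1: "open O1"
proof -
 have "O1 = {p \<in> {p \<in> {p \<in> UNIV. px p \<in> I}. py p \<in> U}. zz p \<in> U}" by (auto simp: O1_def)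
 also have "open \<dots>" by (intro open_preimage_smooth open_UNIV smooth_proj sm_zz I U)
 finally show ?thesis .
qed

lemma basis3: "(1,0) \<in> (Basis :: (real \<times> real \<times> real) set)" "(0,1,0) \<in> (Basis :: (real \<times> real \<times> real) set)"
  "(0,0,1) \<in> (Basis :: (real \<times> real \<times> real) set)"
 and basis4: "(0,0,1,0) \<in> (Basis :: (real \<times> real \<times> real \<times> real) set)"
  "(0,0,0,1) \<in> (Basis :: (real \<times> real \<times> real \<times> real) set)"
 and basis5: "(0,0,1,0) \<in> (Basis :: (real \<times> real \<times> real \<times> real \<times> real) set)"
  "(0,0,0,1,0) \<in> (Basis :: (real \<times> real \<times> real \<times> real \<times> real) set)"
  "(0,0,0,0,1) \<in> (Basis :: (real \<times> real \<times> real \<times> real \<times> real) set)"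
 by (auto simp: Basis_prod_def zero_prod_def)

lemma sm_O1: "S \<subseteq> O1 \<Longrightarrow> smooth S Jp" "S \<subseteq> O1 \<Longrightarrow> smooth S Jx" "S \<subseteq> O1 \<Longrightarrow> smooth S Jy" "S \<subseteq> O1 \<Longrightarrow> smooth S Jz"
 unfolding Jp_def[abs_def] Jx_def[abs_def] Jy_def[abs_def] Jz_def[abs_def]
 by (rule smooth_tuple3[where S' = "I \<times> U \<times> U"];
   auto intro!: smooth_proj sm_zz smooth_pd open_prods sm_J basis3 simp: O1_def)+

lemma open_O2: "open O2"
 unfolding O2_def by (intro open_preimage_smooth open_O1 sm_O1) auto

lemma O2D: "p \<in> O2 \<Longrightarrow> Jp p > 0" "O2 \<subseteq> O1"
 by (auto simp: O2_def)

lemma sm_O2: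
 assumes "S \<subseteq> O2"
 shows "smooth S ka" "smooth S vv" "smooth S Dka" "smooth S vv1" "smooth S ww"
proof -
 have 1: "S \<subseteq> O1" using assms O2D(2) by blast
 show 2: "smooth S ka" unfolding ka_def[abs_def]
  by (rule smooth_inverse[OF sm_O1(1)[OF 1]]) (use assms O2D(1) in force)
 show "smooth S vv" unfolding vv_def[abs_def] by (intro smooth_intros 2)
 show 3: "smooth S Dka" unfolding Dka_def[abs_def] by (intro smooth_intros 2 sm_O1 1)
 show 4: "smooth S vv1" unfolding vv1_def[abs_def] by (intro smooth_intros 2 3)
 show "smooth S ww" unfolding ww_def[abs_def] by (intro smooth_intros 4)
qed

lemma open_O3: "open O3"
 unfolding O3_def by (intro open_preimage_smooth open_O2 sm_O2 U) auto

lemma open_O4: "open O4"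
 unfolding O4_def by (intro open_preimage_smooth open_O3 sm_O2 U) (auto simp: O3_def)

lemma O4D: "p \<in> O4 \<Longrightarrow> px p \<in> I \<and> py p \<in> U \<and> zz p \<in> U \<and> Jp p > 0 \<and> vv p \<in> U \<and> ww p \<in> U"
 by (auto simp: O4_def O3_def O2_def O1_def)

lemma O4_sub: "O4 \<subseteq> O2" "O4 \<subseteq> O1"
 by (auto simp: O4_def O3_def O2_def O1_def)

lemma sm_psi: "S \<subseteq> O4 \<Longrightarrow> b \<in> Basis \<Longrightarrow> smooth S (\<lambda>p. \<psi> p \<bullet> b)"
 unfolding \<psi>_def using sm_O2[of S] O4_sub
 by (auto simp: Basis_prod_def intro!: smooth_proj)

lemma open_psi_V: "open {p \<in> O4. \<psi> p \<in> V}"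
proof -
 have "continuous_on O4 \<psi>"
  by (subst continuous_on_componentwise) (auto intro!: smooth_continuous sm_psi)
 from continuous_open_preimage[OF this open_O4 V(1)] show ?thesis by (simp add: Int_def vimage_def)
qed

lemma open_O5: "open O5"
 unfolding O5_def by (intro open_Un open_psi_V open_preimage_smooth open_O4 smooth_proj) auto

lemma O5_sub: "O5 \<subseteq> O4" "O5 \<subseteq> O2" "O5 \<subseteq> O1"
 using O4_sub by (auto simp: O5_def)

lemma sm_O4:
 assumes S: "S \<subseteq> O4"
 shows "smooth S H1p" "smooth S H2p" "smooth S Lp" "smooth S H2w" "smooth S Hz" "smooth S H1v" "smooth S H2v"
proof -
 note s = sm_O2[OF order_trans[OF S O4_sub(1)]] smooth_proj sm_zz
 show "smooth S H1p" unfolding H1p_def[abs_def]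
  by (rule smooth_tuple4[OF sm_H1]) (use S O4D in \<open>auto intro!: s\<close>)
 show "smooth S H2p" unfolding H2p_def[abs_def]
  by (rule smooth_tuple5[OF sm_H2]) (use S O4D in \<open>auto intro!: s\<close>)
 show L: "smooth S Lp" unfolding Lp_def[abs_def] L_sym_def
  by (intro smooth_intros smooth_real[OF sm_l(1)] smooth_real[OF sm_l(2)]) (use S O4D in auto)
 show "smooth S H2w" unfolding H2w_def[abs_def]
  by (rule smooth_tuple5[OF smooth_pd[OF open_prods(3) sm_H2 basis5(3)]]) (use S O4D in \<open>auto intro!: s\<close>)
 show "smooth S H1v" unfolding H1v_def[abs_def]
  by (rule smooth_tuple4[OF smooth_pd[OF open_prods(2) sm_H1 basis4(2)]]) (use S O4D in \<open>auto intro!: s\<close>)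
 show "smooth S H2v" unfolding H2v_def[abs_def]
  by (rule smooth_tuple5[OF smooth_pd[OF open_prods(3) sm_H2 basis5(2)]]) (use S O4D in \<open>auto intro!: s\<close>)
 have a: "smooth S (\<lambda>p. pd (0,0,1,0) H1 (px p, py p, zz p, vv p))"
  by (rule smooth_tuple4[OF smooth_pd[OF open_prods(2) sm_H1 basis4(1)]]) (use S O4D in \<open>auto intro!: s\<close>)
 have b: "smooth S (\<lambda>p. pd (0,0,1,0) H2 (px p, py p, zz p, vv p, ww p))"
  by (rule smooth_tuple5[OF smooth_pd[OF open_prods(3) sm_H2 basis5(1)]]) (use S O4D in \<open>auto intro!: s\<close>)
 show "smooth S Hz" unfolding Hz_def[abs_def] by (intro smooth_intros a b L)
qed

text \<open>Division by \<open>1 - x\<close>: near \<open>x = 1\<close> the quotient is the given \<open>\<Omega>\<close>, elsewhere it is smooth anyway.\<close>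

lemma smooth_quotient:
 assumes num: "smooth O4 f" and \<Omega>': "smooth V g"
  and eq: "\<And>p. p \<in> O4 \<Longrightarrow> \<psi> p \<in> V \<Longrightarrow> f p = (1 - px p) * g (\<psi> p)"
 shows "smooth O5 (\<lambda>p. if \<psi> p \<in> V then g (\<psi> p) else f p / (1 - px p))" (is "smooth O5 ?q")
  and "p \<in> O5 \<Longrightarrow> f p = (1 - px p) * (if \<psi> p \<in> V then g (\<psi> p) else f p / (1 - px p))"
proof -
 show "smooth O5 ?q"
 proof (rule smooth_open_local[OF open_O5])
  fix p assume p: "p \<in> O5"
  let ?S1 = "{p \<in> O4. \<psi> p \<in> V}" and ?S2 = "{p \<in> O4. px p \<in> - {1}}"
  have 1: "smooth ?S1 ?q"
  proof (rule smooth_cong)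
   show "smooth ?S1 (\<lambda>p. g (\<psi> p))"
    by (rule smooth_compose[OF \<Omega>']) (auto intro!: sm_psi)
  qed auto
  have 2: "smooth ?S2 ?q"
  proof (rule smooth_cong)
   show "smooth ?S2 (\<lambda>p. f p / (1 - px p))"
    by (intro smooth_divide smooth_intros smooth_subset[OF num]) auto
  qed (auto simp: eq)
  have "open ?S2" by (intro open_preimage_smooth open_O4 smooth_proj) auto
  then show "\<exists>V'. open V' \<and> p \<in> V' \<and> smooth V' ?q"
   using p 1 2 open_psi_V unfolding O5_def by blast
 qed
 show "p \<in> O5 \<Longrightarrow> f p = (1 - px p) * (if \<psi> p \<in> V then g (\<psi> p) else f p / (1 - px p))"
  using eq[of p] by (auto simp: O5_def)
qed

lemma sm_MW:
 shows "smooth O5 M" "smooth O5 W" "smooth O5 \<Omega>"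
  and "p \<in> O5 \<Longrightarrow> Jz p = (1 - px p) * M p" "p \<in> O5 \<Longrightarrow> H2w p = (1 - px p) * W p"
  "p \<in> O5 \<Longrightarrow> Hz p = (1 - px p) * \<Omega> p"
proof -
 have 1: "Jz p = (1 - px p) * \<Omega>\<^sub>J (\<psi> p)" if "p \<in> O4" "\<psi> p \<in> V" for p
  using \<Omega>\<^sub>J[of "px p" "py p" "py1 p" "py2 p" "vv p" "vv1 p"] O4D[OF that(1)] that(2)
  by (simp add: \<psi>_def Jz_def zz_def)
 have 2: "H2w p = (1 - px p) * \<Omega>\<^sub>w (\<psi> p)" if "p \<in> O4" "\<psi> p \<in> V" for p
  using \<Omega>\<^sub>w[of "px p" "py p" "py1 p" "py2 p" "vv p" "vv1 p"] O4D[OF that(1)] that(2)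
  by (simp add: \<psi>_def H2w_def zz_def ww_def)
 have 3: "Hz p = (1 - px p) * \<Omega>\<^sub>H (\<psi> p)" if "p \<in> O4" "\<psi> p \<in> V" for p
  using \<Omega>\<^sub>H[of "px p" "py p" "py1 p" "py2 p" "vv p" "vv1 p"] O4D[OF that(1)] that(2)
  by (simp add: \<psi>_def Hz_def zz_def ww_def Lp_def)
 note sm = sm_O1(4)[OF O4_sub(2)] sm_O4[OF order_refl]
 show "smooth O5 M" "smooth O5 W" "smooth O5 \<Omega>"
  unfolding M_def[abs_def] W_def[abs_def] \<Omega>_def[abs_def]
  using smooth_quotient(1)[OF sm(1) sm_\<Omega>(1) 1] smooth_quotient(1)[OF sm(5) sm_\<Omega>(3) 2]
   smooth_quotient(1)[OF sm(6) sm_\<Omega>(2) 3] by simp_all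
 show "p \<in> O5 \<Longrightarrow> Jz p = (1 - px p) * M p" "p \<in> O5 \<Longrightarrow> H2w p = (1 - px p) * W p"
  "p \<in> O5 \<Longrightarrow> Hz p = (1 - px p) * \<Omega> p"
  unfolding M_def W_def \<Omega>_def
  using smooth_quotient(2)[OF sm(1) sm_\<Omega>(1) 1] smooth_quotient(2)[OF sm(5) sm_\<Omega>(3) 2]
   smooth_quotient(2)[OF sm(6) sm_\<Omega>(2) 3] by blast+
qed

lemma sm_AG: "smooth O5 A" "smooth O5 B" "smooth O5 G"
 unfolding A_def[abs_def] B_def[abs_def] G_def[abs_def]
 by (intro smooth_intros sm_MW sm_O1 sm_O2 sm_O4 O5_sub)+

lemma open_dom: "open dom"
 unfolding dom_def by (intro open_preimage_smooth open_O5 sm_AG) auto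

text \<open>The prefix \<open>d\<close> stands for the partial derivative in \<open>Dy\<close>. As
  \<open>z = x Dy\<close>, each derivative in \<open>z\<close> comes with a factor
  \<open>x\<close>.\<close>

definition dJx where "dJx p = px p * pd (0,0,1) (pd (1,0) J) (px p, py p, zz p)"
definition dJy where "dJy p = px p * pd (0,0,1) (pd (0,1,0) J) (px p, py p, zz p)"
definition dJz where "dJz p = px p * pd (0,0,1) (pd (0,0,1) J) (px p, py p, zz p)"
definition dka where "dka p = - (ka p * ka p * (px p * Jz p))"
definition dDka where "dDka p = - (2 * ka p * dka p * (Jx p + Jy p * py1 p + Jz p * (py1 p + px p * py2 p))
  + ka p * ka p * (dJx p + dJy p * py1 p + Jy p + dJz p * (py1 p + px p * py2 p) + Jz p))"
definition dvv1 where "dvv1 p = dka p * pu1 p + pu p * dDka p"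
text \<open>What is left of the \<open>Dy\<close>-derivative of \<open>G\<close> once the singular
  part is split off and \<open>x (1 - x)\<close> is cancelled. The last summand corrects for writing
  the singular part with \<open>A\<close> instead of \<open>J H1\<close>.\<close>

definition C where
 "C p = H1p p * Lp p * M p + Jp p * \<Omega> p - Jp p * (H1v p * Lp p + H2v p) * (pu p * ka p * ka p * M p)
  + H2p p * M p + Jp p * W p * dvv1 p + ka p * ka p * M p * pu p * (Jy p * pu p + Jz p * px p * pu1 p)
  - ka p * pu p * (pu p * pd (0,1,0) M p + pd (0,0,1,0) M p * pu1 p)
  + l1 (px p) * Jp p * H1p p + (5 / 2 * (1 - px p) - N / 2 * px p) * W p * pu p * ka p * M p"

lemma sm_C: "smooth O5 C"
proof -
 have d: "smooth O5 dJx" "smooth O5 dJy" "smooth O5 dJz"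
  unfolding dJx_def[abs_def] dJy_def[abs_def] dJz_def[abs_def]
  by (intro smooth_intros smooth_tuple3[where S' = "I \<times> U \<times> U"] smooth_pd open_prods sm_J basis3 sm_zz;
    use O5_sub in \<open>auto simp: O1_def\<close>)+
 have dk: "smooth O5 dka" unfolding dka_def[abs_def]
  by (intro smooth_intros sm_O1 sm_O2 O5_sub)
 have dD: "smooth O5 dDka" unfolding dDka_def[abs_def]
  by (intro smooth_intros sm_O1 sm_O2 O5_sub dk d)
 have dv: "smooth O5 dvv1" unfolding dvv1_def[abs_def]
  by (intro smooth_intros dk dD)
 have l: "smooth O5 (\<lambda>p. l1 (px p))"
  by (rule smooth_real[OF sm_l(1)]) (use O5_sub O4D in \<open>auto intro: smooth_proj\<close>)
 show ?thesis unfolding C_def[abs_def]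
  by (intro smooth_intros sm_O1 sm_O2 sm_O4 O5_sub sm_MW dv l smooth_pd[OF open_O5 sm_MW(1)] jet_Basis)
qed

text \<open>The second derivative of \<open>y\<close> enters through \<open>Lp\<close> and through
  \<open>w\<close>. The second contribution carries the derivative of \<open>H2\<close> in
  \<open>w\<close>, which has the factor \<open>1 - x\<close> by hypothesis (ii).\<close>

lemma pd_G_y2:
 assumes p: "p \<in> O5"
 shows "pd (0,0,0,1,0) G p = - (px p * (1 - px p) * A p)"
proof (rule pd_DERIV_eq[OF open_O5 sm_AG(3) p jet_Basis(4)])
 obtain x y y1 y2 u u1 where pp: "p = (x, y, y1, y2, u, u1)" by (metis prod.exhaust)
 define P where "P s = (x, y, y1, y2 + s, u, u1)" for s
 have P: "p + s *\<^sub>R (0,0,0,1,0) = P s" for s by (simp add: pp P_def zero_prod_def)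
 have const: "zz (P s) = zz p" "Jp (P s) = Jp p" "Jx (P s) = Jx p" "Jy (P s) = Jy p" "Jz (P s) = Jz p" "ka (P s) = ka p"
  "vv (P s) = vv p" "H1p (P s) = H1p p" for s
  by (simp_all add: P_def pp zz_def Jp_def Jx_def Jy_def Jz_def ka_def vv_def H1p_def)
 have w: "((\<lambda>s. ww (P s)) has_real_derivative - (x * u * ka p * ka p * Jz p * x)) (at 0)"
  unfolding ww_def vv1_def Dka_def const unfolding P_def
  by (auto intro!: derivative_eq_intros simp: algebra_simps)
 have p4: "p \<in> O4" using p O5_sub by blast
 have 1: "((\<lambda>s. H2 (x, y, zz p, vv p, ww (P s))) has_real_derivative
   - (x * u * ka p * ka p * Jz p * x) * H2w p) (at 0)"
  by (rule smooth_chain5[OF open_prods(3) sm_H2 _ DERIV_const DERIV_const DERIV_const DERIV_const w, THEN DERIV_cong])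
   (use O4D[OF p4] in \<open>auto simp: pp P_def H2w_def\<close>)
 have H2eq: "H2p (P s) = H2 (x, y, zz p, vv p, ww (P s))" for s
  unfolding H2p_def const by (simp add: P_def)
 have 2: "((\<lambda>s. Lp (P s)) has_real_derivative - x * (1 - x)) (at 0)"
  unfolding Lp_def L_sym_def P_def by (auto intro!: derivative_eq_intros)
 have G: "G (P s) = Jp p * H1p p * Lp (P s) + Jp p * H2 (x, y, zz p, vv p, ww (P s))
   - ka p * u * (Jy p * u + Jz p * x * u1)" for s
  unfolding G_def const H2eq by (simp add: P_def)
 have "((\<lambda>s. G (P s)) has_real_derivative Jp p * H1p p * (- x * (1 - x))
   + Jp p * (- (x * u * ka p * ka p * Jz p * x) * H2w p)) (at 0)"
  unfolding G by (rule derivative_eq_intros refl 1 2 | simp)+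
 moreover have "Jp p * ka p = 1" using O4D[OF p4] by (simp add: ka_def)
 then have "Jp p * (x * u * ka p * ka p * Jz p * x * H2w p) = x * u * ka p * Jz p * x * H2w p"
  by (metis (no_types, opaque_lifting) mult.assoc mult.commute mult.left_commute mult_1)
 then have e: "Jp p * (- (x * u * ka p * ka p * Jz p * x) * H2w p) = - (x * u * ka p * Jz p * x * H2w p)"
  by (simp only: mult_minus_left mult_minus_right)
 have xu: "px p = x" "pu p = u" by (simp_all add: pp)
 then have H: "H2w p = (1 - x) * W p" using sm_MW(5)[OF p] by simp
 have "Jp p * H1p p * (- x * (1 - x)) + Jp p * (- (x * u * ka p * ka p * Jz p * x) * H2w p) = - (px p * (1 - px p) * A p)"
  unfolding e unfolding H A_def xu by (simp add: algebra_simps)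
 ultimately show "((\<lambda>s. G (p + s *\<^sub>R (0,0,0,1,0))) has_real_derivative - (px p * (1 - px p) * A p)) (at 0)"
  unfolding P by simp
qed

text \<open>\<open>Du\<close> enters through \<open>w\<close> and through the time derivative of
  \<open>J\<close>. The two contributions carry the derivative of \<open>H2\<close> in
  \<open>w\<close> and that of \<open>J\<close> in \<open>z\<close>, both of which have the factor
  \<open>1 - x\<close>.\<close>

lemma pd_G_u1:
 assumes p: "p \<in> O5"
 shows "pd (0,0,0,0,0,1) G p = px p * (1 - px p) * B p"
proof (rule pd_DERIV_eq[OF open_O5 sm_AG(3) p jet_Basis(6)])
 obtain x y y1 y2 u u1 where pp: "p = (x, y, y1, y2, u, u1)" by (metis prod.exhaust)
 define P where "P s = (x, y, y1, y2, u, u1 + s)" for s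
 have P: "p + s *\<^sub>R (0,0,0,0,0,1) = P s" for s by (simp add: pp P_def zero_prod_def)
 have const: "zz (P s) = zz p" "Jp (P s) = Jp p" "Jx (P s) = Jx p" "Jy (P s) = Jy p" "Jz (P s) = Jz p" "ka (P s) = ka p"
  "vv (P s) = vv p" "H1p (P s) = H1p p" "Dka (P s) = Dka p" "Lp (P s) = Lp p" for s
  by (simp_all add: P_def pp zz_def Jp_def Jx_def Jy_def Jz_def ka_def vv_def H1p_def Dka_def Lp_def)
 have w: "((\<lambda>s. ww (P s)) has_real_derivative x * ka p) (at 0)"
  unfolding ww_def vv1_def const unfolding P_def
  by (auto intro!: derivative_eq_intros simp: algebra_simps)
 have p4: "p \<in> O4" using p O5_sub by blast
 have 1: "((\<lambda>s. H2 (x, y, zz p, vv p, ww (P s))) has_real_derivative x * ka p * H2w p) (at 0)"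
  by (rule smooth_chain5[OF open_prods(3) sm_H2 _ DERIV_const DERIV_const DERIV_const DERIV_const w, THEN DERIV_cong])
   (use O4D[OF p4] in \<open>auto simp: pp P_def H2w_def\<close>)
 have H2eq: "H2p (P s) = H2 (x, y, zz p, vv p, ww (P s))" for s
  unfolding H2p_def const by (simp add: P_def)
 have G: "G (P s) = Jp p * H1p p * Lp p + Jp p * H2 (x, y, zz p, vv p, ww (P s))
   - ka p * u * (Jy p * u + Jz p * x * (u1 + s))" for s
  unfolding G_def const H2eq by (simp add: P_def)
 have "((\<lambda>s. G (P s)) has_real_derivative Jp p * (x * ka p * H2w p) - ka p * u * (Jz p * x)) (at 0)"
  unfolding G by (rule derivative_eq_intros refl 1 | simp)+
 moreover have "Jp p * ka p = 1" using O4D[OF p4] by (simp add: ka_def)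
 then have "Jp p * (x * ka p * H2w p) = x * H2w p"
  by (metis (no_types, opaque_lifting) mult.assoc mult.commute mult.left_commute mult_1)
 note e = this
 have xu: "px p = x" "pu p = u" by (simp_all add: pp)
 then have H: "H2w p = (1 - x) * W p" "Jz p = (1 - x) * M p" using sm_MW(4,5)[OF p] by simp_all
 have "Jp p * (x * ka p * H2w p) - ka p * u * (Jz p * x) = px p * (1 - px p) * B p"
  unfolding e unfolding H B_def xu by (simp add: algebra_simps)
 ultimately show "((\<lambda>s. G (p + s *\<^sub>R (0,0,0,0,0,1))) has_real_derivative px p * (1 - px p) * B p) (at 0)"
  unfolding P by simp
qed

text \<open>The identity \<open>Jz = (1 - x) M\<close> is differentiated in directions that keep
  \<open>x\<close> fixed. It follows that the second derivatives of \<open>J\<close> in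
  \<open>y, z\<close> and in \<open>z, z\<close> are divisible by \<open>1 - x\<close> too.\<close>

lemma pd_M:
 assumes p: "p \<in> O5"
 shows "dJy p = px p * (1 - px p) * pd (0,1,0) M p" "dJz p = (1 - px p) * pd (0,0,1,0) M p"
proof -
 obtain x y y1 y2 u u1 where pp: "p = (x, y, y1, y2, u, u1)" by (metis prod.exhaust)
 have p4: "p \<in> O4" using p O5_sub by blast
 have inP: "(x, y, x * y1) \<in> I \<times> U \<times> U" using O4D[OF p4] by (simp add: pp zz_def)
 have ev: "\<forall>\<^sub>F s in nhds 0. p + s *\<^sub>R e \<in> O5" for e
 proof -
  have "((\<lambda>s. p + s *\<^sub>R e) \<longlongrightarrow> p + 0 *\<^sub>R e) (at 0)" by (intro tendsto_intros)
  then have "((\<lambda>s. p + s *\<^sub>R e) \<longlongrightarrow> p) (nhds 0)"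
   using tendsto_at_iff_tendsto_nhds[of "\<lambda>s. p + s *\<^sub>R e" 0] by simp
  then show ?thesis using topological_tendstoD[OF _ open_O5] p by blast
 qed
 have key: "D = (1 - px p) * pd e M p"
  if D: "((\<lambda>s. Jz (p + s *\<^sub>R e)) has_real_derivative D) (at 0)"
   and e: "e \<in> Basis" and ex: "\<And>s. px (p + s *\<^sub>R e) = px p" for e D
 proof -
  have "((\<lambda>s. (1 - px p) * M (p + s *\<^sub>R e)) has_real_derivative (1 - px p) * pd e M p) (at 0)"
   by (intro DERIV_cmult smooth_partial_DERIV[OF open_O5 sm_MW(1) p e])
  moreover have "\<forall>\<^sub>F s in nhds 0. (1 - px p) * M (p + s *\<^sub>R e) = Jz (p + s *\<^sub>R e)"
   using ev[of e] by eventually_elim (simp add: sm_MW(4) ex)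
  ultimately have "((\<lambda>s. Jz (p + s *\<^sub>R e)) has_real_derivative (1 - px p) * pd e M p) (at 0)"
   using DERIV_cong_ev[of 0 0 "\<lambda>s. (1 - px p) * M (p + s *\<^sub>R e)" "\<lambda>s. Jz (p + s *\<^sub>R e)", OF refl _ refl] by simp
  then show ?thesis using D DERIV_unique by blast
 qed
 have s3: "smooth (I \<times> U \<times> U) (pd (0,0,1) J)" by (rule smooth_pd[OF open_prods(1) sm_J basis3(3)])
 have "((\<lambda>s. pd (0,0,1) J (x, y + s, x * y1)) has_real_derivative pd (0,1,0) (pd (0,0,1) J) (x, y, x * y1)) (at 0)"
  by (rule smooth_chain3[OF open_prods(1) s3, THEN DERIV_cong])
   (use inP in \<open>auto intro!: derivative_eq_intros\<close>)
 then have "((\<lambda>s. Jz (p + s *\<^sub>R (0,1,0))) has_real_derivative pd (0,1,0) (pd (0,0,1) J) (x, y, x * y1)) (at 0)"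
  by (simp add: Jz_def pp zz_def zero_prod_def)
 from key[OF this jet_Basis(2)] have "pd (0,1,0) (pd (0,0,1) J) (x, y, x * y1) = (1 - x) * pd (0,1,0) M p"
  by (simp add: pp zero_prod_def)
 then show "dJy p = px p * (1 - px p) * pd (0,1,0) M p"
  using pd_commute[OF open_prods(1) sm_J inP basis3(2,3)] by (simp add: dJy_def pp zz_def)
 have "((\<lambda>s. pd (0,0,1) J (x, y, x * (y1 + s))) has_real_derivative x * pd (0,0,1) (pd (0,0,1) J) (x, y, x * y1)) (at 0)"
  by (rule smooth_chain3[OF open_prods(1) s3, THEN DERIV_cong])
   (use inP in \<open>auto intro!: derivative_eq_intros\<close>)
 then have "((\<lambda>s. Jz (p + s *\<^sub>R (0,0,1,0))) has_real_derivative dJz p) (at 0)"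
  by (simp add: Jz_def dJz_def pp zz_def zero_prod_def)
 from key[OF this jet_Basis(3)] show "dJz p = (1 - px p) * pd (0,0,1,0) M p"
  by (simp add: pp zero_prod_def)
qed

lemma pd_G_y1:
 assumes p: "p \<in> O5"
 shows "pd (0,0,1,0) G p = - ((5 / 2 * (1 - px p) - N / 2 * px p) * A p) + px p * (1 - px p) * C p"
proof (rule pd_DERIV_eq[OF open_O5 sm_AG(3) p jet_Basis(3)])
 obtain x y y1 y2 u u1 where pp: "p = (x, y, y1, y2, u, u1)" by (metis prod.exhaust)
 define P where "P s = (x, y, y1 + s, y2, u, u1)" for s
 have P: "p + s *\<^sub>R (0,0,1,0) = P s" for s by (simp add: pp P_def zero_prod_def)
 have P0: "P 0 = p" by (simp add: pp P_def)
 have p4: "p \<in> O4" using p O5_sub by blast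
 have inP: "(x, y, zz p) \<in> I \<times> U \<times> U" using O4D[OF p4] by (simp add: pp zz_def)
 have inP': "(x, y, zz (P 0)) \<in> I \<times> U \<times> U" using inP P0 by simp
 have dz: "((\<lambda>s. zz (P s)) has_real_derivative x) (at 0)"
  unfolding zz_def P_def by (auto intro!: derivative_eq_intros)
 have proj: "px (P s) = x" "py (P s) = y" "py1 (P s) = y1 + s" "py2 (P s) = y2" "pu (P s) = u" "pu1 (P s) = u1" for s
  by (simp_all add: P_def)
 note ch = smooth_chain3[OF open_prods(1) _ inP' DERIV_const DERIV_const dz, THEN DERIV_cong]
 have d1: "((\<lambda>s. Jp (P s)) has_real_derivative x * Jz p) (at 0)"
  unfolding Jp_def proj by (rule ch[OF sm_J]) (simp add: Jz_def P0 pp)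
 have d2: "((\<lambda>s. Jx (P s)) has_real_derivative dJx p) (at 0)"
  unfolding Jx_def proj by (rule ch[OF smooth_pd[OF open_prods(1) sm_J basis3(1)]]) (simp add: dJx_def P0 pp)
 have d3: "((\<lambda>s. Jy (P s)) has_real_derivative dJy p) (at 0)"
  unfolding Jy_def proj by (rule ch[OF smooth_pd[OF open_prods(1) sm_J basis3(2)]]) (simp add: dJy_def P0 pp)
 have d4: "((\<lambda>s. Jz (P s)) has_real_derivative dJz p) (at 0)"
  unfolding Jz_def proj by (rule ch[OF smooth_pd[OF open_prods(1) sm_J basis3(3)]]) (simp add: dJz_def P0 pp)
 have Jn: "Jp (P 0) \<noteq> 0" using O4D[OF p4] P0 by simp
 have d5: "((\<lambda>s. ka (P s)) has_real_derivative dka p) (at 0)"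
  unfolding ka_def by (rule DERIV_inverse'[OF d1 Jn, THEN DERIV_cong]) (simp add: dka_def ka_def P0 pp)
 have d6: "((\<lambda>s. vv (P s)) has_real_derivative dka p * u) (at 0)"
  unfolding vv_def proj by (rule derivative_eq_intros refl d5 | simp)+
 have d7: "((\<lambda>s. Dka (P s)) has_real_derivative dDka p) (at 0)"
  unfolding Dka_def proj
  by (rule derivative_eq_intros refl d2 d3 d4 d5 | simp)+ (simp add: dDka_def P0 pp algebra_simps)
 have d8: "((\<lambda>s. ww (P s)) has_real_derivative x * dvv1 p) (at 0)"
  unfolding ww_def vv1_def proj
  by (rule derivative_eq_intros refl d5 d7 | simp)+ (simp add: dvv1_def pp)
 have d9: "((\<lambda>s. Lp (P s)) has_real_derivative - (5 / 2 * (1 - x) - N / 2 * x) + l1 x * x * (1 - x)) (at 0)"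
  unfolding Lp_def L_sym_def proj by (auto intro!: derivative_eq_intros)
 have d10: "((\<lambda>s. H1p (P s)) has_real_derivative x * pd (0,0,1,0) H1 (x, y, zz p, vv p) + dka p * u * H1v p) (at 0)"
  unfolding H1p_def proj
  by (rule smooth_chain4[OF open_prods(2) sm_H1 _ DERIV_const DERIV_const dz d6, THEN DERIV_cong])
   (use O4D[OF p4] in \<open>auto simp: P0 H1v_def pp\<close>)
 have d11: "((\<lambda>s. H2p (P s)) has_real_derivative x * pd (0,0,1,0) H2 (x, y, zz p, vv p, ww p)
   + dka p * u * H2v p + x * dvv1 p * H2w p) (at 0)"
  unfolding H2p_def proj
  by (rule smooth_chain5[OF open_prods(3) sm_H2 _ DERIV_const DERIV_const dz d6 d8, THEN DERIV_cong])
   (use O4D[OF p4] in \<open>auto simp: P0 H2v_def H2w_def pp\<close>)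
 have "((\<lambda>s. G (P s)) has_real_derivative
   (x * Jz p * H1p p + Jp p * (x * pd (0,0,1,0) H1 (x, y, zz p, vv p) + dka p * u * H1v p)) * Lp p
   + Jp p * H1p p * (- (5 / 2 * (1 - x) - N / 2 * x) + l1 x * x * (1 - x))
   + (x * Jz p * H2p p + Jp p * (x * pd (0,0,1,0) H2 (x, y, zz p, vv p, ww p)
     + dka p * u * H2v p + x * dvv1 p * H2w p))
   - (dka p * u * (Jy p * u + Jz p * x * u1) + ka p * u * (dJy p * u + dJz p * x * u1))) (at 0)"
  unfolding G_def proj
  by (rule derivative_eq_intros refl d1 d3 d4 d5 d9 d10 d11 | simp)+ (simp add: P0 algebra_simps)
 \<comment> \<open>The derivatives of \<open>H1\<close> and \<open>H2\<close> in \<open>z\<close>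
   are collected into \<open>Hz\<close>, the combination that hypothesis (ii) makes divisible by
   \<open>1 - x\<close>.\<close>
 moreover have "(x * Jz p * H1p p + Jp p * (x * pd (0,0,1,0) H1 (x, y, zz p, vv p) + dka p * u * H1v p)) * Lp p
   + Jp p * H1p p * (- (5 / 2 * (1 - x) - N / 2 * x) + l1 x * x * (1 - x))
   + (x * Jz p * H2p p + Jp p * (x * pd (0,0,1,0) H2 (x, y, zz p, vv p, ww p)
     + dka p * u * H2v p + x * dvv1 p * H2w p))
   - (dka p * u * (Jy p * u + Jz p * x * u1) + ka p * u * (dJy p * u + dJz p * x * u1))
  = x * Jz p * H1p p * Lp p + Jp p * x * Hz p + Jp p * dka p * u * (H1v p * Lp p + H2v p)
   + Jp p * H1p p * (- (5 / 2 * (1 - x) - N / 2 * x) + l1 x * x * (1 - x))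
   + x * Jz p * H2p p + Jp p * x * dvv1 p * H2w p
   - (dka p * u * (Jy p * u + Jz p * x * u1) + ka p * u * (dJy p * u + dJz p * x * u1))"
  by (simp add: Hz_def pp algebra_simps)
 moreover have "\<dots> = - ((5 / 2 * (1 - x) - N / 2 * x) * A p) + x * (1 - x) * C p"
 proof -
  define m1 m2 where "m1 = pd (0,1,0) M p" and "m2 = pd (0,0,1,0) M p"
  have e: "dka p = - (ka p * ka p * (x * ((1 - x) * M p)))"
   using sm_MW(4)[OF p] by (simp add: dka_def pp)
  have a: "A p = Jp p * H1p p + x * W p * u * ka p * ((1 - x) * M p)"
   using sm_MW(4)[OF p] by (simp add: A_def pp)
  have J: "Jz p = (1 - x) * M p" "Hz p = (1 - x) * \<Omega> p" "H2w p = (1 - x) * W p"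
   "dJy p = x * (1 - x) * m1" "dJz p = (1 - x) * m2"
   using sm_MW(4-6)[OF p] pd_M[OF p] by (simp_all add: pp m1_def m2_def)
  have c: "C p = H1p p * Lp p * M p + Jp p * \<Omega> p - Jp p * (H1v p * Lp p + H2v p) * (u * ka p * ka p * M p)
  + H2p p * M p + Jp p * W p * dvv1 p + ka p * ka p * M p * u * (Jy p * u + ((1 - x) * M p) * x * u1)
  - ka p * u * (u * m1 + m2 * u1)
  + l1 x * Jp p * H1p p + (5 / 2 * (1 - x) - N / 2 * x) * W p * u * ka p * M p"
   using J(1) by (simp add: C_def pp m1_def m2_def)
  show ?thesis unfolding e a c J by (simp add: field_simps)
 qed
 moreover have "px p = x" by (simp add: pp)
 ultimately show "((\<lambda>s. G (p + s *\<^sub>R (0,0,1,0))) has_real_derivative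
   - ((5 / 2 * (1 - px p) - N / 2 * px p) * A p) + px p * (1 - px p) * C p) (at 0)"
  unfolding P by (elim DERIV_cong) simp
qed

text \<open>At a zero jet \<open>v\<close>, \<open>Dv\<close> and \<open>w\<close> vanish, so
  \<open>\<psi>\<close> fixes it: at \<open>x = 1\<close> it lies in \<open>V\<close>, elsewhere the
  division by \<open>1 - x\<close> is harmless. Positivity of \<open>A\<close> reduces to that of
  \<open>J H1\<close>.\<close>

lemma zero_in_dom: "x \<in> {0..1} \<Longrightarrow> (x, 0) \<in> dom"
proof -
 assume x: "x \<in> {0..1}"
 then have xI: "x \<in> I" using I by blast
 have z: "(x, 0::real \<times> real \<times> real \<times> real \<times> real) = (x, 0, 0, 0, 0, 0)" by (simp add: zero_prod_def)
 have pr: "Jp (x, 0, 0, 0, 0, 0) > 0" "vv (x, 0, 0, 0, 0, 0) = 0" "ww (x, 0, 0, 0, 0, 0) = 0" "zz (x, 0, 0, 0, 0, 0) = 0"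
  "vv1 (x, 0, 0, 0, 0, 0) = 0" "H1p (x, 0, 0, 0, 0, 0) > 0"
  using J_0[OF xI] H1_0[OF xI] by (simp_all add: Jp_def zz_def vv_def ww_def vv1_def H1p_def)
 have 4: "(x, 0, 0, 0, 0, 0) \<in> O4"
  using pr xI U by (auto simp: O4_def O3_def O2_def O1_def)
 have "x \<noteq> 1 \<or> \<psi> (x, 0, 0, 0, 0, 0) \<in> V"
  using V(2) pr by (auto simp: \<psi>_def zero_prod_def)
 then have "(x, 0, 0, 0, 0, 0) \<in> O5" using 4 by (auto simp: O5_def)
 moreover have "A (x, 0, 0, 0, 0, 0) > 0" using pr by (simp add: A_def)
 ultimately show "(x, 0) \<in> dom" unfolding z by (simp add: dom_def)
qed

lemma G_zero: "x \<in> I \<Longrightarrow> G (x, 0) = 0"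
 using H2_0[of x] by (simp add: zero_prod_def G_def Lp_def L_sym_def H2p_def zz_def vv_def ww_def vv1_def)

end

section \<open>Weighted Sobolev inequalities\<close>

abbreviation itg :: "(real \<Rightarrow> real) \<Rightarrow> real" where
 "itg \<equiv> integral {0..1}"

definition XX :: "real \<Rightarrow> real" where "XX x = x * (1 - x)"

text \<open>A function given together with all its derivatives, one-sided at the ends of
  \<open>[0, 1]\<close>. Such sequences are what energies, Sobolev bounds and jets act on.\<close>

definition derivs :: "(nat \<Rightarrow> real \<Rightarrow> real) \<Rightarrow> bool" where
 "derivs f \<longleftrightarrow> (\<forall>i. \<forall>x\<in>{0..1}. (f i has_real_derivative f (Suc i) x) (at x within {0..1}))"

lemma derivsD: "derivs f \<Longrightarrow> x \<in> {0..1} \<Longrightarrow> (f i has_real_derivative f (Suc i) x) (at x within {0..1})"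
 by (simp add: derivs_def)

lemma derivs_continuous: "derivs f \<Longrightarrow> continuous_on {0..1} (f i)"
 by (rule DERIV_continuous_on) (rule derivsD)

lemma XX_bounds: "x \<in> {0..1} \<Longrightarrow> 0 \<le> XX x \<and> XX x \<le> 1"
 unfolding XX_def by (auto intro: mult_le_one)

lemma XX_pos: "0 < x \<Longrightarrow> x < 1 \<Longrightarrow> 0 < XX x"
 by (simp add: XX_def)

lemma XX_has_derivative: "(XX has_real_derivative (1 - 2 * x)) (at x within S)"
 unfolding XX_def[abs_def] by (auto intro!: derivative_eq_intros)

lemma continuous_XX [continuous_intros]: "continuous_on S f \<Longrightarrow> continuous_on S (\<lambda>x. XX (f x))"
 unfolding XX_def by (intro continuous_intros)

lemma integral_zero_of_derivative:
 fixes F f :: "real \<Rightarrow> real"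
 assumes "continuous_on {0..1} F" "\<And>x. x \<in> {0<..<1} \<Longrightarrow> (F has_real_derivative f x) (at x)" "F 0 = F 1"
 shows "itg f = 0"
proof -
 have "(f has_integral (F 1 - F 0)) {0..1}"
  by (rule fundamental_theorem_of_calculus_interior)
    (use assms in \<open>auto simp: has_real_derivative_iff_has_vector_derivative\<close>)
 then show ?thesis using assms(3) by (simp add: integral_unique)
qed

locale weights =
 fixes al be :: real
 assumes al: "al > 0" and be: "be > 0"
begin

definition w0 :: "real \<Rightarrow> real" where "w0 x = x powr al * (1 - x) powr be"
definition w :: "nat \<Rightarrow> real \<Rightarrow> real" where "w k x = XX x ^ k * w0 x"
text \<open>The coefficient with \<open>(XX * w k)' = w k * d k\<close>. It satisfies
  \<open>d k = d 0 + k * (1 - 2 * x)\<close>, and for the exponents \<open>3/2\<close> and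
  \<open>N/2 - 1\<close> the function \<open>d 0\<close> is
  \<open>5/2 (1 - x) - N/2 x\<close>.\<close>

definition d :: "nat \<Rightarrow> real \<Rightarrow> real" where "d k x = (al + 1 + k) * (1 - x) - (be + 1 + k) * x"
text \<open>An integer that dominates both exponents, so that the weights are bounded below by
  integer powers of \<open>XX\<close>.\<close>

definition \<mu> :: nat where "\<mu> = nat \<lceil>max al be\<rceil>"

lemma w0_bounds: "x \<in> {0..1} \<Longrightarrow> 0 \<le> w0 x \<and> w0 x \<le> 1"
 using al be by (auto simp: w0_def intro!: mult_le_one powr_le1)

lemma w_bounds: "x \<in> {0..1} \<Longrightarrow> 0 \<le> w k x \<and> w k x \<le> XX x ^ k"
 using w0_bounds[of x] XX_bounds[of x] by (auto simp: w_def intro!: mult_left_le)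

lemma w_nonneg: "x \<in> {0..1} \<Longrightarrow> 0 \<le> w k x"
 using w_bounds by blast

lemma w_le1: "x \<in> {0..1} \<Longrightarrow> w k x \<le> 1"
 using w_bounds[of x k] XX_bounds[of x] by (meson order_trans power_le_one)

lemma w_mono: "x \<in> {0..1} \<Longrightarrow> i \<le> k \<Longrightarrow> w k x \<le> w i x"
 unfolding w_def using w0_bounds[of x] XX_bounds[of x] by (auto intro!: mult_right_mono power_decreasing)

lemma w_Suc: "w (Suc k) x = XX x * w k x"
 by (simp add: w_def)

lemma w_ge: "x \<in> {0..1} \<Longrightarrow> XX x ^ (k + \<mu>) \<le> w k x"
proof -
 assume x: "x \<in> {0..1}"
 have p: "y ^ \<mu> \<le> y powr c" if "0 \<le> y" "y \<le> 1" "c \<le> max al be" "c > 0" for y c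
 proof (cases "y = 0")
  case True
  have "\<mu> > 0" using al by (auto simp: \<mu>_def max_def)
  then show ?thesis using True by (simp add: zero_power)
 next
  case False
  then have "y ^ \<mu> = y powr real \<mu>" using that by (simp add: powr_realpow)
  also have "\<dots> \<le> y powr c"
   by (rule powr_mono') (use that False in \<open>auto simp: \<mu>_def, linarith?\<close>)
  finally show ?thesis .
 qed
 have "XX x ^ \<mu> = x ^ \<mu> * (1 - x) ^ \<mu>" by (simp add: XX_def power_mult_distrib)
 also have "\<dots> \<le> w0 x" unfolding w0_def
  using x al be by (intro mult_mono p) auto
 finally show ?thesis unfolding w_def power_add using XX_bounds[OF x] by (intro mult_left_mono) auto
qed

lemma continuous_w0: "continuous_on {0..1} w0"
 unfolding w0_def[abs_def] using al be by (intro continuous_on_mult continuous_on_powr' continuous_intros) auto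

lemma continuous_w [continuous_intros]: "continuous_on {0..1} (w k)"
 unfolding w_def[abs_def] by (intro continuous_intros continuous_w0)

lemma integrable: "continuous_on {0..1} f \<Longrightarrow> (f :: real \<Rightarrow> real) integrable_on {0..1}"
 by (rule integrable_continuous_real)

lemma XXw_has_derivative:
 assumes "0 < x" "x < 1"
 shows "((\<lambda>x. XX x * w k x) has_real_derivative w k x * d k x) (at x)"
proof -
 have "(w0 has_real_derivative (al * x powr (al - 1) * (1 - x) powr be - x powr al * (be * (1 - x) powr (be - 1)))) (at x)"
  unfolding w0_def[abs_def] using assms by (auto intro!: derivative_eq_intros simp: algebra_simps)
 then have w0': "(w0 has_real_derivative w0 x * (al / x - be / (1 - x))) (at x)"
  using assms by (elim DERIV_cong) (simp add: w0_def powr_diff field_simps)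
 have "((\<lambda>x. XX x ^ Suc k * w0 x) has_real_derivative
   (real (Suc k) * XX x ^ k * (1 - 2 * x)) * w0 x + XX x ^ Suc k * (w0 x * (al / x - be / (1 - x)))) (at x)"
  by (rule derivative_eq_intros XX_has_derivative w0' refl)+ simp
 moreover have "XX x ^ Suc k * (w0 x * (al / x - be / (1 - x))) = w k x * (al * (1 - x) - be * x)"
  using assms by (simp add: w_def XX_def field_simps)
 ultimately have "((\<lambda>x. XX x ^ Suc k * w0 x) has_real_derivative
   (real (Suc k) * XX x ^ k * (1 - 2 * x)) * w0 x + w k x * (al * (1 - x) - be * x)) (at x)" by simp
 then show ?thesis
  by (rule DERIV_cong[THEN has_field_derivative_transform_within[OF _ zero_less_one UNIV_I]])
   (simp_all add: w_def d_def algebra_simps)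
qed

text \<open>No boundary terms arise because \<open>XX * w k\<close> vanishes at both ends, whatever
  the values of \<open>f\<close> there. This is why polynomials without boundary conditions can be
  used.\<close>

lemma by_parts:
 assumes f: "\<And>x. x \<in> {0..1} \<Longrightarrow> (f has_real_derivative f' x) (at x within {0..1})"
 shows "itg (\<lambda>x. w k x * (d k x * f x + XX x * f' x)) = 0"
proof (rule integral_zero_of_derivative[where F = "\<lambda>x. XX x * w k x * f x"])
 have "continuous_on {0..1} f" by (rule DERIV_continuous_on[OF f])
 then show "continuous_on {0..1} (\<lambda>x. XX x * w k x * f x)"
  by (intro continuous_intros)
 fix x :: real assume x: "x \<in> {0<..<1}"
 have "(f has_real_derivative f' x) (at x)"
  using f[of x] x at_within_interior[of x "{0..1}"] by simp
 from DERIV_mult[OF XXw_has_derivative[of x k] this]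
 show "((\<lambda>x. XX x * w k x * f x) has_real_derivative w k x * (d k x * f x + XX x * f' x)) (at x)"
  using x by (auto elim!: DERIV_cong simp: algebra_simps)
qed (simp add: XX_def)

definition energy :: "nat \<Rightarrow> (nat \<Rightarrow> real \<Rightarrow> real) \<Rightarrow> real" where
 "energy k f = (\<Sum>i\<le>k. itg (\<lambda>x. w i x * (f i x)\<^sup>2))"

lemma integrable_energy: "derivs f \<Longrightarrow> (\<lambda>x. w i x * (f i x)\<^sup>2) integrable_on {0..1}"
 by (intro integrable continuous_intros) (rule derivs_continuous)

lemma energy_term_nonneg: "derivs f \<Longrightarrow> 0 \<le> itg (\<lambda>x. w i x * (f i x)\<^sup>2)"
 by (intro integral_nonneg integrable_energy) (simp_all add: w_nonneg)

lemma energy_nonneg: "derivs f \<Longrightarrow> 0 \<le> energy k f"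
 unfolding energy_def by (intro sum_nonneg energy_term_nonneg)

lemma energy_mono: "derivs f \<Longrightarrow> j \<le> k \<Longrightarrow> energy j f \<le> energy k f"
 unfolding energy_def by (intro sum_mono2) (auto intro: energy_term_nonneg)

text \<open>One-dimensional trace inequality: \<open>X\<^sup>m f\<^sup>2\<close> is the integral of its derivative.\<close>

lemma sup_bound_top:
 assumes f: "derivs f" and x: "x \<in> {0..1}"
 shows "XX x ^ (Suc j + \<mu>) * (f j x)\<^sup>2 \<le> (real j + \<mu> + 2) * energy (Suc j) f"
proof -
 let ?m = "Suc j + \<mu>"
 let ?F = "\<lambda>x. XX x ^ ?m * (f j x)\<^sup>2"
 let ?F' = "\<lambda>x. real ?m * XX x ^ (j + \<mu>) * (1 - 2 * x) * (f j x)\<^sup>2 + XX x ^ ?m * (2 * f j x * f (Suc j) x)"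
 let ?B = "\<lambda>x. (real ?m + 1) * (w j x * (f j x)\<^sup>2) + w (Suc j) x * (f (Suc j) x)\<^sup>2"
 note c = derivs_continuous[OF f]
 have F': "(?F has_real_derivative ?F' t) (at t within {0..1})" if "t \<in> {0..1}" for t
 proof -
  have 1: "((\<lambda>x. XX x ^ ?m) has_real_derivative real ?m * XX t ^ (j + \<mu>) * (1 - 2 * t)) (at t within {0..1})"
   by (rule DERIV_cong[OF DERIV_power[OF XX_has_derivative]]) simp
  have 2: "((\<lambda>x. (f j x)\<^sup>2) has_real_derivative 2 * f j t * f (Suc j) t) (at t within {0..1})"
   by (rule DERIV_cong[OF DERIV_power[OF derivsD[OF f that]]]) simp
  show ?thesis by (rule DERIV_cong[OF DERIV_mult[OF 1 2]]) simp
 qed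
 have "(?F' has_integral (?F x - ?F 0)) {0..x}"
 proof (rule fundamental_theorem_of_calculus)
  show "0 \<le> x" using x by simp
  fix t assume "t \<in> {0..x}"
  then have "(?F has_real_derivative ?F' t) (at t within {0..x})"
   using x by (intro DERIV_subset[OF F']) auto
  then show "(?F has_vector_derivative ?F' t) (at t within {0..x})"
   by (simp add: has_real_derivative_iff_has_vector_derivative)
 qed
 then have 1: "integral {0..x} ?F' = ?F x" by (simp add: integral_unique XX_def)
 have le: "\<bar>?F' t\<bar> \<le> ?B t" if t: "t \<in> {0..1}" for t
 proof -
  have X: "0 \<le> XX t" "XX t \<le> 1" using XX_bounds[OF t] by auto
  have "\<bar>real ?m * XX t ^ (j + \<mu>) * (1 - 2 * t) * (f j t)\<^sup>2\<bar> = real ?m * XX t ^ (j + \<mu>) * (f j t)\<^sup>2 * \<bar>1 - 2 * t\<bar>"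
   using X by (simp add: abs_mult)
  also have "\<dots> \<le> real ?m * XX t ^ (j + \<mu>) * (f j t)\<^sup>2 * 1"
   by (rule mult_left_mono) (use t X in auto)
  finally have a: "\<bar>real ?m * XX t ^ (j + \<mu>) * (1 - 2 * t) * (f j t)\<^sup>2\<bar> \<le> real ?m * (XX t ^ (j + \<mu>) * (f j t)\<^sup>2)" by simp
  \<comment> \<open>Young's inequality with the spare factor \<open>XX\<close> attached to
    \<open>f (Suc j)\<close>: it is the power by which \<open>w (Suc j)\<close> differs from
    \<open>w j\<close>.\<close>
  have "2 * \<bar>f j t\<bar> * (XX t * \<bar>f (Suc j) t\<bar>) \<le> (f j t)\<^sup>2 + (XX t * \<bar>f (Suc j) t\<bar>)\<^sup>2"
   using sum_squares_bound[of "\<bar>f j t\<bar>" "XX t * \<bar>f (Suc j) t\<bar>"] by simp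
  then have "XX t ^ (j + \<mu>) * (2 * \<bar>f j t\<bar> * (XX t * \<bar>f (Suc j) t\<bar>)) \<le> XX t ^ (j + \<mu>) * ((f j t)\<^sup>2 + (XX t * \<bar>f (Suc j) t\<bar>)\<^sup>2)"
   using X by (intro mult_left_mono) auto
  then have b: "\<bar>XX t ^ ?m * (2 * f j t * f (Suc j) t)\<bar> \<le> XX t ^ (j + \<mu>) * (f j t)\<^sup>2 + XX t ^ (Suc j + \<mu>) * (XX t * (f (Suc j) t)\<^sup>2)"
   using X by (simp add: abs_mult algebra_simps power2_eq_square)
  have c: "XX t ^ (j + \<mu>) * (f j t)\<^sup>2 \<le> w j t * (f j t)\<^sup>2" by (intro mult_right_mono w_ge t) auto
  have "XX t ^ (Suc j + \<mu>) * (XX t * (f (Suc j) t)\<^sup>2) \<le> w (Suc j) t * (1 * (f (Suc j) t)\<^sup>2)"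
   using X w_nonneg[OF t] by (intro mult_mono w_ge t) auto
  moreover have "real ?m * (XX t ^ (j + \<mu>) * (f j t)\<^sup>2) \<le> real ?m * (w j t * (f j t)\<^sup>2)"
   using c by (intro mult_left_mono) auto
  ultimately show ?thesis using a b c by (simp add: algebra_simps)
 qed
 have cB: "continuous_on {0..1} ?B" by (intro continuous_intros c)
 have cF: "continuous_on {0..1} ?F'" by (intro continuous_intros c)
 have sub: "{0..x} \<subseteq> {0..1}" using x by auto
 have i: "?B integrable_on {0..x}" "?F' integrable_on {0..x}"
  by (rule integrable_continuous_real[OF continuous_on_subset[OF cB sub]])
   (rule integrable_continuous_real[OF continuous_on_subset[OF cF sub]])
 have le1: "?F' t \<le> ?B t" "0 \<le> ?B t" if "t \<in> {0..1}" for t using le[OF that] by linarith+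
 have "integral {0..x} ?F' \<le> integral {0..x} ?B"
  by (rule integral_le[OF i(2,1)]) (use le1(1) sub in blast)
 moreover have "integral {0..x} ?B \<le> itg ?B"
  by (rule integral_subset_le[OF sub i(1) integrable[OF cB]]) (use le1(2) in blast)
 ultimately have "integral {0..x} ?F' \<le> itg ?B" by linarith
 also have "\<dots> = (real ?m + 1) * itg (\<lambda>x. w j x * (f j x)\<^sup>2) + itg (\<lambda>x. w (Suc j) x * (f (Suc j) x)\<^sup>2)"
  by (subst integral_add) (simp_all add: integrable_energy[OF f] integrable_on_mult_right)
 also have "\<dots> \<le> (real ?m + 1) * energy (Suc j) f"
 proof -
  let ?T = "\<lambda>i. itg (\<lambda>x. w i x * (f i x)\<^sup>2)"
  have "sum ?T {j, Suc j} \<le> sum ?T {..Suc j}"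
   by (rule sum_mono2) (simp_all add: energy_term_nonneg[OF f])
  then have "?T j + ?T (Suc j) \<le> energy (Suc j) f" by (simp add: energy_def)
  then have "(real ?m + 1) * (?T j + ?T (Suc j)) \<le> (real ?m + 1) * energy (Suc j) f"
   by (rule mult_left_mono) simp
  moreover have "0 \<le> real ?m * ?T (Suc j)" using energy_term_nonneg[OF f, of "Suc j"] by simp
  ultimately show ?thesis by (simp only: distrib_left distrib_right)
 qed
 finally show ?thesis using 1 by (simp add: algebra_simps)
qed

end

text \<open>The bound on \<open>g'\<close> is integrated from \<open>1/2\<close> towards
  \<open>0\<close> by comparing \<open>g\<close> and \<open>- g\<close> with an antiderivative of
  the majorant. One power of the singularity is gained, and for \<open>a < 1\<close> nothing
  singular remains.\<close>

lemma singular_bound_half: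
 fixes g g' :: "real \<Rightarrow> real"
 assumes a: "a \<ge> 0" "a \<noteq> 1" and y: "0 < y" "y \<le> 1/2"
  and g: "\<And>x. 0 < x \<Longrightarrow> x \<le> 1/2 \<Longrightarrow> (g has_real_derivative g' x) (at x)"
  and g': "\<And>x. 0 < x \<Longrightarrow> x \<le> 1/2 \<Longrightarrow> \<bar>g' x\<bar> \<le> B * XX x powr - a"
  and B: "\<bar>g (1/2)\<bar> \<le> B"
 shows "\<bar>g y\<bar> \<le> (1 + 2 powr a / \<bar>1 - a\<bar>) * B * XX y powr - max 0 (a - 1)"
proof -
 have B0: "B \<ge> 0" using B by linarith
 define K where "K = 2 powr a * B"
 have K: "K \<ge> 0" using B0 by (simp add: K_def)
 \<comment> \<open>An antiderivative of \<open>K * t powr - a\<close>; for \<open>a = 1\<close> it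
   would be a logarithm.\<close>
 define \<phi> where "\<phi> t = K * (t powr (1 - a) / (1 - a))" for t
 have \<phi>: "(\<phi> has_real_derivative K * t powr - a) (at t)" if "t > 0" for t
  unfolding \<phi>_def[abs_def] using that a by (auto intro!: derivative_eq_intros)
 have bd: "\<bar>g' t\<bar> \<le> K * t powr - a" if t: "0 < t" "t \<le> 1/2" for t
 proof -
  have "t / 2 = t * (1/2)" by simp
  also have "\<dots> \<le> XX t" unfolding XX_def using t by (intro mult_left_mono) auto
  finally have "XX t powr - a \<le> (t / 2) powr - a"
   using t a by (intro powr_mono2') auto
  also have "\<dots> = 2 powr a * t powr - a" using t by (simp add: powr_divide powr_minus field_simps)
  finally have "B * XX t powr - a \<le> B * (2 powr a * t powr - a)" using B0 by (rule mult_left_mono)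
  then show ?thesis using g'[OF t] by (simp add: K_def mult_ac)
 qed
 have "\<phi> y - g y \<le> \<phi> (1/2) - g (1/2)"
 proof (rule DERIV_nonneg_imp_nondecreasing[OF y(2), of "\<lambda>t. \<phi> t - g t"])
  fix t assume "y \<le> t" "t \<le> 1/2"
  then have t: "0 < t" "t \<le> 1/2" using y by auto
  show "\<exists>z. ((\<lambda>t. \<phi> t - g t) has_real_derivative z) (at t) \<and> 0 \<le> z"
   using DERIV_diff[OF \<phi>[OF t(1)] g[OF t]] bd[OF t] by (intro exI conjI) auto
 qed
 moreover have "\<phi> y + g y \<le> \<phi> (1/2) + g (1/2)"
 proof (rule DERIV_nonneg_imp_nondecreasing[OF y(2), of "\<lambda>t. \<phi> t + g t"])
  fix t assume "y \<le> t" "t \<le> 1/2"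
  then have t: "0 < t" "t \<le> 1/2" using y by auto
  show "\<exists>z. ((\<lambda>t. \<phi> t + g t) has_real_derivative z) (at t) \<and> 0 \<le> z"
   using DERIV_add[OF \<phi>[OF t(1)] g[OF t]] bd[OF t] by (intro exI conjI) auto
 qed
 ultimately have 1: "\<bar>g y\<bar> \<le> B + (\<phi> (1/2) - \<phi> y)" using B by linarith
 have ge1: "1 \<le> y powr - max 0 (a - 1)"
  using y powr_mono2'[of "- max 0 (a - 1)" y 1] by simp
 have 2: "\<phi> (1/2) - \<phi> y \<le> K / \<bar>1 - a\<bar> * y powr - max 0 (a - 1)"
 proof (cases "a < 1")
  case True
  have "\<phi> y \<ge> 0" using True K by (simp add: \<phi>_def)
  moreover have "(1/2) powr (1 - a) \<le> (1::real)" using True by (intro powr_le1) auto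
  then have "\<phi> (1/2) \<le> K * (1 / (1 - a))"
   unfolding \<phi>_def using True K by (intro mult_left_mono divide_right_mono) auto
  ultimately have "\<phi> (1/2) - \<phi> y \<le> K / \<bar>1 - a\<bar> * 1" using True by simp
  also have "\<dots> \<le> K / \<bar>1 - a\<bar> * y powr - max 0 (a - 1)"
   using K ge1 by (intro mult_left_mono) auto
  finally show ?thesis .
 next
  case False
  then have "a > 1" using a by simp
  then have "\<phi> (1/2) \<le> 0" using K by (simp add: \<phi>_def mult_le_0_iff divide_le_0_iff)
  moreover have "- \<phi> y = K / \<bar>1 - a\<bar> * y powr - max 0 (a - 1)"
   using \<open>a > 1\<close> by (simp add: \<phi>_def max_def field_simps)
  ultimately show ?thesis by linarith
 qed
 have "B \<le> B * y powr - max 0 (a - 1)" using mult_left_mono[OF ge1 B0] by simp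
 with 1 2 have "\<bar>g y\<bar> \<le> (1 + 2 powr a / \<bar>1 - a\<bar>) * B * y powr - max 0 (a - 1)"
  by (simp add: K_def algebra_simps)
 also have "\<dots> \<le> (1 + 2 powr a / \<bar>1 - a\<bar>) * B * XX y powr - max 0 (a - 1)"
 proof (rule mult_left_mono)
  have "XX y \<le> y" using y by (simp add: XX_def mult_left_le)
  then show "y powr - max 0 (a - 1) \<le> XX y powr - max 0 (a - 1)"
   using y XX_pos[of y] by (intro powr_mono2') auto
 qed (use B0 in auto)
 finally show ?thesis .
qed

text \<open>The two ends are alike because \<open>XX\<close> is invariant under reflection at
  \<open>1/2\<close>.\<close>

lemma singular_bound:
 fixes g g' :: "real \<Rightarrow> real"
 assumes a: "a \<ge> 0" "a \<noteq> 1" and y: "0 < y" "y < 1"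
  and g: "\<And>x. 0 < x \<Longrightarrow> x < 1 \<Longrightarrow> (g has_real_derivative g' x) (at x)"
  and g': "\<And>x. 0 < x \<Longrightarrow> x < 1 \<Longrightarrow> \<bar>g' x\<bar> \<le> B * XX x powr - a"
  and B: "\<bar>g (1/2)\<bar> \<le> B"
 shows "\<bar>g y\<bar> \<le> (1 + 2 powr a / \<bar>1 - a\<bar>) * B * XX y powr - max 0 (a - 1)"
proof (cases "y \<le> 1/2")
 case True
 show ?thesis by (rule singular_bound_half[where g' = g', OF a y(1) True]) (use g g' B in auto)
next
 case False
 have X: "XX (1 - x) = XX x" for x by (simp add: XX_def)
 have "\<bar>g (1 - (1 - y))\<bar> \<le> (1 + 2 powr a / \<bar>1 - a\<bar>) * B * XX (1 - y) powr - max 0 (a - 1)"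
 proof (rule singular_bound_half[OF a, where g' = "\<lambda>x. - g' (1 - x)" and g = "\<lambda>x. g (1 - x)"])
  fix x :: real assume x: "0 < x" "x \<le> 1/2"
  have "((\<lambda>x. g (1 - x)) has_real_derivative g' (1 - x) * (-1)) (at x)"
   by (rule DERIV_chain2[OF g]) (use x in \<open>auto intro!: derivative_eq_intros\<close>)
  then show "((\<lambda>x. g (1 - x)) has_real_derivative - g' (1 - x)) (at x)" by simp
  show "\<bar>- g' (1 - x)\<bar> \<le> B * XX x powr - a"
   using g'[of "1 - x"] x by (simp add: X)
 qed (use False y B in auto)
 then show ?thesis by (simp add: X)
qed

context weights
begin

lemma derivs_interior: "derivs f \<Longrightarrow> 0 < x \<Longrightarrow> x < 1 \<Longrightarrow> (f i has_real_derivative f (Suc i) x) (at x)"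
 using derivsD[of f x i] at_within_interior[of x "{0..1::real}"] by simp

text \<open>The exponent \<open>(k + \<mu>) / 2 + 1/4\<close> is never an integer, so that the chain of integrations
 does not meet a logarithm.\<close>

lemma sobolev_chain:
 assumes "dd < k"
 shows "\<exists>C\<ge>0. \<forall>f. derivs f \<longrightarrow> (\<forall>x. 0 < x \<longrightarrow> x < 1 \<longrightarrow>
  \<bar>f (k - 1 - dd) x\<bar> \<le> C * sqrt (energy k f) * XX x powr - max 0 ((real k + \<mu>) / 2 + 1/4 - real dd))"
 using assms
proof (induction dd)
 case 0
 define C where "C = sqrt (real (k - 1) + \<mu> + 2)"
 have "\<bar>f (k - 1) x\<bar> \<le> C * sqrt (energy k f) * XX x powr - max 0 ((real k + \<mu>) / 2 + 1/4)"
  if f: "derivs f" and x: "0 < x" "x < 1" for f x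
 proof -
  have X: "0 < XX x" "XX x \<le> 1" using XX_pos[OF x] XX_bounds[of x] x by auto
  have "XX x ^ (k + \<mu>) * (f (k - 1) x)\<^sup>2 \<le> (real (k - 1) + \<mu> + 2) * energy k f"
   using sup_bound_top[OF f, of x "k - 1"] x 0 by simp
  then have "sqrt (XX x ^ (k + \<mu>) * (f (k - 1) x)\<^sup>2) \<le> sqrt ((real (k - 1) + \<mu> + 2) * energy k f)"
   by (rule real_sqrt_le_mono)
  moreover have "sqrt (XX x ^ (k + \<mu>)) = XX x powr ((real k + \<mu>) / 2)"
   using X by (simp add: powr_realpow[symmetric] powr_half_sqrt[symmetric] powr_powr)
  ultimately have "XX x powr ((real k + \<mu>) / 2) * \<bar>f (k - 1) x\<bar> \<le> C * sqrt (energy k f)"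
   by (simp add: C_def real_sqrt_mult)
  then have "\<bar>f (k - 1) x\<bar> \<le> C * sqrt (energy k f) * XX x powr - ((real k + \<mu>) / 2)"
   using X by (simp add: powr_minus field_simps)
  also have "\<dots> \<le> C * sqrt (energy k f) * XX x powr - max 0 ((real k + \<mu>) / 2 + 1/4)"
   using X energy_nonneg[OF f, of k] by (intro mult_left_mono powr_mono') (auto simp: C_def)
  finally show ?thesis .
 qed
 moreover have "C \<ge> 0" by (simp add: C_def)
 ultimately show ?case by auto
next
 case (Suc dd)
 then obtain C where C: "C \<ge> 0" "\<And>f x. derivs f \<Longrightarrow> 0 < x \<Longrightarrow> x < 1 \<Longrightarrow>
  \<bar>f (k - 1 - dd) x\<bar> \<le> C * sqrt (energy k f) * XX x powr - max 0 ((real k + \<mu>) / 2 + 1/4 - real dd)"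
  by auto
 define a where "a = max 0 ((real k + \<mu>) / 2 + 1/4 - real dd)"
 define j where "j = k - 1 - Suc dd"
 have j: "Suc j = k - 1 - dd" "j < k" using Suc.prems by (auto simp: j_def)
 have a: "a \<ge> 0" "a \<noteq> 1"
 proof -
  have "(real k + \<mu>) / 2 + 1/4 - real dd \<noteq> 1"
  proof
   assume "(real k + \<mu>) / 2 + 1/4 - real dd = 1"
   \<comment> \<open>Parity: the left-hand side is odd, the right-hand side even.\<close>
   then have "real (2 * k + 2 * \<mu> + 1) = real (4 * dd + 4)" by (simp add: field_simps)
   then have "2 * k + 2 * \<mu> + 1 = 4 * dd + 4" by (simp only: of_nat_eq_iff)
   then show False by presburger
  qed
  then show "a \<ge> 0" "a \<noteq> 1" by (auto simp: a_def max_def)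
 qed
 \<comment> \<open>Bounds \<open>f j\<close> at the midpoint, where \<open>XX = 1/4\<close> and the
   trace inequality has no degeneracy; the integration of the derivative starts there.\<close>
 define C1 where "C1 = sqrt ((real j + \<mu> + 2) * 4 ^ (Suc j + \<mu>))"
 define C2 where "C2 = (1 + 2 powr a / \<bar>1 - a\<bar>) * (C + C1)"
 have "\<bar>f j x\<bar> \<le> C2 * sqrt (energy k f) * XX x powr - max 0 ((real k + \<mu>) / 2 + 1/4 - real (Suc dd))"
  if f: "derivs f" and x: "0 < x" "x < 1" for f x
 proof -
  have "XX (1/2) ^ (Suc j + \<mu>) * (f j (1/2))\<^sup>2 \<le> (real j + \<mu> + 2) * energy (Suc j) f"
   using sup_bound_top[OF f, of "1/2" j] by simp
  also have "\<dots> \<le> (real j + \<mu> + 2) * energy k f"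
   using energy_mono[OF f, of "Suc j" k] j by (intro mult_left_mono) auto
  finally have "(f j (1/2))\<^sup>2 \<le> (real j + \<mu> + 2) * 4 ^ (Suc j + \<mu>) * energy k f"
   by (simp add: XX_def power_one_over power_divide field_simps)
  then have "sqrt ((f j (1/2))\<^sup>2) \<le> sqrt ((real j + \<mu> + 2) * 4 ^ (Suc j + \<mu>) * energy k f)"
   by (rule real_sqrt_le_mono)
  then have h: "\<bar>f j (1/2)\<bar> \<le> C1 * sqrt (energy k f)"
   by (simp add: C1_def real_sqrt_mult)
  let ?B = "(C + C1) * sqrt (energy k f)"
  have e0: "0 \<le> sqrt (energy k f)" using energy_nonneg[OF f] by simp
  have C10: "C1 \<ge> 0" by (simp add: C1_def)
  have "\<bar>f j x\<bar> \<le> (1 + 2 powr a / \<bar>1 - a\<bar>) * ?B * XX x powr - max 0 (a - 1)"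
  proof (rule singular_bound[OF a x derivs_interior[OF f]])
   fix y :: real assume y: "0 < y" "y < 1"
   have "\<bar>f (Suc j) y\<bar> \<le> C * sqrt (energy k f) * XX y powr - a"
    using C(2)[OF f y] by (simp add: j a_def)
   also have "\<dots> \<le> ?B * XX y powr - a"
    using e0 C10 by (intro mult_right_mono) auto
   finally show "\<bar>f (Suc j) y\<bar> \<le> ?B * XX y powr - a" .
  next
   have "C1 * sqrt (energy k f) \<le> ?B" using e0 C(1) by (intro mult_right_mono) auto
   then show "\<bar>f j (1/2)\<bar> \<le> ?B" using h by linarith
  qed
  moreover have "max 0 (a - 1) = max 0 ((real k + \<mu>) / 2 + 1/4 - real (Suc dd))"
   unfolding a_def of_nat_Suc by linarith
  ultimately show ?thesis by (simp add: C2_def mult_ac)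
 qed
 moreover have "C2 \<ge> 0" using C(1) by (simp add: C2_def C1_def)
 ultimately show ?case unfolding j_def by blast
qed

text \<open>The derivative of order \<open>k - 1\<close> is bounded by \<open>XX\<close> to a power
  close to \<open>- (k + \<mu>) / 2\<close>, and each integration removes one power until none is
  left. The hypothesis on \<open>h\<close> says precisely that the exponent reached at order
  \<open>j\<close> is at most \<open>j - h\<close>: derivatives up to \<open>h\<close> are bounded
  outright, the following ones at the price of one power of \<open>XX\<close> each.\<close>

lemma sobolev:
 assumes h: "4 * real h + 2 * \<mu> + 5 \<le> 2 * real k"
 shows "\<exists>C\<ge>0. \<forall>f. derivs f \<longrightarrow> (\<forall>j<k. \<forall>x. 0 < x \<longrightarrow> x < 1 \<longrightarrow>
  XX x ^ (j - h) * \<bar>f j x\<bar> \<le> C * sqrt (energy k f))"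
proof -
 have "\<forall>dd\<in>{..<k}. \<exists>C\<ge>0. \<forall>f. derivs f \<longrightarrow> (\<forall>x. 0 < x \<longrightarrow> x < 1 \<longrightarrow>
  \<bar>f (k - 1 - dd) x\<bar> \<le> C * sqrt (energy k f) * XX x powr - max 0 ((real k + \<mu>) / 2 + 1/4 - real dd))"
  using sobolev_chain by simp
 then obtain C where C: "\<And>dd. dd < k \<Longrightarrow> C dd \<ge> 0"
  "\<And>dd f x. dd < k \<Longrightarrow> derivs f \<Longrightarrow> 0 < x \<Longrightarrow> x < 1 \<Longrightarrow>
  \<bar>f (k - 1 - dd) x\<bar> \<le> C dd * sqrt (energy k f) * XX x powr - max 0 ((real k + \<mu>) / 2 + 1/4 - real dd)"
  unfolding bchoice_iff by auto
 define CC where "CC = (\<Sum>dd<k. C dd)"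
 have "XX x ^ (j - h) * \<bar>f j x\<bar> \<le> CC * sqrt (energy k f)"
  if f: "derivs f" and j: "j < k" and x: "0 < x" "x < 1" for f j x
 proof -
  have X: "0 < XX x" "XX x \<le> 1" using XX_pos[OF x] XX_bounds[of x] x by auto
  define dd where "dd = k - 1 - j"
  have dd: "dd < k" "k - 1 - dd = j" using j by (auto simp: dd_def)
  have e0: "0 \<le> sqrt (energy k f)" using energy_nonneg[OF f] by simp
  have ex: "max 0 ((real k + \<mu>) / 2 + 1/4 - real dd) \<le> real (j - h)"
  proof -
   have "real dd = real k - 1 - real j" using j by (simp add: dd_def)
   then have "(real k + \<mu>) / 2 + 1/4 - real dd \<le> real j - real h" using h by (simp add: field_simps)
   then show ?thesis by linarith
  qed
  have "XX x ^ (j - h) = XX x powr real (j - h)" using X by (simp add: powr_realpow)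
  then have "XX x ^ (j - h) * \<bar>f j x\<bar> \<le> XX x powr real (j - h) *
    (C dd * sqrt (energy k f) * XX x powr - max 0 ((real k + \<mu>) / 2 + 1/4 - real dd))"
   using C(2)[OF dd(1) f x] dd(2) by (simp add: mult_left_mono)
  also have "\<dots> = C dd * sqrt (energy k f) * XX x powr (real (j - h) - max 0 ((real k + \<mu>) / 2 + 1/4 - real dd))"
   using X by (simp add: powr_diff powr_minus field_simps)
  also have "\<dots> \<le> C dd * sqrt (energy k f) * 1"
   using X ex C(1)[OF dd(1)] e0 by (intro mult_left_mono powr_le1) auto
  also have "\<dots> \<le> CC * sqrt (energy k f) * 1"
   unfolding CC_def using dd C(1) e0 by (intro mult_right_mono member_le_sum) auto
  finally show ?thesis by simp
 qed
 moreover have "CC \<ge> 0" unfolding CC_def using C(1) by (intro sum_nonneg) auto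
 ultimately show ?thesis by blast
qed

end

section \<open>Differential monomials\<close>

definition jet :: "real \<Rightarrow> (nat \<Rightarrow> real) \<Rightarrow> (nat \<Rightarrow> real) \<Rightarrow> jet" where
 "jet x q u = (x, q 0, q 1, q 2, u 0, u 1)"

lemma jet_simps [simp]: "px (jet x q u) = x" "py (jet x q u) = q 0" "py1 (jet x q u) = q 1"
 "py2 (jet x q u) = q 2" "pu (jet x q u) = u 0" "pu1 (jet x q u) = u 1"
 by (simp_all add: jet_def)

text \<open>Functions of \<open>x\<close> and of the full sequences of \<open>x\<close>-derivatives
  of \<open>y\<close> and of \<open>u\<close> at that point. The letter \<open>q\<close> stands for
  \<open>y\<close> from here on.\<close>

type_synonym dpoly = "real \<Rightarrow> (nat \<Rightarrow> real) \<Rightarrow> (nat \<Rightarrow> real) \<Rightarrow> real"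

text \<open>Differential monomials in \<open>q\<close> and \<open>u\<close> of weight \<open>\<kappa>\<close> and order \<open>m\<close>: the derivatives that
 enter the jet are free, \<open>q\<^sub>i\<close> counts \<open>i - 2\<close> and \<open>u\<^sub>i\<close> counts \<open>i - 1\<close>.
 The flag \<open>z\<close> records that the expression vanishes with the jet.\<close>

inductive mon :: "jet set \<Rightarrow> bool \<Rightarrow> nat \<Rightarrow> nat \<Rightarrow> dpoly \<Rightarrow> bool" for S where
 base: "smooth S \<Phi> \<Longrightarrow> (z \<Longrightarrow> \<forall>x. (x, 0) \<in> S \<longrightarrow> \<Phi> (x, 0) = 0) \<Longrightarrow> mon S z \<kappa> m (\<lambda>x q u. \<Phi> (jet x q u))"
| mulq: "mon S False \<kappa> m F \<Longrightarrow> 3 \<le> i \<Longrightarrow> i \<le> m \<Longrightarrow> \<kappa> + i \<le> \<kappa>' + 2 \<Longrightarrow> mon S z \<kappa>' m (\<lambda>x q u. F x q u * q i)"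
| mulu: "mon S False \<kappa> m F \<Longrightarrow> 2 \<le> i \<Longrightarrow> i \<le> m \<Longrightarrow> \<kappa> + i \<le> \<kappa>' + 1 \<Longrightarrow> mon S z \<kappa>' m (\<lambda>x q u. F x q u * u i)"
| add: "mon S z \<kappa> m F \<Longrightarrow> mon S z \<kappa> m F' \<Longrightarrow> mon S z \<kappa> m (\<lambda>x q u. F x q u + F' x q u)"

lemma mon_mono: "mon S z \<kappa> m F \<Longrightarrow> \<kappa> \<le> \<kappa>' \<Longrightarrow> m \<le> m' \<Longrightarrow> (z' \<Longrightarrow> z) \<Longrightarrow> mon S z' \<kappa>' m' F"
proof (induction arbitrary: \<kappa>' z' rule: mon.induct)
 case (base \<Phi> z \<kappa> m)
 then show ?case by (intro mon.base) auto
next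
 case (mulq \<kappa> m F i \<kappa>1 z)
 have "mon S False \<kappa> m' F" by (rule mulq.IH) (use mulq.prems in auto)
 then show ?case by (rule mon.mulq) (use mulq.hyps mulq.prems in auto)
next
 case (mulu \<kappa> m F i \<kappa>1 z)
 have "mon S False \<kappa> m' F" by (rule mulu.IH) (use mulu.prems in auto)
 then show ?case by (rule mon.mulu) (use mulu.hyps mulu.prems in auto)
next
 case (add z \<kappa> m F F')
 show ?case by (rule mon.add) (use add in auto)
qed

lemma mon_smult: "mon S z \<kappa> m F \<Longrightarrow> smooth S \<Phi> \<Longrightarrow> mon S z \<kappa> m (\<lambda>x q u. \<Phi> (jet x q u) * F x q u)"
proof (induction rule: mon.induct)
 case (base \<Psi> z \<kappa> m)
 have "mon S z \<kappa> m (\<lambda>x q u. (\<lambda>p. \<Phi> p * \<Psi> p) (jet x q u))"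
  by (rule mon.base) (use base in \<open>auto intro: smooth_mult\<close>)
 then show ?case by simp
next
 case (mulq \<kappa> m F i \<kappa>' z)
 then show ?case using mon.mulq[of S \<kappa> m "\<lambda>x q u. \<Phi> (jet x q u) * F x q u" i \<kappa>' z]
  by (simp add: mult.assoc)
next
 case (mulu \<kappa> m F i \<kappa>' z)
 then show ?case using mon.mulu[of S \<kappa> m "\<lambda>x q u. \<Phi> (jet x q u) * F x q u" i \<kappa>' z]
  by (simp add: mult.assoc)
next
 case (add z \<kappa> m F F')
 then show ?case using mon.add[of S z \<kappa> m "\<lambda>x q u. \<Phi> (jet x q u) * F x q u" "\<lambda>x q u. \<Phi> (jet x q u) * F' x q u"]
  by (simp add: distrib_left)
qed

lemma mon_cmult: "mon S z \<kappa> m F \<Longrightarrow> mon S z \<kappa> m (\<lambda>x q u. c * F x q u)"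
 using mon_smult[of S z \<kappa> m F "\<lambda>_. c"] by simp

lemma mon_diff: "mon S z \<kappa> m F \<Longrightarrow> mon S z \<kappa> m F' \<Longrightarrow> mon S z \<kappa> m (\<lambda>x q u. F x q u - F' x q u)"
 using mon.add[of S z \<kappa> m F "\<lambda>x q u. -1 * F' x q u"] mon_cmult[of S z \<kappa> m F' "-1"] by simp

text \<open>The total derivative as a relation, tested on all pairs of smooth functions whose jet
  lies in \<open>S\<close>. In this way differential polynomials need no syntax of their
  own.\<close>

definition tder :: "jet set \<Rightarrow> dpoly \<Rightarrow> dpoly \<Rightarrow> bool" where
 "tder S F F' \<longleftrightarrow> (\<forall>q u x. derivs q \<longrightarrow> derivs u \<longrightarrow> x \<in> {0..1} \<longrightarrow> jet x (\<lambda>i. q i x) (\<lambda>i. u i x) \<in> S \<longrightarrow>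
   ((\<lambda>x. F x (\<lambda>i. q i x) (\<lambda>i. u i x)) has_real_derivative F' x (\<lambda>i. q i x) (\<lambda>i. u i x)) (at x within {0..1}))"

lemma tderD:
 "tder S F F' \<Longrightarrow> derivs q \<Longrightarrow> derivs u \<Longrightarrow> x \<in> {0..1} \<Longrightarrow> jet x (\<lambda>i. q i x) (\<lambda>i. u i x) \<in> S \<Longrightarrow>
   ((\<lambda>x. F x (\<lambda>i. q i x) (\<lambda>i. u i x)) has_real_derivative F' x (\<lambda>i. q i x) (\<lambda>i. u i x)) (at x within {0..1})"
 by (simp add: tder_def)

lemma tder_cong: "tder S F F' \<Longrightarrow> (\<And>x q u. jet x q u \<in> S \<Longrightarrow> F' x q u = F'' x q u) \<Longrightarrow> tder S F F''"
 unfolding tder_def by simp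

lemma tder_add: "tder S F F' \<Longrightarrow> tder S H H' \<Longrightarrow> tder S (\<lambda>x q u. F x q u + H x q u) (\<lambda>x q u. F' x q u + H' x q u)"
 unfolding tder_def by (auto intro!: DERIV_add)

lemma tder_diff: "tder S F F' \<Longrightarrow> tder S H H' \<Longrightarrow> tder S (\<lambda>x q u. F x q u - H x q u) (\<lambda>x q u. F' x q u - H' x q u)"
 unfolding tder_def by (auto intro!: DERIV_diff)

lemma tder_mult: "tder S F F' \<Longrightarrow> tder S H H' \<Longrightarrow>
  tder S (\<lambda>x q u. F x q u * H x q u) (\<lambda>x q u. F' x q u * H x q u + H' x q u * F x q u)"
 unfolding tder_def by (auto intro!: DERIV_mult)

lemma tder_cmult: "tder S F F' \<Longrightarrow> tder S (\<lambda>x q u. c * F x q u) (\<lambda>x q u. c * F' x q u)"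
 unfolding tder_def by (auto intro!: DERIV_cmult)

lemma tder_q: "tder S (\<lambda>x q u. q i) (\<lambda>x q u. q (Suc i))"
 unfolding tder_def by (auto intro!: derivsD)

lemma tder_u: "tder S (\<lambda>x q u. u i) (\<lambda>x q u. u (Suc i))"
 unfolding tder_def by (auto intro!: derivsD)

abbreviation "e0 \<equiv> (1,0) :: jet"
abbreviation "e1 \<equiv> (0,1,0) :: jet"
abbreviation "e2 \<equiv> (0,0,1,0) :: jet"
abbreviation "e3 \<equiv> (0,0,0,1,0) :: jet"
abbreviation "e4 \<equiv> (0,0,0,0,1,0) :: jet"
abbreviation "e5 \<equiv> (0,0,0,0,0,1) :: jet"

text \<open>The part of the total derivative of \<open>\<Phi>\<close> that is again a function of the jet.\<close>

definition DT :: "(jet \<Rightarrow> real) \<Rightarrow> jet \<Rightarrow> real" where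
 "DT \<Phi> p = pd e0 \<Phi> p + py1 p * pd e1 \<Phi> p + py2 p * pd e2 \<Phi> p + pu1 p * pd e4 \<Phi> p"

definition TT :: "(jet \<Rightarrow> real) \<Rightarrow> dpoly" where
 "TT \<Phi> = (\<lambda>x q u. DT \<Phi> (jet x q u) + pd e3 \<Phi> (jet x q u) * q 3 + pd e5 \<Phi> (jet x q u) * u 2)"

lemma smooth_DT: "open S \<Longrightarrow> smooth S \<Phi> \<Longrightarrow> smooth S (DT \<Phi>)"
 unfolding DT_def[abs_def] by (intro smooth_intros smooth_pd jet_Basis)

lemma tder_base:
 assumes S: "open S" "smooth S \<Phi>"
 shows "tder S (\<lambda>x q u. \<Phi> (jet x q u)) (TT \<Phi>)"
 unfolding tder_def
proof (intro allI impI)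
 fix q u :: "nat \<Rightarrow> real \<Rightarrow> real" and x :: real
 assume a: "derivs q" "derivs u" "x \<in> {0..1}" "jet x (\<lambda>i. q i x) (\<lambda>i. u i x) \<in> S"
 have d: "(q 0 has_real_derivative q 1 x) (at x within {0..1})" "(q 1 has_real_derivative q 2 x) (at x within {0..1})"
  "(q 2 has_real_derivative q 3 x) (at x within {0..1})" "(u 0 has_real_derivative u 1 x) (at x within {0..1})"
  "(u 1 has_real_derivative u 2 x) (at x within {0..1})"
  using derivsD[OF a(1,3), of 0] derivsD[OF a(1,3), of 1] derivsD[OF a(1,3), of 2]
   derivsD[OF a(2,3), of 0] derivsD[OF a(2,3), of 1] by (simp_all add: eval_nat_numeral)
 show "((\<lambda>x. \<Phi> (jet x (\<lambda>i. q i x) (\<lambda>i. u i x))) has_real_derivative TT \<Phi> x (\<lambda>i. q i x) (\<lambda>i. u i x)) (at x within {0..1})"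
  unfolding jet_def
  by (rule smooth_chain6[OF S _ DERIV_ident d, THEN DERIV_cong])
   (use a(4) in \<open>auto simp: jet_def TT_def DT_def\<close>)
qed

text \<open>With this, vanishing at zero jets survives total differentiation: every other term of
  \<open>DT\<close> carries \<open>py1\<close>, \<open>py2\<close> or \<open>pu1\<close>, and the
  remaining terms of \<open>TT\<close> carry \<open>q 3\<close> or \<open>u 2\<close>.\<close>

lemma pd_e0_zero:
 assumes S: "open S" "smooth S \<Phi>" and z: "\<forall>x. (x, 0) \<in> S \<longrightarrow> \<Phi> (x, 0) = 0" and x: "(x, 0) \<in> S"
 shows "pd e0 \<Phi> (x, 0) = 0"
proof (rule pd_DERIV_eq[OF S x jet_Basis(1)])
 have "((\<lambda>s. (x + s, 0)) \<longlongrightarrow> (x + 0, 0 :: real \<times> real \<times> real \<times> real \<times> real)) (at (0::real))" by (intro tendsto_intros)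
 then have "((\<lambda>s. (x + s, 0)) \<longlongrightarrow> (x, 0 :: real \<times> real \<times> real \<times> real \<times> real)) (nhds (0::real))"
  using tendsto_at_iff_tendsto_nhds[of "\<lambda>s. (x + s, 0 :: real \<times> real \<times> real \<times> real \<times> real)" 0] by simp
 then have "\<forall>\<^sub>F s in nhds 0. (x + s, 0) \<in> S" using topological_tendstoD[OF _ S(1)] x by blast
 then have "\<forall>\<^sub>F s in nhds 0. 0 = \<Phi> ((x, 0) + s *\<^sub>R e0)"
  by eventually_elim (use z in \<open>simp add: zero_prod_def\<close>)
 then show "((\<lambda>s. \<Phi> ((x, 0) + s *\<^sub>R e0)) has_real_derivative 0) (at 0)"
  using DERIV_cong_ev[of 0 0 "\<lambda>_. 0" "\<lambda>s. \<Phi> ((x, 0) + s *\<^sub>R e0)" 0 0] by simp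
qed

lemma mon_TT:
 assumes S: "open S" "smooth S \<Phi>" and z: "z \<Longrightarrow> \<forall>x. (x, 0) \<in> S \<longrightarrow> \<Phi> (x, 0) = 0" and m: "3 \<le> m"
 shows "mon S z (Suc \<kappa>) m (TT \<Phi>)"
 unfolding TT_def
proof (intro mon.add)
 show "mon S z (Suc \<kappa>) m (\<lambda>x q u. DT \<Phi> (jet x q u))"
  by (rule mon.base[OF smooth_DT[OF S]])
   (use pd_e0_zero[OF S z] in \<open>auto simp: DT_def py1_def py2_def pu1_def\<close>)
 have "mon S False \<kappa> m (\<lambda>x q u. pd e3 \<Phi> (jet x q u))" "mon S False \<kappa> m (\<lambda>x q u. pd e5 \<Phi> (jet x q u))"
  by (rule mon.base[OF smooth_pd[OF S jet_Basis(4)]], simp) (rule mon.base[OF smooth_pd[OF S jet_Basis(6)]], simp)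
 from mon.mulq[OF this(1), of 3 "Suc \<kappa>" z] mon.mulu[OF this(2), of 2 "Suc \<kappa>" z] m
 show "mon S z (Suc \<kappa>) m (\<lambda>x q u. pd e3 \<Phi> (jet x q u) * q 3)" "mon S z (Suc \<kappa>) m (\<lambda>x q u. pd e5 \<Phi> (jet x q u) * u 2)"
  by simp_all
qed

text \<open>By the product rule a total derivative either raises the order of one factor by one, or
  hits the function of the jet and produces at most a factor \<open>q 3\<close> or
  \<open>u 2\<close>. Either way the weight grows by one.\<close>

lemma mon_tder:
 assumes S: "open S" and F: "mon S z \<kappa> m F" "2 \<le> m"
 shows "\<exists>F'. mon S z (Suc \<kappa>) (Suc m) F' \<and> tder S F F'"
 using F
proof (induction rule: mon.induct)
 case (base \<Phi> z \<kappa> m)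
 then show ?case using tder_base[OF S] mon_TT[OF S, of \<Phi> z "Suc m" \<kappa>] by auto
next
 case (mulq \<kappa> m F i \<kappa>' z)
 then obtain F' where F': "mon S False (Suc \<kappa>) (Suc m) F'" "tder S F F'" by auto
 have "mon S z (Suc \<kappa>') (Suc m) (\<lambda>x q u. F' x q u * q i + F x q u * q (Suc i))"
 proof (rule mon.add)
  show "mon S z (Suc \<kappa>') (Suc m) (\<lambda>x q u. F' x q u * q i)"
   by (rule mon.mulq[OF F'(1)]) (use mulq.hyps in auto)
  have "mon S False \<kappa> (Suc m) F" using mulq.hyps(1) by (rule mon_mono) auto
  then show "mon S z (Suc \<kappa>') (Suc m) (\<lambda>x q u. F x q u * q (Suc i))"
   by (rule mon.mulq) (use mulq.hyps in auto)
 qed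
 then show ?case using tder_mult[OF F'(2) tder_q[of S i]] by (auto simp: mult.commute)
next
 case (mulu \<kappa> m F i \<kappa>' z)
 then obtain F' where F': "mon S False (Suc \<kappa>) (Suc m) F'" "tder S F F'" by auto
 have "mon S z (Suc \<kappa>') (Suc m) (\<lambda>x q u. F' x q u * u i + F x q u * u (Suc i))"
 proof (rule mon.add)
  show "mon S z (Suc \<kappa>') (Suc m) (\<lambda>x q u. F' x q u * u i)"
   by (rule mon.mulu[OF F'(1)]) (use mulu.hyps in auto)
  have "mon S False \<kappa> (Suc m) F" using mulu.hyps(1) by (rule mon_mono) auto
  then show "mon S z (Suc \<kappa>') (Suc m) (\<lambda>x q u. F x q u * u (Suc i))"
   by (rule mon.mulu) (use mulu.hyps in auto)
 qed
 then show ?case using tder_mult[OF F'(2) tder_u[of S i]] by (auto simp: mult.commute)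
next
 case (add z \<kappa> m F H)
 then obtain F' H' where "mon S z (Suc \<kappa>) (Suc m) F'" "tder S F F'" "mon S z (Suc \<kappa>) (Suc m) H'" "tder S H H'" by auto
 then show ?case by (intro exI[of _ "\<lambda>x q u. F' x q u + H' x q u"] conjI mon.add tder_add)
qed

text \<open>The leading terms of the \<open>k\<close>-th derivative of \<open>G\<close> along a solution; from \<open>k = 3\<close> on the
 remainder contains derivatives of order at most \<open>k\<close> only.\<close>

definition lead :: "(jet \<Rightarrow> real) \<Rightarrow> nat \<Rightarrow> dpoly" where
 "lead G k = (\<lambda>x q u. pd e3 G (jet x q u) * q (k + 2)
   + (real k * TT (pd e3 G) x q u + pd e2 G (jet x q u)) * q (k + 1) + pd e5 G (jet x q u) * u (k + 1))"

abbreviation "deriv_chain S z G F R \<equiv> (\<forall>k. mon S z k (k + 2) (F k)) \<and> (\<forall>k. tder S (F k) (F (Suc k))) \<and> F 0 = (\<lambda>x q u. G (jet x q u)) \<and>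
   (\<forall>k\<ge>3. mon S z k k (R k) \<and> F k = (\<lambda>x q u. lead G k x q u + R k x q u))"

text \<open>Each differentiation of \<open>pd e3 G * q (k + 2)\<close> puts one more copy of
  \<open>TT (pd e3 G)\<close> in front of the second-highest derivative of \<open>q\<close>; this is
  the factor \<open>k\<close> in \<open>lead\<close>. Orders up to \<open>3\<close> are computed by
  hand, higher ones by recursion.\<close>

lemma leading_terms:
 assumes S: "open S" and G: "smooth S G" and z: "z \<Longrightarrow> \<forall>x. (x, 0) \<in> S \<longrightarrow> G (x, 0) = 0"
 shows "\<exists>Fs R. deriv_chain S z G Fs R"
proof -
 define P where "P = pd e3 G"
 define Q where "Q = pd e2 G"
 define V where "V = pd e5 G"
 note sp = smooth_pd[OF S]
 have sm: "smooth S P" "smooth S Q" "smooth S V" "smooth S (DT P)" "smooth S (pd e3 P)" "smooth S (pd e5 P)"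
   "smooth S (DT V)" "smooth S (pd e5 V)" "smooth S (DT G)" "smooth S (pd e5 (DT G))" "smooth S (DT (DT G))"
  unfolding P_def Q_def V_def by (intro sp smooth_DT S G jet_Basis)+
 \<comment> \<open>The second total derivative of \<open>P\<close> without its top term, which is
   \<open>pd e3 P * q 4\<close>.\<close>
 define P2r where "P2r = (\<lambda>x q u. TT (DT P) x q u + TT (pd e3 P) x q u * q 3 + TT (pd e5 P) x q u * u 2 + pd e5 P (jet x q u) * u 3)"
 have P2: "tder S (TT P) (\<lambda>x q u. pd e3 P (jet x q u) * q 4 + P2r x q u)"
 proof -
  have "tder S (TT P) (\<lambda>x q u. TT (DT P) x q u + (TT (pd e3 P) x q u * q 3 + q (Suc 3) * pd e3 P (jet x q u))
    + (TT (pd e5 P) x q u * u 2 + u (Suc 2) * pd e5 P (jet x q u)))"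
   unfolding TT_def[of P] by (intro tder_add tder_mult tder_base S sm tder_q tder_u)
  then show ?thesis by (simp add: P2r_def algebra_simps eval_nat_numeral)
 qed
 have bs: "mon S False 0 m (\<lambda>x q u. \<Phi> (jet x q u))" if "smooth S \<Phi>" for \<Phi> m
  by (rule mon.base[OF that]) simp
 have mTT: "mon S False (Suc 0) m (TT \<Phi>)" if "smooth S \<Phi>" "3 \<le> m" for \<Phi> m
  using mon_TT[OF S that(1), of False m 0] that by simp
 have mP2r: "mon S False 2 m P2r" if m: "3 \<le> m" for m
  unfolding P2r_def
 proof (intro mon.add)
  show "mon S False 2 m (TT (DT P))" by (rule mon_mono[OF mTT[OF sm(4) m]]) auto
  show "mon S False 2 m (\<lambda>x q u. TT (pd e3 P) x q u * q 3)" by (rule mon.mulq[OF mTT[OF sm(5) m]]) (use m in auto)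
  show "mon S False 2 m (\<lambda>x q u. TT (pd e5 P) x q u * u 2)" by (rule mon.mulu[OF mTT[OF sm(6) m]]) (use m in auto)
  show "mon S False 2 m (\<lambda>x q u. pd e5 P (jet x q u) * u 3)" by (rule mon.mulu[OF bs[OF sm(6)]]) (use m in auto)
 qed
 have mP2: "mon S False 2 m (\<lambda>x q u. pd e3 P (jet x q u) * q 4 + P2r x q u)" if m: "4 \<le> m" for m
  by (intro mon.add mon.mulq[OF bs[OF sm(5)]] mP2r) (use m in auto)
 have step: "\<exists>R'. mon S z (Suc k) (Suc k) R' \<and>
   tder S (\<lambda>x q u. lead G k x q u + R x q u) (\<lambda>x q u. lead G (Suc k) x q u + R' x q u)"
  if k: "k \<ge> 3" and R: "mon S z k k R" for k R
 proof -
  obtain Rd where Rd: "mon S z (Suc k) (Suc k) Rd" "tder S R Rd"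
   using mon_tder[OF S R] k by auto
  \<comment> \<open>The second total derivative of \<open>P\<close> contains \<open>q 4\<close>,
    which is admissible in a remainder of order \<open>Suc k\<close> because
    \<open>k \<ge> 3\<close>.\<close>
  define R' where "R' = (\<lambda>x q u. Rd x q u
   + (real k * (pd e3 P (jet x q u) * q 4 + P2r x q u) + TT Q x q u) * q (Suc k) + TT V x q u * u (Suc k))"
  have "mon S z (Suc k) (Suc k) R'"
   unfolding R'_def
  proof (intro mon.add Rd)
   have "mon S False 2 (Suc k) (\<lambda>x q u. real k * (pd e3 P (jet x q u) * q 4 + P2r x q u) + TT Q x q u)"
    by (intro mon.add[OF mon_cmult] mP2 mon_mono[OF mTT[OF sm(2)]]) (use k in auto)
   then show "mon S z (Suc k) (Suc k) (\<lambda>x q u. (real k * (pd e3 P (jet x q u) * q 4 + P2r x q u) + TT Q x q u) * q (Suc k))"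
    by (rule mon.mulq) (use k in auto)
   show "mon S z (Suc k) (Suc k) (\<lambda>x q u. TT V x q u * u (Suc k))"
    by (rule mon.mulu[OF mTT[OF sm(3)]]) (use k in auto)
  qed
  moreover have "tder S (\<lambda>x q u. P (jet x q u) * q (k + 2) + (real k * TT P x q u + Q (jet x q u)) * q (k + 1)
     + V (jet x q u) * u (k + 1) + R x q u)
    (\<lambda>x q u. (TT P x q u * q (k + 2) + q (Suc (k + 2)) * P (jet x q u))
     + ((real k * (pd e3 P (jet x q u) * q 4 + P2r x q u) + TT Q x q u) * q (k + 1)
      + q (Suc (k + 1)) * (real k * TT P x q u + Q (jet x q u)))
     + (TT V x q u * u (k + 1) + u (Suc (k + 1)) * V (jet x q u)) + Rd x q u)"
   by (intro tder_add tder_mult tder_cmult tder_base S sm tder_q tder_u P2 Rd)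
  then have "tder S (\<lambda>x q u. lead G k x q u + R x q u) (\<lambda>x q u. lead G (Suc k) x q u + R' x q u)"
   by (simp add: lead_def R'_def P_def[symmetric] Q_def[symmetric] V_def[symmetric] algebra_simps)
  ultimately show ?thesis by blast
 qed
 define E2 where "E2 = (\<lambda>x q u. (DT V (jet x q u) + pd e5 (DT G) (jet x q u)) * u 2
   + pd e5 V (jet x q u) * u 2 * u 2 + DT (DT G) (jet x q u))"
 have zD: "\<forall>x. (x, 0) \<in> S \<longrightarrow> DT \<Phi> (x, 0) = 0" if "smooth S \<Phi>" "\<forall>x. (x, 0) \<in> S \<longrightarrow> \<Phi> (x, 0) = 0" for \<Phi>
  using pd_e0_zero[OF S that] by (auto simp: DT_def py1_def py2_def pu1_def)
 have mE2: "mon S z 2 m E2" if m: "2 \<le> m" for m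
  unfolding E2_def
 proof (intro mon.add)
  show "mon S z 2 m (\<lambda>x q u. (DT V (jet x q u) + pd e5 (DT G) (jet x q u)) * u 2)"
   by (rule mon.mulu[OF mon.add[OF bs[OF sm(7)] bs[OF sm(10)]]]) (use m in auto)
  have "mon S False 1 m (\<lambda>x q u. pd e5 V (jet x q u) * u 2)"
   by (rule mon.mulu[OF bs[OF sm(8)]]) (use m in auto)
  then show "mon S z 2 m (\<lambda>x q u. pd e5 V (jet x q u) * u 2 * u 2)"
   by (rule mon.mulu) (use m in auto)
  show "mon S z 2 m (\<lambda>x q u. DT (DT G) (jet x q u))"
   by (rule mon.base[OF sm(11)]) (use zD[OF sm(9) zD[OF G z]] in auto)
 qed
 obtain E2d where E2d: "mon S z 3 3 E2d" "tder S E2 E2d"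
  using mon_tder[OF S mE2[of 2]] by (auto simp: eval_nat_numeral)
 define F1 where "F1 = TT G"
 \<comment> \<open>The product \<open>2 * TT P * q 3\<close> contains
   \<open>pd e3 P * q 3 * q 3\<close> twice, whereas it occurs once; hence the subtraction. This
   term has order \<open>3\<close>, so a remainder of order at most \<open>k\<close> exists only
   from \<open>k = 3\<close> on.\<close>
 define F2 where "F2 = (\<lambda>x q u. P (jet x q u) * q 4 + (2 * TT P x q u + Q (jet x q u)) * q 3 + V (jet x q u) * u 3
   + (E2 x q u - pd e3 P (jet x q u) * q 3 * q 3))"
 define R3 where "R3 = (\<lambda>x q u. (2 * P2r x q u + TT Q x q u) * q 3 + TT V x q u * u 3 + E2d x q u
   - TT (pd e3 P) x q u * q 3 * q 3)"
 \<comment> \<open>\<open>DT G\<close> contains \<open>py2 * pd e2 G\<close>, whose derivative in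
   direction \<open>e3\<close> yields the extra \<open>Q\<close>; the rest is commutation of partial
   derivatives.\<close>
 have com: "pd e3 (DT G) p = DT P p + Q p" "pd e3 V p = pd e5 P p" if p: "p \<in> S" for p
 proof -
  show "pd e3 V p = pd e5 P p" unfolding V_def P_def by (rule pd_commute[OF S G p jet_Basis(4,6)])
  have "((\<lambda>s. DT G (p + s *\<^sub>R e3)) has_real_derivative
    pd e3 (pd e0 G) p + py1 p * pd e3 (pd e1 G) p + (pd e2 G p + py2 p * pd e3 (pd e2 G) p)
    + pu1 p * pd e3 (pd e4 G) p) (at 0)"
  proof -
   have pr: "py1 (p + s *\<^sub>R e3) = py1 p" "py2 (p + s *\<^sub>R e3) = py2 p + s" "pu1 (p + s *\<^sub>R e3) = pu1 p" for s
    by (simp_all add: py1_def py2_def pu1_def)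
   have d: "((\<lambda>s. pd e G (p + s *\<^sub>R e3)) has_real_derivative pd e3 (pd e G) p) (at 0)" if "e \<in> Basis" for e
    by (rule smooth_partial_DERIV[OF S sp[OF G that] p jet_Basis(4)])
   show ?thesis unfolding DT_def pr
    by (rule DERIV_cong[OF DERIV_add[OF DERIV_add[OF DERIV_add[OF d[OF jet_Basis(1)]
     DERIV_cmult[OF d[OF jet_Basis(2)]]] DERIV_mult[OF DERIV_add[OF DERIV_const DERIV_ident] d[OF jet_Basis(3)]]]
     DERIV_cmult[OF d[OF jet_Basis(5)]]]]) (simp del: scaleR_Pair)
  qed
  then have "pd e3 (DT G) p = pd e3 (pd e0 G) p + py1 p * pd e3 (pd e1 G) p + (pd e2 G p + py2 p * pd e3 (pd e2 G) p)
    + pu1 p * pd e3 (pd e4 G) p"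
   by (rule pd_DERIV_eq[OF S sm(9) p jet_Basis(4)])
  then show "pd e3 (DT G) p = DT P p + Q p"
   unfolding DT_def P_def Q_def using pd_commute[OF S G p jet_Basis(4)] jet_Basis by simp
 qed
 have t0: "tder S (\<lambda>x q u. G (jet x q u)) F1" unfolding F1_def by (rule tder_base[OF S G])
 have t1: "tder S F1 F2"
 proof -
  have "tder S F1 (\<lambda>x q u. TT (DT G) x q u + (TT P x q u * q 3 + q (Suc 3) * P (jet x q u))
    + (TT V x q u * u 2 + u (Suc 2) * V (jet x q u)))"
   unfolding F1_def TT_def[of G] P_def[symmetric] V_def[symmetric]
   by (intro tder_add tder_mult tder_base S sm tder_q tder_u)
  moreover have "TT (DT G) x q u + (TT P x q u * q 3 + q (Suc 3) * P (jet x q u))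
    + (TT V x q u * u 2 + u (Suc 2) * V (jet x q u)) = F2 x q u" if "jet x q u \<in> S" for x q u
   unfolding F2_def E2_def TT_def using com[OF that] by (simp add: algebra_simps)
  ultimately show ?thesis by (rule tder_cong)
 qed
 have t2: "tder S F2 (\<lambda>x q u. lead G 3 x q u + R3 x q u)"
 proof -
  have "tder S F2 (\<lambda>x q u. (TT P x q u * q 4 + q (Suc 4) * P (jet x q u))
   + ((2 * (pd e3 P (jet x q u) * q 4 + P2r x q u) + TT Q x q u) * q 3 + q (Suc 3) * (2 * TT P x q u + Q (jet x q u)))
   + (TT V x q u * u 3 + u (Suc 3) * V (jet x q u))
   + (E2d x q u - ((TT (pd e3 P) x q u * q 3 + q (Suc 3) * pd e3 P (jet x q u)) * q 3 + q (Suc 3) * (pd e3 P (jet x q u) * q 3))))"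
   unfolding F2_def by (intro tder_add tder_diff tder_mult tder_cmult tder_base S sm tder_q tder_u P2 E2d)
  then show ?thesis
   by (simp add: lead_def R3_def P_def[symmetric] Q_def[symmetric] V_def[symmetric] algebra_simps eval_nat_numeral)
 qed
 have mR3: "mon S z 3 3 R3"
  unfolding R3_def
 proof (intro mon_diff mon.add)
  have "mon S False 2 3 (\<lambda>x q u. 2 * P2r x q u + TT Q x q u)"
   by (intro mon.add[OF mon_cmult] mP2r mon_mono[OF mTT[OF sm(2)]]) auto
  then show "mon S z 3 3 (\<lambda>x q u. (2 * P2r x q u + TT Q x q u) * q 3)" by (rule mon.mulq) auto
  show "mon S z 3 3 (\<lambda>x q u. TT V x q u * u 3)" by (rule mon.mulu[OF mTT[OF sm(3)]]) auto
  show "mon S z 3 3 E2d" by (rule E2d)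
  show "mon S z 3 3 (\<lambda>x q u. TT (pd e3 P) x q u * q 3 * q 3)"
  proof -
   have "mon S False 2 3 (\<lambda>x q u. TT (pd e3 P) x q u * q 3)" by (rule mon.mulq[OF mTT[OF sm(5)]]) auto
   then show ?thesis by (rule mon.mulq) auto
  qed
 qed
 have "\<exists>f. \<forall>n. mon S z (n + 3) (n + 3) (f n) \<and>
   tder S (\<lambda>x q u. lead G (n + 3) x q u + f n x q u) (\<lambda>x q u. lead G (Suc n + 3) x q u + f (Suc n) x q u) \<and> (n = 0 \<longrightarrow> f n = R3)"
 proof -
  have "\<exists>f. \<forall>n. (mon S z (n + 3) (n + 3) (f n) \<and> (n = 0 \<longrightarrow> f n = R3)) \<and>
    tder S (\<lambda>x q u. lead G (n + 3) x q u + f n x q u) (\<lambda>x q u. lead G (Suc n + 3) x q u + f (Suc n) x q u)"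
   by (rule dependent_nat_choice) (use mR3 step in \<open>auto simp: eval_nat_numeral\<close>)
  then show ?thesis by blast
 qed
 then obtain f where f: "\<And>n. mon S z (n + 3) (n + 3) (f n)" "f 0 = R3"
   "\<And>n. tder S (\<lambda>x q u. lead G (n + 3) x q u + f n x q u) (\<lambda>x q u. lead G (Suc n + 3) x q u + f (Suc n) x q u)" by auto
 define R where "R k = f (k - 3)" for k
 define Fs where "Fs k = (if k = 0 then (\<lambda>x q u. G (jet x q u)) else if k = 1 then F1 else if k = 2 then F2
  else (\<lambda>x q u. lead G k x q u + R k x q u))" for k
 have k4: "k = 0 \<or> k = 1 \<or> k = 2 \<or> (\<exists>n. k = n + 3)" for k :: nat by presburger
 have td: "tder S (Fs k) (Fs (Suc k))" for k
  using k4[of k] t0 t1 t2 f by (auto simp: Fs_def R_def eval_nat_numeral)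
 have ml: "mon S z k (k + 2) (lead G k)" if k: "k \<ge> 2" for k
  unfolding lead_def P_def[symmetric] Q_def[symmetric] V_def[symmetric]
 proof (intro mon.add)
  show "mon S z k (k + 2) (\<lambda>x q u. P (jet x q u) * q (k + 2))"
   by (rule mon.mulq[OF bs[OF sm(1)]]) (use k in auto)
  show "mon S z k (k + 2) (\<lambda>x q u. V (jet x q u) * u (k + 1))"
   by (rule mon.mulu[OF bs[OF sm(3)]]) (use k in auto)
  show "mon S z k (k + 2) (\<lambda>x q u. (real k * TT P x q u + Q (jet x q u)) * q (k + 1))"
   by (rule mon.mulq[where \<kappa> = "Suc 0"]) (use k in \<open>auto intro!: mon.add mon_cmult mTT sm mon_mono[OF bs[OF sm(2)]]\<close>)
 qed
 have mF: "mon S z k (k + 2) (Fs k)" for k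
 proof -
  consider "k = 0" | "k = 1" | "k = 2" | "k \<ge> 3" by linarith
  then show ?thesis
  proof cases
   case 1
   have "mon S z 0 2 (\<lambda>x q u. G (jet x q u))" by (rule mon.base[OF G z])
   then show ?thesis using 1 by (simp add: Fs_def eval_nat_numeral)
  next
   case 2
   then show ?thesis using mon_TT[OF S G z, of z 3 0] by (simp add: Fs_def F1_def eval_nat_numeral)
  next
   case 3
   have "mon S z 2 4 F2"
    unfolding F2_def
   proof (intro mon_diff mon.add)
    show "mon S z 2 4 (\<lambda>x q u. P (jet x q u) * q 4)" by (rule mon.mulq[OF bs[OF sm(1)]]) auto
    show "mon S z 2 4 (\<lambda>x q u. (2 * TT P x q u + Q (jet x q u)) * q 3)"
     by (rule mon.mulq[where \<kappa> = "Suc 0"]) (auto intro!: mon.add mon_cmult mTT sm mon_mono[OF bs[OF sm(2)]])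
    show "mon S z 2 4 (\<lambda>x q u. V (jet x q u) * u 3)" by (rule mon.mulu[OF bs[OF sm(3)]]) auto
    show "mon S z 2 4 E2" by (rule mE2) simp
    show "mon S z 2 4 (\<lambda>x q u. pd e3 P (jet x q u) * q 3 * q 3)"
    proof -
     have "mon S False 1 4 (\<lambda>x q u. pd e3 P (jet x q u) * q 3)" by (rule mon.mulq[OF bs[OF sm(5)]]) auto
     then show ?thesis by (rule mon.mulq) auto
    qed
   qed
   then show ?thesis using 3 by (simp add: Fs_def eval_nat_numeral)
  next
   case 4
   then obtain n where n: "k = n + 3" by (metis le_add_diff_inverse2)
   have "mon S z k (k + 2) (R k)"
    by (rule mon_mono[of S z k k "R k"]) (use f(1)[of n] in \<open>auto simp: R_def n\<close>)
   from mon.add[OF ml this] show ?thesis using 4 by (auto simp: Fs_def)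
  qed
 qed
 have 1: "\<forall>k\<ge>3. mon S z k k (R k) \<and> Fs k = (\<lambda>x q u. lead G k x q u + R k x q u)"
 proof (intro allI impI conjI)
  fix k :: nat assume k: "3 \<le> k"
  then show "Fs k = (\<lambda>x q u. lead G k x q u + R k x q u)" by (simp add: Fs_def)
  show "mon S z k k (R k)" using f(1)[of "k - 3"] k by (simp add: R_def)
 qed
 have 2: "Fs 0 = (\<lambda>x q u. G (jet x q u))" by (simp add: Fs_def)
 have 3: "\<forall>k. mon S z k (k + 2) (Fs k)" using mF by (rule allI)
 have 4: "\<forall>k. tder S (Fs k) (Fs (Suc k))" using td by (rule allI)
 show ?thesis by (rule exI[of _ Fs], rule exI[of _ R], intro conjI 1 2 3 4)
qed

section \<open>Uniform bounds on a box of jets and bounds for differential monomials\<close>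

definition jbox :: "real \<Rightarrow> jet set" where
 "jbox \<rho> = {0..1} \<times> {-\<rho>..\<rho>} \<times> {-\<rho>..\<rho>} \<times> {-\<rho>..\<rho>} \<times> {-\<rho>..\<rho>} \<times> {-\<rho>..\<rho>}"

lemma compact_box: "compact (jbox \<rho>)"
 unfolding jbox_def by (intro compact_Times compact_Icc)

lemma convex_box: "convex (jbox \<rho>)"
 unfolding jbox_def by (intro convex_Times convex_real_interval)

lemma jet_in_box: "jet x q u \<in> jbox \<rho> \<longleftrightarrow> x \<in> {0..1} \<and> \<bar>q 0\<bar> \<le> \<rho> \<and> \<bar>q 1\<bar> \<le> \<rho> \<and> \<bar>q 2\<bar> \<le> \<rho> \<and> \<bar>u 0\<bar> \<le> \<rho> \<and> \<bar>u 1\<bar> \<le> \<rho>"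
 by (auto simp: jet_def jbox_def)

lemma smooth_bounded_box:
 assumes "smooth S \<Phi>" "jbox \<rho> \<subseteq> S"
 shows "\<exists>C\<ge>0. \<forall>p\<in>jbox \<rho>. \<bar>\<Phi> p\<bar> \<le> C"
proof -
 have "continuous_on (jbox \<rho>) \<Phi>" using assms smooth_continuous continuous_on_subset by blast
 then have "bounded (\<Phi> ` jbox \<rho>)" using compact_continuous_image compact_box compact_imp_bounded by blast
 then obtain C where "\<forall>y\<in>\<Phi> ` jbox \<rho>. \<bar>y\<bar> \<le> C" unfolding bounded_iff real_norm_def by (elim exE)
 then have "\<forall>p\<in>jbox \<rho>. \<bar>\<Phi> p\<bar> \<le> max 0 C" by auto
 then show ?thesis by (intro exI[of _ "max 0 C"]) simp
qed

abbreviation "jdist q u q' u' \<equiv> \<bar>q 0 - q' 0\<bar> + \<bar>q 1 - q' 1\<bar> + \<bar>q 2 - q' 2\<bar> + \<bar>u 0 - u' 0\<bar> + \<bar>u (1::nat) - u' 1\<bar> :: real"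
abbreviation "lip_bd \<rho> G C \<equiv> \<forall>x q u q' u'. jet x q u \<in> jbox \<rho> \<longrightarrow> jet x q' u' \<in> jbox \<rho> \<longrightarrow>
  \<bar>G (jet x q u) - G (jet x q' u')\<bar> \<le> C * jdist q u q' u'"

text \<open>Mean value theorem along the segment between the two jets, which stays in the convex box
  and keeps \<open>x\<close> fixed.\<close>

lemma box_lipschitz:
 assumes S: "open S" "smooth S \<Phi>" "jbox \<rho> \<subseteq> S"
 shows "\<exists>C\<ge>0. lip_bd \<rho> \<Phi> C"
proof -
 have "\<exists>C\<ge>0. \<forall>p\<in>jbox \<rho>. \<bar>pd e \<Phi> p\<bar> \<le> C" if "e \<in> Basis" for e
  by (rule smooth_bounded_box[OF smooth_pd[OF S(1,2) that] S(3)])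
 then obtain C1 C2 C3 C4 C5 where C: "C1 \<ge> 0" "C2 \<ge> 0" "C3 \<ge> 0" "C4 \<ge> 0" "C5 \<ge> 0"
  "\<forall>p\<in>jbox \<rho>. \<bar>pd e1 \<Phi> p\<bar> \<le> C1" "\<forall>p\<in>jbox \<rho>. \<bar>pd e2 \<Phi> p\<bar> \<le> C2" "\<forall>p\<in>jbox \<rho>. \<bar>pd e3 \<Phi> p\<bar> \<le> C3"
  "\<forall>p\<in>jbox \<rho>. \<bar>pd e4 \<Phi> p\<bar> \<le> C4" "\<forall>p\<in>jbox \<rho>. \<bar>pd e5 \<Phi> p\<bar> \<le> C5"
  using jet_Basis by metis
 define C where "C = C1 + C2 + C3 + C4 + C5"
 have "\<bar>\<Phi> (jet x q u) - \<Phi> (jet x q' u')\<bar> \<le> C * jdist q u q' u'"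
  if p: "jet x q u \<in> jbox \<rho>" "jet x q' u' \<in> jbox \<rho>" for x q u q' u'
 proof -
  define y y1 y2 v v1 where y: "y = q 0 - q' 0" "y1 = q 1 - q' 1" "y2 = q 2 - q' 2" "v = u 0 - u' 0" "v1 = u 1 - u' 1"
  define \<gamma> where "\<gamma> s = (x, q' 0 + s * y, q' 1 + s * y1, q' 2 + s * y2, u' 0 + s * v, u' 1 + s * v1)" for s
  have inb: "\<gamma> s \<in> jbox \<rho>" if s: "0 \<le> s" "s \<le> 1" for s
  proof -
   have "(1 - s) *\<^sub>R jet x q' u' + s *\<^sub>R jet x q u \<in> jbox \<rho>"
    using convex_box[of \<rho>] p s unfolding convex_alt by blast
   moreover have "(1 - s) *\<^sub>R jet x q' u' + s *\<^sub>R jet x q u = \<gamma> s"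
    by (simp add: jet_def \<gamma>_def y algebra_simps)
   ultimately show ?thesis by simp
  qed
  define D where "D s = y * pd e1 \<Phi> (\<gamma> s) + y1 * pd e2 \<Phi> (\<gamma> s) + y2 * pd e3 \<Phi> (\<gamma> s) + v * pd e4 \<Phi> (\<gamma> s) + v1 * pd e5 \<Phi> (\<gamma> s)" for s
  have "((\<lambda>s. \<Phi> (\<gamma> s)) has_real_derivative D s) (at s)" if s: "0 \<le> s" "s \<le> 1" for s
  proof -
   have m: "((\<lambda>s. r + s * t) has_real_derivative t) (at s)" for r t
    by (auto intro!: derivative_eq_intros)
   show ?thesis unfolding \<gamma>_def
    by (rule smooth_chain6[OF S(1,2) _ DERIV_const m m m m m, THEN DERIV_cong])
     (use inb[OF s] S(3) in \<open>auto simp: \<gamma>_def D_def\<close>)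
  qed
  then have "\<exists>s>0. s < 1 \<and> \<Phi> (\<gamma> 1) - \<Phi> (\<gamma> 0) = (1 - 0) * D s"
   by (intro MVT2) auto
  then obtain s where s: "0 < s" "s < 1" "\<Phi> (\<gamma> 1) - \<Phi> (\<gamma> 0) = D s" by auto
  have "\<gamma> 1 = jet x q u" "\<gamma> 0 = jet x q' u'" by (simp_all add: \<gamma>_def y jet_def)
  then have "\<bar>\<Phi> (jet x q u) - \<Phi> (jet x q' u')\<bar> = \<bar>D s\<bar>" using s by simp
  also have "\<dots> \<le> \<bar>y\<bar> * C1 + \<bar>y1\<bar> * C2 + \<bar>y2\<bar> * C3 + \<bar>v\<bar> * C4 + \<bar>v1\<bar> * C5"
  proof -
   have b: "\<gamma> s \<in> jbox \<rho>" using inb[of s] s by simp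
   have tri: "\<bar>a + b\<bar> \<le> c + d" if "\<bar>a\<bar> \<le> c" "\<bar>b\<bar> \<le> d" for a b c d :: real using that by linarith
   have "\<bar>y * pd e1 \<Phi> (\<gamma> s)\<bar> \<le> \<bar>y\<bar> * C1" "\<bar>y1 * pd e2 \<Phi> (\<gamma> s)\<bar> \<le> \<bar>y1\<bar> * C2" "\<bar>y2 * pd e3 \<Phi> (\<gamma> s)\<bar> \<le> \<bar>y2\<bar> * C3"
    "\<bar>v * pd e4 \<Phi> (\<gamma> s)\<bar> \<le> \<bar>v\<bar> * C4" "\<bar>v1 * pd e5 \<Phi> (\<gamma> s)\<bar> \<le> \<bar>v1\<bar> * C5"
    unfolding abs_mult using C b by (auto intro!: mult_left_mono)
   then show ?thesis unfolding D_def by (intro tri)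
  qed
  also have "\<dots> \<le> \<bar>y\<bar> * C + \<bar>y1\<bar> * C + \<bar>y2\<bar> * C + \<bar>v\<bar> * C + \<bar>v1\<bar> * C"
   unfolding C_def using C by (intro add_mono mult_left_mono) auto
  finally show ?thesis by (simp add: y algebra_simps)
 qed
 moreover have "C \<ge> 0" using C by (simp add: C_def)
 ultimately show ?thesis by (intro exI[of _ C]) blast
qed

text \<open>Lipschitz comparison with the zero jet over the same \<open>x\<close>.\<close>

lemma box_linear_bound:
 assumes S: "open S" "smooth S \<Phi>" "jbox \<rho> \<subseteq> S" and z: "\<forall>x. (x, 0) \<in> S \<longrightarrow> \<Phi> (x, 0) = 0"
 shows "\<exists>C\<ge>0. \<forall>p\<in>jbox \<rho>. \<bar>\<Phi> p\<bar> \<le> C * (\<bar>py p\<bar> + \<bar>py1 p\<bar> + \<bar>py2 p\<bar> + \<bar>pu p\<bar> + \<bar>pu1 p\<bar>)"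
proof -
 obtain C where C: "C \<ge> 0" "lip_bd \<rho> \<Phi> C" using box_lipschitz[OF S] by (elim exE conjE)
 have "\<bar>\<Phi> p\<bar> \<le> C * (\<bar>py p\<bar> + \<bar>py1 p\<bar> + \<bar>py2 p\<bar> + \<bar>pu p\<bar> + \<bar>pu1 p\<bar>)" if p: "p \<in> jbox \<rho>" for p
 proof -
  obtain x y y1 y2 u u1 where pp: "p = (x, y, y1, y2, u, u1)" by (metis prod.exhaust)
  define qs us where "qs i = (if i = 0 then y else if i = 1 then y1 else y2)" and "us i = (if i = 0 then u else u1)" for i :: nat
  have j: "jet x qs us = p" "jet x (\<lambda>_. 0) (\<lambda>_. 0) = (x, 0)" by (simp_all add: jet_def pp qs_def us_def zero_prod_def)
  have z0: "jet x (\<lambda>_. 0) (\<lambda>_. 0) \<in> jbox \<rho>" using p by (auto simp: pp jbox_def jet_def)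
  have "\<bar>\<Phi> (jet x qs us) - \<Phi> (jet x (\<lambda>_. 0) (\<lambda>_. 0))\<bar> \<le> C * jdist qs us (\<lambda>_. 0) (\<lambda>_. 0)"
   by (rule C(2)[rule_format]) (use p z0 in \<open>simp_all add: j\<close>)
  moreover have "\<Phi> (x, 0) = 0" using z0 S(3) z unfolding j by blast
  ultimately show ?thesis unfolding j by (simp add: pp qs_def us_def)
 qed
 with C(1) show ?thesis by (intro exI[of _ C] conjI ballI)
qed

lemma divide_power_mono:
 fixes X c :: real
 assumes "0 < X" "X \<le> 1" "0 \<le> c" "e \<le> e'"
 shows "c / X ^ e \<le> c / X ^ e'"
 using assms by (intro divide_left_mono power_decreasing) auto

text \<open>A monomial contains at most one factor of order above \<open>h\<close>, or else its total weight is so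
 large that all factors are controlled by the weighted sup norms.\<close>

definition bd :: "nat \<Rightarrow> bool \<Rightarrow> nat \<Rightarrow> nat \<Rightarrow> real \<Rightarrow> (nat \<Rightarrow> real) \<Rightarrow> (nat \<Rightarrow> real) \<Rightarrow> real \<Rightarrow> real" where
 "bd h z \<kappa> m X q u B = (if z then B else 1) + (\<Sum>i\<in>{h<..min m (\<kappa> + 2)}. \<bar>q i\<bar> + \<bar>u i\<bar>)
   + (if 2 * (h - 1) \<le> \<kappa> then B\<^sup>2 / X ^ (\<kappa> - 2 * (h - 2)) else 0)"

text \<open>One more factor \<open>a\<close> of order \<open>i\<close> is multiplied on. If
  \<open>i \<le> h\<close>, it is bounded by \<open>B\<close>. Otherwise it stands alone or meets
  another factor of order above \<open>h\<close>. A factor \<open>q j\<close> of weight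
  \<open>j - 2\<close> costs \<open>j - h\<close> powers of \<open>XX\<close>, so two of them cost
  at most \<open>\<kappa>' - 2 * (h - 2)\<close> powers, and their joint weight is at least
  \<open>2 * (h - 1)\<close>. Since either of them uses up at least \<open>h - 1\<close> of the
  weight \<open>k \<le> p + 2\<close>, both orders are at most \<open>p\<close> and the sup bounds
  apply.\<close>

lemma bd_step:
 fixes X B B0 :: real
 assumes X: "0 < X" "X \<le> 1" and B: "0 \<le> B" "B \<le> B0" and h: "5 \<le> h" "h \<le> p" "k \<le> p + 2" "\<kappa>' \<le> k"
  and i: "2 \<le> i" "i \<le> m" "\<kappa> + i \<le> \<kappa>' + 2" and a: "a = \<bar>q i\<bar> \<or> a = \<bar>u i\<bar>"
  and sup: "\<And>j. j \<le> p \<Longrightarrow> X ^ (j - h) * \<bar>q j\<bar> \<le> B" "\<And>j. j \<le> p \<Longrightarrow> X ^ (j - h) * \<bar>u j\<bar> \<le> B"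
 shows "bd h False \<kappa> m X q u B * a \<le> (1 + 3 * B0 + 2 * real m) * bd h z \<kappa>' m X q u B"
proof -
 define s where "s \<kappa> = (\<Sum>i\<in>{h<..min m (\<kappa> + 2)}. \<bar>q i\<bar> + \<bar>u i\<bar>)" for \<kappa>
 define T where "T \<kappa> = (if 2 * (h - 1) \<le> \<kappa> then B\<^sup>2 / X ^ (\<kappa> - 2 * (h - 2)) else 0)" for \<kappa>
 define b where "b = (if z then B else 1)"
 have bd: "bd h False \<kappa> m X q u B = 1 + s \<kappa> + T \<kappa>" "bd h z \<kappa>' m X q u B = b + s \<kappa>' + T \<kappa>'"
  by (simp_all add: bd_def s_def T_def b_def)
 have nn: "0 \<le> s \<kappa>" "0 \<le> s \<kappa>'" "0 \<le> T \<kappa>" "0 \<le> T \<kappa>'" "0 \<le> b" "0 \<le> a" "0 \<le> B0"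
  using X B a by (auto simp: s_def T_def b_def intro!: sum_nonneg)
 have \<kappa>: "\<kappa> \<le> \<kappa>'" using i by simp
 have mono: "s \<kappa> \<le> s \<kappa>'" "T \<kappa> \<le> T \<kappa>'"
 proof -
  show "s \<kappa> \<le> s \<kappa>'" unfolding s_def using \<kappa> by (intro sum_mono2) auto
  show "T \<kappa> \<le> T \<kappa>'" unfolding T_def using \<kappa> X by (auto intro!: divide_power_mono)
 qed
 have pw: "\<bar>q j\<bar> \<le> B / X ^ (j - h)" "\<bar>u j\<bar> \<le> B / X ^ (j - h)" if "j \<le> p" for j
  using sup[OF that] X by (simp_all add: pos_le_divide_eq mult.commute)
 have ap: "a \<le> B / X ^ (i - h)" if "i \<le> p" using pw[OF that] a by auto
 have "a + s \<kappa> * a + T \<kappa> * a \<le> (1 + B0) * b + s \<kappa>' + B0 * s \<kappa>' + 2 * real m * T \<kappa>' + B0 * T \<kappa>'"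
 proof (cases "i \<le> h")
  case True
  then have "a \<le> B" using ap h by simp
  then have "a \<le> B0" using B by simp
  have "a \<le> (1 + B0) * b"
  proof (cases z)
   case True
   have "B \<le> (1 + B0) * B" using B nn by (simp add: distrib_right)
   then show ?thesis using True \<open>a \<le> B\<close> by (simp add: b_def)
  next
   case False then show ?thesis using \<open>a \<le> B0\<close> by (simp add: b_def)
  qed
  moreover have "s \<kappa> * a \<le> B0 * s \<kappa>'"
   using mult_mono[OF mono(1) \<open>a \<le> B0\<close>] nn by (simp add: mult.commute)
  moreover have "T \<kappa> * a \<le> B0 * T \<kappa>'"
   using mult_mono[OF mono(2) \<open>a \<le> B0\<close>] nn by (simp add: mult.commute)
  moreover have "0 \<le> 2 * real m * T \<kappa>'" using nn by simp
  ultimately show ?thesis using nn by linarith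
 next
  case False
  then have ih: "h < i" by simp
  have "\<bar>q i\<bar> + \<bar>u i\<bar> \<le> s \<kappa>'"
   unfolding s_def using ih i by (intro member_le_sum) auto
  then have 1: "a \<le> s \<kappa>'" using a by auto
  have term_le: "(\<bar>q j\<bar> + \<bar>u j\<bar>) * a \<le> 2 * T \<kappa>'" if j: "j \<in> {h<..min m (\<kappa> + 2)}" for j
  proof -
   have jp: "j \<le> p" "i \<le> p" "2 * (h - 1) \<le> \<kappa>'" "(j - h) + (i - h) \<le> \<kappa>' - 2 * (h - 2)"
    using j i h ih by auto
   have "(\<bar>q j\<bar> + \<bar>u j\<bar>) * a \<le> (B / X ^ (j - h) + B / X ^ (j - h)) * (B / X ^ (i - h))"
    using pw[OF jp(1)] ap[OF jp(2)] nn by (intro mult_mono add_mono) auto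
   also have "\<dots> = 2 * (B\<^sup>2 / X ^ ((j - h) + (i - h)))" by (simp add: power_add power2_eq_square)
   also have "\<dots> \<le> 2 * (B\<^sup>2 / X ^ (\<kappa>' - 2 * (h - 2)))"
    using X jp(4) by (intro mult_left_mono divide_power_mono) auto
   finally show ?thesis using jp(3) by (simp add: T_def)
  qed
  have "s \<kappa> * a \<le> (\<Sum>j\<in>{h<..min m (\<kappa> + 2)}. 2 * T \<kappa>')"
   unfolding s_def sum_distrib_right by (intro sum_mono term_le)
  also have "\<dots> = 2 * real (card {h<..min m (\<kappa> + 2)}) * T \<kappa>'" by simp
  also have "\<dots> \<le> 2 * real m * T \<kappa>'"
   using nn by (intro mult_right_mono) auto
  finally have 2: "s \<kappa> * a \<le> 2 * real m * T \<kappa>'" .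
  have 3: "T \<kappa> * a \<le> B0 * T \<kappa>'"
  proof (cases "2 * (h - 1) \<le> \<kappa>")
   case True
   then have ip: "i \<le> p" "(\<kappa> - 2 * (h - 2)) + (i - h) \<le> \<kappa>' - 2 * (h - 2)" "2 * (h - 1) \<le> \<kappa>'" using i h ih by auto
   have "T \<kappa> * a \<le> B\<^sup>2 / X ^ (\<kappa> - 2 * (h - 2)) * (B / X ^ (i - h))"
    using mult_left_mono[OF ap[OF ip(1)] nn(3)] True by (simp only: T_def if_True)
   also have "\<dots> = B * (B\<^sup>2 / X ^ ((\<kappa> - 2 * (h - 2)) + (i - h)))" by (simp add: power_add)
   also have "\<dots> \<le> B0 * (B\<^sup>2 / X ^ (\<kappa>' - 2 * (h - 2)))"
    using X B ip(2) by (intro mult_mono divide_power_mono) auto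
   finally show ?thesis using ip(3) by (simp add: T_def)
  qed (use nn in \<open>simp add: T_def\<close>)
  have "0 \<le> (1 + B0) * b" "0 \<le> B0 * s \<kappa>'" using nn by simp_all
  then show ?thesis using 1 2 3 by linarith
 qed
 also have "\<dots> \<le> (1 + 3 * B0 + 2 * real m) * (b + s \<kappa>' + T \<kappa>')"
 proof -
  have "(1 + 3 * B0 + 2 * real m) * (b + s \<kappa>' + T \<kappa>') = (1 + B0) * b + s \<kappa>' + B0 * s \<kappa>' + 2 * real m * T \<kappa>' + B0 * T \<kappa>'
   + (2 * B0 * b + 2 * real m * b + 2 * B0 * s \<kappa>' + 2 * real m * s \<kappa>' + T \<kappa>' + 2 * B0 * T \<kappa>')"
   by (simp add: algebra_simps)
  moreover have "0 \<le> 2 * B0 * b + 2 * real m * b + 2 * B0 * s \<kappa>' + 2 * real m * s \<kappa>' + T \<kappa>' + 2 * B0 * T \<kappa>'"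
   using nn by simp
  ultimately show ?thesis by linarith
 qed
 finally show ?thesis unfolding bd by (simp add: algebra_simps)
qed

text \<open>\<open>B\<close> is the actual size and \<open>B0\<close> a fixed a priori bound for it.
  Constants may depend on \<open>B0\<close> but not on \<open>B\<close>, which keeps the estimates
  for expressions vanishing with the jet linear in \<open>B\<close>, apart from the high
  factors.\<close>

definition adm :: "real \<Rightarrow> nat \<Rightarrow> nat \<Rightarrow> real \<Rightarrow> real \<Rightarrow> (nat \<Rightarrow> real) \<Rightarrow> (nat \<Rightarrow> real) \<Rightarrow> real \<Rightarrow> bool" where
 "adm \<rho> h p B0 x q u B \<longleftrightarrow> 0 < x \<and> x < 1 \<and> jet x q u \<in> jbox \<rho> \<and> 0 \<le> B \<and> B \<le> B0 \<and>
  (\<forall>i\<le>p. XX x ^ (i - h) * \<bar>q i\<bar> \<le> B \<and> XX x ^ (i - h) * \<bar>u i\<bar> \<le> B)"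

text \<open>A single factor may have an order beyond the reach \<open>p\<close> of the sup bounds;
  it is not estimated but kept in \<open>bd\<close>. Everything else is the repeated use of
  \<open>bd_step\<close>, starting from bounds for smooth functions on the compact box.\<close>

lemma mon_bound:
 assumes S: "open S" "jbox \<rho> \<subseteq> S" and B0: "0 \<le> B0" and h: "5 \<le> h" "h \<le> p" "k \<le> p + 2"
  and F: "mon S z \<kappa> m F" "\<kappa> \<le> k"
 shows "\<exists>C\<ge>0. \<forall>x q u B. adm \<rho> h p B0 x q u B \<longrightarrow>
  \<bar>F x q u\<bar> \<le> C * bd h z \<kappa> m (XX x) q u B"
 using F
proof (induction rule: mon.induct)
 case (base \<Phi> z \<kappa> m)
 have ge: "(if z then B else 1) \<le> bd h z \<kappa> m (XX x) q u B" if "0 < x" "x < 1" for x q u B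
  unfolding bd_def using XX_pos[OF that] by (auto intro!: add_nonneg_nonneg sum_nonneg)
 obtain C1 where C1: "C1 \<ge> 0" "\<forall>p\<in>jbox \<rho>. \<bar>\<Phi> p\<bar> \<le> C1" using smooth_bounded_box[OF base(1) S(2)] by blast
 obtain C2 where C2: "C2 \<ge> 0" "z \<Longrightarrow> \<forall>p\<in>jbox \<rho>. \<bar>\<Phi> p\<bar> \<le> C2 * (\<bar>py p\<bar> + \<bar>py1 p\<bar> + \<bar>py2 p\<bar> + \<bar>pu p\<bar> + \<bar>pu1 p\<bar>)"
 proof (cases z)
  case True
  then show ?thesis using that box_linear_bound[OF S(1) base(1) S(2) base(2)] by blast
 qed (use that[of 0] in auto)
 have "\<bar>\<Phi> (jet x q u)\<bar> \<le> (C1 + 5 * C2) * bd h z \<kappa> m (XX x) q u B"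
  if ad: "adm \<rho> h p B0 x q u B" for x q u B
 proof -
  have x: "0 < x" "x < 1" and jb: "jet x q u \<in> jbox \<rho>" and B: "0 \<le> B"
   and sup: "\<forall>i\<le>p. XX x ^ (i - h) * \<bar>q i\<bar> \<le> B \<and> XX x ^ (i - h) * \<bar>u i\<bar> \<le> B"
   using ad by (auto simp: adm_def)
  have "\<bar>\<Phi> (jet x q u)\<bar> \<le> (C1 + 5 * C2) * (if z then B else 1)"
  proof (cases z)
   case True
   have le: "\<bar>q i\<bar> \<le> B" "\<bar>u i\<bar> \<le> B" if "i \<le> h" for i
    using sup[rule_format, of i] that h by auto
   have "\<bar>q 0\<bar> \<le> B" "\<bar>q 1\<bar> \<le> B" "\<bar>q 2\<bar> \<le> B" "\<bar>u 0\<bar> \<le> B" "\<bar>u 1\<bar> \<le> B"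
    by (intro le; use h in simp)+
   then have "\<bar>q 0\<bar> + \<bar>q 1\<bar> + \<bar>q 2\<bar> + \<bar>u 0\<bar> + \<bar>u 1\<bar> \<le> 5 * B" by linarith
   then have "C2 * (\<bar>q 0\<bar> + \<bar>q 1\<bar> + \<bar>q 2\<bar> + \<bar>u 0\<bar> + \<bar>u 1\<bar>) \<le> C2 * (5 * B)"
    using C2(1) by (rule mult_left_mono)
   moreover have "\<bar>\<Phi> (jet x q u)\<bar> \<le> C2 * (\<bar>q 0\<bar> + \<bar>q 1\<bar> + \<bar>q 2\<bar> + \<bar>u 0\<bar> + \<bar>u 1\<bar>)"
    using C2(2)[OF True] jb by force
   moreover have "0 \<le> C1 * B" using C1 B by simp
   ultimately show ?thesis using True by (simp add: algebra_simps)
  next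
   case False
   then show ?thesis using C1(2) C2(1) jb by force
  qed
  also have "\<dots> \<le> (C1 + 5 * C2) * bd h z \<kappa> m (XX x) q u B"
   using C1(1) C2(1) ge[OF x] by (intro mult_left_mono) auto
  finally show ?thesis .
 qed
 moreover have "0 \<le> C1 + 5 * C2" using C1 C2 by simp
 ultimately show ?case by blast
next
 case (mulq \<kappa> m F i \<kappa>' z)
 then have "\<kappa> \<le> k" by simp
 with mulq obtain C where C: "C \<ge> 0" "\<forall>x q u B. adm \<rho> h p B0 x q u B \<longrightarrow> \<bar>F x q u\<bar> \<le> C * bd h False \<kappa> m (XX x) q u B" by blast
 define D where "D = C * (1 + 3 * B0 + 2 * real m)"
 have "\<bar>F x q u * q i\<bar> \<le> D * bd h z \<kappa>' m (XX x) q u B"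
  if ad: "adm \<rho> h p B0 x q u B" for x q u B
 proof -
  note a = ad[unfolded adm_def]
  have "\<bar>F x q u * q i\<bar> \<le> C * bd h False \<kappa> m (XX x) q u B * \<bar>q i\<bar>"
   unfolding abs_mult by (rule mult_right_mono[OF C(2)[rule_format, OF ad]]) simp
  also have "\<dots> \<le> C * ((1 + 3 * B0 + 2 * real m) * bd h z \<kappa>' m (XX x) q u B)"
  proof -
   have "XX x \<le> 1" using XX_bounds[of x] a by simp
   then have "bd h False \<kappa> m (XX x) q u B * \<bar>q i\<bar> \<le> (1 + 3 * B0 + 2 * real m) * bd h z \<kappa>' m (XX x) q u B"
    by (intro bd_step[where p = p and k = k and i = i]) (use mulq a h XX_pos[of x] in auto)
   from mult_left_mono[OF this C(1)] show ?thesis by (simp only: mult.assoc)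
  qed
  finally show ?thesis by (simp add: D_def mult.assoc)
 qed
 moreover have "0 \<le> D" using C(1) B0 by (simp add: D_def)
 ultimately show ?case by blast
next
 case (mulu \<kappa> m F i \<kappa>' z)
 then have "\<kappa> \<le> k" by simp
 with mulu obtain C where C: "C \<ge> 0" "\<forall>x q u B. adm \<rho> h p B0 x q u B \<longrightarrow> \<bar>F x q u\<bar> \<le> C * bd h False \<kappa> m (XX x) q u B" by blast
 define D where "D = C * (1 + 3 * B0 + 2 * real m)"
 have "\<bar>F x q u * u i\<bar> \<le> D * bd h z \<kappa>' m (XX x) q u B"
  if ad: "adm \<rho> h p B0 x q u B" for x q u B
 proof -
  note a = ad[unfolded adm_def]
  have "\<bar>F x q u * u i\<bar> \<le> C * bd h False \<kappa> m (XX x) q u B * \<bar>u i\<bar>"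
   unfolding abs_mult by (rule mult_right_mono[OF C(2)[rule_format, OF ad]]) simp
  also have "\<dots> \<le> C * ((1 + 3 * B0 + 2 * real m) * bd h z \<kappa>' m (XX x) q u B)"
  proof -
   have "XX x \<le> 1" using XX_bounds[of x] a by simp
   then have "bd h False \<kappa> m (XX x) q u B * \<bar>u i\<bar> \<le> (1 + 3 * B0 + 2 * real m) * bd h z \<kappa>' m (XX x) q u B"
    by (intro bd_step[where p = p and k = k and i = i]) (use mulu a h XX_pos[of x] in auto)
   from mult_left_mono[OF this C(1)] show ?thesis by (simp only: mult.assoc)
  qed
  finally show ?thesis by (simp add: D_def mult.assoc)
 qed
 moreover have "0 \<le> D" using C(1) B0 by (simp add: D_def)
 ultimately show ?case by blast
next
 case (add z \<kappa> m F F')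
 then obtain C C' where C: "C \<ge> 0" "\<forall>x q u B. adm \<rho> h p B0 x q u B \<longrightarrow> \<bar>F x q u\<bar> \<le> C * bd h z \<kappa> m (XX x) q u B"
  and C': "C' \<ge> 0" "\<forall>x q u B. adm \<rho> h p B0 x q u B \<longrightarrow> \<bar>F' x q u\<bar> \<le> C' * bd h z \<kappa> m (XX x) q u B" by blast
 have "\<bar>F x q u + F' x q u\<bar> \<le> (C + C') * bd h z \<kappa> m (XX x) q u B"
  if ad: "adm \<rho> h p B0 x q u B" for x q u B
  using C(2)[rule_format, OF ad] C'(2)[rule_format, OF ad] abs_triangle_ineq[of "F x q u" "F' x q u"] by (simp add: distrib_right)
 moreover have "0 \<le> C + C'" using C C' by simp
 ultimately show ?case by blast
qed

text \<open>For \<open>m \<le> h\<close> the sum over high factors is empty, and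
  \<open>\<kappa> \<le> h + 2\<close> lies below the threshold \<open>2 * (h - 1)\<close> since
  \<open>h \<ge> 5\<close>. Only the first summand of \<open>bd\<close> remains.\<close>

lemma mon_crude:
 assumes S: "open S" "jbox \<rho> \<subseteq> S" and B0: "0 \<le> B0" and h: "5 \<le> h" "m \<le> h" "\<kappa> \<le> h + 2"
  and F: "mon S z \<kappa> m F"
 shows "\<exists>C\<ge>0. \<forall>x q u B. adm \<rho> h h B0 x q u B \<longrightarrow> \<bar>F x q u\<bar> \<le> C * (if z then B else 1)"
proof -
 obtain C where C: "C \<ge> 0" "\<forall>x q u B. adm \<rho> h h B0 x q u B \<longrightarrow> \<bar>F x q u\<bar> \<le> C * bd h z \<kappa> m (XX x) q u B"
  using mon_bound[OF S B0 h(1) order_refl h(3) F order_refl] by blast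
 have "bd h z \<kappa> m X q u B = (if z then B else 1)" for X q u B
  unfolding bd_def using h by auto
 then have "\<forall>x q u B. adm \<rho> h h B0 x q u B \<longrightarrow> \<bar>F x q u\<bar> \<le> C * (if z then B else 1)"
  using C(2) by simp
 with C(1) show ?thesis by (intro exI[of _ C]) simp
qed

context weights
begin

text \<open>Squares of single high factors are energy densities because \<open>w k \<le> w i\<close>
  for \<open>i \<le> k\<close>. When the singular summand of \<open>bd\<close> is present,
  \<open>k + 8 \<le> 4 * h\<close> says that \<open>2 * (k - 2 * (h - 2)) \<le> k\<close>, so the
  power \<open>XX ^ k\<close> contained in \<open>w k\<close> absorbs its square.\<close>

lemma mon_weighted:
 assumes S: "open S" "jbox \<rho> \<subseteq> S" and B0: "0 \<le> B0" and h: "5 \<le> h" "h \<le> p" "k \<le> p + 2" "k + 8 \<le> 4 * h"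
  and F: "mon S True k k F"
 shows "\<exists>C\<ge>0. \<forall>x q u B. adm \<rho> h p B0 x q u B \<longrightarrow>
  w k x * (F x q u)\<^sup>2 \<le> C * (B\<^sup>2 + (\<Sum>i\<le>k. w i x * ((q i)\<^sup>2 + (u i)\<^sup>2)))"
proof -
 obtain C where C: "C \<ge> 0" "\<forall>x q u B. adm \<rho> h p B0 x q u B \<longrightarrow> \<bar>F x q u\<bar> \<le> C * bd h True k k (XX x) q u B"
  using mon_bound[OF S B0 h(1-3) F order_refl] by blast
 define D where "D = 3 * (1 + 2 * (real k + 1) + B0\<^sup>2)"
 have "w k x * (F x q u)\<^sup>2 \<le> C\<^sup>2 * D * (B\<^sup>2 + (\<Sum>i\<le>k. w i x * ((q i)\<^sup>2 + (u i)\<^sup>2)))"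
  if ad: "adm \<rho> h p B0 x q u B" for x q u B
 proof -
  note a = ad[unfolded adm_def]
  have x: "x \<in> {0..1}" using a by simp
  have X: "0 < XX x" "XX x \<le> 1" using a XX_pos[of x] XX_bounds[OF x] by auto
  have wn: "0 \<le> w i x" for i by (rule w_nonneg[OF x])
  define s where "s = (\<Sum>i\<in>{h<..k}. \<bar>q i\<bar> + \<bar>u i\<bar>)"
  define T where "T = (if 2 * (h - 1) \<le> k then B\<^sup>2 / XX x ^ (k - 2 * (h - 2)) else 0)"
  define E where "E = (\<Sum>i\<le>k. w i x * ((q i)\<^sup>2 + (u i)\<^sup>2))"
  have bd: "bd h True k k (XX x) q u B = B + s + T" by (simp add: bd_def s_def T_def)
  have "\<bar>F x q u\<bar> \<le> C * (B + s + T)" using C(2)[rule_format, OF ad] by (simp add: bd)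
  then have "(F x q u)\<^sup>2 \<le> (C * (B + s + T))\<^sup>2" by (metis abs_ge_zero power2_abs power_mono)
  also have "\<dots> = C\<^sup>2 * (B + s + T)\<^sup>2" by (rule power_mult_distrib)
  also have "\<dots> \<le> C\<^sup>2 * (3 * (B\<^sup>2 + s\<^sup>2 + T\<^sup>2))"
  proof (rule mult_left_mono)
   have "0 \<le> (B - s)\<^sup>2 + (s - T)\<^sup>2 + (B - T)\<^sup>2" by simp
   then show "(B + s + T)\<^sup>2 \<le> 3 * (B\<^sup>2 + s\<^sup>2 + T\<^sup>2)" by (simp add: power2_eq_square algebra_simps)
  qed simp
  finally have "w k x * (F x q u)\<^sup>2 \<le> w k x * (C\<^sup>2 * (3 * (B\<^sup>2 + s\<^sup>2 + T\<^sup>2)))" using wn by (rule mult_left_mono)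
  then have 1: "w k x * (F x q u)\<^sup>2 \<le> C\<^sup>2 * (3 * (w k x * B\<^sup>2 + w k x * s\<^sup>2 + w k x * T\<^sup>2))" by (simp add: algebra_simps)
  have b1: "w k x * B\<^sup>2 \<le> B\<^sup>2" using w_le1[OF x, of k] wn by (simp add: mult_left_le_one_le)
  have b2: "w k x * s\<^sup>2 \<le> 2 * (real k + 1) * E"
  proof -
   let ?S = "\<Sum>i\<in>{h<..k}. w k x * ((q i)\<^sup>2 + (u i)\<^sup>2)"
   have "s\<^sup>2 \<le> real (card {h<..k}) * (\<Sum>i\<in>{h<..k}. (\<bar>q i\<bar> + \<bar>u i\<bar>)\<^sup>2)"
    unfolding s_def using sum_squared_le_sum_of_squares[of "\<lambda>i. \<bar>q i\<bar> + \<bar>u i\<bar>" "{h<..k}"]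
    by (simp add: mult.commute)
   moreover have "(\<Sum>i\<in>{h<..k}. (\<bar>q i\<bar> + \<bar>u i\<bar>)\<^sup>2) \<le> (\<Sum>i\<in>{h<..k}. 2 * ((q i)\<^sup>2 + (u i)\<^sup>2))"
   proof (rule sum_mono)
    fix i
    have "0 \<le> (\<bar>q i\<bar> - \<bar>u i\<bar>)\<^sup>2" by simp
    then show "(\<bar>q i\<bar> + \<bar>u i\<bar>)\<^sup>2 \<le> 2 * ((q i)\<^sup>2 + (u i)\<^sup>2)" by (simp add: power2_eq_square algebra_simps)
   qed
   then have "real (card {h<..k}) * (\<Sum>i\<in>{h<..k}. (\<bar>q i\<bar> + \<bar>u i\<bar>)\<^sup>2)
     \<le> (real k + 1) * (\<Sum>i\<in>{h<..k}. 2 * ((q i)\<^sup>2 + (u i)\<^sup>2))"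
    by (intro mult_mono sum_nonneg) auto
   ultimately have "s\<^sup>2 \<le> (real k + 1) * (\<Sum>i\<in>{h<..k}. 2 * ((q i)\<^sup>2 + (u i)\<^sup>2))" by (rule order_trans)
   then have "w k x * s\<^sup>2 \<le> w k x * ((real k + 1) * (\<Sum>i\<in>{h<..k}. 2 * ((q i)\<^sup>2 + (u i)\<^sup>2)))"
    using wn by (rule mult_left_mono)
   moreover have "w k x * ((real k + 1) * (\<Sum>i\<in>{h<..k}. 2 * ((q i)\<^sup>2 + (u i)\<^sup>2))) = 2 * (real k + 1) * ?S"
    unfolding sum_distrib_left by (rule sum.cong[OF refl]) (simp add: algebra_simps)
   moreover have "?S \<le> (\<Sum>i\<in>{h<..k}. w i x * ((q i)\<^sup>2 + (u i)\<^sup>2))"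
    by (intro sum_mono mult_right_mono w_mono[OF x]) auto
   moreover have "(\<Sum>i\<in>{h<..k}. w i x * ((q i)\<^sup>2 + (u i)\<^sup>2)) \<le> E"
    unfolding E_def using wn by (intro sum_mono2) auto
   ultimately have "w k x * s\<^sup>2 \<le> 2 * (real k + 1) * ?S" "?S \<le> E" by simp_all
   moreover have "2 * (real k + 1) * ?S \<le> 2 * (real k + 1) * E"
    by (rule mult_left_mono[OF \<open>?S \<le> E\<close>]) simp
   ultimately show ?thesis by linarith
  qed
  have b3: "w k x * T\<^sup>2 \<le> B0\<^sup>2 * B\<^sup>2"
  proof (cases "2 * (h - 1) \<le> k")
   case True
   have "w k x * T\<^sup>2 \<le> XX x ^ k * T\<^sup>2" using w_bounds[OF x, of k] by (intro mult_right_mono) auto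
   moreover have "XX x ^ k * T\<^sup>2 = XX x ^ k / XX x ^ (2 * (k - 2 * (h - 2))) * (B\<^sup>2 * B\<^sup>2)"
    using True by (simp add: T_def power_divide power2_eq_square power_add[symmetric] mult_2)
   moreover have "XX x ^ k / XX x ^ (2 * (k - 2 * (h - 2))) \<le> 1"
    using X h True by (simp add: power_decreasing)
   then have "XX x ^ k / XX x ^ (2 * (k - 2 * (h - 2))) * (B\<^sup>2 * B\<^sup>2) \<le> 1 * (B\<^sup>2 * B\<^sup>2)"
    by (rule mult_right_mono) simp
   moreover have "B\<^sup>2 * B\<^sup>2 \<le> B0\<^sup>2 * B\<^sup>2" using a by (intro mult_right_mono power_mono) auto
   ultimately show ?thesis by linarith
  qed (simp add: T_def)
  have E0: "0 \<le> E" unfolding E_def using wn by (intro sum_nonneg mult_nonneg_nonneg) auto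
  have "3 * (w k x * B\<^sup>2 + w k x * s\<^sup>2 + w k x * T\<^sup>2) \<le> 3 * (B\<^sup>2 + 2 * (real k + 1) * E + B0\<^sup>2 * B\<^sup>2)"
   by (intro mult_left_mono add_mono b1 b2 b3) simp
  also have "\<dots> \<le> D * (B\<^sup>2 + E)"
  proof -
   have "D * (B\<^sup>2 + E) = 3 * (B\<^sup>2 + 2 * (real k + 1) * E + B0\<^sup>2 * B\<^sup>2) + 3 * (2 * (real k + 1) * B\<^sup>2 + E + B0\<^sup>2 * E)"
    by (simp add: D_def algebra_simps)
   moreover have "0 \<le> 3 * (2 * (real k + 1) * B\<^sup>2 + E + B0\<^sup>2 * E)" using E0 by simp
   ultimately show ?thesis by linarith
  qed
  finally have "C\<^sup>2 * (3 * (w k x * B\<^sup>2 + w k x * s\<^sup>2 + w k x * T\<^sup>2)) \<le> C\<^sup>2 * (D * (B\<^sup>2 + E))"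
   by (intro mult_left_mono) auto
  with 1 show ?thesis by (simp add: E_def mult.assoc)
 qed
 moreover have "0 \<le> C\<^sup>2 * D" by (simp add: D_def)
 ultimately show ?thesis by blast
qed

end

section \<open>Global solutions of Lipschitz systems of ordinary differential equations\<close>

instance bcontfun :: (metric_space, banach) banach ..

text \<open>Picard's fixed point for the rescaled unknown
  \<open>exp (- lam * t) *\<^sub>R x t\<close> in the sup norm. With \<open>lam = 2 * M + 1\<close>
  the integral operator contracts by \<open>1/2\<close> on all of \<open>[0, T]\<close> at once, so
  short solutions need not be continued.\<close>

lemma ode_global_lipschitz:
 fixes F :: "'a::banach \<Rightarrow> 'a"
 assumes L: "\<And>x y. norm (F x - F y) \<le> L * norm (x - y)" and T: "T \<ge> 0"
 shows "\<exists>x. x 0 = x0 \<and> (\<forall>t\<in>{0..T}. (x has_vector_derivative F (x t)) (at t within {0..T}))"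
proof -
 define M where "M = \<bar>L\<bar>"
 have M: "M \<ge> 0" "norm (F x - F y) \<le> M * norm (x - y)" for x y
 proof -
  have "L * norm (x - y) \<le> M * norm (x - y)" by (intro mult_right_mono) (auto simp: M_def)
  then show "norm (F x - F y) \<le> M * norm (x - y)" using L[of x y] by linarith
 qed (simp add: M_def)
 have contF: "continuous_on UNIV F"
 proof (rule continuous_on_iff[THEN iffD2], intro ballI allI impI)
  fix x :: 'a and e :: real assume e: "e > 0"
  show "\<exists>d>0. \<forall>y\<in>UNIV. dist y x < d \<longrightarrow> dist (F y) (F x) < e"
  proof (intro exI[of _ "e / (M + 1)"] conjI ballI impI)
   show "e / (M + 1) > 0" using e M(1) by simp
   fix y assume "dist y x < e / (M + 1)"
   then have "(M + 1) * norm (y - x) < e" using M(1) by (simp add: dist_norm field_simps)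
   moreover have "norm (F y - F x) \<le> (M + 1) * norm (y - x)"
    using M(2)[of y x] by (simp add: distrib_right) (meson norm_ge_zero add_increasing2)
   ultimately show "dist (F y) (F x) < e" by (simp add: dist_norm)
  qed
 qed
 define lam where "lam = 2 * M + 1"
 have lam: "lam > 0" "M / lam \<le> 1/2" using M(1) by (auto simp: lam_def field_simps)
 define h where "h z r = F (exp (lam * r) *\<^sub>R apply_bcontfun z r)" for z :: "real \<Rightarrow>\<^sub>C 'a" and r
 have hc: "continuous_on S (h z)" for S z
  unfolding h_def
  by (intro continuous_on_compose2[OF contF] continuous_intros continuous_on_apply_bcontfun) auto
 define P where "P z t = x0 + integral {0..t} (h z)" for z t
 have Pc: "continuous_on {0..T} (P z)" for z
  unfolding P_def by (intro continuous_intros indefinite_integral_continuous_1 integrable_continuous_real hc)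
 \<comment> \<open>Bounded continuous functions live on the whole line; clamping the time freezes
   their values outside \<open>[0, T]\<close>.\<close>
 define cl where "cl t = max 0 (min T t)" for t
 have cl: "cl t \<in> {0..T}" "t \<in> {0..T} \<Longrightarrow> cl t = t" for t using T by (auto simp: cl_def)
 define Q where "Q z t = exp (- lam * cl t) *\<^sub>R P z (cl t)" for z t
 have Qb: "Q z \<in> bcontfun" for z
 proof -
  let ?g = "\<lambda>s. exp (- lam * s) *\<^sub>R P z s"
  have gc: "continuous_on {0..T} ?g" by (intro continuous_intros Pc)
  have "compact (?g ` {0..T})" by (intro compact_continuous_image gc compact_Icc)
  then have "bounded (?g ` {0..T})" by (rule compact_imp_bounded)
  then obtain b where b: "\<forall>x\<in>?g ` {0..T}. norm x \<le> b" unfolding bounded_iff by (elim exE)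
  have clc: "continuous_on UNIV cl" unfolding cl_def by (intro continuous_intros)
  have "continuous_on UNIV (\<lambda>t. ?g (cl t))"
   by (rule continuous_on_compose2[OF gc clc]) (use cl in auto)
  moreover have "norm (Q z t) \<le> b" for t using b cl(1)[of t] by (auto simp: Q_def)
  ultimately show ?thesis by (intro bcontfun_normI) (auto simp: Q_def[abs_def])
 qed
 define \<Phi> where "\<Phi> z = Bcontfun (Q z)" for z
 have ap: "apply_bcontfun (\<Phi> z) t = Q z t" for z t
  unfolding \<Phi>_def using Qb by (simp add: Bcontfun_inverse)
 have contr: "dist (\<Phi> z) (\<Phi> z') \<le> 1/2 * dist z z'" for z z'
 proof (rule dist_bound)
  fix t
  define s where "s = cl t"
  have s: "s \<in> {0..T}" using cl by (simp add: s_def)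
  let ?D = "dist z z'"
  have "((\<lambda>r. M * ?D * exp (lam * r)) has_integral (M * ?D * exp (lam * s) / lam - M * ?D * exp (lam * 0) / lam)) {0..s}"
  proof (rule fundamental_theorem_of_calculus)
   show "0 \<le> s" using s by simp
   fix r
   have "((\<lambda>r. M * ?D * exp (lam * r) / lam) has_real_derivative M * ?D * exp (lam * r)) (at r within {0..s})"
    using lam by (auto intro!: derivative_eq_intros)
   then show "((\<lambda>r. M * ?D * exp (lam * r) / lam) has_vector_derivative M * ?D * exp (lam * r)) (at r within {0..s})"
    by (simp add: has_real_derivative_iff_has_vector_derivative)
  qed
  note hi = this
  have I: "(\<lambda>r. M * ?D * exp (lam * r)) integrable_on {0..s}"
   "integral {0..s} (\<lambda>r. M * ?D * exp (lam * r)) = M * ?D * exp (lam * s) / lam - M * ?D / lam"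
   using has_integral_integrable[OF hi] integral_unique[OF hi] by (simp_all only: mult_zero_right exp_zero mult_1_right)
  have "norm (integral {0..s} (\<lambda>r. h z r - h z' r)) \<le> integral {0..s} (\<lambda>r. M * ?D * exp (lam * r))"
  proof (rule integral_norm_bound_integral)
   show "(\<lambda>r. h z r - h z' r) integrable_on {0..s}"
    by (intro integrable_continuous_real continuous_intros hc)
   fix r
   have "norm (h z r - h z' r) \<le> M * norm (exp (lam * r) *\<^sub>R apply_bcontfun z r - exp (lam * r) *\<^sub>R apply_bcontfun z' r)"
    unfolding h_def by (rule M(2))
   also have "\<dots> = M * (exp (lam * r) * dist (apply_bcontfun z r) (apply_bcontfun z' r))"
    by (simp add: scaleR_diff_right[symmetric] dist_norm)
   also have "\<dots> \<le> M * (exp (lam * r) * ?D)"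
    by (rule mult_left_mono[OF mult_left_mono[OF dist_bounded]]) (use M(1) in auto)
   finally show "norm (h z r - h z' r) \<le> M * ?D * exp (lam * r)" by (simp add: mult_ac)
  qed (rule I(1))
  moreover have "P z s - P z' s = integral {0..s} (\<lambda>r. h z r - h z' r)"
   unfolding P_def by (subst integral_diff) (auto intro!: integrable_continuous_real hc)
  ultimately have "norm (P z s - P z' s) \<le> M * ?D * exp (lam * s) / lam - M * ?D / lam" using I(2) by simp
  moreover have "0 \<le> M * ?D / lam" using M(1) lam by simp
  ultimately have "norm (P z s - P z' s) \<le> M / lam * ?D * exp (lam * s)" by simp
  then have "exp (- lam * s) * norm (P z s - P z' s) \<le> exp (- lam * s) * (M / lam * ?D * exp (lam * s))"
   by (rule mult_left_mono) simp
  moreover have "exp (- lam * s) * (M / lam * ?D * exp (lam * s)) = M / lam * ?D"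
   by (simp add: exp_minus)
  moreover have "M / lam * ?D \<le> 1/2 * ?D" using lam(2) by (rule mult_right_mono) simp
  moreover have "dist (Q z t) (Q z' t) = exp (- lam * s) * norm (P z s - P z' s)"
   by (simp add: Q_def s_def dist_norm scaleR_diff_right[symmetric])
  ultimately show "dist (apply_bcontfun (\<Phi> z) t) (apply_bcontfun (\<Phi> z') t) \<le> 1/2 * ?D" unfolding ap by linarith
 qed
 have "\<exists>!z. \<Phi> z = z" by (rule banach_fix_type[of "1/2"]) (use contr in auto)
 then obtain z where z: "\<Phi> z = z" by blast
 define x where "x t = exp (lam * t) *\<^sub>R apply_bcontfun z t" for t
 have xP: "x t = P z t" if "t \<in> {0..T}" for t
  unfolding x_def using ap[of z t] z cl(2)[OF that] by (simp add: Q_def exp_minus)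
 have "x 0 = x0" using xP[of 0] T by (simp add: P_def)
 moreover have "(x has_vector_derivative F (x t)) (at t within {0..T})" if t: "t \<in> {0..T}" for t
 proof -
  have "((\<lambda>t. x0 + integral {0..t} (h z)) has_vector_derivative 0 + h z t) (at t within {0..T})"
   by (intro has_vector_derivative_add has_vector_derivative_const integral_has_vector_derivative hc t)
  then have "(P z has_vector_derivative F (x t)) (at t within {0..T})"
   by (simp add: P_def[abs_def] h_def x_def)
  then show ?thesis using xP t by (metis (no_types, lifting) has_vector_derivative_transform)
 qed
 ultimately show ?thesis by blast
qed

lemma bounded_linear_apply_bcontfun: "bounded_linear (\<lambda>s. apply_bcontfun s j)"
proof (rule bounded_linear_intro[where K = 1])
 show "norm (apply_bcontfun s j) \<le> norm s * 1" for s using norm_bounded[of s j] by simp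
qed (auto simp: plus_bcontfun.rep_eq scaleR_bcontfun.rep_eq)

text \<open>The dimension \<open>n\<close> is a number and not a type. Vectors are therefore encoded
  in one fixed Banach space, as bounded continuous functions that interpolate the components at the
  integers by the functions \<open>hat j\<close>; evaluation at the integers decodes them.\<close>

lemma ode_system:
 fixes f :: "nat \<Rightarrow> (nat \<Rightarrow> real) \<Rightarrow> real"
 assumes L: "\<And>j c c'. j < n \<Longrightarrow> \<bar>f j c - f j c'\<bar> \<le> L * (\<Sum>i<n. \<bar>c i - c' i\<bar>)" and T: "T \<ge> 0" and L0: "L \<ge> 0"
 shows "\<exists>c. (\<forall>j<n. c 0 j = cz j) \<and>
  (\<forall>j<n. \<forall>t\<in>{0..T}. ((\<lambda>t. c t j) has_real_derivative f j (c t)) (at t within {0..T}))"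
proof -
 define hat where "hat j x = max 0 (1 - \<bar>x - real j\<bar>)" for j :: nat and x :: real
 have hat: "0 \<le> hat j x" "hat j x \<le> 1" "hat j (real i) = (if i = j then 1 else 0)" for i j x
  by (auto simp: hat_def)
 define emb where "emb c = Bcontfun (\<lambda>x. \<Sum>j<n. c j * hat j x)" for c :: "nat \<Rightarrow> real"
 have ap: "apply_bcontfun (emb c) x = (\<Sum>j<n. c j * hat j x)" for c x
 proof -
  have "(\<lambda>x. \<Sum>j<n. c j * hat j x) \<in> bcontfun"
  proof (rule bcontfun_normI)
   show "continuous_on UNIV (\<lambda>x. \<Sum>j<n. c j * hat j x)" unfolding hat_def by (intro continuous_intros)
   fix x
   have "norm (\<Sum>j<n. c j * hat j x) \<le> (\<Sum>j<n. \<bar>c j\<bar> * hat j x)"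
    by (rule order_trans[OF norm_sum]) (simp add: abs_mult hat)
   also have "\<dots> \<le> (\<Sum>j<n. \<bar>c j\<bar> * 1)" by (intro sum_mono mult_left_mono hat) auto
   finally show "norm (\<Sum>j<n. c j * hat j x) \<le> (\<Sum>j<n. \<bar>c j\<bar> * 1)" .
  qed
  from Bcontfun_inverse[OF this] show ?thesis by (simp add: emb_def)
 qed
 have api: "apply_bcontfun (emb c) (real i) = c i" if "i < n" for c i
  using that by (simp add: ap hat if_distrib[of "\<lambda>x. _ * x"] cong: if_cong)
 define co where "co s i = apply_bcontfun s (real i)" for s :: "real \<Rightarrow>\<^sub>C real" and i
 define F where "F s = emb (\<lambda>j. f j (co s))" for s
 have lip: "norm (F s - F s') \<le> (n * (L * n)) * norm (s - s')" for s s'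
 proof -
  have "dist (F s) (F s') \<le> (n * (L * n)) * dist s s'"
  proof (rule dist_bound)
   fix x
   have "(\<Sum>i<n. \<bar>co s i - co s' i\<bar>) \<le> (\<Sum>i<n. dist s s')"
    unfolding co_def by (intro sum_mono) (metis dist_bounded dist_real_def)
   then have "L * (\<Sum>i<n. \<bar>co s i - co s' i\<bar>) \<le> L * (n * dist s s')"
    using L0 by (intro mult_left_mono) auto
   then have d: "\<bar>f j (co s) - f j (co s')\<bar> \<le> L * (n * dist s s')" if "j < n" for j
    using L[OF that, of "co s" "co s'"] by linarith
   have "dist (apply_bcontfun (F s) x) (apply_bcontfun (F s') x) = \<bar>\<Sum>j<n. (f j (co s) - f j (co s')) * hat j x\<bar>"
    by (simp add: F_def ap dist_real_def sum_subtractf[symmetric] left_diff_distrib)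
   also have "\<dots> \<le> (\<Sum>j<n. \<bar>f j (co s) - f j (co s')\<bar> * hat j x)"
    by (rule order_trans[OF sum_abs]) (simp add: abs_mult hat)
   also have "\<dots> \<le> (\<Sum>j<n. L * (n * dist s s') * 1)"
    by (intro sum_mono mult_mono d hat) (use L0 in auto)
   finally show "dist (apply_bcontfun (F s) x) (apply_bcontfun (F s') x) \<le> n * (L * n) * dist s s'"
    by (simp add: mult_ac)
  qed
  then show ?thesis by (simp add: dist_norm)
 qed
 have "\<exists>x. x 0 = emb cz \<and> (\<forall>t\<in>{0..T}. (x has_vector_derivative F (x t)) (at t within {0..T}))"
  by (rule ode_global_lipschitz[OF lip T])
 then obtain x where x: "x 0 = emb cz" "\<forall>t\<in>{0..T}. (x has_vector_derivative F (x t)) (at t within {0..T})" by blast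
 have "((\<lambda>t. co (x t) j) has_real_derivative f j (co (x t))) (at t within {0..T})"
  if "j < n" "t \<in> {0..T}" for j t
 proof -
  have "(x has_vector_derivative F (x t)) (at t within {0..T})" using x(2) that by blast
  from bounded_linear.has_vector_derivative[OF bounded_linear_apply_bcontfun this, of "real j"]
  show ?thesis using that by (simp add: has_real_derivative_iff_has_vector_derivative F_def api co_def[abs_def])
 qed
 then show ?thesis
  by (intro exI[of _ "\<lambda>t. co (x t)"]) (simp add: x(1) co_def api)
qed

section \<open>Galerkin approximation\<close>

definition dp :: "real poly \<Rightarrow> nat \<Rightarrow> real \<Rightarrow> real" where
 "dp p i x = poly ((pderiv ^^ i) p) x"

lemma dp_0: "dp p 0 x = poly p x"
 by (simp add: dp_def)

lemma dp_sum: "dp (\<Sum>j\<in>A. smult (c j) (f j)) i x = (\<Sum>j\<in>A. c j * dp (f j) i x)"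
 by (simp add: dp_def higher_pderiv_sum higher_pderiv_smult poly_sum)

lemma derivs_dp: "derivs (dp p)"
 unfolding derivs_def
proof (intro allI ballI)
 fix i :: nat and x :: real
 show "(dp p i has_real_derivative dp p (Suc i) x) (at x within {0..1})"
  using has_field_derivative_at_within[OF poly_DERIV[of "(pderiv ^^ i) p" x]] by (simp add: dp_def[abs_def])
qed

lemma continuous_dp [continuous_intros]: "continuous_on S (dp p i)"
 unfolding dp_def by (intro continuous_intros)

context weights
begin

definition ip :: "real poly \<Rightarrow> real poly \<Rightarrow> real" where
 "ip p q = itg (\<lambda>x. w 0 x * (poly p x * poly q x))"

lemma integrable_ip: "(\<lambda>x. w 0 x * (poly p x * poly q x)) integrable_on {0..1}"
 by (intro integrable continuous_intros)

lemma ip_commute: "ip p q = ip q p"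
 by (simp add: ip_def mult.commute)

lemma ip_add: "ip (p + r) q = ip p q + ip r q"
 unfolding ip_def poly_add distrib_right distrib_left
 by (rule integral_add[OF integrable_ip integrable_ip])

lemma ip_smult: "ip (smult c p) q = c * ip p q"
proof -
 have "ip (smult c p) q = itg (\<lambda>x. c * (w 0 x * (poly p x * poly q x)))"
  by (simp add: ip_def mult_ac)
 then show ?thesis by (simp add: ip_def)
qed

lemma ip_zero [simp]: "ip 0 q = 0"
 by (simp add: ip_def)

lemma ip_sum: "ip (\<Sum>i\<in>A. smult (c i) (f i)) q = (\<Sum>i\<in>A. c i * ip (f i) q)"
 by (induction A rule: infinite_finite_induct) (auto simp: ip_add ip_smult)

text \<open>The weight is positive inside the interval, so a polynomial of zero norm would have
  infinitely many roots.\<close>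

lemma ip_pos:
 assumes "p \<noteq> 0"
 shows "ip p p > 0"
proof -
 have nn: "\<And>x. x \<in> {0..1} \<Longrightarrow> 0 \<le> w 0 x * (poly p x * poly p x)" by (simp add: w_nonneg)
 have "ip p p \<noteq> 0"
 proof
  assume "ip p p = 0"
  moreover have c: "continuous_on {0..1} (\<lambda>x. w 0 x * (poly p x * poly p x))"
   by (intro continuous_intros)
  ultimately have z: "\<forall>x\<in>{0..1}. w 0 x * (poly p x * poly p x) = 0"
   using integral_eq_0_iff[OF c zero_less_one nn] by (simp only: ip_def)
  have "poly p x = 0" if "x \<in> {0<..<1}" for x
  proof -
   have "w 0 x * (poly p x * poly p x) = 0" using z that by simp
   moreover have "w 0 x \<noteq> 0" using that by (simp add: w_def w0_def)
   ultimately show ?thesis by simp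
  qed
  then have "{0<..<1} \<subseteq> {x. poly p x = 0}" by auto
  then have "finite {0<..<1::real}" using poly_roots_finite[OF assms] finite_subset by blast
  then show False using infinite_Ioo[of "0::real" 1] by simp
 qed
 moreover have "0 \<le> ip p p" unfolding ip_def by (intro integral_nonneg integrable_ip nn)
 ultimately show ?thesis by simp
qed

text \<open>Gram-Schmidt: the next monomial minus its projection is orthogonal to the previous
  polynomials and nonzero because its leading coefficient is \<open>1\<close>. The expansion formula
  allows a test polynomial to be replaced by basis elements.\<close>

lemma orthonormal_polys:
 "\<exists>e. (\<forall>i\<le>n. \<forall>j\<le>n. ip (e i) (e j) = (if i = j then 1 else 0)) \<and> (\<forall>i\<le>n. degree (e i) \<le> n) \<and>
   (\<forall>\<phi>. degree \<phi> \<le> n \<longrightarrow> \<phi> = (\<Sum>i\<le>n. smult (ip \<phi> (e i)) (e i)))"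
proof (induction n)
 case 0
 define c where "c = 1 / sqrt (ip [:1:] [:1:])"
 have p: "ip [:1:] [:1:] > 0" by (rule ip_pos) simp
 then have c2: "c * c * ip [:1:] [:1:] = 1" by (simp add: c_def)
 have s: "[:a:] = smult a [:1:]" for a :: real by simp
 have ipc: "ip [:a:] [:b:] = a * b * ip [:1:] [:1:]" for a b
  by (subst s[of a], subst s[of b]) (simp only: ip_smult ip_commute[of "[:1:]" "smult b [:1:]"] mult.assoc)
 have key: "\<phi> = smult (ip \<phi> [:c:]) [:c:]" if d0: "degree \<phi> = 0" for \<phi>
 proof -
  obtain a where a: "\<phi> = [:a:]" by (rule degree_eq_zeroE[OF d0])
  have "a * c * ip [:1:] [:1:] * c = a * (c * c * ip [:1:] [:1:])" by (simp only: mult_ac)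
  then have "a * c * ip [:1:] [:1:] * c = a" by (simp only: c2 mult_1_right)
  then show ?thesis using ipc[of a c] by (simp add: a)
 qed
 have one: "ip [:c:] [:c:] = 1" using c2 ipc[of c c] by simp
 show ?case
 proof (intro exI[of _ "\<lambda>_. [:c:]"] conjI allI impI)
  fix \<phi> :: "real poly" assume "degree \<phi> \<le> 0"
  then have d0: "degree \<phi> = 0" by simp
  have "(\<Sum>i\<le>(0::nat). smult (ip \<phi> [:c:]) [:c:]) = smult (ip \<phi> [:c:]) [:c:]" by simp
  from trans[OF key[OF d0] this[symmetric]] show "\<phi> = (\<Sum>i\<le>(0::nat). smult (ip \<phi> [:c:]) [:c:])" .
 qed (use one in simp_all)
next
 case (Suc n)
 then obtain e where e0: "(\<forall>i\<le>n. \<forall>j\<le>n. ip (e i) (e j) = (if i = j then 1 else 0)) \<and> (\<forall>i\<le>n. degree (e i) \<le> n) \<and>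
   (\<forall>\<phi>. degree \<phi> \<le> n \<longrightarrow> \<phi> = (\<Sum>i\<le>n. smult (ip \<phi> (e i)) (e i)))" by (elim exE)
 note e = e0[THEN conjunct1, rule_format] e0[THEN conjunct2, THEN conjunct1, rule_format] e0[THEN conjunct2, THEN conjunct2, rule_format]
 define m where "m = monom (1::real) (Suc n)"
 define pr where "pr = (\<Sum>i\<le>n. smult (ip m (e i)) (e i))"
 define r where "r = m - pr"
 have dpr: "degree pr \<le> n" unfolding pr_def by (intro degree_sum_le) (auto intro: order_trans[OF degree_smult_le] e(2))
 have lc: "coeff r (Suc n) = 1" using dpr by (simp add: r_def m_def coeff_eq_0)
 have dr: "degree r \<le> Suc n" unfolding r_def using dpr by (intro degree_diff_le) (auto simp: m_def degree_monom_eq)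
 have r0: "r \<noteq> 0" using lc by auto
 have re: "ip r (e j) = 0" if j: "j \<le> n" for j
 proof -
  have "ip pr (e j) = (\<Sum>i\<le>n. ip m (e i) * ip (e i) (e j))" unfolding pr_def by (rule ip_sum)
  also have "\<dots> = (\<Sum>i\<le>n. if i = j then ip m (e i) else 0)" using e(1) j by (intro sum.cong) auto
  also have "\<dots> = ip m (e j)" using j by simp
  finally have "ip (m + smult (-1) pr) (e j) = 0" by (simp only: ip_add ip_smult)
  then show ?thesis by (simp add: r_def)
 qed
 define \<nu> where "\<nu> = sqrt (ip r r)"
 have \<nu>: "\<nu> > 0" "\<nu> * \<nu> = ip r r" using ip_pos[OF r0] by (auto simp: \<nu>_def)
 define e' where "e' i = (if i = Suc n then smult (1 / \<nu>) r else e i)" for i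
 have 1: "ip (e' i) (e' j) = (if i = j then 1 else 0)" if "i \<le> Suc n" "j \<le> Suc n" for i j
 proof -
  have "ip (smult (1 / \<nu>) r) (smult (1 / \<nu>) r) = (1 / \<nu>) * ip (smult (1 / \<nu>) r) r"
   by (subst ip_smult) (subst ip_commute, rule refl)
  then have "ip (smult (1 / \<nu>) r) (smult (1 / \<nu>) r) = (1 / \<nu>) * ((1 / \<nu>) * ip r r)" by (simp only: ip_smult)
  then have "ip (smult (1 / \<nu>) r) (smult (1 / \<nu>) r) = 1"
   using \<nu>(1) by (simp add: \<nu>(2)[symmetric])
  moreover have "ip (smult (1 / \<nu>) r) (e k) = 0" "ip (e k) (smult (1 / \<nu>) r) = 0" if "k \<le> n" for k
   using re[OF that] by (simp_all add: ip_smult ip_commute[of "e k"])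
  ultimately show ?thesis using that e(1) by (auto simp: e'_def le_Suc_eq)
 qed
 have 2: "degree (e' i) \<le> Suc n" if "i \<le> Suc n" for i
  using that dr e(2)[of i] by (auto simp: e'_def intro: order_trans[OF degree_smult_le] le_SucI)
 have 3: "\<phi> = (\<Sum>i\<le>Suc n. smult (ip \<phi> (e' i)) (e' i))" if d: "degree \<phi> \<le> Suc n" for \<phi>
 proof -
  define a where "a = coeff \<phi> (Suc n)"
  define \<eta> where "\<eta> = \<phi> - smult a r"
  have \<phi>: "\<phi> = \<eta> + smult a r" by (simp add: \<eta>_def)
  have "degree \<eta> \<le> n"
  proof (rule degree_le, intro allI impI)
   fix i assume "n < i"
   then consider "i = Suc n" | "i > Suc n" by linarith
   then show "coeff \<eta> i = 0"
    by cases (use lc d dr in \<open>auto simp: \<eta>_def a_def coeff_eq_0\<close>)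
  qed
  then have \<eta>: "\<eta> = (\<Sum>i\<le>n. smult (ip \<eta> (e i)) (e i))" by (rule e(3))
  have i1: "ip \<phi> (e i) = ip \<eta> (e i)" if "i \<le> n" for i
   using re[OF that] by (simp add: \<phi> ip_add ip_smult)
  have "ip (\<Sum>i\<le>n. smult (ip \<eta> (e i)) (e i)) r = (\<Sum>i\<le>n. ip \<eta> (e i) * ip (e i) r)" by (rule ip_sum)
  also have "\<dots> = 0" using re by (simp add: ip_commute[of _ r])
  finally have "ip \<eta> r = 0" unfolding \<eta>[symmetric] .
  then have "ip \<phi> r = a * (\<nu> * \<nu>)" by (simp add: \<phi> ip_add ip_smult \<nu>(2))
  moreover have "ip \<phi> (e' (Suc n)) = (1 / \<nu>) * ip \<phi> r"
   using ip_commute[of \<phi> "smult (1 / \<nu>) r"] ip_commute[of r \<phi>] by (simp add: e'_def ip_smult)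
  ultimately have "ip \<phi> (e' (Suc n)) = a * \<nu>" using \<nu>(1) by simp
  then have "smult (ip \<phi> (e' (Suc n))) (e' (Suc n)) = smult a r" using \<nu>(1) by (simp add: e'_def)
  moreover have "(\<Sum>i\<le>n. smult (ip \<phi> (e' i)) (e' i)) = (\<Sum>i\<le>n. smult (ip \<eta> (e i)) (e i))"
   by (intro sum.cong) (auto simp: e'_def i1)
  ultimately show ?thesis by (simp only: sum.atMost_Suc \<eta>[symmetric] \<phi>[symmetric])
 qed
 show ?case by (intro exI[of _ e'] conjI allI impI 1 2 3)
qed

text \<open>The first \<open>n + 1\<close> entries of the coefficient vector describe
  \<open>q\<close>, the others \<open>u\<close>, and \<open>a\<close> is minus the projection of
  \<open>g\<close> along the solution, hence the time derivative of \<open>u\<close>. The global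
  Lipschitz assumption is to be met by a truncation of \<open>G\<close>.\<close>

lemma galerkin_exists:
 fixes g :: "jet \<Rightarrow> real"
 assumes gc: "continuous_on ({0..1} \<times> UNIV) g"
  and gl: "\<And>x q u q' u'. x \<in> {0..1} \<Longrightarrow> \<bar>g (jet x q u) - g (jet x q' u')\<bar>
    \<le> Lg * jdist q u q' u'"
  and Lg: "Lg \<ge> 0" and T: "T \<ge> 0" and deg: "degree q0 \<le> n" "degree u0 \<le> n"
 shows "\<exists>q u a. q 0 = q0 \<and> u 0 = u0 \<and>
  (\<forall>t. degree (q t) \<le> n \<and> degree (u t) \<le> n \<and> degree (a t) \<le> n) \<and>
  (\<forall>i x. \<forall>t\<in>{0..T}. ((\<lambda>t. dp (q t) i x) has_real_derivative dp (u t) i x) (at t within {0..T}) \<and>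
    ((\<lambda>t. dp (u t) i x) has_real_derivative dp (a t) i x) (at t within {0..T})) \<and>
  (\<forall>i. continuous_on ({0..T} \<times> {0..1}) (\<lambda>(t, x). dp (q t) i x) \<and> continuous_on ({0..T} \<times> {0..1}) (\<lambda>(t, x). dp (u t) i x)
    \<and> continuous_on ({0..T} \<times> {0..1}) (\<lambda>(t, x). dp (a t) i x)) \<and>
  (\<forall>t\<in>{0..T}. \<forall>\<phi>. degree \<phi> \<le> n \<longrightarrow>
    itg (\<lambda>x. w 0 x * ((dp (a t) 0 x + g (jet x (\<lambda>i. dp (q t) i x) (\<lambda>i. dp (u t) i x))) * poly \<phi> x)) = 0)"
proof -
 obtain e where e0: "(\<forall>i\<le>n. \<forall>j\<le>n. ip (e i) (e j) = (if i = j then 1 else 0)) \<and> (\<forall>i\<le>n. degree (e i) \<le> n) \<and>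
   (\<forall>\<phi>. degree \<phi> \<le> n \<longrightarrow> \<phi> = (\<Sum>i\<le>n. smult (ip \<phi> (e i)) (e i)))" using orthonormal_polys[of n] by (elim exE)
 note e = e0[THEN conjunct1, rule_format] e0[THEN conjunct2, THEN conjunct1, rule_format] e0[THEN conjunct2, THEN conjunct2, rule_format]
 define N where "N = Suc n + Suc n"
 define Qc where "Qc c = (\<Sum>i\<le>n. smult (c i) (e i))" for c :: "nat \<Rightarrow> real"
 define Uc where "Uc c = (\<Sum>i\<le>n. smult (c (Suc n + i)) (e i))" for c :: "nat \<Rightarrow> real"
 define J where "J c x = jet x (\<lambda>i. dp (Qc c) i x) (\<lambda>i. dp (Uc c) i x)" for c x
 define ac where "ac c i = - itg (\<lambda>x. w 0 x * (g (J c x) * poly (e i) x))" for c i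
 define f where "f j c = (if j \<le> n then c (Suc n + j) else ac c (j - Suc n))" for j c
 have Jc: "continuous_on {0..1} (J c)" for c unfolding J_def jet_def by (intro continuous_intros)
 have gJ [continuous_intros]: "continuous_on {0..1} (\<lambda>x. g (J c x))" for c
  by (rule continuous_on_compose2[OF gc Jc]) (auto simp: J_def jet_def)
 have "\<exists>M\<ge>0. \<forall>x\<in>{0..1}. \<bar>dp (e i) k x\<bar> \<le> M" for i k
 proof -
  have "compact (dp (e i) k ` {0..1})" by (intro compact_continuous_image continuous_dp compact_Icc)
  then have "bounded (dp (e i) k ` {0..1})" by (rule compact_imp_bounded)
  then obtain b where "\<forall>y\<in>dp (e i) k ` {0..1}. \<bar>y\<bar> \<le> b" unfolding bounded_iff real_norm_def by (elim exE)
  then have "\<forall>x\<in>{0..1}. \<bar>dp (e i) k x\<bar> \<le> max 0 b" by auto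
  then show ?thesis by (intro exI[of _ "max 0 b"]) simp
 qed
 then have "\<forall>i k. \<exists>M. M \<ge> 0 \<and> (\<forall>x\<in>{0..1}. \<bar>dp (e i) k x\<bar> \<le> M)" by blast
 then obtain MM where m: "\<forall>i k. MM i k \<ge> 0 \<and> (\<forall>x\<in>{0..1}. \<bar>dp (e i) k x\<bar> \<le> MM i k)"
  unfolding choice_iff by (elim exE)
 have MM: "MM i k \<ge> 0" "x \<in> {0..1} \<Longrightarrow> \<bar>dp (e i) k x\<bar> \<le> MM i k" for i k x using m by auto
 define M where "M = (\<Sum>i\<le>n. \<Sum>k\<le>2. MM i k)"
 have M0: "M \<ge> 0" unfolding M_def using MM(1) by (intro sum_nonneg) auto
 have M: "\<bar>dp (e i) k x\<bar> \<le> M" if "i \<le> n" "k \<le> 2" "x \<in> {0..1}" for i k x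
 proof -
  have "MM i k \<le> (\<Sum>k\<le>2. MM i k)" using that MM(1) by (intro member_le_sum) auto
  also have "\<dots> \<le> M" unfolding M_def using that MM(1) by (intro member_le_sum[of i "{..n}" "\<lambda>i. \<Sum>k\<le>2. MM i k"] sum_nonneg) auto
  finally show ?thesis using MM(2)[OF that(3), of i k] by linarith
 qed
 define D where "D c c' = (\<Sum>i<N. \<bar>c i - c' i\<bar>)" for c c' :: "nat \<Rightarrow> real"
 have D0: "0 \<le> D c c'" for c c' unfolding D_def by (intro sum_nonneg) auto
 have sub: "(\<Sum>i\<le>n. \<bar>c i - c' i\<bar>) \<le> D c c'" "(\<Sum>i\<le>n. \<bar>c (Suc n + i) - c' (Suc n + i)\<bar>) \<le> D c c'" for c c'
 proof -
  show "(\<Sum>i\<le>n. \<bar>c i - c' i\<bar>) \<le> D c c'" unfolding D_def by (intro sum_mono2) (auto simp: N_def)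
  have "(\<Sum>i\<le>n. \<bar>c (Suc n + i) - c' (Suc n + i)\<bar>) = (\<Sum>j\<in>(\<lambda>i. Suc n + i) ` {..n}. \<bar>c j - c' j\<bar>)"
   by (subst sum.reindex) (auto simp: inj_on_def)
  also have "\<dots> \<le> D c c'" unfolding D_def by (intro sum_mono2) (auto simp: N_def)
  finally show "(\<Sum>i\<le>n. \<bar>c (Suc n + i) - c' (Suc n + i)\<bar>) \<le> D c c'" .
 qed
 have dl: "\<bar>dp (Qc c) k x - dp (Qc c') k x\<bar> \<le> M * D c c'" "\<bar>dp (Uc c) k x - dp (Uc c') k x\<bar> \<le> M * D c c'"
  if k: "k \<le> 2" and x: "x \<in> {0..1}" for c c' k x
 proof -
  have gen: "\<bar>(\<Sum>i\<le>n. b i * dp (e i) k x) - (\<Sum>i\<le>n. b' i * dp (e i) k x)\<bar> \<le> M * (\<Sum>i\<le>n. \<bar>b i - b' i\<bar>)" for b b' :: "nat \<Rightarrow> real"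
  proof -
   have "(\<Sum>i\<le>n. b i * dp (e i) k x) - (\<Sum>i\<le>n. b' i * dp (e i) k x) = (\<Sum>i\<le>n. (b i - b' i) * dp (e i) k x)"
    by (simp add: sum_subtractf left_diff_distrib)
   also have "\<bar>\<dots>\<bar> \<le> (\<Sum>i\<le>n. \<bar>b i - b' i\<bar> * \<bar>dp (e i) k x\<bar>)"
    by (rule order_trans[OF sum_abs]) (simp add: abs_mult)
   also have "\<dots> \<le> (\<Sum>i\<le>n. \<bar>b i - b' i\<bar> * M)" by (intro sum_mono mult_left_mono M k x) auto
   finally show ?thesis by (simp add: sum_distrib_left mult.commute)
  qed
  show "\<bar>dp (Qc c) k x - dp (Qc c') k x\<bar> \<le> M * D c c'"
   unfolding Qc_def dp_sum by (rule order_trans[OF gen mult_left_mono[OF sub(1) M0]])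
  show "\<bar>dp (Uc c) k x - dp (Uc c') k x\<bar> \<le> M * D c c'"
   unfolding Uc_def dp_sum by (rule order_trans[OF gen mult_left_mono[OF sub(2) M0]])
 qed
 \<comment> \<open>The summand \<open>1\<close> serves the components \<open>q_t = u\<close>. In the
   other one, \<open>5 * M\<close> stems from the five jet components and the last \<open>M\<close>
   from the test polynomial.\<close>
 define LL where "LL = 1 + Lg * (5 * M) * M"
 have LL: "LL \<ge> 0" "LL \<ge> 1" using Lg M0 by (auto simp: LL_def)
 have flip: "\<bar>f j c - f j c'\<bar> \<le> LL * D c c'" if j: "j < N" for j c c'
 proof (cases "j \<le> n")
  case True
  have "\<bar>c (Suc n + j) - c' (Suc n + j)\<bar> \<le> D c c'"
   unfolding D_def using True by (intro member_le_sum[of "Suc n + j" "{..<N}" "\<lambda>i. \<bar>c i - c' i\<bar>"]) (auto simp: N_def)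
  also have "\<dots> \<le> LL * D c c'" using mult_right_mono[OF LL(2) D0[of c c']] by simp
  finally show ?thesis using True by (simp add: f_def)
 next
  case False
  define i where "i = j - Suc n"
  have i: "i \<le> n" using j False by (auto simp: i_def N_def)
  let ?h = "\<lambda>x. w 0 x * (g (J c' x) * poly (e i) x) - w 0 x * (g (J c x) * poly (e i) x)"
  have hc: "continuous_on {0..1} ?h" by (intro continuous_intros)
  have "f j c - f j c' = itg ?h"
   using False by (subst integral_diff) (auto simp: f_def ac_def i_def intro!: integrable continuous_intros)
  moreover have "norm (itg ?h) \<le> (Lg * (5 * M) * M * D c c') * (1 - 0)"
  proof (rule integral_bound[OF _ hc])
   fix x :: real assume x: "x \<in> {0..1}"
   have "\<bar>g (J c' x) - g (J c x)\<bar> \<le> Lg * (M * D c' c + M * D c' c + M * D c' c + M * D c' c + M * D c' c)"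
    unfolding J_def
    by (rule order_trans[OF gl[OF x] mult_left_mono[OF add_mono[OF add_mono[OF add_mono[OF add_mono]]] Lg]])
     (auto intro!: dl x)
   also have "\<dots> = Lg * (5 * M) * D c c'" by (simp add: D_def abs_minus_commute)
   finally have 1: "\<bar>g (J c' x) - g (J c x)\<bar> \<le> Lg * (5 * M) * D c c'" .
   have 2: "\<bar>poly (e i) x\<bar> \<le> M" using M[OF i _ x, of 0] by (simp add: dp_0)
   have "?h x = w 0 x * ((g (J c' x) - g (J c x)) * poly (e i) x)" by (simp add: algebra_simps)
   then have "norm (?h x) = w 0 x * (\<bar>g (J c' x) - g (J c x)\<bar> * \<bar>poly (e i) x\<bar>)"
    using w_nonneg[OF x, of 0] by (simp add: abs_mult)
   also have "\<dots> \<le> 1 * ((Lg * (5 * M) * D c c') * M)"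
    using 1 2 w_le1[OF x, of 0] w_nonneg[OF x, of 0] M0 D0[of c c'] Lg by (intro mult_mono) auto
   finally show "norm (?h x) \<le> Lg * (5 * M) * M * D c c'" by (simp add: mult_ac)
  qed simp
  ultimately have "\<bar>f j c - f j c'\<bar> \<le> Lg * (5 * M) * M * D c c'" by simp
  also have "\<dots> \<le> LL * D c c'" using D0[of c c'] by (intro mult_right_mono) (auto simp: LL_def)
  finally show ?thesis .
 qed
 define c0 where "c0 j = (if j \<le> n then ip q0 (e j) else ip u0 (e (j - Suc n)))" for j
 have "\<exists>c. (\<forall>j<N. c 0 j = c0 j) \<and>
  (\<forall>j<N. \<forall>t\<in>{0..T}. ((\<lambda>t. c t j) has_real_derivative f j (c t)) (at t within {0..T}))"
  by (rule ode_system[OF flip[unfolded D_def] T LL(1)])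
 then obtain c where c': "\<forall>j<N. c 0 j = c0 j"
  "\<forall>j<N. \<forall>t\<in>{0..T}. ((\<lambda>t. c t j) has_real_derivative f j (c t)) (at t within {0..T})" by (elim exE conjE)
 note c = c'[rule_format]
 define q where "q t = Qc (c t)" for t
 define u where "u t = Uc (c t)" for t
 define a where "a t = (\<Sum>i\<le>n. smult (ac (c t) i) (e i))" for t
 have cc: "continuous_on {0..T} (\<lambda>t. c t j)" if "j < N" for j
  by (rule DERIV_continuous_on[OF c(2)[OF that]])
 \<comment> \<open>Continuity of the acceleration in time, from the Lipschitz bound for its
   coefficients; it makes differentiation under the energy integrals possible.\<close>
 have accont: "continuous_on {0..T} (\<lambda>t. ac (c t) i)" if i: "i \<le> n" for i
 proof -
  have jN: "Suc n + i < N" using i by (simp add: N_def)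
  have fe: "f (Suc n + i) = (\<lambda>c. ac c i)" by (auto simp: f_def)
  have "((\<lambda>s. ac (c s) i) \<longlongrightarrow> ac (c t) i) (at t within {0..T})" if t: "t \<in> {0..T}" for t
  proof -
   have "((\<lambda>s. LL * D (c s) (c t)) \<longlongrightarrow> LL * (\<Sum>i<N. \<bar>c t i - c t i\<bar>)) (at t within {0..T})"
    unfolding D_def using cc t by (intro tendsto_intros) (auto simp: continuous_on_def)
   then have "((\<lambda>s. LL * D (c s) (c t)) \<longlongrightarrow> 0) (at t within {0..T})" by simp
   then have "((\<lambda>s. ac (c s) i - ac (c t) i) \<longlongrightarrow> 0) (at t within {0..T})"
    by (rule Lim_null_comparison[rotated]) (use flip[OF jN, unfolded fe] in \<open>auto intro!: always_eventually\<close>)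
   then show ?thesis by (simp add: LIM_zero_iff)
  qed
  then show ?thesis by (simp add: continuous_on_def)
 qed
 have fst_c: "continuous_on ({0..T} \<times> {0..1::real}) (\<lambda>p. h (fst p))" if "continuous_on {0..T} h" for h :: "real \<Rightarrow> real"
  by (rule continuous_on_compose2[OF that]) (auto intro!: continuous_intros)
 have snd_c: "continuous_on ({0..T} \<times> {0..1::real}) (\<lambda>p. dp r i (snd p))" for r i
  by (rule continuous_on_compose2[OF continuous_dp[of UNIV]]) (auto intro!: continuous_intros)
 have dq: "dp (q t) i x = (\<Sum>j\<le>n. c t j * dp (e j) i x)" "dp (u t) i x = (\<Sum>j\<le>n. c t (Suc n + j) * dp (e j) i x)"
  "dp (a t) i x = (\<Sum>j\<le>n. ac (c t) j * dp (e j) i x)" for t i x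
  by (simp_all add: q_def Qc_def u_def Uc_def a_def dp_sum)
 have N1: "j < N" "Suc n + j < N" if "j \<le> n" for j using that by (auto simp: N_def)
 have 1: "q 0 = q0" "u 0 = u0"
 proof -
  have "q 0 = (\<Sum>i\<le>n. smult (ip q0 (e i)) (e i))"
   unfolding q_def Qc_def using c(1) N1 by (intro sum.cong) (auto simp: c0_def)
  then show "q 0 = q0" unfolding e(3)[OF deg(1), symmetric] .
  have "u 0 = (\<Sum>i\<le>n. smult (ip u0 (e i)) (e i))"
   unfolding u_def Uc_def using c(1) N1 by (intro sum.cong) (auto simp: c0_def)
  then show "u 0 = u0" unfolding e(3)[OF deg(2), symmetric] .
 qed
 have 2: "degree (q t) \<le> n" "degree (u t) \<le> n" "degree (a t) \<le> n" for t
 proof -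
  have dg: "degree (\<Sum>i\<le>n. smult (b i) (e i)) \<le> n" for b
   by (rule degree_sum_le) (auto intro: order_trans[OF degree_smult_le] e(2))
  show "degree (q t) \<le> n" "degree (u t) \<le> n" "degree (a t) \<le> n"
   unfolding q_def Qc_def u_def Uc_def a_def by (rule dg)+
 qed
 have 3: "((\<lambda>t. dp (q t) i x) has_real_derivative dp (u t) i x) (at t within {0..T})"
  "((\<lambda>t. dp (u t) i x) has_real_derivative dp (a t) i x) (at t within {0..T})" if t: "t \<in> {0..T}" for i x t
 proof -
  show "((\<lambda>t. dp (q t) i x) has_real_derivative dp (u t) i x) (at t within {0..T})"
   unfolding dq
  proof (intro DERIV_sum)
   fix j assume "j \<in> {..n}"
   then show "((\<lambda>t. c t j * dp (e j) i x) has_real_derivative c t (Suc n + j) * dp (e j) i x) (at t within {0..T})"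
    using c(2)[OF N1(1) t, of j] by (intro DERIV_cmult_right) (simp add: f_def)
  qed
  show "((\<lambda>t. dp (u t) i x) has_real_derivative dp (a t) i x) (at t within {0..T})"
   unfolding dq
  proof (intro DERIV_sum)
   fix j assume "j \<in> {..n}"
   then show "((\<lambda>t. c t (Suc n + j) * dp (e j) i x) has_real_derivative ac (c t) j * dp (e j) i x) (at t within {0..T})"
    using c(2)[OF N1(2) t, of j] by (intro DERIV_cmult_right) (simp add: f_def)
  qed
 qed
 have 4: "continuous_on ({0..T} \<times> {0..1}) (\<lambda>(t, x). dp (q t) i x)" "continuous_on ({0..T} \<times> {0..1}) (\<lambda>(t, x). dp (u t) i x)"
    "continuous_on ({0..T} \<times> {0..1}) (\<lambda>(t, x). dp (a t) i x)" for i
 proof -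
  have mm: "continuous_on ({0..T} \<times> {0..1}) (\<lambda>p. \<Sum>j\<le>n. b (fst p) j * dp (e j) i (snd p))"
   if "\<And>j. j \<le> n \<Longrightarrow> continuous_on {0..T} (\<lambda>t. b t j)" for b :: "real \<Rightarrow> nat \<Rightarrow> real"
   by (rule continuous_on_sum, rule continuous_on_mult[OF fst_c[OF that] snd_c]) simp
  show "continuous_on ({0..T} \<times> {0..1}) (\<lambda>(t, x). dp (q t) i x)"
   unfolding dq case_prod_beta by (rule mm[OF cc[OF N1(1)]])
  show "continuous_on ({0..T} \<times> {0..1}) (\<lambda>(t, x). dp (u t) i x)"
   unfolding dq case_prod_beta by (rule mm[of "\<lambda>t j. c t (Suc n + j)", OF cc[OF N1(2)]])
  show "continuous_on ({0..T} \<times> {0..1}) (\<lambda>(t, x). dp (a t) i x)"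
   unfolding dq case_prod_beta by (rule mm[of "\<lambda>t j. ac (c t) j", OF accont])
 qed
 have 5: "itg (\<lambda>x. w 0 x * ((dp (a t) 0 x + g (jet x (\<lambda>i. dp (q t) i x) (\<lambda>i. dp (u t) i x))) * poly \<phi> x)) = 0"
  if d: "degree \<phi> \<le> n" for t \<phi>
 proof -
  have gjc: "continuous_on {0..1} (\<lambda>x. g (J (c t) x))" by (rule gJ)
  have b: "itg (\<lambda>x. w 0 x * (g (J (c t) x) * poly (\<Sum>j\<in>A. smult (b j) (e j)) x))
    = (\<Sum>j\<in>A. b j * (- ac (c t) j))" for A b
  proof (induction A rule: infinite_finite_induct)
   case (insert j A)
   let ?p = "\<Sum>j\<in>A. smult (b j) (e j)"
   have i1: "(\<lambda>x. b j * (w 0 x * (g (J (c t) x) * poly (e j) x))) integrable_on {0..1}"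
    "(\<lambda>x. w 0 x * (g (J (c t) x) * poly ?p x)) integrable_on {0..1}"
    by (intro integrable continuous_intros gjc)+
   have "poly (\<Sum>j\<in>insert j A. smult (b j) (e j)) x = b j * poly (e j) x + poly ?p x" for x
    by (simp only: sum.insert[OF insert.hyps] poly_add poly_smult)
   then have "w 0 x * (g (J (c t) x) * poly (\<Sum>j\<in>insert j A. smult (b j) (e j)) x)
    = b j * (w 0 x * (g (J (c t) x) * poly (e j) x)) + w 0 x * (g (J (c t) x) * poly ?p x)" for x
    by (simp only:) (simp add: algebra_simps)
   then have "itg (\<lambda>x. w 0 x * (g (J (c t) x) * poly (\<Sum>j\<in>insert j A. smult (b j) (e j)) x))
    = itg (\<lambda>x. b j * (w 0 x * (g (J (c t) x) * poly (e j) x))) + itg (\<lambda>x. w 0 x * (g (J (c t) x) * poly ?p x))"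
    by (simp only: integral_add[OF i1])
   moreover have "itg (\<lambda>x. b j * (w 0 x * (g (J (c t) x) * poly (e j) x))) = b j * (- ac (c t) j)"
    by (simp add: ac_def)
   ultimately show ?case by (simp only: insert.IH sum.insert[OF insert.hyps])
  next
   case (infinite A) then show ?case by simp
  next
   case empty then show ?case by simp
  qed
  have "ip (a t) \<phi> = (\<Sum>j\<le>n. ac (c t) j * ip (e j) \<phi>)" unfolding a_def by (rule ip_sum)
  moreover have "itg (\<lambda>x. w 0 x * (g (J (c t) x) * poly \<phi> x)) = (\<Sum>j\<le>n. ip \<phi> (e j) * (- ac (c t) j))"
   using b[where A = "{..n}" and b = "\<lambda>j. ip \<phi> (e j)"] unfolding e(3)[OF d, symmetric] .
  moreover have "itg (\<lambda>x. w 0 x * ((dp (a t) 0 x + g (J (c t) x)) * poly \<phi> x))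
    = ip (a t) \<phi> + itg (\<lambda>x. w 0 x * (g (J (c t) x) * poly \<phi> x))"
   unfolding ip_def dp_0 distrib_right distrib_left
   by (rule integral_add) (intro integrable continuous_intros gjc)+
  ultimately show ?thesis
   by (simp add: J_def q_def u_def sum_negf[symmetric] ip_commute[of \<phi>] sum.distrib[symmetric] mult.commute)
 qed
 show ?thesis
  by (rule exI[of _ q], rule exI[of _ u], rule exI[of _ a]) (intro conjI allI ballI impI 1 2 3 4 5)
qed

end

section \<open>Energy estimates\<close>

text \<open>Many pointwise estimates divide by powers of \<open>XX\<close> and hold in the open
  interval only; continuity carries them to the ends.\<close>

lemma integral_le_Ioo:
 fixes f g :: "real \<Rightarrow> real"
 assumes c: "continuous_on {0..1} f" "continuous_on {0..1} g" and le: "\<And>x. 0 < x \<Longrightarrow> x < 1 \<Longrightarrow> f x \<le> g x"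
 shows "itg f \<le> itg g"
proof (rule integral_le)
 have cl: "closure {0<..<1::real} = {0..1}" by simp
 have "0 \<le> g x - f x" if "x \<in> {0..1}" for x
 proof (rule continuous_ge_on_closure[of "{0<..<1}" "\<lambda>x. g x - f x"])
  show "continuous_on (closure {0<..<1}) (\<lambda>x. g x - f x)" unfolding cl by (intro continuous_intros c)
  show "x \<in> closure {0<..<1}" using that cl by simp
 qed (use le in auto)
 then show "\<And>x. x \<in> {0..1} \<Longrightarrow> f x \<le> g x" by force
qed (auto intro: integrable_continuous_real c)

text \<open>The conditions on \<open>pd e3 G\<close> and \<open>pd e2 G\<close> mean that the
  linearised spatial operator is \<open>- (1 / w 0) * (XX * w 0 * A * q')'\<close>, symmetric for
  the weight \<open>w 0\<close>, up to first-order terms with a factor \<open>XX\<close>. That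
  factor keeps these terms within the energy, in which the top derivative of \<open>q\<close>
  carries \<open>XX\<close> as well.\<close>

locale wave = weights al be for al be :: real +
 fixes S :: "jet set" and G A b c :: "jet \<Rightarrow> real" and \<rho> :: real
 assumes S: "open S" and smG: "smooth S G" and smA: "smooth S A" and smb: "smooth S b" and smc: "smooth S c"
  and G0: "\<forall>x. (x, 0) \<in> S \<longrightarrow> G (x, 0) = 0" and A_pos: "\<And>p. p \<in> S \<Longrightarrow> A p > 0"
  and G_q2: "\<And>p. p \<in> S \<Longrightarrow> pd e3 G p = - (XX (px p) * A p)"
  and G_u1: "\<And>p. p \<in> S \<Longrightarrow> pd e5 G p = XX (px p) * b p"
  and G_q1: "\<And>p. p \<in> S \<Longrightarrow> pd e2 G p = - (d 0 (px p) * A p) + XX (px p) * c p"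
  and \<rho>: "\<rho> > 0" "jbox \<rho> \<subseteq> S"
begin

text \<open>Chosen once, so that all estimates refer to the same derivatives \<open>Fs k\<close> and
  remainders \<open>Rs k\<close>.\<close>

definition FR where "FR = (SOME p. deriv_chain S True G (fst p) (snd p))"
definition Fs where "Fs = fst FR"
definition Rs where "Rs = snd FR"

lemma Fs: "mon S True k (k + 2) (Fs k)" "tder S (Fs k) (Fs (Suc k))" "Fs 0 = (\<lambda>x q u. G (jet x q u))"
 and Rs: "3 \<le> k \<Longrightarrow> mon S True k k (Rs k)" "3 \<le> k \<Longrightarrow> Fs k x q u = lead G k x q u + Rs k x q u"
proof -
 obtain F R where "deriv_chain S True G F R" using leading_terms[OF S smG G0, of True] by (elim exE)
 then have "deriv_chain S True G (fst (F, R)) (snd (F, R))" unfolding fst_conv snd_conv .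
 note f = someI[of "\<lambda>p. deriv_chain S True G (fst p) (snd p)", OF this, folded FR_def, folded Fs_def Rs_def]
 show "mon S True k (k + 2) (Fs k)" "tder S (Fs k) (Fs (Suc k))" "Fs 0 = (\<lambda>x q u. G (jet x q u))"
  using f by blast+
 show "3 \<le> k \<Longrightarrow> mon S True k k (Rs k)" using f by blast
 show "3 \<le> k \<Longrightarrow> Fs k x q u = lead G k x q u + Rs k x q u" using f by metis
qed

abbreviation "jt qq uu x \<equiv> jet x (\<lambda>i. dp qq i x) (\<lambda>i. dp uu i x)"
abbreviation "at_poly F qq uu x \<equiv> F x (\<lambda>i. dp qq i x) (\<lambda>i. dp uu i x)"

text \<open>The state of a Galerkin solution at one instant, with \<open>aa\<close> in the place of
  the time derivative of \<open>uu\<close>. The spatial estimates use nothing else, so time does not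
  appear in them.\<close>

definition slice :: "nat \<Rightarrow> real poly \<Rightarrow> real poly \<Rightarrow> real poly \<Rightarrow> bool" where
 "slice n qq uu aa \<longleftrightarrow> degree qq \<le> n \<and> degree uu \<le> n \<and> degree aa \<le> n \<and> (\<forall>x\<in>{0..1}. jt qq uu x \<in> jbox \<rho>) \<and>
  (\<forall>\<phi>. degree \<phi> \<le> n \<longrightarrow> itg (\<lambda>x. w 0 x * ((dp aa 0 x + G (jt qq uu x)) * poly \<phi> x)) = 0)"

lemma tder_slice:
 assumes "\<forall>x\<in>{0..1}. jt qq uu x \<in> jbox \<rho>" "tder S F F'" "x \<in> {0..1}"
 shows "((\<lambda>x. at_poly F qq uu x) has_real_derivative at_poly F' qq uu x) (at x within {0..1})"
 using tderD[OF assms(2) derivs_dp derivs_dp assms(3)] assms(1,3) \<rho>(2) by blast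

lemma cont_slice:
 assumes "\<forall>x\<in>{0..1}. jt qq uu x \<in> jbox \<rho>" "tder S F F'"
 shows "continuous_on {0..1} (\<lambda>x. at_poly F qq uu x)"
 by (rule DERIV_continuous_on[OF tder_slice[OF assms]])

lemma cont_smooth_slice:
 assumes "\<forall>x\<in>{0..1}. jt qq uu x \<in> jbox \<rho>" "smooth S \<Phi>"
 shows "continuous_on {0..1} (\<lambda>x. \<Phi> (jt qq uu x))"
 using cont_slice[OF assms(1) tder_base[OF S assms(2)]] .

text \<open>Integration by parts turns a test function \<open>\<phi>\<close> at level
  \<open>i + 1\<close> into \<open>- (d i * \<phi> + XX * \<phi>')\<close> at level
  \<open>i\<close>, of degree at most one higher. Hence the projected equation, known for test
  functions of degree at most \<open>n\<close>, holds for the \<open>i\<close>-th derivative with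
  degrees up to \<open>n - i\<close>.\<close>

lemma weak_level:
 assumes s: "slice n qq uu aa"
 shows "degree \<phi> + i \<le> n \<Longrightarrow> itg (\<lambda>x. w i x * ((dp aa i x + at_poly (Fs i) qq uu x) * poly \<phi> x)) = 0"
proof (induction i arbitrary: \<phi>)
 case 0
 then show ?case using s by (simp add: slice_def Fs(3))
next
 case (Suc i)
 have jb: "\<forall>x\<in>{0..1}. jt qq uu x \<in> jbox \<rho>" using s by (simp add: slice_def)
 define g0 where "g0 x = dp aa i x + at_poly (Fs i) qq uu x" for x
 define g1 where "g1 x = dp aa (Suc i) x + at_poly (Fs (Suc i)) qq uu x" for x
 have g0: "(g0 has_real_derivative g1 x) (at x within {0..1})" if x: "x \<in> {0..1}" for x
  unfolding g0_def g1_def by (rule DERIV_add[OF derivsD[OF derivs_dp x] tder_slice[OF jb Fs(2) x]])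
 have c: "continuous_on {0..1} g0" "continuous_on {0..1} g1"
 proof -
  show "continuous_on {0..1} g0" by (rule DERIV_continuous_on[OF g0])
  show "continuous_on {0..1} g1" unfolding g1_def
   by (intro continuous_on_add continuous_dp cont_slice[OF jb Fs(2)])
 qed
 have f: "((\<lambda>x. g0 x * poly \<phi> x) has_real_derivative g1 x * poly \<phi> x + poly (pderiv \<phi>) x * g0 x) (at x within {0..1})"
  if x: "x \<in> {0..1}" for x
  by (rule DERIV_mult[OF g0[OF x] has_field_derivative_at_within[OF poly_DERIV]])
 define dpol where "dpol = [: al + 1 + i, - (al + 1 + i) - (be + 1 + i) :]"
 define Xp where "Xp = [: 0, 1, -1 :: real :]"
 define \<psi> where "\<psi> = dpol * \<phi> + Xp * pderiv \<phi>"
 have pd: "poly dpol x = d i x" "poly Xp x = XX x" for x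
  by (simp_all add: dpol_def Xp_def d_def XX_def algebra_simps)
 have "degree \<psi> \<le> Suc (degree \<phi>)"
  unfolding \<psi>_def
 proof (rule degree_add_le)
  show "degree (dpol * \<phi>) \<le> Suc (degree \<phi>)"
   using degree_mult_le[of dpol \<phi>] by (simp add: dpol_def split: if_splits)
  have "degree Xp \<le> 2" by (simp add: Xp_def)
  show "degree (Xp * pderiv \<phi>) \<le> Suc (degree \<phi>)"
  proof (cases "degree \<phi> = 0")
   case True
   then have "pderiv \<phi> = 0" by (simp add: pderiv_eq_0_iff)
   then show ?thesis by simp
  next
   case False
   then show ?thesis using degree_mult_le[of Xp "pderiv \<phi>"] \<open>degree Xp \<le> 2\<close> by (simp add: degree_pderiv)
  qed
 qed
 then have z: "itg (\<lambda>x. w i x * (g0 x * poly \<psi> x)) = 0"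
  unfolding g0_def using Suc.prems by (intro Suc.IH) simp
 have "itg (\<lambda>x. w i x * (d i x * (g0 x * poly \<phi> x) + XX x * (g1 x * poly \<phi> x + poly (pderiv \<phi>) x * g0 x))) = 0"
  by (rule by_parts[OF f])
 moreover have "w i x * (d i x * (g0 x * poly \<phi> x) + XX x * (g1 x * poly \<phi> x + poly (pderiv \<phi>) x * g0 x))
   = w i x * (g0 x * poly \<psi> x) + w (Suc i) x * (g1 x * poly \<phi> x)" for x
  by (simp add: \<psi>_def pd w_Suc algebra_simps)
 ultimately have "itg (\<lambda>x. w i x * (g0 x * poly \<psi> x) + w (Suc i) x * (g1 x * poly \<phi> x)) = 0" by simp
 moreover have "(\<lambda>x. w i x * (g0 x * poly \<psi> x)) integrable_on {0..1}" "(\<lambda>x. w (Suc i) x * (g1 x * poly \<phi> x)) integrable_on {0..1}"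
  by (intro integrable continuous_intros c)+
 ultimately have "itg (\<lambda>x. w (Suc i) x * (g1 x * poly \<phi> x)) = 0" using z by (simp add: integral_add)
 then show ?case by (simp add: g1_def)
qed

text \<open>The \<open>i\<close>-th derivative of a polynomial of degree at most \<open>n\<close> is
  either zero or has lost exactly the \<open>i\<close> degrees that \<open>weak_level\<close>
  demands.\<close>

lemma weak_test:
 assumes s: "slice n qq uu aa" and r: "degree r \<le> n"
 shows "itg (\<lambda>x. w i x * ((dp aa i x + at_poly (Fs i) qq uu x) * dp r i x)) = 0"
proof (cases "i \<le> degree r")
 case True
 then show ?thesis using weak_level[OF s, of "(pderiv ^^ i) r" i] r by (simp add: degree_higher_pderiv dp_def)
next
 case False
 then have "(pderiv ^^ i) r = 0"
 proof -
  obtain j where j: "i = Suc (degree r + j)" using False by (metis less_imp_Suc_add not_le)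
  have "degree ((pderiv ^^ (degree r + j)) r) = 0" by (simp add: degree_higher_pderiv)
  then show ?thesis by (simp add: j pderiv_eq_0_iff)
 qed
 then show ?thesis by (simp add: dp_def)
qed

text \<open>Testing the equation for \<open>D\<^sup>i u\<^sub>t\<close> with itself.\<close>

lemma accel_le:
 assumes s: "slice n qq uu aa"
 shows "itg (\<lambda>x. w i x * (dp aa i x)\<^sup>2) \<le> itg (\<lambda>x. w i x * (at_poly (Fs i) qq uu x)\<^sup>2)"
proof -
 have jb: "\<forall>x\<in>{0..1}. jt qq uu x \<in> jbox \<rho>" and da: "degree aa \<le> n" using s by (simp_all add: slice_def)
 define f where "f x = at_poly (Fs i) qq uu x" for x
 have c: "continuous_on {0..1} f" unfolding f_def by (rule cont_slice[OF jb Fs(2)])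
 have i1: "(\<lambda>x. w i x * (dp aa i x)\<^sup>2) integrable_on {0..1}" "(\<lambda>x. w i x * (f x)\<^sup>2) integrable_on {0..1}"
  "(\<lambda>x. w i x * ((dp aa i x + f x) * dp aa i x)) integrable_on {0..1}"
  by (intro integrable continuous_intros c)+
 have "itg (\<lambda>x. w i x * (dp aa i x)\<^sup>2)
   \<le> itg (\<lambda>x. w i x * (f x)\<^sup>2 + 2 * (w i x * ((dp aa i x + f x) * dp aa i x)))"
 proof (rule integral_le_Ioo)
  fix x :: real assume "0 < x" "x < 1"
  then have wn: "0 \<le> w i x" by (intro w_nonneg) auto
  have "0 \<le> w i x * (dp aa i x + f x)\<^sup>2" using wn by simp
  then show "w i x * (dp aa i x)\<^sup>2 \<le> w i x * (f x)\<^sup>2 + 2 * (w i x * ((dp aa i x + f x) * dp aa i x))"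
   by (simp add: power2_eq_square algebra_simps)
 qed (intro continuous_intros c)+
 also have "\<dots> = itg (\<lambda>x. w i x * (f x)\<^sup>2) + 2 * itg (\<lambda>x. w i x * ((dp aa i x + f x) * dp aa i x))"
  using i1 by (subst integral_add) (auto intro: integrable_on_mult_right)
 also have "itg (\<lambda>x. w i x * ((dp aa i x + f x) * dp aa i x)) = 0"
  unfolding f_def by (rule weak_test[OF s da])
 finally show ?thesis by (simp add: f_def)
qed

lemma continuous_d [continuous_intros]: "continuous_on T (d k)"
 unfolding d_def[abs_def] by (intro continuous_intros)

text \<open>Both sides are the derivative of \<open>pd e3 G = - (XX * A)\<close> along the slice.
  One-sided derivatives on \<open>[0, 1]\<close> are unique, so the ends are included.\<close>

lemma TT_P:
 assumes jb: "\<forall>x\<in>{0..1}. jt qq uu x \<in> jbox \<rho>" and x: "x \<in> {0..1}"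
 shows "at_poly (TT (pd e3 G)) qq uu x = - ((1 - 2 * x) * A (jt qq uu x) + XX x * at_poly (TT A) qq uu x)"
proof -
 have 1: "((\<lambda>x. pd e3 G (jt qq uu x)) has_real_derivative at_poly (TT (pd e3 G)) qq uu x) (at x within {0..1})"
  by (rule tder_slice[OF jb tder_base[OF S smooth_pd[OF S smG jet_Basis(4)]] x])
 have "((\<lambda>x. - (XX x * A (jt qq uu x))) has_real_derivative
   - ((1 - 2 * x) * A (jt qq uu x) + at_poly (TT A) qq uu x * XX x)) (at x within {0..1})"
  by (intro DERIV_minus DERIV_mult XX_has_derivative tder_slice[OF jb tder_base[OF S smA] x])
 then have 2: "((\<lambda>x. pd e3 G (jt qq uu x)) has_real_derivative
   - ((1 - 2 * x) * A (jt qq uu x) + at_poly (TT A) qq uu x * XX x)) (at x within {0..1})"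
 proof (rule has_field_derivative_transform_within[OF _ zero_less_one x])
  fix y :: real assume y: "y \<in> {0..1}"
  have "jt qq uu y \<in> S" using jb y \<rho>(2) by blast
  from G_q2[OF this] show "- (XX y * A (jt qq uu y)) = pd e3 G (jt qq uu y)" by (simp add: jet_def)
 qed
 have "at_poly (TT (pd e3 G)) qq uu x = - ((1 - 2 * x) * A (jt qq uu x) + at_poly (TT A) qq uu x * XX x)"
  using vector_derivative_unique_within_closed_interval[of 0 1 x] 1 2 x
  unfolding has_real_derivative_iff_has_vector_derivative by auto
 then show ?thesis by (simp add: mult.commute)
qed

text \<open>The term \<open>i * TT (pd e3 G)\<close> contributes
  \<open>- i * (1 - 2 * x) * A\<close>, which turns the coefficient \<open>d 0\<close> of the
  equation into \<open>d 0 + i * (1 - 2 * x) = d i\<close>. This is the coefficient that belongs to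
  the weight \<open>w i\<close>.\<close>

lemma lead_eq:
 assumes jb: "\<forall>x\<in>{0..1}. jt qq uu x \<in> jbox \<rho>" and x: "x \<in> {0..1}"
 shows "at_poly (lead G i) qq uu x = - (XX x * A (jt qq uu x) * dp qq (i + 2) x) - d i x * A (jt qq uu x) * dp qq (i + 1) x
   + XX x * (c (jt qq uu x) - i * at_poly (TT A) qq uu x) * dp qq (i + 1) x + XX x * b (jt qq uu x) * dp uu (i + 1) x"
proof -
 have "jt qq uu x \<in> S" using jb x \<rho>(2) by blast
 note g = G_q2[OF this] G_u1[OF this] G_q1[OF this]
 show ?thesis unfolding lead_def g TT_P[OF jb x]
  by (simp add: d_def algebra_simps)
qed

text \<open>The \<open>i\<close>-th differentiated equation is tested with the \<open>i\<close>-th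
  derivative of \<open>u\<close>. \<open>Z2\<close> moves one derivative from \<open>q\<close> to
  \<open>u\<close>, which creates the potential energy term, and the derivative of the weight
  cancels the term with \<open>d i * A\<close>. \<open>Z3\<close> treats \<open>b * U1 * U\<close>
  as half of \<open>b\<close> times the derivative of the square of \<open>U\<close>. On the right
  no derivative beyond those in the energy is left.\<close>

lemma energy_identity:
 assumes s: "slice n qq uu aa" and i: "3 \<le> i"
 shows "itg (\<lambda>x. w i x * (dp uu i x * dp aa i x + XX x * A (jt qq uu x) * dp qq (i + 1) x * dp uu (i + 1) x))
  = itg (\<lambda>x. w i x * (- (XX x * (at_poly (TT A) qq uu x + (c (jt qq uu x) - i * at_poly (TT A) qq uu x)) * dp qq (i + 1) x * dp uu i x)
    + (d i x * b (jt qq uu x) + XX x * at_poly (TT b) qq uu x) * (dp uu i x)\<^sup>2 / 2 - at_poly (Rs i) qq uu x * dp uu i x))"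
proof -
 have jb: "\<forall>x\<in>{0..1}. jt qq uu x \<in> jbox \<rho>" and du: "degree uu \<le> n" using s by (simp_all add: slice_def)
 define AA A' bb b' cc where ab: "AA = (\<lambda>x. A (jt qq uu x))" "A' = (\<lambda>x. at_poly (TT A) qq uu x)"
  "bb = (\<lambda>x. b (jt qq uu x))" "b' = (\<lambda>x. at_poly (TT b) qq uu x)" "cc = (\<lambda>x. c (jt qq uu x))"
 define F R where FR': "F = (\<lambda>x. at_poly (Fs i) qq uu x)" "R = (\<lambda>x. at_poly (Rs i) qq uu x)"
 have dA: "(AA has_real_derivative A' x) (at x within {0..1})" "(bb has_real_derivative b' x) (at x within {0..1})" if "x \<in> {0..1}" for x
  unfolding ab using tder_slice[OF jb tder_base[OF S smA] that] tder_slice[OF jb tder_base[OF S smb] that] .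
 have mT: "\<exists>F'. tder S (TT \<Phi>) F'" if "smooth S \<Phi>" for \<Phi>
  using mon_tder[OF S mon_TT[OF S that, of False 3 0]] by auto
 have cA: "continuous_on {0..1} AA" "continuous_on {0..1} bb" "continuous_on {0..1} cc" "continuous_on {0..1} A'" "continuous_on {0..1} b'"
  unfolding ab using cont_smooth_slice[OF jb smA] cont_smooth_slice[OF jb smb] cont_smooth_slice[OF jb smc]
   mT[OF smA] mT[OF smb] cont_slice[OF jb] by blast+
 have cF: "continuous_on {0..1} F" unfolding FR' by (rule cont_slice[OF jb Fs(2)])
 have cR: "continuous_on {0..1} R" unfolding FR'
 proof -
  obtain R' where "tder S (Rs i) R'" using mon_tder[OF S Rs(1)[OF i]] i by auto
  then show "continuous_on {0..1} (\<lambda>x. at_poly (Rs i) qq uu x)" by (rule cont_slice[OF jb])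
 qed
 define Q Q1 Q2 U U1 a where qu: "Q = dp qq i" "Q1 = dp qq (i + 1)" "Q2 = dp qq (i + 2)" "U = dp uu i" "U1 = dp uu (i + 1)" "a = dp aa i"
 have cq: "continuous_on {0..1} Q" "continuous_on {0..1} Q1" "continuous_on {0..1} Q2" "continuous_on {0..1} U"
  "continuous_on {0..1} U1" "continuous_on {0..1} a" unfolding qu by (rule continuous_dp)+
 have dq: "(Q1 has_real_derivative Q2 x) (at x within {0..1})" "(U has_real_derivative U1 x) (at x within {0..1})" if "x \<in> {0..1}" for x
  unfolding qu using derivsD[OF derivs_dp that, of qq "i + 1"] derivsD[OF derivs_dp that, of uu i] by simp_all
 have Z1: "itg (\<lambda>x. w i x * ((a x + F x) * U x)) = 0"
  unfolding qu FR' by (rule weak_test[OF s du])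
 have "itg (\<lambda>x. w i x * (d i x * (AA x * (Q1 x * U x)) + XX x * (A' x * (Q1 x * U x) + (Q2 x * U x + U1 x * Q1 x) * AA x))) = 0"
  by (rule by_parts) (intro DERIV_mult dA dq)
 note Z2 = this
 have "itg (\<lambda>x. w i x * (d i x * (bb x * (U x * U x)) + XX x * (b' x * (U x * U x) + (U1 x * U x + U1 x * U x) * bb x))) = 0"
  by (rule by_parts) (intro DERIV_mult dA dq)
 note Z3 = this
 define L where "L x = w i x * (U x * a x + XX x * AA x * Q1 x * U1 x)" for x
 define Rh where "Rh x = w i x * (- (XX x * (A' x + (cc x - i * A' x)) * Q1 x * U x)
    + (d i x * bb x + XX x * b' x) * (U x)\<^sup>2 / 2 - R x * U x)" for x
 let ?z1 = "\<lambda>x. w i x * ((a x + F x) * U x)"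
 let ?z2 = "\<lambda>x. w i x * (d i x * (AA x * (Q1 x * U x)) + XX x * (A' x * (Q1 x * U x) + (Q2 x * U x + U1 x * Q1 x) * AA x))"
 let ?z3 = "\<lambda>x. w i x * (d i x * (bb x * (U x * U x)) + XX x * (b' x * (U x * U x) + (U1 x * U x + U1 x * U x) * bb x))"
 have eq: "L x = Rh x + (?z1 x + (?z2 x + (-(1/2)) * ?z3 x))" if x: "x \<in> {0..1}" for x
 proof -
  have Fx: "F x = (- (XX x * AA x * Q2 x) - d i x * AA x * Q1 x + XX x * (cc x - i * A' x) * Q1 x + XX x * bb x * U1 x) + R x"
   unfolding FR' ab qu using Rs(2)[OF i] lead_eq[OF jb x, of i] by simp
  show ?thesis unfolding L_def Rh_def Fx by (simp add: power2_eq_square field_simps)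
 qed
 have ci: "continuous_on {0..1} Rh" unfolding Rh_def by (intro continuous_intros cA cR cq ballI) simp
 have i0: "?z1 integrable_on {0..1}" "?z2 integrable_on {0..1}" "?z3 integrable_on {0..1}"
  by (intro integrable continuous_intros cA cF cq)+
 have "itg L = itg (\<lambda>x. Rh x + (?z1 x + (?z2 x + (-(1/2)) * ?z3 x)))"
  by (rule integral_cong) (rule eq)
 also have "\<dots> = itg Rh + (itg ?z1 + (itg ?z2 + (-(1/2)) * itg ?z3))"
  by (simp only: integral_add integrable_add integrable_on_mult_right i0 integrable[OF ci] integral_mult_right)
 also have "\<dots> = itg Rh" using Z1 Z2 Z3 by simp
 finally show ?thesis unfolding L_def Rh_def ab qu FR' .
qed

end

lemma abs_prod_le:
 fixes r r' C e :: real
 assumes "\<bar>e\<bar> \<le> C"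
 shows "2 * (e * (r * r')) \<le> C * (r\<^sup>2 + r'\<^sup>2)"
proof -
 have "2 * \<bar>r * r'\<bar> \<le> r\<^sup>2 + r'\<^sup>2"
  using sum_squares_bound[of "\<bar>r\<bar>" "\<bar>r'\<bar>"] by (simp add: abs_mult)
 then have "\<bar>e\<bar> * (2 * \<bar>r * r'\<bar>) \<le> C * (r\<^sup>2 + r'\<^sup>2)" using assms by (intro mult_mono) auto
 moreover have "2 * (e * (r * r')) \<le> \<bar>e\<bar> * (2 * \<bar>r * r'\<bar>)"
  using abs_ge_self[of "2 * (e * (r * r'))"] by (simp add: abs_mult mult.left_commute)
 ultimately show ?thesis by linarith
qed

lemma weighted_sq_le:
 fixes \<omega> e C z P :: real
 assumes "0 \<le> \<omega>" "\<bar>e\<bar> \<le> C" "0 \<le> z" "\<omega> * z \<le> P"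
 shows "\<omega> * (e * z) \<le> C * P"
proof -
 have "\<omega> * (e * z) = e * (\<omega> * z)" by simp
 also have "\<dots> \<le> C * (\<omega> * z)" using assms by (intro mult_right_mono) auto
 also have "\<dots> \<le> C * P" using assms by (intro mult_left_mono) auto
 finally show ?thesis .
qed

lemma bounded_choice: "(\<And>e. Q e \<Longrightarrow> \<exists>C. P e C) \<Longrightarrow> \<exists>f. \<forall>e. Q e \<longrightarrow> P e (f e)"
 by metis

section \<open>Energies and bounds for their rates of change\<close>

context wave
begin

definition good :: "nat \<Rightarrow> nat \<Rightarrow> real \<Rightarrow> real poly \<Rightarrow> real poly \<Rightarrow> real \<Rightarrow> bool" where
 "good h p B0 qq uu B \<longleftrightarrow> (\<forall>x. 0 < x \<longrightarrow> x < 1 \<longrightarrow> adm \<rho> h p B0 x (\<lambda>i. dp qq i x) (\<lambda>i. dp uu i x) B)"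

lemma goodD:
 assumes "good h p B0 qq uu B"
 shows "0 < x \<Longrightarrow> x < 1 \<Longrightarrow> adm \<rho> h p B0 x (\<lambda>i. dp qq i x) (\<lambda>i. dp uu i x) B" "0 \<le> B" "B \<le> B0"
proof -
 show g: "0 < x \<Longrightarrow> x < 1 \<Longrightarrow> adm \<rho> h p B0 x (\<lambda>i. dp qq i x) (\<lambda>i. dp uu i x) B" for x
  using assms by (simp add: good_def)
 show "0 \<le> B" "B \<le> B0" using g[of "1/2"] by (simp_all add: adm_def)
qed

lemma admD: "adm \<rho> h p B0 x q u B \<Longrightarrow> i \<le> p \<Longrightarrow> XX x ^ (i - h) * \<bar>q i\<bar> \<le> B"
 "adm \<rho> h p B0 x q u B \<Longrightarrow> i \<le> p \<Longrightarrow> XX x ^ (i - h) * \<bar>u i\<bar> \<le> B"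
 by (simp_all add: adm_def)

lemma adm_le: "adm \<rho> h p B0 x q u B \<Longrightarrow> p' \<le> p \<Longrightarrow> adm \<rho> h p' B0 x q u B"
 unfolding adm_def by auto

lemma continuous_Fs: "slice n qq uu aa \<Longrightarrow> continuous_on {0..1} (\<lambda>x. at_poly (Fs i) qq uu x)"
 unfolding slice_def by (rule cont_slice[OF _ Fs(2)]) auto

abbreviation "accel_bd h B0 i C \<equiv> \<forall>n qq uu aa B. slice n qq uu aa \<longrightarrow> good h h B0 qq uu B \<longrightarrow>
  itg (\<lambda>x. w i x * (dp aa i x)\<^sup>2) \<le> C * B\<^sup>2"

text \<open>The acceleration is bounded by \<open>Fs i\<close> in the weighted mean. At low order
  all derivatives in \<open>Fs i\<close> are bounded by \<open>B\<close>, and since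
  \<open>Fs i\<close> vanishes with the jet, the integral is quadratic in \<open>B\<close>.\<close>

lemma accel_crude:
 assumes h: "5 \<le> h" "i + 2 \<le> h" and B0: "0 \<le> B0"
 shows "\<exists>C\<ge>0. accel_bd h B0 i C"
proof -
 have "\<exists>C\<ge>0. \<forall>x q u B. adm \<rho> h h B0 x q u B \<longrightarrow> \<bar>Fs i x q u\<bar> \<le> C * (if True then B else 1)"
  by (rule mon_crude[OF S \<rho>(2) B0 h(1,2) _ Fs(1)]) (use h in simp)
 then obtain C where C: "C \<ge> 0" "\<And>x q u B. adm \<rho> h h B0 x q u B \<Longrightarrow> \<bar>Fs i x q u\<bar> \<le> C * B" by auto
 have "itg (\<lambda>x. w i x * (dp aa i x)\<^sup>2) \<le> C\<^sup>2 * B\<^sup>2"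
  if s: "slice n qq uu aa" and g: "good h h B0 qq uu B" for n qq uu aa B
 proof -
  have "itg (\<lambda>x. w i x * (dp aa i x)\<^sup>2) \<le> itg (\<lambda>x. w i x * (at_poly (Fs i) qq uu x)\<^sup>2)"
   by (rule accel_le[OF s])
  also have "\<dots> \<le> itg (\<lambda>x::real. C\<^sup>2 * B\<^sup>2)"
  proof (rule integral_le_Ioo)
   fix x :: real assume x: "0 < x" "x < 1"
   have "\<bar>at_poly (Fs i) qq uu x\<bar> \<le> C * B" by (rule C(2)[OF goodD(1)[OF g x]])
   then have "(at_poly (Fs i) qq uu x)\<^sup>2 \<le> (C * B)\<^sup>2" using C(1) goodD(2)[OF g] by (subst power2_le_iff_abs_le) auto
   moreover have "0 \<le> w i x" "w i x \<le> 1" using x w_nonneg[of x i] w_le1[of x i] by auto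
   ultimately have "w i x * (at_poly (Fs i) qq uu x)\<^sup>2 \<le> 1 * (C * B)\<^sup>2" by (intro mult_mono) auto
   then show "w i x * (at_poly (Fs i) qq uu x)\<^sup>2 \<le> C\<^sup>2 * B\<^sup>2" by (simp add: power_mult_distrib)
  qed (intro continuous_intros continuous_Fs[OF s])+
  finally show ?thesis by simp
 qed
 then show ?thesis by (intro exI[of _ "C\<^sup>2"]) simp
qed

abbreviation "accel_sup_bd h B0 C \<equiv> \<forall>n qq uu aa B. slice n qq uu aa \<longrightarrow> good h h B0 qq uu B \<longrightarrow>
  (\<forall>x. 0 < x \<longrightarrow> x < 1 \<longrightarrow> \<bar>dp aa 0 x\<bar> \<le> C * B \<and> \<bar>dp aa 1 x\<bar> \<le> C * B)"

text \<open>The time derivative of \<open>A\<close> along a solution involves the acceleration and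
  its first \<open>x\<close>-derivative pointwise. These follow from the mean bounds up to order
  \<open>\<mu> + 5\<close> by the Sobolev inequality with one free derivative; as
  \<open>Fs i\<close> has order \<open>i + 2\<close>, this leads to
  \<open>\<mu> + 7 \<le> h\<close>.\<close>

lemma accel_sup:
 assumes h: "\<mu> + 7 \<le> h" and B0: "0 \<le> B0"
 shows "\<exists>C\<ge>0. accel_sup_bd h B0 C"
proof -
 have "\<exists>C. \<forall>i. i \<le> \<mu> + 5 \<longrightarrow> (C i\<ge>0 \<and> (accel_bd h B0 i (C i)))"
  by (rule bounded_choice, rule accel_crude[OF _ _ B0]) (use h in auto)
 then obtain C where C0: "\<forall>i. i \<le> \<mu> + 5 \<longrightarrow> (C i\<ge>0 \<and> (accel_bd h B0 i (C i)))" by (elim exE)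
 have C: "i \<le> \<mu> + 5 \<Longrightarrow> C i \<ge> 0"
  "i \<le> \<mu> + 5 \<Longrightarrow> slice n qq uu aa \<Longrightarrow> good h h B0 qq uu B \<Longrightarrow>
    itg (\<lambda>x. w i x * (dp aa i x)\<^sup>2) \<le> C i * B\<^sup>2" for i n qq uu aa B using C0[rule_format, of i] by simp_all
 define D where "D = (\<Sum>i\<le>\<mu> + 5. C i)"
 have D: "D \<ge> 0" unfolding D_def using C(1) by (intro sum_nonneg) auto
 obtain Cs where Cs: "Cs \<ge> 0" "\<And>f j x. derivs f \<Longrightarrow> j < \<mu> + 5 \<Longrightarrow> 0 < x \<Longrightarrow> x < 1 \<Longrightarrow>
   XX x ^ (j - 1) * \<bar>f j x\<bar> \<le> Cs * sqrt (energy (\<mu> + 5) f)"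
  using sobolev[of 1 "\<mu> + 5"] by auto
 have "\<bar>dp aa j x\<bar> \<le> Cs * sqrt D * B"
  if s: "slice n qq uu aa" and g: "good h h B0 qq uu B" and x: "0 < x" "x < 1" and j: "j \<le> 1" for n qq uu aa B x j
 proof -
  have "energy (\<mu> + 5) (dp aa) \<le> (\<Sum>i\<le>\<mu> + 5. C i * B\<^sup>2)"
   unfolding energy_def using C(2)[OF _ s g] by (intro sum_mono) auto
  then have "energy (\<mu> + 5) (dp aa) \<le> D * B\<^sup>2" by (simp add: D_def sum_distrib_right)
  then have "sqrt (energy (\<mu> + 5) (dp aa)) \<le> sqrt D * B"
   using real_sqrt_le_mono[of "energy (\<mu> + 5) (dp aa)" "D * B\<^sup>2"] goodD(2)[OF g] by (simp add: real_sqrt_mult)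
  moreover have "\<bar>dp aa j x\<bar> \<le> Cs * sqrt (energy (\<mu> + 5) (dp aa))"
   using Cs(2)[OF derivs_dp[of aa] _ x, of j] j by simp
  ultimately show ?thesis using Cs(1) by (smt (verit) mult.assoc mult_left_mono)
 qed
 then show ?thesis using D Cs(1) by (intro exI[of _ "Cs * sqrt D"]) simp
qed

text \<open>The factor \<open>A\<close> makes the energy symmetric: the product of the two top
  derivatives in its time derivative pairs with the acceleration term as in the energy identity. The
  square of the \<open>i\<close>-th derivative of \<open>q\<close> is included so that
  \<open>q\<close> is controlled together with \<open>u\<close>.\<close>

definition lev where "lev i qq uu = itg (\<lambda>x. w i x * ((dp uu i x)\<^sup>2 + (dp qq i x)\<^sup>2 + XX x * A (jt qq uu x) * (dp qq (i + 1) x)\<^sup>2))"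
definition En where "En k qq uu = (\<Sum>i\<le>k. lev i qq uu)"
text \<open>The time derivative of \<open>A\<close> at the jet when \<open>q_t = u\<close> and
  \<open>u_t = a\<close>; \<open>rate\<close> is the corresponding integrand for
  \<open>lev\<close>.\<close>

definition At where "At qq uu aa x = pd e1 A (jt qq uu x) * dp uu 0 x + pd e2 A (jt qq uu x) * dp uu 1 x + pd e3 A (jt qq uu x) * dp uu 2 x
  + pd e4 A (jt qq uu x) * dp aa 0 x + pd e5 A (jt qq uu x) * dp aa 1 x"
definition rate where "rate i qq uu aa x = w i x * (2 * dp uu i x * dp aa i x + 2 * dp qq i x * dp uu i x
  + 2 * (XX x * A (jt qq uu x) * dp qq (i + 1) x * dp uu (i + 1) x) + XX x * At qq uu aa x * (dp qq (i + 1) x)\<^sup>2)"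
abbreviation "pe i qq uu x \<equiv> w i x * ((dp uu i x)\<^sup>2 + (dp qq i x)\<^sup>2 + XX x * (dp qq (i + 1) x)\<^sup>2)"
text \<open>The energy density without \<open>A\<close>: its integral is continuous in time even
  before the jets are known to stay in the box where \<open>A\<close> is under control. The
  smallness threshold is therefore put on this quantity.\<close>

definition PP where "PP k qq uu x = (\<Sum>i\<le>k. pe i qq uu x)"

lemma A_bounds: "\<exists>a0>0. \<exists>a1\<ge>1. \<forall>p\<in>jbox \<rho>. a0 \<le> A p \<and> A p \<le> a1"
proof -
 have c: "continuous_on (jbox \<rho>) A" using smA smooth_continuous \<rho>(2) continuous_on_subset by blast
 have ne: "jbox \<rho> \<noteq> {}" using \<rho>(1) by (auto simp: jbox_def)
 obtain p where p: "p \<in> jbox \<rho>" "\<forall>y\<in>jbox \<rho>. A p \<le> A y" using continuous_attains_inf[OF compact_box ne c] by blast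
 obtain r where r: "r \<in> jbox \<rho>" "\<forall>y\<in>jbox \<rho>. A y \<le> A r" using continuous_attains_sup[OF compact_box ne c] by blast
 have "A p > 0" using p \<rho>(2) A_pos by blast
 then show ?thesis using p r by (intro exI[of _ "A p"] exI[of _ "max 1 (A r)"] conjI ballI) fastforce+
qed

lemma jbD: "slice n qq uu aa \<Longrightarrow> \<forall>x\<in>{0..1}. jt qq uu x \<in> jbox \<rho>" by (simp add: slice_def)

lemma PP_term:
 assumes "i \<le> k" "x \<in> {0..1}"
 shows "w i x * (dp uu i x)\<^sup>2 \<le> PP k qq uu x" "w i x * (dp qq i x)\<^sup>2 \<le> PP k qq uu x" "w i x * (XX x * (dp qq (i + 1) x)\<^sup>2) \<le> PP k qq uu x"
  "pe i qq uu x \<le> PP k qq uu x"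
  "0 \<le> w i x * (dp uu i x)\<^sup>2" "0 \<le> w i x * (dp qq i x)\<^sup>2" "0 \<le> w i x * (XX x * (dp qq (i + 1) x)\<^sup>2)"
proof -
 have nn: "0 \<le> w i x * (dp uu i x)\<^sup>2" "0 \<le> w i x * (dp qq i x)\<^sup>2" "0 \<le> w i x * (XX x * (dp qq (i + 1) x)\<^sup>2)" for i
  using w_nonneg[OF assms(2)] XX_bounds[OF assms(2)] by auto
 show "pe i qq uu x \<le> PP k qq uu x"
  unfolding PP_def using assms(1) nn
  by (intro member_le_sum[of i "{..k}" "\<lambda>i. pe i qq uu x"])
   (auto simp: distrib_left)
 then show "w i x * (dp uu i x)\<^sup>2 \<le> PP k qq uu x" "w i x * (dp qq i x)\<^sup>2 \<le> PP k qq uu x" "w i x * (XX x * (dp qq (i + 1) x)\<^sup>2) \<le> PP k qq uu x"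
  using nn[of i] by (auto simp: distrib_left)
qed (use w_nonneg[OF assms(2)] XX_bounds[OF assms(2)] in auto)

lemma continuous_PP: "continuous_on {0..1} (PP k qq uu)"
 unfolding PP_def[abs_def] by (intro continuous_intros)

lemma En_PP_equiv: "\<exists>K\<ge>1. \<forall>n qq uu aa k. slice n qq uu aa \<longrightarrow>
  itg (PP k qq uu) \<le> K * En k qq uu \<and> En k qq uu \<le> K * itg (PP k qq uu)"
proof -
 obtain a0 a1 where a0: "a0 > 0" and a: "\<And>p. p \<in> jbox \<rho> \<Longrightarrow> a0 \<le> A p \<and> A p \<le> a1" using A_bounds by auto
 define K where "K = max (max 1 a1) (1 / a0)"
 have K: "K \<ge> 1" "K \<ge> a1" "K \<ge> 1 / a0" by (auto simp: K_def)
 have "itg (PP k qq uu) \<le> K * En k qq uu \<and> En k qq uu \<le> K * itg (PP k qq uu)"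
  if s: "slice n qq uu aa" for n qq uu aa k
 proof -
  note cA = cont_smooth_slice[OF jbD[OF s] smA]
  let ?g = "\<lambda>i x. w i x * ((dp uu i x)\<^sup>2 + (dp qq i x)\<^sup>2 + XX x * A (jt qq uu x) * (dp qq (i + 1) x)\<^sup>2)"
  have cmp: "pe i qq uu x \<le> K * ?g i x" "?g i x \<le> K * pe i qq uu x" if x: "x \<in> {0..1}" for i x
  proof -
   define z where "z = XX x * (dp qq (i + 1) x)\<^sup>2"
   have z: "0 \<le> z" using XX_bounds[OF x] by (simp add: z_def)
   have "jt qq uu x \<in> jbox \<rho>" using jbD[OF s] x by simp
   note A = a[OF this]
   have "1 / a0 * a0 \<le> K * A (jt qq uu x)" using A a0 K by (intro mult_mono) auto
   then have "1 \<le> K * A (jt qq uu x)" using a0 by simp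
   then have "1 * z \<le> K * A (jt qq uu x) * z" "A (jt qq uu x) * z \<le> K * z"
    using A K z by (intro mult_right_mono; linarith)+
   moreover have "1 * (dp uu i x)\<^sup>2 \<le> K * (dp uu i x)\<^sup>2" "1 * (dp qq i x)\<^sup>2 \<le> K * (dp qq i x)\<^sup>2"
    by (rule mult_right_mono[OF K(1) zero_le_power2])+
   ultimately have "(dp uu i x)\<^sup>2 + (dp qq i x)\<^sup>2 + z \<le> K * ((dp uu i x)\<^sup>2 + (dp qq i x)\<^sup>2 + A (jt qq uu x) * z)"
    "(dp uu i x)\<^sup>2 + (dp qq i x)\<^sup>2 + A (jt qq uu x) * z \<le> K * ((dp uu i x)\<^sup>2 + (dp qq i x)\<^sup>2 + z)"
    by (auto simp: algebra_simps)
   from mult_left_mono[OF this(1) w_nonneg[OF x, of i]] mult_left_mono[OF this(2) w_nonneg[OF x, of i]]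
   show "pe i qq uu x \<le> K * ?g i x" "?g i x \<le> K * pe i qq uu x" by (simp_all add: z_def mult_ac)
  qed
  have I: "itg (pe i qq uu) \<le> K * lev i qq uu" "lev i qq uu \<le> K * itg (pe i qq uu)" for i
   unfolding lev_def integral_mult_right[symmetric]
   by (rule integral_le_Ioo; (intro continuous_intros cA | rule cmp; simp))+
  have P: "itg (PP k qq uu) = (\<Sum>i\<le>k. itg (pe i qq uu))"
   unfolding PP_def[abs_def] by (intro integral_sum integrable continuous_intros) simp
  show ?thesis unfolding P En_def sum_distrib_left by (intro conjI sum_mono I)
 qed
 then show ?thesis by (intro exI[of _ K] conjI[OF K(1)] allI impI)
qed

abbreviation "slice_bd \<Phi> C \<equiv> \<forall>n qq uu aa. slice n qq uu aa \<longrightarrow> (\<forall>x\<in>{0..1}. \<bar>\<Phi> (jt qq uu x)\<bar> \<le> C)"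
abbreviation "TT_bd h B0 \<Phi> C \<equiv> \<forall>qq uu B. good h h B0 qq uu B \<longrightarrow> (\<forall>x. 0 < x \<longrightarrow> x < 1 \<longrightarrow> \<bar>at_poly (TT \<Phi>) qq uu x\<bar> \<le> C)"
abbreviation "At_bd h B0 C \<equiv> \<forall>n qq uu aa B. slice n qq uu aa \<longrightarrow> good h h B0 qq uu B \<longrightarrow> (\<forall>x. 0 < x \<longrightarrow> x < 1 \<longrightarrow> \<bar>At qq uu aa x\<bar> \<le> C)"

lemma smooth_bounded_slice:
 assumes "smooth S \<Phi>"
 shows "\<exists>C\<ge>0. slice_bd \<Phi> C"
proof -
 obtain C where "C \<ge> 0" "\<forall>p\<in>jbox \<rho>. \<bar>\<Phi> p\<bar> \<le> C" using smooth_bounded_box[OF assms \<rho>(2)] by (elim exE conjE)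
 with jbD show ?thesis by (intro exI[of _ C] conjI allI impI ballI) simp_all
qed

lemma TT_bounded:
 assumes "smooth S \<Phi>" and h: "5 \<le> h" and B0: "0 \<le> B0"
 shows "\<exists>C\<ge>0. TT_bd h B0 \<Phi> C"
proof -
 have m: "mon S False (Suc 0) 3 (TT \<Phi>)"
  by (rule mon_TT[OF S assms(1)]) simp_all
 have l: "3 \<le> h" "Suc 0 \<le> h + 2" using h by simp_all
 obtain C where C: "C \<ge> 0" "\<forall>x q u B. adm \<rho> h h B0 x q u B \<longrightarrow> \<bar>TT \<Phi> x q u\<bar> \<le> C * (if False then B else 1)"
  using mon_crude[OF S \<rho>(2) B0 h l m] by (elim exE conjE)
 have C': "\<bar>TT \<Phi> x q u\<bar> \<le> C" if "adm \<rho> h h B0 x q u B" for x q u B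
  using C(2)[rule_format, OF that] by simp
 show ?thesis
 proof (intro exI[of _ C] conjI allI impI)
  fix qq uu B and x :: real assume g: "good h h B0 qq uu B" "0 < x" "x < 1"
  show "\<bar>at_poly (TT \<Phi>) qq uu x\<bar> \<le> C" by (rule C'[OF goodD(1)[OF g]])
 qed (rule C(1))
qed

lemma At_bounded:
 assumes h: "\<mu> + 7 \<le> h" and B0: "0 \<le> B0"
 shows "\<exists>C\<ge>0. At_bd h B0 C"
proof -
 obtain Ca where Ca: "Ca \<ge> 0" "accel_sup_bd h B0 Ca"
  using accel_sup[OF h B0] by (elim exE conjE)
 have "\<exists>P. \<forall>e. e \<in> Basis \<longrightarrow> (P e\<ge>0 \<and> (slice_bd (pd e A) (P e)))"
  by (rule bounded_choice, rule smooth_bounded_slice, rule smooth_pd[OF S smA])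
 then obtain P where P0: "\<forall>e. e \<in> Basis \<longrightarrow> (P e\<ge>0 \<and> (slice_bd (pd e A) (P e)))"
  by (elim exE)
 have P: "e \<in> Basis \<Longrightarrow> P e \<ge> 0"
  "e \<in> Basis \<Longrightarrow> slice n qq uu aa \<Longrightarrow> x \<in> {0..1} \<Longrightarrow> \<bar>pd e A (jt qq uu x)\<bar> \<le> P e" for e n qq uu aa x
  using P0[rule_format, THEN conjunct1, of e] P0[rule_format, THEN conjunct2, rule_format, of e n qq uu aa x] by simp_all
 have "\<bar>At qq uu aa x\<bar> \<le> P e1 * B0 + P e2 * B0 + P e3 * B0 + P e4 * (Ca * B0) + P e5 * (Ca * B0)"
  if s: "slice n qq uu aa" and g: "good h h B0 qq uu B" and x: "0 < x" "x < 1" for n qq uu aa B x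
 proof -
  have tri: "\<bar>a + b\<bar> \<le> c + d" if "\<bar>a\<bar> \<le> c" "\<bar>b\<bar> \<le> d" for a b c d :: real using that by linarith
  have m: "\<bar>pd e A (jt qq uu x) * z\<bar> \<le> P e * y" if "e \<in> Basis" "\<bar>z\<bar> \<le> y" for e z y
   unfolding abs_mult using P(1)[OF that(1)] P(2)[OF that(1) s, of x] x that(2) by (intro mult_mono) auto
  have "\<bar>dp uu j x\<bar> \<le> B0" if "j \<le> 2" for j
  proof -
   have "j \<le> h" "j - h = 0" using that h by simp_all
   then have "\<bar>dp uu j x\<bar> \<le> B" using admD(2)[OF goodD(1)[OF g x], of j] by simp
   then show ?thesis using goodD(3)[OF g] by simp
  qed
  from this[of 0] this[of 1] this[of 2] have u: "\<bar>dp uu 0 x\<bar> \<le> B0" "\<bar>dp uu 1 x\<bar> \<le> B0" "\<bar>dp uu 2 x\<bar> \<le> B0" by simp_all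
  have "\<bar>dp aa 0 x\<bar> \<le> Ca * B0" "\<bar>dp aa 1 x\<bar> \<le> Ca * B0"
  proof -
   have "Ca * B \<le> Ca * B0" using Ca(1) goodD(3)[OF g] by (intro mult_left_mono)
   then show "\<bar>dp aa 0 x\<bar> \<le> Ca * B0" "\<bar>dp aa 1 x\<bar> \<le> Ca * B0" using Ca(2)[rule_format, OF s g x] by linarith+
  qed
  note m' = m[OF jet_Basis(2) u(1)] m[OF jet_Basis(3) u(2)] m[OF jet_Basis(4) u(3)] m[OF jet_Basis(5) this(1)] m[OF jet_Basis(6) this(2)]
  show ?thesis unfolding At_def by (rule tri[OF tri[OF tri[OF tri[OF m'(1,2)] m'(3)] m'(4)] m'(5)])
 qed
 moreover have "0 \<le> P e1 * B0 + P e2 * B0 + P e3 * B0 + P e4 * (Ca * B0) + P e5 * (Ca * B0)"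
  using P(1) jet_Basis Ca(1) B0 by (intro add_nonneg_nonneg mult_nonneg_nonneg) auto
 ultimately show ?thesis by (intro exI[of _ "P e1 * B0 + P e2 * B0 + P e3 * B0 + P e4 * (Ca * B0) + P e5 * (Ca * B0)"] conjI allI impI)
qed

lemma good_le: "good h p B0 qq uu B \<Longrightarrow> p' \<le> p \<Longrightarrow> good h p' B0 qq uu B"
 unfolding good_def using adm_le by blast

lemma continuous_At: "slice n qq uu aa \<Longrightarrow> continuous_on {0..1} (At qq uu aa)"
 unfolding At_def[abs_def]
 by (intro continuous_intros cont_smooth_slice[OF jbD] smooth_pd[OF S smA] jet_Basis)

lemma continuous_rate: "slice n qq uu aa \<Longrightarrow> continuous_on {0..1} (rate i qq uu aa)"
 unfolding rate_def[abs_def]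
 by (intro continuous_intros continuous_At cont_smooth_slice[OF jbD smA])

lemma continuous_TT:
 assumes s: "slice n qq uu aa" and "smooth S \<Phi>"
 shows "continuous_on {0..1} (\<lambda>x. at_poly (TT \<Phi>) qq uu x)"
proof -
 have "mon S False (Suc 0) 3 (TT \<Phi>)" by (rule mon_TT[OF S assms(2)]) simp_all
 then obtain F' where "tder S (TT \<Phi>) F'" using mon_tder[OF S, of False "Suc 0" 3 "TT \<Phi>"] by auto
 then show ?thesis by (rule cont_slice[OF jbD[OF s]])
qed

lemma PP_nonneg: "x \<in> {0..1} \<Longrightarrow> 0 \<le> PP k qq uu x"
 unfolding PP_def using w_nonneg XX_bounds by (intro sum_nonneg) simp

abbreviation "rate_bd h p k B0 i K \<equiv> \<forall>n qq uu aa B. slice n qq uu aa \<longrightarrow> good h p B0 qq uu B \<longrightarrow>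
  itg (rate i qq uu aa) \<le> K * (B\<^sup>2 + itg (PP k qq uu))"

text \<open>For \<open>i \<le> 2\<close> no cancellation is required: the acceleration is controlled
  by \<open>B\<close>, and derivatives of order \<open>i + 1 \<le> 3 \<le> k\<close> already belong
  to the energy of order \<open>k\<close>.\<close>

lemma rate_low:
 assumes h: "\<mu> + 7 \<le> h" and i: "i \<le> 2" "3 \<le> k" and B0: "0 \<le> B0"
 shows "\<exists>K\<ge>0. rate_bd h h k B0 i K"
proof -
 have h5: "5 \<le> h" "i + 2 \<le> h" using h i by simp_all
 obtain C where C: "C \<ge> 0" "accel_bd h B0 i C" using accel_crude[OF h5 B0] by (elim exE conjE)
 obtain D where D: "D \<ge> 0" "At_bd h B0 D"
  using At_bounded[OF h B0] by (elim exE conjE)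
 obtain a1 where a1: "a1 \<ge> 0" "slice_bd A a1"
  using smooth_bounded_slice[OF smA] by (elim exE conjE)
 define K where "K = max C (4 + 2 * a1 + D)"
 show ?thesis
 proof (intro exI[of _ K] conjI allI impI)
  fix n qq uu aa B assume s: "slice n qq uu aa" and g: "good h h B0 qq uu B"
  have "itg (rate i qq uu aa) \<le> itg (\<lambda>x. w i x * (dp aa i x)\<^sup>2 + (4 + 2 * a1 + D) * PP k qq uu x)"
  proof (rule integral_le_Ioo)
   fix x :: real assume x: "0 < x" "x < 1"
   then have x': "x \<in> {0..1}" by simp
   have i1: "i \<le> k" "i + 1 \<le> k" using i by simp_all
   note P = PP_term(1-3)[OF i1(1) x', where qq=qq and uu=uu] PP_term(1)[OF i1(2) x', where qq=qq and uu=uu]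
   note wn = w_nonneg[OF x']
   have X: "0 \<le> XX x" using XX_bounds[OF x'] by simp
   have 1: "w i x * (2 * dp uu i x * dp aa i x) \<le> w i x * (dp uu i x)\<^sup>2 + w i x * (dp aa i x)\<^sup>2"
    using mult_left_mono[OF sum_squares_bound[of "dp uu i x" "dp aa i x"] wn[of i]] by (simp add: distrib_left)
   have 2: "w i x * (2 * dp qq i x * dp uu i x) \<le> w i x * (dp qq i x)\<^sup>2 + w i x * (dp uu i x)\<^sup>2"
    using mult_left_mono[OF sum_squares_bound[of "dp qq i x" "dp uu i x"] wn[of i]] by (simp add: distrib_left)
   have "2 * (A (jt qq uu x) * (dp qq (i + 1) x * dp uu (i + 1) x)) \<le> a1 * ((dp qq (i + 1) x)\<^sup>2 + (dp uu (i + 1) x)\<^sup>2)"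
    by (rule abs_prod_le) (use a1(2) s x' in blast)
   from mult_left_mono[OF this wn, of "Suc i"]
   have 3: "w i x * (2 * (XX x * A (jt qq uu x) * dp qq (i + 1) x * dp uu (i + 1) x))
     \<le> a1 * (w i x * (XX x * (dp qq (i + 1) x)\<^sup>2) + w (i + 1) x * (dp uu (i + 1) x)\<^sup>2)"
    by (simp add: w_Suc algebra_simps)
   have 31: "\<dots> \<le> a1 * (PP k qq uu x + PP k qq uu x)" using a1(1) P(3,4) by (intro mult_left_mono add_mono)
   have 4: "w i x * (At qq uu aa x * (XX x * (dp qq (i + 1) x)\<^sup>2)) \<le> D * PP k qq uu x"
    by (rule weighted_sq_le) (use wn D(2)[rule_format, OF s g x] P(3) X in auto)
   have "rate i qq uu aa x = w i x * (2 * dp uu i x * dp aa i x) + w i x * (2 * dp qq i x * dp uu i x)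
     + w i x * (2 * (XX x * A (jt qq uu x) * dp qq (i + 1) x * dp uu (i + 1) x)) + w i x * (At qq uu aa x * (XX x * (dp qq (i + 1) x)\<^sup>2))"
    by (simp add: rate_def algebra_simps)
   also have "\<dots> \<le> (PP k qq uu x + w i x * (dp aa i x)\<^sup>2) + (PP k qq uu x + PP k qq uu x) + a1 * (PP k qq uu x + PP k qq uu x) + D * PP k qq uu x"
    using 1 2 3 31 4 P by (intro add_mono) linarith+
   also have "\<dots> \<le> w i x * (dp aa i x)\<^sup>2 + (4 + 2 * a1 + D) * PP k qq uu x" using PP_nonneg[OF x', of k qq uu] by (simp add: algebra_simps)
   finally show "rate i qq uu aa x \<le> w i x * (dp aa i x)\<^sup>2 + (4 + 2 * a1 + D) * PP k qq uu x" .
  qed (intro continuous_intros continuous_rate[OF s] continuous_PP)+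
  also have "\<dots> = itg (\<lambda>x. w i x * (dp aa i x)\<^sup>2) + (4 + 2 * a1 + D) * itg (PP k qq uu)"
   by (subst integral_add) (auto intro!: integrable continuous_intros continuous_PP)
  also have "\<dots> \<le> K * B\<^sup>2 + K * itg (PP k qq uu)"
  proof (rule add_mono)
   have "C * B\<^sup>2 \<le> K * B\<^sup>2" by (intro mult_right_mono) (simp_all add: K_def)
   then show "itg (\<lambda>x. w i x * (dp aa i x)\<^sup>2) \<le> K * B\<^sup>2" using C(2)[rule_format, OF s g] by linarith
   have "0 \<le> itg (PP k qq uu)"
    by (intro integral_nonneg integrable continuous_PP PP_nonneg)
   then show "(4 + 2 * a1 + D) * itg (PP k qq uu) \<le> K * itg (PP k qq uu)"
    by (intro mult_right_mono) (simp_all add: K_def)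
  qed
  finally show "itg (rate i qq uu aa) \<le> K * (B\<^sup>2 + itg (PP k qq uu))" by (simp add: distrib_left)
 qed (use C(1) in \<open>simp add: K_def\<close>)
qed

text \<open>The product of the derivatives of order \<open>i + 1\<close> of \<open>q\<close> and
  \<open>u\<close> is not controlled by the energy of order \<open>k\<close> when
  \<open>i = k\<close>; the energy identity replaces it together with the acceleration. What remains
  is quadratic in the energy variables, with coefficients bounded pointwise, plus the remainder
  \<open>Rs i\<close>, bounded in the weighted mean.\<close>

lemma rate_high:
 assumes h: "\<mu> + 7 \<le> h" "h \<le> p" "k \<le> p + 2" "k + 8 \<le> 4 * h" and i: "3 \<le> i" "i \<le> k" and B0: "0 \<le> B0"
 shows "\<exists>K\<ge>0. rate_bd h p k B0 i K"
proof -
 have h5: "5 \<le> h" "i \<le> p + 2" "i + 8 \<le> 4 * h" using h i by simp_all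
 obtain D where D: "D \<ge> 0" "At_bd h B0 D"
  using At_bounded[OF h(1) B0] by (elim exE conjE)
 obtain Cb where Cb: "Cb \<ge> 0" "slice_bd b Cb"
  using smooth_bounded_slice[OF smb] by (elim exE conjE)
 obtain Cc where Cc: "Cc \<ge> 0" "slice_bd c Cc"
  using smooth_bounded_slice[OF smc] by (elim exE conjE)
 obtain Ta where Ta: "Ta \<ge> 0" "TT_bd h B0 A Ta"
  using TT_bounded[OF smA h5(1) B0] by (elim exE conjE)
 obtain Tb where Tb: "Tb \<ge> 0" "TT_bd h B0 b Tb"
  using TT_bounded[OF smb h5(1) B0] by (elim exE conjE)
 obtain CR where CR: "CR \<ge> 0" "\<forall>x q u B. adm \<rho> h p B0 x q u B \<longrightarrow>
  w i x * (Rs i x q u)\<^sup>2 \<le> CR * (B\<^sup>2 + (\<Sum>j\<le>i. w j x * ((q j)\<^sup>2 + (u j)\<^sup>2)))"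
  using mon_weighted[OF S \<rho>(2) B0 h5(1) h(2) h5(2,3) Rs(1)[OF i(1)]] by (elim exE conjE)
 define E where "E = Ta + Cc + real i * Ta"
 define Cd where "Cd = al + be + 2 + 2 * real i"
 have E0: "E \<ge> 0" "Cd \<ge> 0" using Ta(1) Cc(1) al be by (simp_all add: E_def Cd_def)
 define K1 where "K1 = 2 * E + (Cd * Cb + Tb) + 3 + D"
 define K where "K = max CR (CR + K1)"
 have K10: "K1 \<ge> 0" unfolding K1_def using E0 Cb(1) Tb(1) D(1) by simp
 show ?thesis
 proof (intro exI[of _ "CR + K1"] conjI allI impI)
  fix n qq uu aa B assume s: "slice n qq uu aa" and gp: "good h p B0 qq uu B"
  have g: "good h h B0 qq uu B" by (rule good_le[OF gp h(2)])
  note cA = cont_smooth_slice[OF jbD[OF s] smA] cont_smooth_slice[OF jbD[OF s] smb] cont_smooth_slice[OF jbD[OF s] smc]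
   continuous_TT[OF s smA] continuous_TT[OF s smb] continuous_At[OF s] continuous_PP
  have cR: "continuous_on {0..1} (\<lambda>x. at_poly (Rs i) qq uu x)"
  proof -
   obtain R' where "tder S (Rs i) R'" using mon_tder[OF S Rs(1)[OF i(1)]] i by auto
   then show ?thesis by (rule cont_slice[OF jbD[OF s]])
  qed
  \<comment> \<open>The rate is split as \<open>2 * L + M\<close>, and \<open>Rh\<close> is the
    right-hand side of the energy identity for \<open>L\<close>.\<close>
  define L where "L x = w i x * (dp uu i x * dp aa i x + XX x * A (jt qq uu x) * dp qq (i + 1) x * dp uu (i + 1) x)" for x
  define Rh where "Rh x = w i x * (- (XX x * (at_poly (TT A) qq uu x + (c (jt qq uu x) - i * at_poly (TT A) qq uu x)) * dp qq (i + 1) x * dp uu i x)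
    + (d i x * b (jt qq uu x) + XX x * at_poly (TT b) qq uu x) * (dp uu i x)\<^sup>2 / 2 - at_poly (Rs i) qq uu x * dp uu i x)" for x
  define M where "M x = w i x * (2 * dp qq i x * dp uu i x + XX x * At qq uu aa x * (dp qq (i + 1) x)\<^sup>2)" for x
  have LR: "itg L = itg Rh"
   unfolding L_def Rh_def by (rule energy_identity[OF s i(1)])
  have cL: "continuous_on {0..1} L" "continuous_on {0..1} M" "continuous_on {0..1} Rh"
  proof -
   show "continuous_on {0..1} L" unfolding L_def by (intro continuous_intros cA)
   show "continuous_on {0..1} M" unfolding M_def by (intro continuous_intros cA)
   show "continuous_on {0..1} Rh" unfolding Rh_def by (intro continuous_intros cA cR ballI) simp
  qed
  have "itg (rate i qq uu aa) = itg (\<lambda>x. 2 * L x + M x)"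
   unfolding rate_def L_def M_def by (intro integral_cong) (simp add: algebra_simps)
  also have "\<dots> = 2 * itg L + itg M"
   by (subst integral_add) (auto intro!: integrable continuous_intros cL)
  also have "\<dots> = 2 * itg Rh + itg M" by (simp add: LR)
  also have "\<dots> = itg (\<lambda>x. 2 * Rh x + M x)"
   by (subst integral_add) (auto intro!: integrable continuous_intros cL)
  also have "\<dots> \<le> itg (\<lambda>x. CR * B\<^sup>2 + (CR + K1) * PP k qq uu x)"
  proof (rule integral_le_Ioo)
   fix x :: real assume x: "0 < x" "x < 1"
   then have x': "x \<in> {0..1}" by simp
   define P where "P = PP k qq uu x"
   define U Q Q1 X W where u: "U = dp uu i x" "Q = dp qq i x" "Q1 = dp qq (i + 1) x" "X = XX x" "W = w i x"
   define R where "R = at_poly (Rs i) qq uu x"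
   have Pt: "W * U\<^sup>2 \<le> P" "W * Q\<^sup>2 \<le> P" "W * (X * Q1\<^sup>2) \<le> P" "0 \<le> P"
    unfolding P_def u using PP_term(1-3)[OF i(2) x'] PP_nonneg[OF x'] by auto
   have W: "0 \<le> W" "0 \<le> X" "X \<le> 1" unfolding u using w_nonneg[OF x'] XX_bounds[OF x'] by auto
   define e1' where "e1' = at_poly (TT A) qq uu x + (c (jt qq uu x) - i * at_poly (TT A) qq uu x)"
   define f1 where "f1 = d i x * b (jt qq uu x) + XX x * at_poly (TT b) qq uu x"
   have ta: "\<bar>at_poly (TT A) qq uu x\<bar> \<le> Ta" "\<bar>at_poly (TT b) qq uu x\<bar> \<le> Tb" using Ta(2)[rule_format, OF g x] Tb(2)[rule_format, OF g x] .
   have cb: "\<bar>b (jt qq uu x)\<bar> \<le> Cb" "\<bar>c (jt qq uu x)\<bar> \<le> Cc" using Cb(2)[rule_format, OF s x'] Cc(2)[rule_format, OF s x'] .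
   have e: "\<bar>- e1'\<bar> \<le> E"
   proof -
    have "\<bar>real i * at_poly (TT A) qq uu x\<bar> \<le> real i * Ta" unfolding abs_mult using ta by (simp add: mult_left_mono)
    then show ?thesis unfolding e1'_def E_def using ta cb by linarith
   qed
   have dd: "\<bar>d i x\<bar> \<le> Cd"
   proof -
    have gen: "\<bar>r - r'\<bar> \<le> R + R'" if "0 \<le> r" "r \<le> R" "0 \<le> r'" "r' \<le> R'" for r r' R R' :: real using that by linarith
    have "\<bar>d i x\<bar> \<le> (al + 1 + real i) * 1 + (be + 1 + real i) * 1"
     unfolding d_def using al be x by (intro gen mult_left_mono mult_nonneg_nonneg) auto
    then show ?thesis unfolding Cd_def by simp
   qed
   have f: "\<bar>f1\<bar> \<le> Cd * Cb + Tb"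
   proof -
    have "\<bar>d i x * b (jt qq uu x)\<bar> \<le> Cd * Cb" unfolding abs_mult using dd cb E0 by (intro mult_mono) auto
    moreover have "\<bar>XX x * at_poly (TT b) qq uu x\<bar> \<le> 1 * Tb" unfolding abs_mult using W ta by (intro mult_mono) (auto simp: u)
    ultimately show ?thesis unfolding f1_def by linarith
   qed
   have 1: "W * (2 * (- e1' * X * (Q1 * U))) \<le> E * (2 * P)"
   proof -
    have "W * (2 * (- e1' * X * (Q1 * U))) = (W * X) * (2 * (- e1' * (Q1 * U)))" by simp
    also have "\<dots> \<le> (W * X) * (E * (Q1\<^sup>2 + U\<^sup>2))" using W by (intro mult_left_mono abs_prod_le[OF e]) auto
    also have "\<dots> = E * (W * (X * Q1\<^sup>2) + X * (W * U\<^sup>2))" by (simp add: algebra_simps)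
    also have "\<dots> \<le> E * (P + 1 * P)" using W Pt E0 by (intro mult_left_mono add_mono mult_mono) auto
    finally show ?thesis by simp
   qed
   have 2: "W * (f1 * U\<^sup>2) \<le> (Cd * Cb + Tb) * P" using W Pt f by (intro weighted_sq_le) auto
   have 3: "W * (2 * (- 1 * (R * U))) \<le> CR * (B\<^sup>2 + P) + P"
   proof -
    have "W * (2 * (- 1 * (R * U))) \<le> W * (1 * (R\<^sup>2 + U\<^sup>2))" using W by (intro mult_left_mono abs_prod_le) auto
    also have "\<dots> = W * R\<^sup>2 + W * U\<^sup>2" by (simp add: distrib_left)
    also have "\<dots> \<le> CR * (B\<^sup>2 + P) + P"
    proof (rule add_mono)
     have "W * R\<^sup>2 \<le> CR * (B\<^sup>2 + (\<Sum>j\<le>i. w j x * ((dp qq j x)\<^sup>2 + (dp uu j x)\<^sup>2)))"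
      unfolding u R_def by (rule CR(2)[rule_format, OF goodD(1)[OF gp x]])
     also have "\<dots> \<le> CR * (B\<^sup>2 + P)"
     proof (intro mult_left_mono add_left_mono CR(1))
      have "(\<Sum>j\<le>i. w j x * ((dp qq j x)\<^sup>2 + (dp uu j x)\<^sup>2)) \<le> (\<Sum>j\<le>k. pe j qq uu x)"
      proof (rule sum_le_included[where i = "\<lambda>j. j"])
       show "\<forall>j\<in>{..i}. \<exists>j'\<in>{..k}. j' = j \<and> w j x * ((dp qq j x)\<^sup>2 + (dp uu j x)\<^sup>2)
         \<le> pe j' qq uu x"
        using i(2) w_nonneg[OF x'] W by (auto intro!: mult_left_mono simp: u)
      qed (use w_nonneg[OF x'] W in \<open>auto simp: u\<close>)
      then show "(\<Sum>j\<le>i. w j x * ((dp qq j x)\<^sup>2 + (dp uu j x)\<^sup>2)) \<le> P" by (simp add: P_def PP_def)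
     qed
     finally show "W * R\<^sup>2 \<le> CR * (B\<^sup>2 + P)" .
    qed (rule Pt)
    finally show ?thesis .
   qed
   have 4: "W * (2 * (1 * (Q * U))) \<le> 2 * P"
   proof -
    have "W * (2 * (1 * (Q * U))) \<le> W * (1 * (Q\<^sup>2 + U\<^sup>2))" using W by (intro mult_left_mono abs_prod_le) auto
    also have "\<dots> = W * Q\<^sup>2 + W * U\<^sup>2" by (simp add: distrib_left)
    finally show ?thesis using Pt by linarith
   qed
   have 5: "W * (At qq uu aa x * (X * Q1\<^sup>2)) \<le> D * P"
    by (rule weighted_sq_le) (use W D(2)[rule_format, OF s g x] Pt in auto)
   have "2 * Rh x + M x = W * (2 * (- e1' * X * (Q1 * U))) + W * (f1 * U\<^sup>2) + W * (2 * (- 1 * (R * U))) + W * (2 * (1 * (Q * U))) + W * (At qq uu aa x * (X * Q1\<^sup>2))"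
    unfolding Rh_def M_def R_def[symmetric] e1'_def[symmetric] f1_def[symmetric]
    unfolding u[symmetric] by (simp add: field_simps)
   also have "\<dots> \<le> E * (2 * P) + (Cd * Cb + Tb) * P + (CR * (B\<^sup>2 + P) + P) + 2 * P + D * P"
    using 1 2 3 4 5 by (intro add_mono)
   also have "\<dots> = CR * B\<^sup>2 + (CR + K1) * P" unfolding K1_def by (simp add: algebra_simps)
   finally show "2 * Rh x + M x \<le> CR * B\<^sup>2 + (CR + K1) * PP k qq uu x" by (simp add: P_def)
  qed (intro continuous_intros cL cA)+
  also have "\<dots> = CR * B\<^sup>2 + (CR + K1) * itg (PP k qq uu)"
   by (subst integral_add) (auto intro!: integrable continuous_intros cA)
  also have "\<dots> \<le> (CR + K1) * B\<^sup>2 + (CR + K1) * itg (PP k qq uu)"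
   using K10 by (intro add_mono mult_right_mono integral_nonneg integrable continuous_PP PP_nonneg) auto
  finally show "itg (rate i qq uu aa) \<le> (CR + K1) * (B\<^sup>2 + itg (PP k qq uu))" by (simp add: distrib_left)
 qed (use K10 CR(1) in simp)
qed

lemma rate_total:
 assumes h: "\<mu> + 7 \<le> h" "h \<le> p" "k \<le> p + 2" "k + 8 \<le> 4 * h" and k: "3 \<le> k" and B0: "0 \<le> B0"
 shows "\<exists>K\<ge>0. \<forall>n qq uu aa B. slice n qq uu aa \<longrightarrow> good h p B0 qq uu B \<longrightarrow>
  (\<Sum>i\<le>k. itg (rate i qq uu aa)) \<le> K * (B\<^sup>2 + En k qq uu)"
proof -
 have "\<exists>C. \<forall>i. i \<le> k \<longrightarrow> (C i \<ge> 0 \<and> (rate_bd h p k B0 i (C i)))"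
 proof (rule bounded_choice)
  fix i assume i: "i \<le> k"
  show "\<exists>C\<ge>0. rate_bd h p k B0 i C"
  proof (cases "i \<le> 2")
   case True
   obtain C where "C \<ge> 0" "rate_bd h h k B0 i C"
    using rate_low[OF h(1) True k B0] by (elim exE conjE)
   then show ?thesis using good_le[OF _ h(2)] by (intro exI[of _ C] conjI allI impI) blast+
  next
   case False
   then have "3 \<le> i" by simp
   show ?thesis by (rule rate_high[OF h \<open>3 \<le> i\<close> i B0])
  qed
 qed
 then obtain C where C: "\<forall>i. i \<le> k \<longrightarrow> (C i \<ge> 0 \<and> (rate_bd h p k B0 i (C i)))" by (elim exE)
 obtain K where K: "K \<ge> 1" "\<forall>n qq uu aa k. slice n qq uu aa \<longrightarrow>
  itg (PP k qq uu) \<le> K * En k qq uu \<and> En k qq uu \<le> K * itg (PP k qq uu)"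
  using En_PP_equiv by (elim exE conjE)
 define D where "D = (\<Sum>i\<le>k. C i)"
 have D: "D \<ge> 0" unfolding D_def by (rule sum_nonneg) (use C[rule_format, THEN conjunct1] in simp)
 show ?thesis
 proof (intro exI[of _ "D * K"] conjI allI impI)
  fix n qq uu aa B assume s: "slice n qq uu aa" and g: "good h p B0 qq uu B"
  have p: "0 \<le> itg (PP k qq uu)" by (intro integral_nonneg integrable continuous_PP PP_nonneg)
  have pk: "itg (PP k qq uu) \<le> K * En k qq uu" using K(2) s by blast
  have "(\<Sum>i\<le>k. itg (rate i qq uu aa)) \<le> (\<Sum>i\<le>k. C i * (B\<^sup>2 + itg (PP k qq uu)))"
  proof (rule sum_mono)
   fix i assume "i \<in> {..k}" then have "i \<le> k" by simp
   show "itg (rate i qq uu aa) \<le> C i * (B\<^sup>2 + itg (PP k qq uu))"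
    by (rule C[rule_format, OF \<open>i \<le> k\<close>, THEN conjunct2, rule_format, OF s g])
  qed
  also have "\<dots> = D * (B\<^sup>2 + itg (PP k qq uu))" by (simp add: D_def sum_distrib_right)
  also have "\<dots> \<le> D * (K * (B\<^sup>2 + En k qq uu))"
  proof (rule mult_left_mono[OF _ D])
   have "1 * B\<^sup>2 \<le> K * B\<^sup>2" using K(1) by (intro mult_right_mono) auto
   then show "B\<^sup>2 + itg (PP k qq uu) \<le> K * (B\<^sup>2 + En k qq uu)"
    using pk by (simp add: distrib_left)
  qed
  finally show "(\<Sum>i\<le>k. itg (rate i qq uu aa)) \<le> D * K * (B\<^sup>2 + En k qq uu)" by (simp add: mult.assoc)
 qed (use D K(1) in simp)
qed

end

section \<open>Evolution in time: growth of the energies and persistence of smallness\<close>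

lemma gronwall:
 fixes f f' :: "real \<Rightarrow> real"
 assumes f: "\<And>t. t \<in> {0..\<tau>} \<Longrightarrow> (f has_real_derivative f' t) (at t within {0..\<tau>})"
  and le: "\<And>t. t \<in> {0..\<tau>} \<Longrightarrow> f' t \<le> K * f t" and \<tau>: "0 \<le> \<tau>"
 shows "f \<tau> \<le> f 0 * exp (K * \<tau>)"
proof -
 have "f \<tau> * exp (- K * \<tau>) \<le> f 0 * exp (- K * 0)"
 proof (rule DERIV_nonpos_imp_decreasing_open[OF \<tau>])
  show "continuous_on {0..\<tau>} (\<lambda>t. f t * exp (- K * t))"
   by (intro continuous_intros DERIV_continuous_on[OF f])
  fix t assume t: "0 < t" "t < \<tau>"
  have d: "(f has_real_derivative f' t) (at t)"
   using f[of t] t at_within_interior[of t "{0..\<tau>}"] by simp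
  have e: "((\<lambda>t. exp (- K * t)) has_real_derivative exp (- K * t) * (- K)) (at t)"
   by (rule derivative_eq_intros refl | simp)+
  have "f' t * exp (- K * t) + exp (- K * t) * (- K) * f t \<le> 0"
  proof -
   have "exp (- K * t) * f' t \<le> exp (- K * t) * (K * f t)" using le[of t] t by (intro mult_left_mono) auto
   then show ?thesis by (simp add: algebra_simps)
  qed
  then show "\<exists>y. ((\<lambda>t. f t * exp (- K * t)) has_real_derivative y) (at t) \<and> y \<le> 0"
   using DERIV_mult[OF d e] by (intro exI conjI) auto
 qed
 then have "f \<tau> * exp (- K * \<tau>) * exp (K * \<tau>) \<le> f 0 * exp (K * \<tau>)" by (intro mult_right_mono) auto
 then show ?thesis by (simp add: mult.assoc flip: exp_add)
qed

text \<open>At the first time the threshold is reached, all values up to then are at most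
  \<open>\<eta>\<close>, so \<open>step\<close> gives a strict inequality there, a
  contradiction.\<close>

lemma continuity_method:
 fixes \<phi> :: "real \<Rightarrow> real"
 assumes c: "continuous_on {0..T} \<phi>" and z: "\<phi> 0 < \<eta>"
  and step: "\<And>\<tau>. \<tau> \<in> {0..T} \<Longrightarrow> \<forall>t\<in>{0..\<tau>}. \<phi> t \<le> \<eta> \<Longrightarrow> \<phi> \<tau> < \<eta>"
 shows "\<forall>t\<in>{0..T}. \<phi> t < \<eta>"
proof (rule ccontr)
 assume "\<not> (\<forall>t\<in>{0..T}. \<phi> t < \<eta>)"
 define Z where "Z = {t\<in>{0..T}. \<phi> t \<in> {\<eta>..}}"
 have ne: "Z \<noteq> {}" using \<open>\<not> (\<forall>t\<in>{0..T}. \<phi> t < \<eta>)\<close> by (force simp: Z_def)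
 have "closed Z" using continuous_closed_preimage[OF c closed_atLeastAtMost closed_atLeast[of \<eta>]]
  by (simp add: Z_def vimage_def Int_def)
 then have "compact ({0..T} \<inter> Z)" by (intro compact_Int_closed compact_Icc)
 moreover have "{0..T} \<inter> Z = Z" by (auto simp: Z_def)
 ultimately have cp: "compact Z" by simp
 obtain t0 where t0: "t0 \<in> Z" "\<And>t. t \<in> Z \<Longrightarrow> t0 \<le> t"
  using compact_attains_inf[OF cp ne] by blast
 have t0T: "0 \<le> t0" "t0 \<le> T" "\<eta> \<le> \<phi> t0" using t0(1) by (auto simp: Z_def)
 have "\<exists>t. 0 \<le> t \<and> t \<le> t0 \<and> \<phi> t = \<eta>"
  by (rule IVT') (use z t0T c continuous_on_subset[OF c, of "{0..t0}"] in auto)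
 then obtain t where t: "0 \<le> t" "t \<le> t0" "\<phi> t = \<eta>" by blast
 have "t \<in> Z" using t t0T by (simp add: Z_def)
 then have "t = t0" using t0(2)[of t] t by simp
 have "\<phi> s \<le> \<eta>" if "s \<in> {0..t0}" for s
 proof (cases "s = t0")
  case True then show ?thesis using \<open>t = t0\<close> t by simp
 next
  case False
  then have "s \<notin> Z" using t0(2)[of s] that by auto
  then show ?thesis using that t0T by (auto simp: Z_def)
 qed
 then have "\<phi> t0 < \<eta>" using t0T by (intro step) auto
 then show False using t0T by simp
qed

context wave
begin

definition evolves :: "real \<Rightarrow> (real \<Rightarrow> real poly) \<Rightarrow> (real \<Rightarrow> real poly) \<Rightarrow> (real \<Rightarrow> real poly) \<Rightarrow> bool" where
 "evolves T q u a \<longleftrightarrow>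
  (\<forall>i x. \<forall>t\<in>{0..T}. ((\<lambda>t. dp (q t) i x) has_real_derivative dp (u t) i x) (at t within {0..T}) \<and>
    ((\<lambda>t. dp (u t) i x) has_real_derivative dp (a t) i x) (at t within {0..T})) \<and>
  (\<forall>i. continuous_on ({0..T} \<times> {0..1}) (\<lambda>(t, x). dp (q t) i x) \<and> continuous_on ({0..T} \<times> {0..1}) (\<lambda>(t, x). dp (u t) i x)
    \<and> continuous_on ({0..T} \<times> {0..1}) (\<lambda>(t, x). dp (a t) i x))"

lemma evolvesD:
 assumes "evolves T q u a"
 shows "t \<in> {0..T} \<Longrightarrow> ((\<lambda>t. dp (q t) i x) has_real_derivative dp (u t) i x) (at t within {0..T})"
  "t \<in> {0..T} \<Longrightarrow> ((\<lambda>t. dp (u t) i x) has_real_derivative dp (a t) i x) (at t within {0..T})"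
  "continuous_on ({0..T} \<times> {0..1}) (\<lambda>p. dp (q (fst p)) i (snd p))"
  "continuous_on ({0..T} \<times> {0..1}) (\<lambda>p. dp (u (fst p)) i (snd p))"
  "continuous_on ({0..T} \<times> {0..1}) (\<lambda>p. dp (a (fst p)) i (snd p))"
 using assms unfolding evolves_def case_prod_unfold by auto

lemma evolves_subset:
 assumes e: "evolves T q u a" and \<tau>: "\<tau> \<le> T"
 shows "evolves \<tau> q u a"
 unfolding evolves_def case_prod_unfold
proof (intro conjI allI ballI)
 fix i x t assume "t \<in> {0..\<tau>}"
 then have t: "t \<in> {0..T}" using \<tau> by simp
 show "((\<lambda>t. dp (q t) i x) has_real_derivative dp (u t) i x) (at t within {0..\<tau>})"
  by (rule DERIV_subset[OF evolvesD(1)[OF e t]]) (use \<tau> in auto)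
 show "((\<lambda>t. dp (u t) i x) has_real_derivative dp (a t) i x) (at t within {0..\<tau>})"
  by (rule DERIV_subset[OF evolvesD(2)[OF e t]]) (use \<tau> in auto)
next
 fix i
 have sub: "{0..\<tau>} \<times> {0..1} \<subseteq> {0..T} \<times> {0..1::real}" using \<tau> by auto
 show "continuous_on ({0..\<tau>} \<times> {0..1}) (\<lambda>p. dp (q (fst p)) i (snd p))" "continuous_on ({0..\<tau>} \<times> {0..1}) (\<lambda>p. dp (u (fst p)) i (snd p))"
  "continuous_on ({0..\<tau>} \<times> {0..1}) (\<lambda>p. dp (a (fst p)) i (snd p))"
  by (rule continuous_on_subset[OF evolvesD(3)[OF e] sub] continuous_on_subset[OF evolvesD(4)[OF e] sub] continuous_on_subset[OF evolvesD(5)[OF e] sub])+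
qed

lemma continuous_jt:
 assumes e: "evolves T q u a"
 shows "continuous_on ({0..T} \<times> {0..1}) (\<lambda>p. jt (q (fst p)) (u (fst p)) (snd p))"
 unfolding jet_def by (intro continuous_intros evolvesD[OF e])

lemma continuous_smooth_jt:
 assumes e: "evolves T q u a" and sl: "\<forall>t\<in>{0..T}. slice n (q t) (u t) (a t)" and \<Phi>: "smooth S \<Phi>"
 shows "continuous_on ({0..T} \<times> {0..1}) (\<lambda>p. \<Phi> (jt (q (fst p)) (u (fst p)) (snd p)))"
proof (rule continuous_on_compose2[OF smooth_continuous[OF \<Phi>] continuous_jt[OF e]])
 show "(\<lambda>p. jt (q (fst p)) (u (fst p)) (snd p)) ` ({0..T} \<times> {0..1}) \<subseteq> S"
 proof (rule image_subsetI)
  fix p :: "real \<times> real" assume p: "p \<in> {0..T} \<times> {0..1}"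
  have "slice n (q (fst p)) (u (fst p)) (a (fst p))" using sl p by auto
  from jbD[OF this] show "jt (q (fst p)) (u (fst p)) (snd p) \<in> S" using p \<rho>(2) by auto
 qed
qed

lemma lev_deriv:
 assumes e: "evolves T q u a" and sl: "\<forall>t\<in>{0..T}. slice n (q t) (u t) (a t)" and t: "t \<in> {0..T}"
 shows "((\<lambda>t. lev i (q t) (u t)) has_real_derivative itg (rate i (q t) (u t) (a t))) (at t within {0..T})"
proof -
 let ?f = "\<lambda>t x. w i x * ((dp (u t) i x)\<^sup>2 + (dp (q t) i x)\<^sup>2 + XX x * A (jt (q t) (u t) x) * (dp (q t) (i + 1) x)\<^sup>2)"
 have jS: "jt (q t) (u t) x \<in> S" if "t \<in> {0..T}" "x \<in> {0..1}" for t x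
  using jbD[of n "q t" "u t" "a t"] sl that \<rho>(2) by auto
 have "((\<lambda>t. integral (cbox 0 1) (?f t)) has_real_derivative integral (cbox 0 1) (rate i (q t) (u t) (a t))) (at t within {0..T})"
 proof (rule leibniz_rule_field_derivative[OF _ _ _ t convex_real_interval(5)])
  fix s x :: real assume s: "s \<in> {0..T}" and "x \<in> cbox 0 1"
  then have x: "x \<in> {0..1}" by simp
  have D: "((\<lambda>t. A (jt (q t) (u t) x)) has_real_derivative At (q s) (u s) (a s) x) (at s within {0..T})"
   unfolding jet_def
   by (rule smooth_chain6[OF S smA _ DERIV_const evolvesD(1)[OF e s] evolvesD(1)[OF e s] evolvesD(1)[OF e s] evolvesD(2)[OF e s] evolvesD(2)[OF e s], THEN DERIV_cong])
    (use jS[OF s x] in \<open>auto simp: jet_def At_def\<close>)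
  note d = evolvesD(1)[OF e s, of i x] evolvesD(2)[OF e s, of i x] evolvesD(1)[OF e s, of "i + 1" x]
  note P = DERIV_power[of _ _ _ _ 2]
  have "((\<lambda>t. ?f t x) has_real_derivative w i x * ((real 2 * (dp (a s) i x * dp (u s) i x ^ (2 - Suc 0)) + real 2 * (dp (u s) i x * dp (q s) i x ^ (2 - Suc 0)))
    + (XX x * At (q s) (u s) (a s) x * (dp (q s) (i + 1) x)\<^sup>2 + real 2 * (dp (u s) (i + 1) x * dp (q s) (i + 1) x ^ (2 - Suc 0)) * (XX x * A (jt (q s) (u s) x))))) (at s within {0..T})"
   by (intro DERIV_cmult DERIV_add DERIV_mult DERIV_power d D)
  then show "((\<lambda>t. ?f t x) has_real_derivative rate i (q s) (u s) (a s) x) (at s within {0..T})"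
   by (rule DERIV_cong) (simp add: rate_def algebra_simps)
 next
  fix s assume s: "s \<in> {0..T}"
  have "continuous_on {0..1} (?f s)"
   by (intro continuous_intros cont_smooth_slice[OF jbD[of n "q s" "u s" "a s"] smA]) (use sl s in auto)
  then show "?f s integrable_on cbox 0 1" unfolding cbox_interval by (rule integrable)
 next
  have w: "continuous_on ({0..T} \<times> {0..1}) (\<lambda>p. w i (snd p))"
   by (rule continuous_on_compose2[OF continuous_w continuous_on_snd[OF continuous_on_id]]) auto
  show "continuous_on ({0..T} \<times> cbox 0 1) (\<lambda>(s, x). rate i (q s) (u s) (a s) x)"
   unfolding case_prod_unfold rate_def At_def cbox_interval
   by (intro continuous_intros w evolvesD[OF e] continuous_smooth_jt[OF e sl] smA smooth_pd[OF S smA] jet_Basis)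
 qed
 then show ?thesis unfolding lev_def cbox_interval .
qed

lemma En_deriv:
 assumes e: "evolves T q u a" and sl: "\<forall>t\<in>{0..T}. slice n (q t) (u t) (a t)" and t: "t \<in> {0..T}"
 shows "((\<lambda>t. En k (q t) (u t)) has_real_derivative (\<Sum>i\<le>k. itg (rate i (q t) (u t) (a t)))) (at t within {0..T})"
 unfolding En_def by (rule DERIV_sum) (rule lev_deriv[OF e sl t])

lemma continuous_PP_integral:
 assumes e: "evolves T q u a"
 shows "continuous_on {0..T} (\<lambda>t. itg (PP k (q t) (u t)))"
proof -
 have w: "continuous_on ({0..T} \<times> {0..1}) (\<lambda>p. w i (snd p))" for i
  by (rule continuous_on_compose2[OF continuous_w continuous_on_snd[OF continuous_on_id]]) auto
 have "continuous_on ({0..T} \<times> cbox 0 1) (\<lambda>(s, x). PP k (q s) (u s) x)"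
  unfolding case_prod_unfold PP_def cbox_interval by (intro continuous_intros w evolvesD[OF e])
 then have "continuous_on {0..T} (\<lambda>t. integral (cbox 0 1) (PP k (q t) (u t)))" by (rule integral_continuous_on_param)
 then show ?thesis by (simp add: cbox_interval)
qed

lemma PP_data:
 assumes "\<And>i x. i \<le> k + 1 \<Longrightarrow> x \<in> {0..1} \<Longrightarrow> \<bar>dp qq i x\<bar> \<le> e \<and> \<bar>dp uu i x\<bar> \<le> e"
 shows "itg (PP k qq uu) \<le> 3 * (real k + 1) * e\<^sup>2"
proof -
 have "itg (PP k qq uu) \<le> itg (\<lambda>x::real. 3 * (real k + 1) * e\<^sup>2)"
 proof (rule integral_le_Ioo)
  fix x :: real assume "0 < x" "x < 1"
  then have x: "x \<in> {0..1}" by simp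
  have "PP k qq uu x \<le> (\<Sum>i\<le>k. 3 * e\<^sup>2)" unfolding PP_def
  proof (rule sum_mono)
   fix i assume "i \<in> {..k}" then have i: "i \<le> k + 1" "i + 1 \<le> k + 1" by simp_all
   have sq: "z\<^sup>2 \<le> e\<^sup>2" if "\<bar>z\<bar> \<le> e" for z :: real using power_mono[OF that abs_ge_zero, of 2] by simp
   have "XX x * (dp qq (i + 1) x)\<^sup>2 \<le> 1 * e\<^sup>2" using XX_bounds[OF x] sq assms[OF i(2) x] by (intro mult_mono) auto
   moreover have "(dp uu i x)\<^sup>2 \<le> e\<^sup>2" "(dp qq i x)\<^sup>2 \<le> e\<^sup>2" using sq assms[OF i(1) x] by auto
   ultimately have "(dp uu i x)\<^sup>2 + (dp qq i x)\<^sup>2 + XX x * (dp qq (i + 1) x)\<^sup>2 \<le> 3 * e\<^sup>2" by simp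
   then have "pe i qq uu x \<le> 1 * (3 * e\<^sup>2)"
    using w_le1[OF x] w_nonneg[OF x] XX_bounds[OF x] by (intro mult_mono) auto
   then show "pe i qq uu x \<le> 3 * e\<^sup>2" by simp
  qed
  then show "PP k qq uu x \<le> 3 * (real k + 1) * e\<^sup>2" by (simp add: algebra_simps)
 qed (intro continuous_intros continuous_PP)+
 then show ?thesis by simp
qed

lemma energy_le_PP:
 "energy k (dp qq) \<le> itg (PP k qq uu)" "energy k (dp uu) \<le> itg (PP k qq uu)"
proof -
 have PP: "itg (PP k qq uu) = (\<Sum>i\<le>k. itg (\<lambda>x. pe i qq uu x))"
  unfolding PP_def[abs_def] by (intro integral_sum integrable continuous_intros) simp
 show "energy k (dp qq) \<le> itg (PP k qq uu)" "energy k (dp uu) \<le> itg (PP k qq uu)"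
  unfolding PP energy_def
  by (intro sum_mono integral_le_Ioo continuous_intros mult_left_mono; use w_nonneg XX_bounds in force)+
qed

lemma PP_mono: "k \<le> k' \<Longrightarrow> itg (PP k qq uu) \<le> itg (PP k' qq uu)"
proof (intro integral_le_Ioo continuous_PP)
 fix x :: real assume "k \<le> k'" "0 < x" "x < 1"
 then show "PP k qq uu x \<le> PP k' qq uu x" unfolding PP_def
  using w_nonneg XX_bounds by (intro sum_mono2) auto
qed

text \<open>The largest \<open>h\<close> that the Sobolev inequality admits for an energy of order
  \<open>m\<close>.\<close>

definition hh :: "nat \<Rightarrow> nat" where "hh m = (m - \<mu> - 3) div 2"
text \<open>Large enough that, for \<open>m \<ge> m0\<close>, \<open>hh m\<close> reaches the
  \<open>\<mu> + 7\<close> required by the acceleration bounds and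
  \<open>k + 8 \<le> 4 * hh m\<close> holds up to \<open>k = m + 1\<close>.\<close>

definition m0 :: nat where "m0 = 3 * \<mu> + 18"

lemma hh: "m0 \<le> m \<Longrightarrow> 4 * real (hh m) + 2 * \<mu> + 5 \<le> 2 * real m" "m0 \<le> m \<Longrightarrow> \<mu> + 7 \<le> hh m"
 "m0 \<le> m \<Longrightarrow> hh m \<le> m - 1" "m0 \<le> m \<Longrightarrow> m + 9 \<le> 4 * hh m" "m0 \<le> m \<Longrightarrow> 18 \<le> m"
proof -
 assume "m0 \<le> m"
 define s where "s = m - \<mu> - 3"
 have s: "m = s + \<mu> + 3" "2 * \<mu> + 15 \<le> s" using \<open>m0 \<le> m\<close> by (simp_all add: s_def m0_def)
 have "s = 2 * (s div 2) + s mod 2" "s mod 2 < 2" by simp_all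
 then have d: "2 * hh m \<le> s" "s \<le> 2 * hh m + 1" unfolding hh_def s_def[symmetric] by linarith+
 have "4 * hh m + 2 * \<mu> + 5 \<le> 2 * m" using d s by linarith
 then show "4 * real (hh m) + 2 * \<mu> + 5 \<le> 2 * real m" by linarith
 show "\<mu> + 7 \<le> hh m" "hh m \<le> m - 1" "m + 9 \<le> 4 * hh m" "18 \<le> m" using d s by linarith+
qed

abbreviation "PP_sup_bd m C \<equiv> \<forall>qq uu j x. j < m \<longrightarrow> 0 < x \<longrightarrow> x < 1 \<longrightarrow>
  XX x ^ (j - hh m) * \<bar>dp qq j x\<bar> \<le> C * sqrt (itg (PP m qq uu)) \<and>
  XX x ^ (j - hh m) * \<bar>dp uu j x\<bar> \<le> C * sqrt (itg (PP m qq uu))"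

lemma PP_sobolev:
 assumes m: "m0 \<le> m"
 shows "\<exists>C\<ge>0. PP_sup_bd m C"
proof -
 obtain C where C: "C \<ge> 0" "\<forall>f. derivs f \<longrightarrow> (\<forall>j<m. \<forall>x. 0 < x \<longrightarrow> x < 1 \<longrightarrow> XX x ^ (j - hh m) * \<bar>f j x\<bar> \<le> C * sqrt (energy m f))"
  using sobolev[OF hh(1)[OF m]] by (elim exE conjE)
 show ?thesis
 proof (intro exI[of _ C] conjI allI impI)
  fix qq uu j and x :: real assume j: "j < m" "0 < x" "x < 1"
  have l: "C * sqrt (energy m (dp qq)) \<le> C * sqrt (itg (PP m qq uu))" "C * sqrt (energy m (dp uu)) \<le> C * sqrt (itg (PP m qq uu))"
   using C(1) energy_le_PP(1)[of m qq uu] energy_le_PP(2)[of m uu qq] by (auto intro!: mult_left_mono)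
  show "XX x ^ (j - hh m) * \<bar>dp qq j x\<bar> \<le> C * sqrt (itg (PP m qq uu))"
   using C(2)[rule_format, OF derivs_dp j] l(1) by (rule order_trans)
  show "XX x ^ (j - hh m) * \<bar>dp uu j x\<bar> \<le> C * sqrt (itg (PP m qq uu))"
   using C(2)[rule_format, OF derivs_dp j] l(2) by (rule order_trans)
 qed (rule C(1))
qed

lemma PP_int_nonneg: "0 \<le> itg (PP k qq uu)"
 by (intro integral_nonneg integrable continuous_PP PP_nonneg)

abbreviation "growth_bd T m k \<eta> K \<equiv> \<forall>n q u a \<tau> e. \<tau> \<in> {0..T} \<longrightarrow> evolves T q u a \<longrightarrow>
  (\<forall>t\<in>{0..\<tau>}. slice n (q t) (u t) (a t) \<and> itg (PP m (q t) (u t)) \<le> \<eta>) \<longrightarrow>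
  (\<forall>i\<le>k + 1. \<forall>x\<in>{0..1}. \<bar>dp (q 0) i x\<bar> \<le> e \<and> \<bar>dp (u 0) i x\<bar> \<le> e) \<longrightarrow>
  itg (PP k (q \<tau>) (u \<tau>)) \<le> K * e\<^sup>2"

text \<open>A bound on the energy of order \<open>m\<close> makes the rates of order
  \<open>m\<close> and \<open>m + 1\<close> linear in the energy. The pointwise size
  \<open>B\<close> is itself a multiple of the square root of the energy integral of order
  \<open>m\<close>, so the differential inequality is homogeneous and the result is a multiple of
  \<open>e\<^sup>2\<close> without additive constant. The case \<open>k = m\<close> keeps the energy
  small, the case \<open>k = m + 1\<close> gains one order.\<close>

lemma growth:
 assumes m: "m0 \<le> m" and k: "m \<le> k" "k \<le> Suc m" and \<eta>: "0 \<le> \<eta>" and T: "0 \<le> T"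
 shows "\<exists>K\<ge>0. growth_bd T m k \<eta> K"
proof -
 note hm = hh[OF m]
 obtain C where C: "C \<ge> 0" "PP_sup_bd m C"
  using PP_sobolev[OF m] by (elim exE conjE)
 define B0 where "B0 = C * sqrt \<eta>"
 have B0: "B0 \<ge> 0" using C(1) \<eta> by (simp add: B0_def)
 have kk: "k \<le> m - 1 + 2" "k + 8 \<le> 4 * hh m" "3 \<le> k" using k hm by simp_all
 obtain K1 where K1: "K1 \<ge> 0" "\<forall>n qq uu aa B. slice n qq uu aa \<longrightarrow> good (hh m) (m - 1) B0 qq uu B \<longrightarrow>
  (\<Sum>i\<le>k. itg (rate i qq uu aa)) \<le> K1 * (B\<^sup>2 + En k qq uu)"
  using rate_total[OF hm(2,3) kk B0] by (elim exE conjE)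
 obtain K2 where K2: "K2 \<ge> 1" "\<forall>n qq uu aa k. slice n qq uu aa \<longrightarrow>
  itg (PP k qq uu) \<le> K2 * En k qq uu \<and> En k qq uu \<le> K2 * itg (PP k qq uu)"
  using En_PP_equiv by (elim exE conjE)
 note K2 = K2(1) K2(2)[rule_format, THEN conjunct1] K2(2)[rule_format, THEN conjunct2]
 have K20: "0 \<le> K2" using K2(1) by simp
 define K4 where "K4 = K1 * (C\<^sup>2 * K2 + 1)"
 have K4: "K4 \<ge> 0" using K1(1) K20 by (simp add: K4_def)
 define K5 where "K5 = K2 * (3 * (real k + 1)) * exp (K4 * T)"
 have K5: "K5 \<ge> 0" using K20 by (simp add: K5_def)
 show ?thesis
 proof (intro exI[of _ "K2 * K5"] conjI allI impI)
  fix n q u a \<tau> e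
  assume \<tau>: "\<tau> \<in> {0..T}" and ev: "evolves T q u a"
   and sl: "\<forall>t\<in>{0..\<tau>}. slice n (q t) (u t) (a t) \<and> itg (PP m (q t) (u t)) \<le> \<eta>"
   and data: "\<forall>i\<le>k + 1. \<forall>x\<in>{0..1}. \<bar>dp (q 0) i x\<bar> \<le> e \<and> \<bar>dp (u 0) i x\<bar> \<le> e"
  have ev': "evolves \<tau> q u a" by (rule evolves_subset[OF ev]) (use \<tau> in simp)
  have sl': "\<forall>t\<in>{0..\<tau>}. slice n (q t) (u t) (a t)" using sl by simp
  have z: "0 \<in> {0..\<tau>}" "\<tau> \<in> {0..\<tau>}" using \<tau> by simp_all
  have "En k (q \<tau>) (u \<tau>) \<le> En k (q 0) (u 0) * exp (K4 * \<tau>)"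
  proof (rule gronwall[OF En_deriv[OF ev' sl']])
   fix t assume t: "t \<in> {0..\<tau>}"
   have s: "slice n (q t) (u t) (a t)" and pp: "itg (PP m (q t) (u t)) \<le> \<eta>" using sl t by auto
   define B where "B = C * sqrt (itg (PP m (q t) (u t)))"
   have B: "0 \<le> B" "B \<le> B0" unfolding B_def B0_def using C(1) PP_int_nonneg pp by (auto intro!: mult_left_mono)
   have "good (hh m) (m - 1) B0 (q t) (u t) B"
    unfolding good_def adm_def
   proof (intro allI impI conjI)
    fix x :: real assume x: "0 < x" "x < 1"
    then show "jt (q t) (u t) x \<in> jbox \<rho>" using jbD[OF s] by simp
    fix i assume "i \<le> m - 1"
    then have "i < m" using hm(5) by simp
    from C(2)[rule_format, OF this x, of "q t" "u t"]
    show "XX x ^ (i - hh m) * \<bar>dp (q t) i x\<bar> \<le> B" "XX x ^ (i - hh m) * \<bar>dp (u t) i x\<bar> \<le> B" by (simp_all add: B_def)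
   qed (use B in auto)
   from K1(2)[rule_format, OF s this]
   have r: "(\<Sum>i\<le>k. itg (rate i (q t) (u t) (a t))) \<le> K1 * (B\<^sup>2 + En k (q t) (u t))" .
   have "B\<^sup>2 \<le> C\<^sup>2 * (K2 * En k (q t) (u t))"
   proof -
    have "B\<^sup>2 = C\<^sup>2 * itg (PP m (q t) (u t))" using PP_int_nonneg by (simp add: B_def power_mult_distrib)
    also have "\<dots> \<le> C\<^sup>2 * (K2 * En k (q t) (u t))"
     using order_trans[OF PP_mono[OF k(1)] K2(2)[OF s]] by (intro mult_left_mono) auto
    finally show ?thesis .
   qed
   from mult_left_mono[OF add_right_mono[OF this, of "En k (q t) (u t)"] K1(1)] r
   show "(\<Sum>i\<le>k. itg (rate i (q t) (u t) (a t))) \<le> K4 * En k (q t) (u t)"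
    by (simp add: K4_def algebra_simps)
  qed (use \<tau> in auto)
  also have "\<dots> \<le> (K2 * (3 * (real k + 1) * e\<^sup>2)) * exp (K4 * T)"
  proof (rule mult_mono)
   have s: "slice n (q 0) (u 0) (a 0)" using sl z by simp
   have "itg (PP k (q 0) (u 0)) \<le> 3 * (real k + 1) * e\<^sup>2"
    by (rule PP_data) (use data in simp)
   then have "K2 * itg (PP k (q 0) (u 0)) \<le> K2 * (3 * (real k + 1) * e\<^sup>2)" using K20 by (rule mult_left_mono)
   then show "En k (q 0) (u 0) \<le> K2 * (3 * (real k + 1) * e\<^sup>2)" using K2(3)[OF s, of k] by linarith
  qed (use K4 \<tau> K20 in \<open>auto intro!: mult_left_mono\<close>)
  also have "\<dots> = K5 * e\<^sup>2" by (simp add: K5_def)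
  finally have "K2 * En k (q \<tau>) (u \<tau>) \<le> K2 * (K5 * e\<^sup>2)" using K20 by (rule mult_left_mono)
  moreover have "slice n (q \<tau>) (u \<tau>) (a \<tau>)" using sl z by simp
  note K2(2)[OF this, of k]
  ultimately show "itg (PP k (q \<tau>) (u \<tau>)) \<le> K2 * K5 * e\<^sup>2" by (simp add: mult.assoc)
 qed (use K20 K5 in simp)
qed

definition gsol where
 "gsol \<eta> n T q u a \<longleftrightarrow> evolves T q u a \<and> (\<forall>t\<in>{0..T}. slice n (q t) (u t) (a t) \<and> itg (PP m0 (q t) (u t)) \<le> \<eta>)"

text \<open>Smallness is used at order \<open>m0\<close> only; from there each order is bounded with
  the help of the preceding one. The constants depend on the order and on the data, but not on the
  degree \<open>n\<close> of the approximation.\<close>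

lemma gsol_bounds:
 assumes \<eta>: "0 \<le> \<eta>" and T: "0 \<le> T"
 shows "\<exists>K\<ge>0. \<forall>n q u a. gsol \<eta> n T q u a \<longrightarrow>
  (\<forall>i\<le>m0 + k + 1. \<forall>x\<in>{0..1}. \<bar>dp (q 0) i x\<bar> \<le> M \<and> \<bar>dp (u 0) i x\<bar> \<le> M) \<longrightarrow>
  (\<forall>t\<in>{0..T}. itg (PP (m0 + k) (q t) (u t)) \<le> K)"
proof (induction k)
 case 0
 show ?case by (intro exI[of _ \<eta>]) (use \<eta> in \<open>simp add: gsol_def\<close>)
next
 case (Suc k)
 then obtain K where K: "K \<ge> 0" "\<forall>n q u a. gsol \<eta> n T q u a \<longrightarrow>
  (\<forall>i\<le>m0 + k + 1. \<forall>x\<in>{0..1}. \<bar>dp (q 0) i x\<bar> \<le> M \<and> \<bar>dp (u 0) i x\<bar> \<le> M) \<longrightarrow>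
  (\<forall>t\<in>{0..T}. itg (PP (m0 + k) (q t) (u t)) \<le> K)" by (elim exE conjE)
 have m: "m0 \<le> m0 + k" "m0 + k \<le> m0 + Suc k" "m0 + Suc k \<le> Suc (m0 + k)" by simp_all
 obtain L where L: "L \<ge> 0" "growth_bd T (m0 + k) (m0 + Suc k) K L"
  using growth[OF m K(1) T] by (elim exE conjE)
 show ?case
 proof (intro exI[of _ "L * M\<^sup>2"] conjI allI impI ballI)
  fix n q u a t assume g: "gsol \<eta> n T q u a" and t: "t \<in> {0..T}"
   and data: "\<forall>i\<le>m0 + Suc k + 1. \<forall>x\<in>{0..1}. \<bar>dp (q 0) i x\<bar> \<le> M \<and> \<bar>dp (u 0) i x\<bar> \<le> M"
  have d: "\<forall>i\<le>m0 + k + 1. \<forall>x\<in>{0..1}. \<bar>dp (q 0) i x\<bar> \<le> M \<and> \<bar>dp (u 0) i x\<bar> \<le> M" using data by simp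
  have ev: "evolves T q u a" using g by (simp add: gsol_def)
  have "\<forall>s\<in>{0..t}. slice n (q s) (u s) (a s) \<and> itg (PP (m0 + k) (q s) (u s)) \<le> K"
  proof
   fix s assume "s \<in> {0..t}"
   then have s: "s \<in> {0..T}" using t by simp
   show "slice n (q s) (u s) (a s) \<and> itg (PP (m0 + k) (q s) (u s)) \<le> K"
    using g s K(2)[rule_format, OF g d[rule_format] s] by (simp add: gsol_def)
  qed
  from L(2)[rule_format, OF t ev this[rule_format] data[rule_format]]
  show "itg (PP (m0 + Suc k) (q t) (u t)) \<le> L * M\<^sup>2" .
 qed (use L(1) in simp)
qed

text \<open>Clamping the jet variables makes \<open>G\<close> globally Lipschitz in them and changes
  nothing on the box, so that the Galerkin system has solutions on all of
  \<open>[0, T]\<close>.\<close>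

definition cl where "cl y = max (- \<rho>) (min \<rho> y)" for y :: real

lemma cl: "\<bar>cl y\<bar> \<le> \<rho>" "\<bar>cl y - cl y'\<bar> \<le> \<bar>y - y'\<bar>" "\<bar>y\<bar> \<le> \<rho> \<Longrightarrow> cl y = y"
 using \<rho>(1) by (auto simp: cl_def max_def min_def)

lemma continuous_cl [continuous_intros]: "continuous_on Z f \<Longrightarrow> continuous_on Z (\<lambda>x. cl (f x))"
 unfolding cl_def by (intro continuous_intros)

definition Gc where "Gc p = G (px p, cl (py p), cl (py1 p), cl (py2 p), cl (pu p), cl (pu1 p))"

lemma Gc_jet: "Gc (jet x q u) = G (jet x (\<lambda>i. cl (q i)) (\<lambda>i. cl (u i)))"
 by (simp add: Gc_def jet_def)

lemma Gc_eq: "jet x q u \<in> jbox \<rho> \<Longrightarrow> Gc (jet x q u) = G (jet x q u)"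
 unfolding Gc_jet jet_in_box by (simp add: jet_def cl(3))

text \<open>As long as the energy integral of order \<open>m0\<close> is at most
  \<open>\<eta>\<close>, the Sobolev bound keeps the jets in the box, the truncation is inactive,
  and for small data \<open>growth\<close> returns a strictly smaller value. The continuity method
  then reaches \<open>T\<close>.\<close>

lemma gsol_exists:
 assumes T: "0 \<le> T"
 shows "\<exists>\<epsilon>>0. \<exists>\<eta>\<ge>0. \<forall>n q0 u0. degree q0 \<le> n \<longrightarrow> degree u0 \<le> n \<longrightarrow>
  (\<forall>i\<le>m0 + 1. \<forall>x\<in>{0..1}. \<bar>dp q0 i x\<bar> \<le> \<epsilon> \<and> \<bar>dp u0 i x\<bar> \<le> \<epsilon>) \<longrightarrow>
  (\<exists>q u a. gsol \<eta> n T q u a \<and> q 0 = q0 \<and> u 0 = u0)"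
proof -
 obtain C where C: "C \<ge> 0" "PP_sup_bd m0 C"
  using PP_sobolev[OF order_refl] by (elim exE conjE)
 \<comment> \<open>Makes \<open>C * sqrt \<eta> \<le> \<rho>\<close>, with the Sobolev constant
   \<open>C\<close>; the added \<open>1\<close> covers \<open>C = 0\<close>.\<close>
 define \<eta> where "\<eta> = (\<rho> / (C + 1))\<^sup>2"
 have \<eta>: "\<eta> > 0" using C(1) \<rho>(1) by (simp add: \<eta>_def)
 have C\<eta>: "C * sqrt \<eta> \<le> \<rho>"
 proof -
  have "C * sqrt \<eta> = C * \<rho> / (C + 1)" using C(1) \<rho>(1) by (simp add: \<eta>_def)
  also have "\<dots> \<le> \<rho>" using C(1) \<rho>(1) by (simp add: field_simps)
  finally show ?thesis .
 qed
 obtain K where K: "K \<ge> 0" "growth_bd T m0 m0 \<eta> K"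
  using growth[OF order_refl order_refl le_SucI[OF order_refl] less_imp_le[OF \<eta>] T] by (elim exE conjE)
 \<comment> \<open>Dominates both the growth constant and the constant of the initial energy, so
   that one \<open>\<epsilon>\<close> serves at time \<open>0\<close> and later.\<close>
 define L where "L = K + 3 * (real m0 + 1) + 1"
 have L: "L > 0" using K(1) by (simp add: L_def)
 define \<epsilon> where "\<epsilon> = sqrt (\<eta> / (2 * L))"
 have \<epsilon>: "\<epsilon> > 0" "L * \<epsilon>\<^sup>2 < \<eta>" using \<eta> L by (simp_all add: \<epsilon>_def)
 have gcont: "continuous_on ({0..1} \<times> UNIV) Gc"
  unfolding Gc_def[abs_def] px_def py_def py1_def py2_def pu_def pu1_def
 proof (rule continuous_on_compose2[OF smooth_continuous[OF smG]])
  show "continuous_on ({0..1} \<times> UNIV) (\<lambda>p. (fst p, cl (fst (snd p)), cl (fst (snd (snd p))), cl (fst (snd (snd (snd p)))),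
    cl (fst (snd (snd (snd (snd p))))), cl (snd (snd (snd (snd (snd p)))))))"
   by (intro continuous_intros)
  have "cl y \<in> {-\<rho>..\<rho>}" for y using cl(1)[of y] by auto
  then show "(\<lambda>p. (fst p, cl (fst (snd p)), cl (fst (snd (snd p))), cl (fst (snd (snd (snd p)))),
    cl (fst (snd (snd (snd (snd p))))), cl (snd (snd (snd (snd (snd p))))))) ` ({0..1} \<times> UNIV) \<subseteq> S"
   by (intro order_trans[OF _ \<rho>(2)] image_subsetI) (auto simp: jbox_def)
 qed
 obtain Lg where Lg: "Lg \<ge> 0" "lip_bd \<rho> G Lg"
  using box_lipschitz[OF S smG \<rho>(2)] by (elim exE conjE)
 have glip: "\<bar>Gc (jet x q u) - Gc (jet x q' u')\<bar>
    \<le> Lg * jdist q u q' u'" if "x \<in> {0..1}" for x q u q' u'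
 proof -
  have j: "jet x (\<lambda>i. cl (q i)) (\<lambda>i. cl (u i)) \<in> jbox \<rho>" for q u unfolding jet_in_box using that cl(1) by simp
  have "\<bar>Gc (jet x q u) - Gc (jet x q' u')\<bar> \<le> Lg * (\<bar>cl (q 0) - cl (q' 0)\<bar> + \<bar>cl (q 1) - cl (q' 1)\<bar> + \<bar>cl (q 2) - cl (q' 2)\<bar> + \<bar>cl (u 0) - cl (u' 0)\<bar> + \<bar>cl (u 1) - cl (u' 1)\<bar>)"
   unfolding Gc_jet by (rule Lg(2)[rule_format, OF j j])
  also have "\<dots> \<le> Lg * jdist q u q' u'"
   by (rule mult_left_mono[OF _ Lg(1)]) (intro add_mono cl(2))
  finally show ?thesis .
 qed
 show ?thesis
 proof (rule exI[of _ \<epsilon>], rule conjI[OF \<epsilon>(1)], rule exI[of _ \<eta>], rule conjI[OF less_imp_le[OF \<eta>]], intro allI impI)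
  fix n q0 u0 assume deg: "degree q0 \<le> n" "degree u0 \<le> n"
   and small: "\<forall>i\<le>m0 + 1. \<forall>x\<in>{0..1}. \<bar>dp q0 i x\<bar> \<le> \<epsilon> \<and> \<bar>dp u0 i x\<bar> \<le> \<epsilon>"
  obtain q u a where H: "q 0 = q0 \<and> u 0 = u0 \<and>
   (\<forall>t. degree (q t) \<le> n \<and> degree (u t) \<le> n \<and> degree (a t) \<le> n) \<and>
   (\<forall>i x. \<forall>t\<in>{0..T}. ((\<lambda>t. dp (q t) i x) has_real_derivative dp (u t) i x) (at t within {0..T}) \<and>
     ((\<lambda>t. dp (u t) i x) has_real_derivative dp (a t) i x) (at t within {0..T})) \<and>
   (\<forall>i. continuous_on ({0..T} \<times> {0..1}) (\<lambda>(t, x). dp (q t) i x) \<and> continuous_on ({0..T} \<times> {0..1}) (\<lambda>(t, x). dp (u t) i x)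
     \<and> continuous_on ({0..T} \<times> {0..1}) (\<lambda>(t, x). dp (a t) i x)) \<and>
   (\<forall>t\<in>{0..T}. \<forall>\<phi>. degree \<phi> \<le> n \<longrightarrow>
     itg (\<lambda>x. w 0 x * ((dp (a t) 0 x + Gc (jt (q t) (u t) x)) * poly \<phi> x)) = 0)"
   using galerkin_exists[OF gcont glip Lg(1) T deg] by - (drule meta_mp, assumption, elim exE)
  note sol = H[THEN conjunct1] H[THEN conjunct2, THEN conjunct1] H[THEN conjunct2, THEN conjunct2, THEN conjunct1]
  note H' = H[THEN conjunct2, THEN conjunct2, THEN conjunct2]
  have ev: "evolves T q u a" unfolding evolves_def by (rule conjI[OF H'[THEN conjunct1] H'[THEN conjunct2, THEN conjunct1]])
  note wk = H'[THEN conjunct2, THEN conjunct2]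
  define \<phi> where "\<phi> t = itg (PP m0 (q t) (u t))" for t
  have sl: "slice n (q t) (u t) (a t)" if t: "t \<in> {0..T}" and le: "\<phi> t \<le> \<eta>" for t
  proof -
   have jb: "jt (q t) (u t) x \<in> jbox \<rho>" if x: "x \<in> {0..1}" for x
   proof -
    have cl: "closure {0<..<1::real} = {0..1}" by simp
    have bnd: "\<bar>dp qq j x\<bar> \<le> \<rho>" if j: "j \<le> 2" and qq: "qq = q t \<or> qq = u t" for j qq
    proof (rule continuous_le_on_closure[of "{0<..<1}" "\<lambda>x. \<bar>dp qq j x\<bar>"])
     show "continuous_on (closure {0<..<1}) (\<lambda>x. \<bar>dp qq j x\<bar>)" unfolding cl by (intro continuous_intros)
     show "x \<in> closure {0<..<1}" using x cl by simp
     fix y :: real assume "y \<in> {0<..<1}"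
     then have y: "0 < y" "y < 1" by simp_all
     have jm: "j < m0" "j - hh m0 = 0" using j hh(2,5)[OF order_refl] by simp_all
     have "C * sqrt (\<phi> t) \<le> C * sqrt \<eta>" using le C(1) by (intro mult_left_mono) auto
     then have "C * sqrt (\<phi> t) \<le> \<rho>" using C\<eta> by (rule order_trans)
     moreover have "\<bar>dp (q t) j y\<bar> \<le> C * sqrt (\<phi> t) \<and> \<bar>dp (u t) j y\<bar> \<le> C * sqrt (\<phi> t)"
      using C(2)[rule_format, OF jm(1) y, of "q t" "u t"] unfolding jm(2) \<phi>_def power_0 mult_1 .
     ultimately show "\<bar>dp qq j y\<bar> \<le> \<rho>" using qq by (elim disjE conjE) simp_all
    qed
    show ?thesis unfolding jet_in_box using x bnd by simp
   qed
   then show ?thesis unfolding slice_def using sol(3) wk t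
   proof (intro conjI allI impI ballI)
    fix f :: "real poly" assume f: "degree f \<le> n"
    have "itg (\<lambda>x. w 0 x * ((dp (a t) 0 x + G (jt (q t) (u t) x)) * poly f x))
      = itg (\<lambda>x. w 0 x * ((dp (a t) 0 x + Gc (jt (q t) (u t) x)) * poly f x))"
     by (rule integral_cong) (simp add: Gc_eq[OF jb])
    then show "itg (\<lambda>x. w 0 x * ((dp (a t) 0 x + G (jt (q t) (u t) x)) * poly f x)) = 0"
     using wk t f by simp
   qed auto
  qed
  have data: "\<forall>i\<le>m0 + 1. \<forall>x\<in>{0..1}. \<bar>dp (q 0) i x\<bar> \<le> \<epsilon> \<and> \<bar>dp (u 0) i x\<bar> \<le> \<epsilon>" using small sol by simp
  have "\<forall>t\<in>{0..T}. \<phi> t < \<eta>"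
  proof (rule continuity_method)
   show "continuous_on {0..T} \<phi>" unfolding \<phi>_def by (rule continuous_PP_integral[OF ev])
   have "\<phi> 0 \<le> 3 * (real m0 + 1) * \<epsilon>\<^sup>2" unfolding \<phi>_def by (rule PP_data) (use data in simp)
   also have "\<dots> \<le> L * \<epsilon>\<^sup>2" using K(1) by (intro mult_right_mono) (auto simp: L_def)
   finally show "\<phi> 0 < \<eta>" using \<epsilon>(2) by simp
   fix \<tau> assume \<tau>: "\<tau> \<in> {0..T}" and le: "\<forall>t\<in>{0..\<tau>}. \<phi> t \<le> \<eta>"
   have "\<forall>t\<in>{0..\<tau>}. slice n (q t) (u t) (a t) \<and> itg (PP m0 (q t) (u t)) \<le> \<eta>"
    using sl le \<tau> by (auto simp: \<phi>_def)
   from K(2)[rule_format, OF \<tau> ev this[rule_format] data[rule_format]]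
   have "\<phi> \<tau> \<le> K * \<epsilon>\<^sup>2" by (simp add: \<phi>_def)
   also have "\<dots> \<le> L * \<epsilon>\<^sup>2" by (intro mult_right_mono) (auto simp: L_def)
   finally show "\<phi> \<tau> < \<eta>" using \<epsilon>(2) by simp
  qed
  then have "gsol \<eta> n T q u a" unfolding gsol_def using ev sl by (auto simp: \<phi>_def intro: less_imp_le)
  then show "\<exists>q u a. gsol \<eta> n T q u a \<and> q 0 = q0 \<and> u 0 = u0" using sol(1,2) by (intro exI conjI)
 qed
qed

end

section \<open>Passage to the limit\<close>

lemma DERIV_uniform_limit:
 fixes f :: "nat \<Rightarrow> real \<Rightarrow> real"
 assumes I: "convex I" and d: "\<And>n x. x \<in> I \<Longrightarrow> (f n has_real_derivative f' n x) (at x within I)"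
  and u: "uniform_limit I f' g' sequentially" and l: "\<And>x. x \<in> I \<Longrightarrow> (\<lambda>n. f n x) \<longlonglongrightarrow> g x" and x: "x \<in> I"
 shows "(g has_real_derivative g' x) (at x within I)"
proof -
 have e: "\<forall>\<^sub>F n in sequentially. \<forall>x\<in>I. \<forall>h. norm (f' n x * h - g' x * h) \<le> e * norm h" if "e > 0" for e
 proof -
  have "\<forall>\<^sub>F n in sequentially. \<forall>x\<in>I. dist (f' n x) (g' x) < e" using uniform_limitD[OF u \<open>e > 0\<close>] .
  then show ?thesis
  proof (rule eventually_mono)
   fix n assume n: "\<forall>x\<in>I. dist (f' n x) (g' x) < e"
   show "\<forall>x\<in>I. \<forall>h. norm (f' n x * h - g' x * h) \<le> e * norm h"
   proof (intro ballI allI)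
    fix x h assume "x \<in> I"
    then have "\<bar>f' n x - g' x\<bar> \<le> e" using n by (auto simp: dist_real_def intro: less_imp_le)
    then have "\<bar>f' n x - g' x\<bar> * \<bar>h\<bar> \<le> e * \<bar>h\<bar>" by (intro mult_right_mono) auto
    then show "norm (f' n x * h - g' x * h) \<le> e * norm h" by (simp add: abs_mult flip: left_diff_distrib)
   qed
  qed
 qed
 have "\<exists>g0. \<forall>x\<in>I. (\<lambda>n. f n x) \<longlonglongrightarrow> g0 x \<and> (g0 has_derivative (\<lambda>h. g' x * h)) (at x within I)"
 proof (rule has_derivative_sequence[OF I, where f' = "\<lambda>n x h. f' n x * h" and g' = "\<lambda>x h. g' x * h"])
  show "\<And>n x. x \<in> I \<Longrightarrow> (f n has_derivative (\<lambda>h. f' n x * h)) (at x within I)" using d by (simp add: has_field_derivative_def)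
 qed (use e x l[OF x] in auto)
 then obtain g0 where g0: "\<And>x. x \<in> I \<Longrightarrow> (\<lambda>n. f n x) \<longlonglongrightarrow> g0 x" "\<And>x. x \<in> I \<Longrightarrow> (g0 has_real_derivative g' x) (at x within I)"
  by (auto simp: has_field_derivative_def)
 have "g0 y = g y" if "y \<in> I" for y using LIMSEQ_unique g0(1) l that by blast
 then show ?thesis using has_field_derivative_transform_within[OF g0(2)[OF x] zero_less_one x] by simp
qed

lemma poly_antiderivative: "\<exists>P. pderiv P = (p :: real poly) \<and> poly P 0 = c"
proof -
 define P where "P = (\<Sum>i\<le>degree p. monom (coeff p i / real (Suc i)) (Suc i))"
 have "pderiv (sum f B) = (\<Sum>i\<in>B. pderiv (f i))" for f :: "nat \<Rightarrow> real poly" and B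
  by (induction B rule: infinite_finite_induct) (simp_all add: pderiv_add)
 then have "pderiv P = (\<Sum>i\<le>degree p. monom (coeff p i) i)"
  unfolding P_def by (simp add: pderiv_monom del: of_nat_Suc)
 then have "pderiv P = p" using poly_as_sum_of_monoms by metis
 then show ?thesis by (intro exI[of _ "P + [:c - poly P 0:]"]) (simp add: pderiv_add pderiv_pCons)
qed

lemma dp_Suc_pderiv: "dp P (Suc i) = dp (pderiv P) i"
 by (simp add: fun_eq_iff dp_def funpow_swap1)

lemma real_poly_approx:
 fixes f :: "real \<Rightarrow> real"
 assumes "continuous_on {0..1} f" "e > 0"
 shows "\<exists>p. \<forall>x\<in>{0..1}. \<bar>poly p x - f x\<bar> \<le> e"
proof -
 obtain g where g: "real_polynomial_function g" "\<And>x. x \<in> {0..1} \<Longrightarrow> \<bar>f x - g x\<bar> < e"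
  using Stone_Weierstrass_real_polynomial_function[OF compact_Icc assms] by blast
 obtain a n where a: "g = (\<lambda>x. \<Sum>i\<le>n. a i * x ^ i)" using g(1) real_polynomial_function_iff_sum by auto
 define p where "p = (\<Sum>i\<le>n. monom (a i) i)"
 have "poly p x = g x" for x by (simp add: p_def a poly_sum poly_monom)
 then show ?thesis using g(2) by (intro exI[of _ p]) (force simp: abs_minus_commute)
qed

text \<open>The highest derivative is approximated by Weierstrass and integrated \<open>n\<close>
  times with matching values at \<open>0\<close>. On an interval of length one, integration does not
  increase the error.\<close>

lemma poly_approx:
 assumes "derivs f" "e > 0"
 shows "\<exists>p. \<forall>i\<le>n. \<forall>x\<in>{0..1}. \<bar>dp p i x - f i x\<bar> \<le> e"
 using assms(1)
proof (induction n arbitrary: f)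
 case 0
 then show ?case using real_poly_approx[OF derivs_continuous[OF 0, of 0] assms(2)] by (simp add: dp_def)
next
 case (Suc n)
 have "derivs (\<lambda>i. f (Suc i))" using Suc.prems by (simp add: derivs_def)
 from Suc.IH[OF this] obtain p where p: "\<forall>i\<le>n. \<forall>x\<in>{0..1}. \<bar>dp p i x - f (Suc i) x\<bar> \<le> e" by (elim exE)
 obtain P where P: "pderiv P = p" "poly P 0 = f 0 0" using poly_antiderivative by blast
 have s: "\<bar>dp P (Suc i) x - f (Suc i) x\<bar> \<le> e" if "i \<le> n" "x \<in> {0..1}" for i x
  using p that by (simp add: dp_Suc_pderiv P)
 have z: "\<bar>dp P 0 x - f 0 x\<bar> \<le> e" if x: "x \<in> {0..1}" for x
 proof -
  have "norm ((dp P 0 x - f 0 x) - (dp P 0 0 - f 0 0)) \<le> e * norm (x - 0)"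
  proof (rule field_differentiable_bound[OF convex_real_interval(5)])
   fix y :: real assume y: "y \<in> {0..1}"
   show "((\<lambda>x. dp P 0 x - f 0 x) has_field_derivative dp P (Suc 0) y - f (Suc 0) y) (at y within {0..1})"
    by (rule DERIV_diff[OF derivsD[OF derivs_dp y] derivsD[OF Suc.prems y]])
   show "norm (dp P (Suc 0) y - f (Suc 0) y) \<le> e" using s[of 0 y] y by simp
  qed (use x in auto)
  also have "\<dots> \<le> e * 1" using x assms(2) by (intro mult_left_mono) auto
  finally show ?thesis using P(2) by (simp add: dp_def)
 qed
 have "\<bar>dp P i x - f i x\<bar> \<le> e" if "i \<le> Suc n" "x \<in> {0..1}" for i x
  using s[of "i - 1" x] z[of x] that by (cases i) auto
 then show ?case by (intro exI[of _ P]) simp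
qed

lemma uniform_subsequence:
 fixes F :: "nat \<Rightarrow> 'a::euclidean_space \<Rightarrow> real"
 assumes R: "compact R" and K: "\<And>n x. x \<in> R \<Longrightarrow> \<bar>F n x\<bar> \<le> K"
  and L: "\<And>n x y. x \<in> R \<Longrightarrow> y \<in> R \<Longrightarrow> \<bar>F n x - F n y\<bar> \<le> L * norm (x - y)"
 shows "\<exists>r g. strict_mono (r :: nat \<Rightarrow> nat) \<and> uniform_limit R (\<lambda>n. F (r n)) g sequentially"
proof -
 obtain g and k :: "nat \<Rightarrow> nat" where gk: "strict_mono k"
  "\<And>e. 0 < e \<Longrightarrow> \<exists>N. \<forall>n x. n \<ge> N \<and> x \<in> R \<longrightarrow> norm (F (k n) x - g x) < e"
 proof (rule Arzela_Ascoli[OF R, of F K])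
  fix x e assume x: "x \<in> R" "(0::real) < e"
  show "\<exists>d. 0 < d \<and> (\<forall>n y. y \<in> R \<and> norm (x - y) < d \<longrightarrow> norm (F n x - F n y) < e)"
  proof (intro exI[of _ "e / (\<bar>L\<bar> + 1)"] conjI allI impI)
   show "0 < e / (\<bar>L\<bar> + 1)" using x by simp
   fix n y assume y: "y \<in> R \<and> norm (x - y) < e / (\<bar>L\<bar> + 1)"
   have "\<bar>F n x - F n y\<bar> \<le> L * norm (x - y)" using L x y by simp
   also have "\<dots> \<le> (\<bar>L\<bar> + 1) * norm (x - y)" by (intro mult_right_mono) auto
   also have "\<dots> < e" using y by (simp add: field_simps)
   finally show "norm (F n x - F n y) < e" by simp
  qed
 qed (use K in auto)
 have "uniform_limit R (\<lambda>n. F (k n)) g sequentially"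
  unfolding uniform_limit_sequentially_iff dist_norm using gk(2) by blast
 then show ?thesis using gk(1) by blast
qed

text \<open>For each \<open>j\<close> Arzela-Ascoli extracts a subsequence along which
  \<open>F j\<close> converges; a tail of the diagonal sequence is a subsequence of it.\<close>

lemma uniform_diagonal_subsequence:
 fixes F :: "nat \<Rightarrow> nat \<Rightarrow> 'a::euclidean_space \<Rightarrow> real"
 assumes R: "compact R" and K: "\<And>j. \<exists>K. \<forall>n. \<forall>x\<in>R. \<bar>F j n x\<bar> \<le> K"
  and L: "\<And>j. \<exists>L. \<forall>n. \<forall>x\<in>R. \<forall>y\<in>R. \<bar>F j n x - F j n y\<bar> \<le> L * norm (x - y)"
 shows "\<exists>r. strict_mono (r :: nat \<Rightarrow> nat) \<and> (\<forall>j. \<exists>g. uniform_limit R (\<lambda>n. F j (r n)) g sequentially)"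
proof -
 define P where "P j s \<longleftrightarrow> (\<exists>g. uniform_limit R (\<lambda>n. F j (s n)) g sequentially)" for j and s :: "nat \<Rightarrow> nat"
 interpret subseqs P
 proof
  fix j and s :: "nat \<Rightarrow> nat" assume "strict_mono s"
  obtain K' where K': "\<forall>n. \<forall>x\<in>R. \<bar>F j n x\<bar> \<le> K'" using K[of j] by (elim exE)
  obtain L' where L': "\<forall>n. \<forall>x\<in>R. \<forall>y\<in>R. \<bar>F j n x - F j n y\<bar> \<le> L' * norm (x - y)" using L[of j] by (elim exE)
  have "\<exists>r g. strict_mono (r :: nat \<Rightarrow> nat) \<and> uniform_limit R (\<lambda>n. F j (s (r n))) g sequentially"
   by (rule uniform_subsequence[OF R, of "\<lambda>n. F j (s n)" K' L']) (use K' L' in auto)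
  then show "\<exists>r'. strict_mono r' \<and> P j (s \<circ> r')" by (auto simp: P_def o_def)
 qed
 have st: "P n (s \<circ> r)" if r: "strict_mono r" and s: "P n s" for r s n
 proof -
  obtain g where "uniform_limit R (\<lambda>n'. F n (s n')) g sequentially" using s by (auto simp: P_def)
  then have "uniform_limit R (\<lambda>n'. F n (s (r n'))) g sequentially"
   by (rule filterlim_compose) (rule filterlim_subseq[OF r])
  then show ?thesis by (auto simp: P_def o_def)
 qed
 show ?thesis
 proof (intro exI[of _ diagseq] conjI allI)
  show "strict_mono diagseq" by (rule subseq_diagseq)
  fix j
  obtain g where "uniform_limit R (\<lambda>n. F j (diagseq (Suc j + n))) g sequentially"
   using diagseq_holds[of j, OF st] by (auto simp: P_def o_def)
  then have "uniform_limit R (\<lambda>n. F j (diagseq (n + Suc j))) g sequentially" by (simp add: add.commute)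
  then have "uniform_limit R (\<lambda>n. F j (diagseq n)) g sequentially"
   unfolding uniform_limit_iff
   using eventually_sequentially_seg[of "\<lambda>n. \<forall>x\<in>R. dist (F j (diagseq n) x) (g x) < e" "Suc j" for e] by simp
  then show "\<exists>g. uniform_limit R (\<lambda>n. F j (diagseq n)) g sequentially" by blast
 qed
qed

text \<open>Uniform approximation of \<open>Z\<close> by polynomials shows that the weighted
  integral of its square is zero. The weight is positive inside the interval, and continuity covers
  the ends.\<close>

lemma (in weights) orthogonal_polys_zero:
 assumes Z: "continuous_on {0..1} Z" and o: "\<And>\<phi>. itg (\<lambda>x. w 0 x * (Z x * poly \<phi> x)) = 0" and x: "x \<in> {0..1}"
 shows "Z x = 0"
proof -
 have "bounded (Z ` {0..1})" by (intro compact_imp_bounded compact_continuous_image Z compact_Icc)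
 then obtain M where M: "\<forall>y\<in>Z ` {0..1}. \<bar>y\<bar> \<le> M" unfolding bounded_iff real_norm_def by (elim exE)
 have M: "\<bar>Z x\<bar> \<le> M" if "x \<in> {0..1}" for x using M that by simp
 have M0: "0 \<le> M" using M[of 0] by simp
 let ?I = "itg (\<lambda>x. w 0 x * (Z x * Z x))"
 have "?I \<le> 0 + e" if e: "e > 0" for e
 proof -
  obtain p where p: "\<forall>x\<in>{0..1}. \<bar>poly p x - Z x\<bar> \<le> e / (M + 1)" using real_poly_approx[OF Z, of "e / (M + 1)"] e M0 by auto
  have "?I \<le> itg (\<lambda>x. w 0 x * (Z x * poly p x) + e)"
  proof (rule integral_le_Ioo)
   fix x :: real assume "0 < x" "x < 1"
   then have x: "x \<in> {0..1}" by simp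
   have "\<bar>w 0 x * (Z x * (Z x - poly p x))\<bar> \<le> 1 * (M * (e / (M + 1)))"
    unfolding abs_mult using w_nonneg[OF x, of 0] w_le1[OF x, of 0] M[OF x] M0 e p x
    by (intro mult_mono) (auto simp: abs_minus_commute)
   also have "\<dots> \<le> e" using M0 e by (simp add: field_simps)
   finally show "w 0 x * (Z x * Z x) \<le> w 0 x * (Z x * poly p x) + e" by (simp add: algebra_simps)
  qed (intro continuous_intros Z)+
  also have "\<dots> = e" by (subst integral_add) (auto intro!: integrable continuous_intros Z simp: o)
  finally show ?thesis by simp
 qed
 then have le: "?I \<le> 0" by (rule field_le_epsilon)
 have nn: "0 \<le> w 0 x * (Z x * Z x)" if "x \<in> {0..1}" for x using w_nonneg[OF that] by simp
 have c: "continuous_on {0..1} (\<lambda>x. w 0 x * (Z x * Z x))" by (intro continuous_intros Z)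
 have "?I = 0" using le integral_nonneg[OF integrable[OF c] nn] by simp
 then have z: "w 0 x * (Z x * Z x) = 0" if "x \<in> {0..1}" for x
  using integral_eq_0_iff[OF c zero_less_one nn] that by auto
 have "Z x = 0" if "0 < x" "x < 1" for x
 proof -
  have "0 < XX x ^ (0 + \<mu>)" using XX_pos[OF that] by simp
  also have "\<dots> \<le> w 0 x" using that by (intro w_ge) auto
  finally show ?thesis using z[of x] that by simp
 qed
 then have "\<bar>Z x\<bar> \<le> 0"
  by (intro continuous_le_on_closure[of "{0<..<1::real}" "\<lambda>x. \<bar>Z x\<bar>" x]) (use x Z in \<open>auto intro!: continuous_intros\<close>)
 then show ?thesis by simp
qed

lemma abs_le_closure:
 fixes f :: "real \<Rightarrow> real"
 assumes f: "continuous_on {0..1} f" and le: "\<And>x. 0 < x \<Longrightarrow> x < 1 \<Longrightarrow> \<bar>f x\<bar> \<le> K" and x: "x \<in> {0..1}"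
 shows "\<bar>f x\<bar> \<le> K"
 by (rule continuous_le_on_closure[of "{0<..<1::real}" "\<lambda>x. \<bar>f x\<bar>" x]) (use x f le in \<open>auto intro!: continuous_intros\<close>)

lemma continuous_bounded_01:
 fixes f :: "real \<Rightarrow> real"
 assumes "continuous_on {0..1} f"
 shows "\<exists>b\<ge>0. \<forall>x\<in>{0..1}. \<bar>f x\<bar> \<le> b"
proof -
 have "bounded (f ` {0..1})" by (intro compact_imp_bounded compact_continuous_image assms compact_Icc)
 then obtain M where M: "\<forall>y\<in>f ` {0..1}. \<bar>y\<bar> \<le> M" unfolding bounded_iff real_norm_def by (elim exE)
 then have "\<forall>x\<in>{0..1}. \<bar>f x\<bar> \<le> max 0 M" by auto
 then show ?thesis by (intro exI[of _ "max 0 M"]) simp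
qed

lemma integral_abs_le:
 fixes f :: "real \<Rightarrow> real"
 assumes f: "continuous_on {0..1} f" and le: "\<And>x. x \<in> {0..1} \<Longrightarrow> \<bar>f x\<bar> \<le> K"
 shows "\<bar>itg f\<bar> \<le> K"
proof -
 have "norm (itg f) \<le> K * (1 - 0)" by (rule integral_bound) (use f le in auto)
 then show ?thesis by simp
qed

lemma uniform_limit_compose_point:
 assumes "uniform_limit R F g sequentially" "\<And>y. y \<in> Y \<Longrightarrow> h y \<in> R"
 shows "uniform_limit Y (\<lambda>n y. F n (h y)) (\<lambda>y. g (h y)) sequentially"
 unfolding uniform_limit_iff
proof (intro allI impI)
 fix e :: real assume "e > 0"
 from uniform_limitD[OF assms(1) this]
 show "\<forall>\<^sub>F n in sequentially. \<forall>y\<in>Y. dist (F n (h y)) (g (h y)) < e"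
  by (rule eventually_mono) (use assms(2) in blast)
qed

lemma rect_lipschitz:
 fixes f :: "real \<Rightarrow> real \<Rightarrow> real"
 assumes t: "\<And>t x. t \<in> {0..T} \<Longrightarrow> x \<in> {0..1} \<Longrightarrow> ((\<lambda>t. f t x) has_real_derivative ft t x) (at t within {0..T})"
  "\<And>t x. t \<in> {0..T} \<Longrightarrow> x \<in> {0..1} \<Longrightarrow> \<bar>ft t x\<bar> \<le> K"
  and x: "\<And>t x. t \<in> {0..T} \<Longrightarrow> x \<in> {0..1} \<Longrightarrow> ((\<lambda>x. f t x) has_real_derivative fx t x) (at x within {0..1})"
  "\<And>t x. t \<in> {0..T} \<Longrightarrow> x \<in> {0..1} \<Longrightarrow> \<bar>fx t x\<bar> \<le> K"
  and K: "0 \<le> K" and p: "p \<in> {0..T} \<times> {0..1}" "p' \<in> {0..T} \<times> {0..1}"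
 shows "\<bar>f (fst p) (snd p) - f (fst p') (snd p')\<bar> \<le> (2 * K) * norm (p - p')"
proof -
 have m: "fst p \<in> {0..T}" "snd p \<in> {0..1}" "fst p' \<in> {0..T}" "snd p' \<in> {0..1}" using p by auto
 have "norm (f (fst p) (snd p) - f (fst p') (snd p)) \<le> K * norm (fst p - fst p')"
  by (rule field_differentiable_bound[OF convex_real_interval(5) t(1)]) (use m t(2) in auto)
 moreover have "norm (f (fst p') (snd p) - f (fst p') (snd p')) \<le> K * norm (snd p - snd p')"
  by (rule field_differentiable_bound[OF convex_real_interval(5) x(1)]) (use m x(2) in auto)
 moreover have "norm (fst p - fst p') \<le> norm (p - p')" "norm (snd p - snd p') \<le> norm (p - p')"
 proof -
  have e: "p - p' = (fst p - fst p', snd p - snd p')" by (simp add: prod_eq_iff)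
  show "norm (fst p - fst p') \<le> norm (p - p')" "norm (snd p - snd p') \<le> norm (p - p')"
   unfolding e by (rule norm_fst_le norm_snd_le)+
 qed
 then have "K * norm (fst p - fst p') \<le> K * norm (p - p')" "K * norm (snd p - snd p') \<le> K * norm (p - p')"
  using K by (auto intro!: mult_left_mono)
 ultimately show ?thesis unfolding real_norm_def by linarith
qed

text \<open>Regularity of the entries passes to differential monomials, which are products of these
  with smooth functions of the jet. The entries are functions on an arbitrary set, since they will
  depend on \<open>t\<close> and \<open>x\<close> jointly.\<close>

lemma mon_cdiff:
 assumes F: "mon S z \<kappa> m F" and X: "cdiff n R X" "\<And>i. cdiff n R (Q i)" "\<And>i. cdiff n R (U i)"
  and j: "\<And>p. p \<in> R \<Longrightarrow> jet (X p) (\<lambda>i. Q i p) (\<lambda>i. U i p) \<in> S"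
 shows "cdiff n R (\<lambda>p. F (X p) (\<lambda>i. Q i p) (\<lambda>i. U i p))"
 using F
proof (induction rule: mon.induct)
 case (base \<Phi> z \<kappa> m)
 have s: "cdiff n S \<Phi>" using base(1) by (simp add: smooth_def)
 show ?case
  by (rule cdiff_compose[OF s]) (use j X in \<open>auto simp: Basis_prod_def jet_def\<close>)
qed (auto intro: cdiff_mult cdiff_add X)

context wave
begin

definition data_bdd where
 "data_bdd M q0 u0 \<longleftrightarrow> (\<forall>i. \<forall>x\<in>{0..1}. \<bar>dp q0 i x\<bar> \<le> (M :: nat \<Rightarrow> real) i \<and> \<bar>dp u0 i x\<bar> \<le> M i)"

abbreviation "sup_bd \<eta> T M j K \<equiv> \<forall>n q u a. gsol \<eta> n T q u a \<longrightarrow> data_bdd M (q 0) (u 0) \<longrightarrow>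
  (\<forall>t\<in>{0..T}. \<forall>x\<in>{0..1}. \<bar>dp (q t) j x\<bar> \<le> K \<and> \<bar>dp (u t) j x\<bar> \<le> K)"
abbreviation "accel_sup_at \<eta> T M j K \<equiv> \<forall>n q u a. gsol \<eta> n T q u a \<longrightarrow> data_bdd M (q 0) (u 0) \<longrightarrow>
  (\<forall>t\<in>{0..T}. \<forall>x\<in>{0..1}. \<bar>dp (a t) j x\<bar> \<le> K)"

text \<open>For the order \<open>m0 + 2 * j\<close> of the energy, the number \<open>hh\<close> of
  derivatives bounded without weight is at least \<open>j\<close>.\<close>

lemma gsol_sup:
 assumes \<eta>: "0 \<le> \<eta>" and T: "0 \<le> T"
 shows "\<exists>K\<ge>0. sup_bd \<eta> T M j K"
proof -
 define M' where "M' = (\<Sum>i\<le>m0 + 2 * j + 1. \<bar>M i\<bar>)"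
 obtain K where K: "K \<ge> 0" "\<forall>n q u a. gsol \<eta> n T q u a \<longrightarrow>
  (\<forall>i\<le>m0 + 2 * j + 1. \<forall>x\<in>{0..1}. \<bar>dp (q 0) i x\<bar> \<le> M' \<and> \<bar>dp (u 0) i x\<bar> \<le> M') \<longrightarrow>
  (\<forall>t\<in>{0..T}. itg (PP (m0 + 2 * j) (q t) (u t)) \<le> K)"
  using gsol_bounds[OF \<eta> T, of "2 * j" M'] by (elim exE conjE)
 define m where "m = m0 + 2 * j"
 have m: "m0 \<le> m" by (simp add: m_def)
 have jm: "j < m" "j - hh m = 0" by (simp_all add: m_def hh_def m0_def)
 obtain C where C: "C \<ge> 0" "PP_sup_bd m C"
  using PP_sobolev[OF m] by (elim exE conjE)
 show ?thesis
 proof (rule exI[of _ "C * sqrt K"], intro conjI[of "0 \<le> C * sqrt K"] allI impI ballI)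
  show "0 \<le> C * sqrt K" using C(1) K(1) by simp
  fix n q u a t and x :: real assume g: "gsol \<eta> n T q u a" and d: "data_bdd M (q 0) (u 0)" and t: "t \<in> {0..T}" and x: "x \<in> {0..1}"
  have "\<bar>dp (q 0) i x\<bar> \<le> M' \<and> \<bar>dp (u 0) i x\<bar> \<le> M'" if "i \<le> m0 + 2 * j + 1" "x \<in> {0..1}" for i x
  proof -
   have "\<bar>M i\<bar> \<le> M'" unfolding M'_def using that by (intro member_le_sum) auto
   moreover have "\<bar>dp (q 0) i x\<bar> \<le> M i" "\<bar>dp (u 0) i x\<bar> \<le> M i" using d that by (auto simp: data_bdd_def)
   ultimately show ?thesis by linarith
  qed
  then have dd: "\<forall>i\<le>m0 + 2 * j + 1. \<forall>x\<in>{0..1}. \<bar>dp (q 0) i x\<bar> \<le> M' \<and> \<bar>dp (u 0) i x\<bar> \<le> M'" by simp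
  have "itg (PP m (q t) (u t)) \<le> K" unfolding m_def by (rule K(2)[rule_format, OF g dd[rule_format] t])
  then have le: "C * sqrt (itg (PP m (q t) (u t))) \<le> C * sqrt K" using C(1) by (intro mult_left_mono) auto
  have c: "\<bar>dp (q t) j y\<bar> \<le> C * sqrt K" "\<bar>dp (u t) j y\<bar> \<le> C * sqrt K" if y: "0 < y" "y < 1" for y
  proof -
   have "\<bar>dp (q t) j y\<bar> \<le> C * sqrt (itg (PP m (q t) (u t))) \<and> \<bar>dp (u t) j y\<bar> \<le> C * sqrt (itg (PP m (q t) (u t)))"
    using C(2)[rule_format, OF jm(1) y, of "q t" "u t"] unfolding jm(2) power_0 mult_1 .
   then show "\<bar>dp (q t) j y\<bar> \<le> C * sqrt K" "\<bar>dp (u t) j y\<bar> \<le> C * sqrt K" using le by linarith+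
  qed
  show "\<bar>dp (q t) j x\<bar> \<le> C * sqrt K \<and> \<bar>dp (u t) j x\<bar> \<le> C * sqrt K"
   by (intro conjI abs_le_closure[OF continuous_dp _ x] c)
 qed
qed

text \<open>Bounds on the acceleration that are uniform in the degree provide equicontinuity of
  \<open>u\<close> in time. All derivatives of \<open>q\<close> and \<open>u\<close> being bounded,
  \<open>accel_crude\<close> applies at every order, with \<open>h = i + 7\<close>, and the Sobolev
  inequality gives pointwise bounds.\<close>

lemma gsol_sup_accel:
 assumes \<eta>: "0 \<le> \<eta>" and T: "0 \<le> T"
 shows "\<exists>K\<ge>0. accel_sup_at \<eta> T M j K"
proof -
 define m where "m = m0 + 2 * j"
 have m: "m0 \<le> m" by (simp add: m_def)
 have jm: "j < m" "j - hh m = 0" by (simp_all add: m_def hh_def m0_def)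
 have "\<exists>K. \<forall>i. True \<longrightarrow> (K i \<ge> 0 \<and> (sup_bd \<eta> T M i (K i)))"
  by (rule bounded_choice, rule gsol_sup[OF \<eta> T])
 then obtain K where K: "\<forall>i. True \<longrightarrow> (K i \<ge> 0 \<and> (sup_bd \<eta> T M i (K i)))" by (elim exE)
 have K0: "K i \<ge> 0" for i using K[rule_format, THEN conjunct1, OF TrueI] .
 define B where "B h = (\<Sum>l\<le>h. K l)" for h :: nat
 have B0: "B h \<ge> 0" for h unfolding B_def by (rule sum_nonneg) (rule K0)
 have "\<exists>C. \<forall>i. True \<longrightarrow> (C i \<ge> 0 \<and> (accel_bd (i + 7) (B (i + 7)) i (C i)))"
  by (rule bounded_choice, rule accel_crude[OF _ _ B0]) simp_all
 then obtain C where C: "\<forall>i. True \<longrightarrow> (C i \<ge> 0 \<and> (accel_bd (i + 7) (B (i + 7)) i (C i)))" by (elim exE)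
 define D where "D = (\<Sum>i\<le>m. C i * (B (i + 7))\<^sup>2)"
 have D0: "D \<ge> 0" unfolding D_def by (rule sum_nonneg) (use C[rule_format, THEN conjunct1, OF TrueI] in simp)
 obtain Cs where Cs: "Cs \<ge> 0" "\<forall>f. derivs f \<longrightarrow> (\<forall>j<m. \<forall>x. 0 < x \<longrightarrow> x < 1 \<longrightarrow> XX x ^ (j - hh m) * \<bar>f j x\<bar> \<le> Cs * sqrt (energy m f))"
  using sobolev[OF hh(1)[OF m]] by (elim exE conjE)
 show ?thesis
 proof (rule exI[of _ "Cs * sqrt D"], intro conjI[of "0 \<le> Cs * sqrt D"] allI impI ballI)
  show "0 \<le> Cs * sqrt D" using Cs(1) D0 by simp
  fix n q u a t and x :: real assume g: "gsol \<eta> n T q u a" and d: "data_bdd M (q 0) (u 0)" and t: "t \<in> {0..T}" and x: "x \<in> {0..1}"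
  have s: "slice n (q t) (u t) (a t)" using g t by (simp add: gsol_def)
  have "good (i + 7) (i + 7) (B (i + 7)) (q t) (u t) (B (i + 7))" for i
   unfolding good_def adm_def
  proof (intro allI impI conjI)
   fix y :: real assume y: "0 < y" "y < 1"
   then show "jt (q t) (u t) y \<in> jbox \<rho>" using jbD[OF s] by simp
   fix l assume l: "l \<le> i + 7"
   then have e: "XX y ^ (l - (i + 7)) = 1" by simp
   have "K l \<le> B (i + 7)" unfolding B_def using l K0 by (intro member_le_sum) auto
   moreover have "\<bar>dp (q t) l y\<bar> \<le> K l \<and> \<bar>dp (u t) l y\<bar> \<le> K l"
    by (rule K[rule_format, OF TrueI, THEN conjunct2, rule_format, OF g d t]) (use y in simp)
   ultimately show "XX y ^ (l - (i + 7)) * \<bar>dp (q t) l y\<bar> \<le> B (i + 7)" "XX y ^ (l - (i + 7)) * \<bar>dp (u t) l y\<bar> \<le> B (i + 7)"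
    unfolding e by simp_all
  qed (use B0 in auto)
  then have i: "itg (\<lambda>x. w i x * (dp (a t) i x)\<^sup>2) \<le> C i * (B (i + 7))\<^sup>2" for i
   by (rule C[rule_format, OF TrueI, THEN conjunct2, rule_format, OF s])
  have "energy m (dp (a t)) \<le> D" unfolding energy_def D_def by (rule sum_mono) (rule i)
  then have le: "Cs * sqrt (energy m (dp (a t))) \<le> Cs * sqrt D" using Cs(1) by (intro mult_left_mono) auto
  have c: "\<bar>dp (a t) j y\<bar> \<le> Cs * sqrt D" if y: "0 < y" "y < 1" for y
   using Cs(2)[rule_format, OF derivs_dp[of "a t"] jm(1) y] le unfolding jm(2) power_0 mult_1 by linarith
  show "\<bar>dp (a t) j x\<bar> \<le> Cs * sqrt D" by (intro abs_le_closure[OF continuous_dp _ x] c)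
 qed
qed

text \<open>The approximations are close to the data at order \<open>i\<close> only from index
  \<open>i\<close> on; the finitely many earlier ones are bounded one by one.\<close>

lemma bounded_data:
 assumes Q0: "derivs Q0" and p: "\<And>n i x. i \<le> n \<Longrightarrow> x \<in> {0..1} \<Longrightarrow> \<bar>dp (p n) i x - Q0 i x\<bar> \<le> e"
 shows "\<exists>M. \<forall>n. \<forall>x\<in>{0..1}. \<bar>dp (p n) i x\<bar> \<le> M"
proof -
 obtain b where b: "b \<ge> 0" "\<forall>x\<in>{0..1}. \<bar>Q0 i x\<bar> \<le> b" using continuous_bounded_01[OF derivs_continuous[OF Q0, of i]] by (elim exE conjE)
 have "\<exists>B. \<forall>n. True \<longrightarrow> (B n \<ge> 0 \<and> (\<forall>x\<in>{0..1}. \<bar>dp (p n) i x\<bar> \<le> B n))"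
  by (rule bounded_choice, rule continuous_bounded_01[OF continuous_dp])
 then obtain B where B': "\<forall>n. True \<longrightarrow> (B n \<ge> 0 \<and> (\<forall>x\<in>{0..1}. \<bar>dp (p n) i x\<bar> \<le> B n))" by (elim exE)
 have B: "B n \<ge> 0" "x \<in> {0..1} \<Longrightarrow> \<bar>dp (p n) i x\<bar> \<le> B n" for n x using B' by auto
 have "\<bar>dp (p n) i x\<bar> \<le> b + e + (\<Sum>n<i. B n)" if x: "x \<in> {0..1}" for n x
 proof (cases "i \<le> n")
  case True
  have "0 \<le> (\<Sum>n<i. B n)" by (rule sum_nonneg) (rule B(1))
  moreover have "\<bar>Q0 i x\<bar> \<le> b" using b(2) x by blast
  ultimately show ?thesis using p[OF True x] by linarith
 next
  case False
  have "B n \<le> (\<Sum>n<i. B n)" using False B(1) by (intro member_le_sum) auto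
  moreover have "0 \<le> e" using p[of 0 0 x] x by auto
  ultimately show ?thesis using B(2)[OF x, of n] b(1) by linarith
 qed
 then show ?thesis by (intro exI[of _ "b + e + (\<Sum>n<i. B n)"]) simp
qed

end

lemma DERIV_unique_01:
 fixes f :: "real \<Rightarrow> real"
 assumes "(f has_real_derivative r) (at x within {0..1})" "(f has_real_derivative s) (at x within {0..1})" "x \<in> {0..1}"
 shows "r = s"
 using vector_derivative_unique_within_closed_interval[of 0 1 x] assms
 unfolding has_real_derivative_iff_has_vector_derivative by auto

section \<open>Weak formulation and the limit equation\<close>

context weights
begin

definition wint :: "real poly \<Rightarrow> (real \<Rightarrow> real) \<Rightarrow> real" where
 "wint \<phi> f = itg (\<lambda>x. w 0 x * (f x * poly \<phi> x))"

lemma wint_add: "continuous_on {0..1} f \<Longrightarrow> continuous_on {0..1} g \<Longrightarrow> wint \<phi> (\<lambda>x. f x + g x) = wint \<phi> f + wint \<phi> g"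
 unfolding wint_def by (subst integral_add[symmetric]) (auto intro!: integrable continuous_intros integral_cong simp: algebra_simps)

lemma wint_minus: "wint \<phi> (\<lambda>x. - f x) = - wint \<phi> f"
 by (simp add: wint_def)

lemma wint_leibniz:
 assumes d: "\<And>t x. t \<in> {0..T} \<Longrightarrow> x \<in> {0..1} \<Longrightarrow> ((\<lambda>t. f t x) has_real_derivative f' t x) (at t within {0..T})"
  and c: "\<And>t. t \<in> {0..T} \<Longrightarrow> continuous_on {0..1} (f t)"
  and c': "continuous_on ({0..T} \<times> {0..1}) (\<lambda>p. f' (fst p) (snd p))" and t: "t \<in> {0..T}"
 shows "((\<lambda>t. wint \<phi> (f t)) has_real_derivative wint \<phi> (f' t)) (at t within {0..T})"
proof -
 have "((\<lambda>t. integral (cbox 0 1) (\<lambda>x. w 0 x * (f t x * poly \<phi> x))) has_real_derivative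
   integral (cbox 0 1) (\<lambda>x. w 0 x * (f' t x * poly \<phi> x))) (at t within {0..T})"
 proof (rule leibniz_rule_field_derivative[OF _ _ _ t convex_real_interval(5)])
  fix s x :: real assume s: "s \<in> {0..T}" and "x \<in> cbox 0 1"
  then show "((\<lambda>t. w 0 x * (f t x * poly \<phi> x)) has_real_derivative w 0 x * (f' s x * poly \<phi> x)) (at s within {0..T})"
   by (intro DERIV_cmult DERIV_cmult_right d) auto
 next
  fix s assume "s \<in> {0..T}"
  then show "(\<lambda>x. w 0 x * (f s x * poly \<phi> x)) integrable_on cbox 0 1"
   unfolding cbox_interval by (intro integrable continuous_intros c)
 next
  have w: "continuous_on ({0..T} \<times> {0..1}) (\<lambda>p. w 0 (snd p))"
   by (rule continuous_on_compose2[OF continuous_w continuous_on_snd[OF continuous_on_id]]) auto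
  show "continuous_on ({0..T} \<times> cbox 0 1) (\<lambda>(s, x). w 0 x * (f' s x * poly \<phi> x))"
   unfolding case_prod_unfold cbox_interval by (intro continuous_intros w c')
 qed
 then show ?thesis unfolding wint_def cbox_interval .
qed

lemma wint_uniform_limit:
 assumes u: "uniform_limit (Y \<times> {0..1}) (\<lambda>n p. F n (fst p) (snd p)) (\<lambda>p. f (fst p) (snd p)) sequentially"
  and c: "\<And>n t. t \<in> Y \<Longrightarrow> continuous_on {0..1} (F n t)" "\<And>t. t \<in> Y \<Longrightarrow> continuous_on {0..1} (f t)"
 shows "uniform_limit Y (\<lambda>n t. wint \<phi> (F n t)) (\<lambda>t. wint \<phi> (f t)) sequentially"
 unfolding uniform_limit_iff
proof (intro allI impI)
 fix e :: real assume e: "e > 0"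
 obtain b where b: "b \<ge> 0" "\<forall>x\<in>{0..1}. \<bar>poly \<phi> x\<bar> \<le> b"
  using continuous_bounded_01[OF continuous_on_poly[OF continuous_on_id, of "{0..1}" \<phi>]] by (elim exE conjE)
 have "0 < e / (2 * (b + 1))" using e b by simp
 from uniform_limitD[OF u this]
 show "\<forall>\<^sub>F n in sequentially. \<forall>t\<in>Y. dist (wint \<phi> (F n t)) (wint \<phi> (f t)) < e"
 proof (rule eventually_mono)
  fix n assume n: "\<forall>p\<in>Y \<times> {0..1}. dist (F n (fst p) (snd p)) (f (fst p) (snd p)) < e / (2 * (b + 1))"
  show "\<forall>t\<in>Y. dist (wint \<phi> (F n t)) (wint \<phi> (f t)) < e"
  proof
   fix t assume t: "t \<in> Y"
   have "wint \<phi> (F n t) - wint \<phi> (f t) = itg (\<lambda>x. w 0 x * ((F n t x - f t x) * poly \<phi> x))"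
    unfolding wint_def using c t
    by (subst integral_diff[symmetric]) (auto intro!: integrable continuous_intros integral_cong simp: algebra_simps)
   also have "\<bar>\<dots>\<bar> \<le> e / 2"
   proof (rule integral_abs_le)
    show "continuous_on {0..1} (\<lambda>x. w 0 x * ((F n t x - f t x) * poly \<phi> x))" using c t by (intro continuous_intros) auto
    fix x :: real assume x: "x \<in> {0..1}"
    have d: "\<bar>F n t x - f t x\<bar> \<le> e / (2 * (b + 1))" using bspec[OF n, of "(t, x)"] t x by (simp add: dist_real_def)
    have "\<bar>w 0 x * ((F n t x - f t x) * poly \<phi> x)\<bar> \<le> 1 * (e / (2 * (b + 1)) * (b + 1))"
     unfolding abs_mult using w_nonneg[OF x, of 0] w_le1[OF x, of 0] d e b x by (intro mult_mono) force+
    also have "1 * (e / (2 * (b + 1)) * (b + 1)) = e / 2" using b(1) by (simp add: field_simps)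
    finally show "\<bar>w 0 x * ((F n t x - f t x) * poly \<phi> x)\<bar> \<le> e / 2" .
   qed
   finally show "dist (wint \<phi> (F n t)) (wint \<phi> (f t)) < e" using e by (simp add: dist_real_def)
  qed
 qed
qed

end

context wave
begin

text \<open>The limit is recorded with the equations for all its \<open>x\<close>-derivatives, the
  form from which joint smoothness is derived.\<close>

definition wsol :: "real \<Rightarrow> (nat \<Rightarrow> real \<Rightarrow> real \<Rightarrow> real) \<Rightarrow> (nat \<Rightarrow> real \<Rightarrow> real \<Rightarrow> real) \<Rightarrow> bool" where
 "wsol T Q U \<longleftrightarrow>
  (\<forall>j. continuous_on ({0..T} \<times> {0..1}) (\<lambda>p. Q j (fst p) (snd p)) \<and> continuous_on ({0..T} \<times> {0..1}) (\<lambda>p. U j (fst p) (snd p))) \<and>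
  (\<forall>t\<in>{0..T}. \<forall>x\<in>{0..1}. jet x (\<lambda>i. Q i t x) (\<lambda>i. U i t x) \<in> jbox \<rho>) \<and>
  (\<forall>j. \<forall>t\<in>{0..T}. \<forall>x\<in>{0..1}.
   (Q j t has_real_derivative Q (Suc j) t x) (at x within {0..1}) \<and>
   (U j t has_real_derivative U (Suc j) t x) (at x within {0..1}) \<and>
   ((\<lambda>t. Q j t x) has_real_derivative U j t x) (at t within {0..T}) \<and>
   ((\<lambda>t. U j t x) has_real_derivative - Fs j x (\<lambda>i. Q i t x) (\<lambda>i. U i t x)) (at t within {0..T}))"

text \<open>No pointwise limit of the accelerations is taken. Paired with a fixed polynomial they
  are expressed by \<open>G\<close> through the projected equation, and \<open>G\<close> converges
  uniformly because the jets do. The paired equation thus holds in the limit for every polynomial,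
  and orthogonality to all polynomials yields the equation itself.\<close>

lemma gsol_limit:
 assumes T: "0 < T" and g: "\<And>n. gsol \<eta> (dg n) T (q n) (u n) (a n)" and dg: "\<And>n. n \<le> dg n"
  and lq: "\<And>j. uniform_limit ({0..T} \<times> {0..1}) (\<lambda>n p. dp (q n (fst p)) j (snd p)) (\<lambda>p. Q j (fst p) (snd p)) sequentially"
  and lu: "\<And>j. uniform_limit ({0..T} \<times> {0..1}) (\<lambda>n p. dp (u n (fst p)) j (snd p)) (\<lambda>p. U j (fst p) (snd p)) sequentially"
 shows "wsol T Q U"
proof -
 let ?R = "{0..T} \<times> {0..1::real}"
 have ev: "evolves T (q n) (u n) (a n)" for n using g[of n] by (simp add: gsol_def)
 have sl: "slice (dg n) (q n t) (u n t) (a n t)" if "t \<in> {0..T}" for n t using g[of n] that by (simp add: gsol_def)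
 have cQ: "continuous_on ?R (\<lambda>p. Q j (fst p) (snd p))" for j
  by (rule uniform_limit_theorem[OF always_eventually[OF allI[OF evolvesD(3)[OF ev]]] lq trivial_limit_sequentially])
 have cU: "continuous_on ?R (\<lambda>p. U j (fst p) (snd p))" for j
  by (rule uniform_limit_theorem[OF always_eventually[OF allI[OF evolvesD(4)[OF ev]]] lu trivial_limit_sequentially])
 have pq: "(\<lambda>n. dp (q n t) j x) \<longlonglongrightarrow> Q j t x" and pu: "(\<lambda>n. dp (u n t) j x) \<longlonglongrightarrow> U j t x" if "t \<in> {0..T}" "x \<in> {0..1}" for j t x
  using tendsto_uniform_limitI[OF lq[of j], of "(t, x)"] tendsto_uniform_limitI[OF lu[of j], of "(t, x)"] that by simp_all
 have xQ: "(Q j t has_real_derivative Q (Suc j) t x) (at x within {0..1})" if t: "t \<in> {0..T}" and x: "x \<in> {0..1}" for j t x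
 proof (rule DERIV_uniform_limit[OF convex_real_interval(5), where f = "\<lambda>n x. dp (q n t) j x" and f' = "\<lambda>n x. dp (q n t) (Suc j) x"])
  show "uniform_limit {0..1} (\<lambda>n x. dp (q n t) (Suc j) x) (Q (Suc j) t) sequentially"
   using uniform_limit_compose_point[OF lq[of "Suc j"], of "{0..1}" "\<lambda>x. (t, x)"] t by simp
 qed (use derivsD[OF derivs_dp] pq t x in auto)
 have xU: "(U j t has_real_derivative U (Suc j) t x) (at x within {0..1})" if t: "t \<in> {0..T}" and x: "x \<in> {0..1}" for j t x
 proof (rule DERIV_uniform_limit[OF convex_real_interval(5), where f = "\<lambda>n x. dp (u n t) j x" and f' = "\<lambda>n x. dp (u n t) (Suc j) x"])
  show "uniform_limit {0..1} (\<lambda>n x. dp (u n t) (Suc j) x) (U (Suc j) t) sequentially"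
   using uniform_limit_compose_point[OF lu[of "Suc j"], of "{0..1}" "\<lambda>x. (t, x)"] t by simp
 qed (use derivsD[OF derivs_dp] pu t x in auto)
 have tQ: "((\<lambda>t. Q j t x) has_real_derivative U j t x) (at t within {0..T})" if t: "t \<in> {0..T}" and x: "x \<in> {0..1}" for j t x
 proof (rule DERIV_uniform_limit[OF convex_real_interval(5), where f = "\<lambda>n t. dp (q n t) j x" and f' = "\<lambda>n t. dp (u n t) j x"])
  show "uniform_limit {0..T} (\<lambda>n t. dp (u n t) j x) (\<lambda>t. U j t x) sequentially"
   using uniform_limit_compose_point[OF lu[of j], of "{0..T}" "\<lambda>t. (t, x)"] x by simp
 qed (use evolvesD(1)[OF ev] pq t x in auto)
 have dQ: "derivs (\<lambda>i. Q i t)" "derivs (\<lambda>i. U i t)" if "t \<in> {0..T}" for t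
  unfolding derivs_def using xQ[OF that] xU[OF that] by auto
 have jB: "jet x (\<lambda>i. Q i t x) (\<lambda>i. U i t x) \<in> jbox \<rho>" if t: "t \<in> {0..T}" and x: "x \<in> {0..1}" for t x
 proof -
  have b: "jt (q n t) (u n t) x \<in> jbox \<rho>" for n using jbD[OF sl[OF t]] x by blast
  have "\<bar>Q j t x\<bar> \<le> \<rho>" "\<bar>U j' t x\<bar> \<le> \<rho>" if "j = 0 \<or> j = 1 \<or> j = 2" "j' = 0 \<or> j' = 1" for j j'
   by (rule LIMSEQ_le_const2[OF tendsto_rabs[OF pq[OF t x]]] LIMSEQ_le_const2[OF tendsto_rabs[OF pu[OF t x]]],
     use b that in \<open>auto simp: jet_in_box\<close>)+
  then show ?thesis using x unfolding jet_in_box by blast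
 qed
 have jS: "jet x (\<lambda>i. Q i t x) (\<lambda>i. U i t x) \<in> S" if "t \<in> {0..T}" "x \<in> {0..1}" for t x using jB[OF that] \<rho>(2) by blast
 define FF where "FF j s x = Fs j x (\<lambda>i. Q i s x) (\<lambda>i. U i s x)" for j s x
 have cF: "continuous_on ?R (\<lambda>p. FF j (fst p) (snd p))" for j
 proof -
  have "cdiff 0 ?R (\<lambda>p. Fs j (snd p) (\<lambda>i. Q i (fst p) (snd p)) (\<lambda>i. U i (fst p) (snd p)))"
  proof (rule mon_cdiff[OF Fs(1)])
   show "cdiff 0 ?R snd" by (simp add: continuous_on_snd)
   show "cdiff 0 ?R (\<lambda>p. Q i (fst p) (snd p))" "cdiff 0 ?R (\<lambda>p. U i (fst p) (snd p))" for i using cQ cU by simp_all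
   show "jet (snd p) (\<lambda>i. Q i (fst p) (snd p)) (\<lambda>i. U i (fst p) (snd p)) \<in> S" if "p \<in> ?R" for p
    using that by (intro jS) auto
  qed
  then show ?thesis by (simp add: FF_def)
 qed
 have cc: "continuous_on Y (\<lambda>y. FF j (f y) (g y))" if "continuous_on Y f" "continuous_on Y g" "\<And>y. y \<in> Y \<Longrightarrow> f y \<in> {0..T} \<and> g y \<in> {0..1}"
  for j and Y :: "'z::topological_space set" and f g
 proof -
  have "continuous_on Y (\<lambda>y. (f y, g y))" using that(1,2) by (rule continuous_on_Pair)
  moreover have "(\<lambda>y. (f y, g y)) ` Y \<subseteq> ?R" using that(3) by auto
  ultimately show ?thesis using continuous_on_compose2[OF cF[of j], of Y "\<lambda>y. (f y, g y)"] by simp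
 qed
 have cFx: "continuous_on {0..1} (FF j t)" if "t \<in> {0..T}" for j t
  using that by (intro cc continuous_intros) auto
 have cFt: "continuous_on {0..t} (\<lambda>s. FF j s x)" if "t \<in> {0..T}" "x \<in> {0..1}" for j t x
  using that by (intro cc continuous_intros) auto
 have cFsw: "continuous_on ({0..1} \<times> cbox 0 t) (\<lambda>(x, s). FF j s x)" if "t \<in> {0..T}" for j t
  unfolding case_prod_unfold using that by (intro cc continuous_intros) auto
 have F0: "FF 0 t x = G (jet x (\<lambda>i. Q i t x) (\<lambda>i. U i t x))" for t x by (simp add: FF_def Fs(3))
 have unG: "uniform_limit ?R (\<lambda>n p. G (jt (q n (fst p)) (u n (fst p)) (snd p))) (\<lambda>p. FF 0 (fst p) (snd p)) sequentially"
  unfolding uniform_limit_iff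
 proof (intro allI impI)
  fix e :: real assume e: "e > 0"
  obtain L where L: "L \<ge> 0" "lip_bd \<rho> G L"
   using box_lipschitz[OF S smG \<rho>(2)] by (elim exE conjE)
  define c' where "c' = e / (5 * (L + 1))"
  have c': "c' > 0" "L * (5 * c') < e" using e L(1) by (simp_all add: c'_def field_simps)
  have "\<forall>\<^sub>F n in sequentially. (\<forall>p\<in>?R. dist (dp (q n (fst p)) 0 (snd p)) (Q 0 (fst p) (snd p)) < c') \<and>
   (\<forall>p\<in>?R. dist (dp (q n (fst p)) 1 (snd p)) (Q 1 (fst p) (snd p)) < c') \<and>
   (\<forall>p\<in>?R. dist (dp (q n (fst p)) 2 (snd p)) (Q 2 (fst p) (snd p)) < c') \<and>
   (\<forall>p\<in>?R. dist (dp (u n (fst p)) 0 (snd p)) (U 0 (fst p) (snd p)) < c') \<and>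
   (\<forall>p\<in>?R. dist (dp (u n (fst p)) 1 (snd p)) (U 1 (fst p) (snd p)) < c')"
   by (intro eventually_conj uniform_limitD[OF lq c'(1)] uniform_limitD[OF lu c'(1)])
  then show "\<forall>\<^sub>F n in sequentially. \<forall>p\<in>?R. dist (G (jt (q n (fst p)) (u n (fst p)) (snd p))) (FF 0 (fst p) (snd p)) < e"
  proof (rule eventually_mono, intro ballI)
   fix n p assume n: "(\<forall>p\<in>?R. dist (dp (q n (fst p)) 0 (snd p)) (Q 0 (fst p) (snd p)) < c') \<and>
    (\<forall>p\<in>?R. dist (dp (q n (fst p)) 1 (snd p)) (Q 1 (fst p) (snd p)) < c') \<and>
    (\<forall>p\<in>?R. dist (dp (q n (fst p)) 2 (snd p)) (Q 2 (fst p) (snd p)) < c') \<and>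
    (\<forall>p\<in>?R. dist (dp (u n (fst p)) 0 (snd p)) (U 0 (fst p) (snd p)) < c') \<and>
    (\<forall>p\<in>?R. dist (dp (u n (fst p)) 1 (snd p)) (U 1 (fst p) (snd p)) < c')" and p: "p \<in> ?R"
   have pm: "fst p \<in> {0..T}" "snd p \<in> {0..1}" using p by auto
   have "jt (q n (fst p)) (u n (fst p)) (snd p) \<in> jbox \<rho>" using jbD[OF sl[OF pm(1)]] pm(2) by blast
   from L(2)[rule_format, OF this jB[OF pm]]
   have "\<bar>G (jt (q n (fst p)) (u n (fst p)) (snd p)) - FF 0 (fst p) (snd p)\<bar> \<le> L * (\<bar>dp (q n (fst p)) 0 (snd p) - Q 0 (fst p) (snd p)\<bar>
    + \<bar>dp (q n (fst p)) 1 (snd p) - Q 1 (fst p) (snd p)\<bar> + \<bar>dp (q n (fst p)) 2 (snd p) - Q 2 (fst p) (snd p)\<bar>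
    + \<bar>dp (u n (fst p)) 0 (snd p) - U 0 (fst p) (snd p)\<bar> + \<bar>dp (u n (fst p)) 1 (snd p) - U 1 (fst p) (snd p)\<bar>)" unfolding F0 .
   also have "\<dots> \<le> L * (c' + c' + c' + c' + c')"
    using n p unfolding dist_real_def by (intro mult_left_mono[OF _ L(1)] add_mono) (auto intro: less_imp_le)
   also have "\<dots> < e" using c'(2) by simp
   finally show "dist (G (jt (q n (fst p)) (u n (fst p)) (snd p))) (FF 0 (fst p) (snd p)) < e" by (simp add: dist_real_def)
  qed
 qed
 have cUx: "continuous_on {0..1} (U 0 t)" if "t \<in> {0..T}" for t by (rule derivs_continuous[OF dQ(2)[OF that]])
 define Rr where "Rr t x = integral {0..t} (\<lambda>s. FF 0 s x)" for t x
 have dI: "((\<lambda>t. integral {0..t} (\<lambda>s. FF j s x)) has_real_derivative FF j t x) (at t within {0..T})" if "t \<in> {0..T}" "x \<in> {0..1}" for j t x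
  by (rule integral_has_real_derivative) (use cFt[of T x j] that T in auto)
 have cR: "continuous_on {0..1} (Rr t)" if "t \<in> {0..T}" for t
  using integral_continuous_on_param[OF cFsw[OF that, of 0]] by (simp add: Rr_def[abs_def])
 \<comment> \<open>The equation comes in integrated form, because differentiability of
   \<open>U 0\<close> in time is not known beforehand; after pairing with \<open>\<phi>\<close> it
   is.\<close>
 have e0: "U 0 t x = U 0 0 x - Rr t x" if t: "t \<in> {0..T}" and x: "x \<in> {0..1}" for t x
 proof -
  have "wint \<phi> (\<lambda>x. U 0 t x + Rr t x + - U 0 0 x) = 0" for \<phi>
  proof -
   have zT: "0 \<in> {0..T}" using T by simp
   have h1: "((\<lambda>t. wint \<phi> (U 0 t)) has_real_derivative - wint \<phi> (FF 0 s)) (at s within {0..T})" if s: "s \<in> {0..T}" for s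
   proof (rule DERIV_uniform_limit[OF convex_real_interval(5), where f = "\<lambda>n t. wint \<phi> (dp (u n t) 0)" and f' = "\<lambda>n t. wint \<phi> (dp (a n t) 0)"])
    show "((\<lambda>t. wint \<phi> (dp (u n t) 0)) has_real_derivative wint \<phi> (dp (a n x) 0)) (at x within {0..T})" if "x \<in> {0..T}" for n x
     by (rule wint_leibniz[OF evolvesD(2)[OF ev] continuous_dp evolvesD(5)[OF ev] that])
    have "uniform_limit {0..T} (\<lambda>n t. wint \<phi> (\<lambda>x. G (jt (q n t) (u n t) x))) (\<lambda>t. wint \<phi> (FF 0 t)) sequentially"
     by (rule wint_uniform_limit[OF unG]) (use cFx cont_smooth_slice[OF jbD[OF sl] smG] in auto)
    then have "uniform_limit {0..T} (\<lambda>n t. - wint \<phi> (\<lambda>x. G (jt (q n t) (u n t) x))) (\<lambda>t. - wint \<phi> (FF 0 t)) sequentially"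
     by (rule uniform_limit_uminus)
    \<comment> \<open>The projected equation sees \<open>\<phi>\<close> only once its degree is at
      most \<open>dg n\<close>, hence eventually.\<close>
    moreover have "\<forall>\<^sub>F n in sequentially. \<forall>t\<in>{0..T}. wint \<phi> (dp (a n t) 0) = - wint \<phi> (\<lambda>x. G (jt (q n t) (u n t) x))"
     using eventually_ge_at_top[of "degree \<phi>"]
    proof (rule eventually_mono, intro ballI)
     fix n t assume n: "degree \<phi> \<le> n" and t: "t \<in> {0..T}"
     have d: "degree \<phi> \<le> dg n" using n dg[of n] by simp
     have "wint \<phi> (\<lambda>x. dp (a n t) 0 x + G (jt (q n t) (u n t) x)) = 0"
      unfolding wint_def using sl[OF t, of n] d by (simp add: slice_def)
     moreover have "wint \<phi> (\<lambda>x. dp (a n t) 0 x + G (jt (q n t) (u n t) x)) = wint \<phi> (dp (a n t) 0) + wint \<phi> (\<lambda>x. G (jt (q n t) (u n t) x))"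
      by (rule wint_add[OF continuous_dp cont_smooth_slice[OF jbD[OF sl[OF t]] smG]])
     ultimately show "wint \<phi> (dp (a n t) 0) = - wint \<phi> (\<lambda>x. G (jt (q n t) (u n t) x))" by linarith
    qed
    ultimately show "uniform_limit {0..T} (\<lambda>n t. wint \<phi> (dp (a n t) 0)) (\<lambda>t. - wint \<phi> (FF 0 t)) sequentially"
     by (subst uniform_limit_cong) auto
    have "uniform_limit {0..T} (\<lambda>n t. wint \<phi> (dp (u n t) 0)) (\<lambda>t. wint \<phi> (U 0 t)) sequentially"
     by (rule wint_uniform_limit[OF lu]) (use cUx continuous_dp in auto)
    then show "(\<lambda>n. wint \<phi> (dp (u n x) 0)) \<longlonglongrightarrow> wint \<phi> (U 0 x)" if "x \<in> {0..T}" for x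
     using tendsto_uniform_limitI that by fastforce
   qed (rule s)
   have h2: "((\<lambda>t. wint \<phi> (Rr t)) has_real_derivative wint \<phi> (FF 0 s)) (at s within {0..T})" if s: "s \<in> {0..T}" for s
    by (rule wint_leibniz[OF _ cR cF s]) (simp_all add: Rr_def dI)
   have "((\<lambda>t. wint \<phi> (U 0 t) + wint \<phi> (Rr t)) has_real_derivative 0) (at s within {0..T})" if s: "s \<in> {0..T}" for s
    using DERIV_add[OF h1[OF s] h2[OF s]] by simp
   from has_field_derivative_zero_constant[OF convex_real_interval(5) this]
   have "wint \<phi> (U 0 t) + wint \<phi> (Rr t) = wint \<phi> (U 0 0) + wint \<phi> (Rr 0)" using t zT by auto
   moreover have "wint \<phi> (Rr 0) = 0" by (simp add: Rr_def wint_def)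
   ultimately have "wint \<phi> (U 0 t) + wint \<phi> (Rr t) - wint \<phi> (U 0 0) = 0" by simp
   moreover have "wint \<phi> (\<lambda>x. U 0 t x + Rr t x + - U 0 0 x) = wint \<phi> (\<lambda>x. U 0 t x + Rr t x) + wint \<phi> (\<lambda>x. - U 0 0 x)"
    by (rule wint_add) (intro continuous_intros cUx[OF t] cUx[OF zT] cR[OF t])+
   moreover have "wint \<phi> (\<lambda>x. U 0 t x + Rr t x) = wint \<phi> (U 0 t) + wint \<phi> (Rr t)"
    by (rule wint_add[OF cUx[OF t] cR[OF t]])
   ultimately show ?thesis by (simp add: wint_minus)
  qed
  then have "U 0 t x + Rr t x + - U 0 0 x = 0"
   unfolding wint_def by (rule orthogonal_polys_zero[rotated, OF _ x]) (use cUx[OF t] cUx[of 0] cR[OF t] T in \<open>auto intro!: continuous_intros\<close>)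
  then show ?thesis by simp
 qed
 \<comment> \<open>The integrated equation is differentiated in \<open>x\<close> under the integral.
   Comparison with the known \<open>x\<close>-derivative of \<open>U j\<close> gives the next
   order.\<close>
 have ej: "\<forall>t\<in>{0..T}. \<forall>x\<in>{0..1}. U j t x = U j 0 x - integral {0..t} (\<lambda>s. FF j s x)" for j
 proof (induction j)
  case 0
  show ?case by (intro ballI) (rule e0[unfolded Rr_def])
 next
  case (Suc j)
  show ?case
  proof (intro ballI)
   fix t x assume t: "t \<in> {0..T}" and x: "x \<in> {0..1::real}"
   have zT: "0 \<in> {0..T}" using T by simp
   have "((\<lambda>x. integral (cbox 0 t) (\<lambda>s. FF j s x)) has_real_derivative integral (cbox 0 t) (\<lambda>s. FF (Suc j) s x)) (at x within {0..1})"
   proof (rule leibniz_rule_field_derivative[OF _ _ cFsw[OF t] x convex_real_interval(5)])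
    fix y s :: real assume y: "y \<in> {0..1}" and "s \<in> cbox 0 t"
    then have s: "s \<in> {0..T}" using t by simp
    show "((\<lambda>x. FF j s x) has_real_derivative FF (Suc j) s y) (at y within {0..1})"
     unfolding FF_def by (rule tderD[OF Fs(2) dQ[OF s] y jS[OF s y]])
   next
    fix y :: real assume y: "y \<in> {0..1}"
    show "(\<lambda>s. FF j s y) integrable_on cbox 0 t" unfolding cbox_interval by (rule integrable_continuous_real[OF cFt[OF t y]])
   qed
   from DERIV_diff[OF xU[OF zT x, of j] this]
   have "((\<lambda>x. U j 0 x - integral {0..t} (\<lambda>s. FF j s x)) has_real_derivative U (Suc j) 0 x - integral {0..t} (\<lambda>s. FF (Suc j) s x)) (at x within {0..1})"
    by (simp add: cbox_interval)
   then have "(U j t has_real_derivative U (Suc j) 0 x - integral {0..t} (\<lambda>s. FF (Suc j) s x)) (at x within {0..1})"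
    by (rule has_field_derivative_transform_within[OF _ zero_less_one x]) (rule Suc[rule_format, OF t, symmetric])
   from DERIV_unique_01[OF xU[OF t x] this x]
   show "U (Suc j) t x = U (Suc j) 0 x - integral {0..t} (\<lambda>s. FF (Suc j) s x)" .
  qed
 qed
 have tU: "((\<lambda>t. U j t x) has_real_derivative - FF j t x) (at t within {0..T})" if t: "t \<in> {0..T}" and x: "x \<in> {0..1}" for j t x
 proof -
  have "((\<lambda>t. U j 0 x - integral {0..t} (\<lambda>s. FF j s x)) has_real_derivative 0 - FF j t x) (at t within {0..T})"
   by (intro DERIV_diff DERIV_const dI t x)
  then have "((\<lambda>t. U j 0 x - integral {0..t} (\<lambda>s. FF j s x)) has_real_derivative - FF j t x) (at t within {0..T})" by simp
  then show ?thesis by (rule has_field_derivative_transform_within[OF _ zero_less_one t]) (rule ej[rule_format, OF _ x, symmetric])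
 qed
 show ?thesis unfolding wsol_def
 proof (intro conjI allI ballI)
  fix j t x assume tx: "t \<in> {0..T}" "x \<in> {0..1::real}"
  show "(Q j t has_real_derivative Q (Suc j) t x) (at x within {0..1})" by (rule xQ[OF tx])
  show "(U j t has_real_derivative U (Suc j) t x) (at x within {0..1})" by (rule xU[OF tx])
  show "((\<lambda>t. Q j t x) has_real_derivative U j t x) (at t within {0..T})" by (rule tQ[OF tx])
  show "((\<lambda>t. U j t x) has_real_derivative - Fs j x (\<lambda>i. Q i t x) (\<lambda>i. U i t x)) (at t within {0..T})"
   using tU[OF tx] unfolding FF_def .
 next
  fix j
  show "continuous_on ?R (\<lambda>p. Q j (fst p) (snd p))" "continuous_on ?R (\<lambda>p. U j (fst p) (snd p))" by (rule cQ cU)+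
 next
  fix t x assume "t \<in> {0..T}" "x \<in> {0..1::real}"
  then show "jet x (\<lambda>i. Q i t x) (\<lambda>i. U i t x) \<in> jbox \<rho>" by (rule jB)
 qed
qed

end

text \<open>For total differentiability it suffices that one partial derivative, here the one in
  \<open>x\<close>, is jointly continuous.\<close>

lemma rect_has_derivative:
 fixes f :: "real \<Rightarrow> real \<Rightarrow> real"
 assumes t: "\<And>t x. t \<in> {0..T} \<Longrightarrow> x \<in> {0..1} \<Longrightarrow> ((\<lambda>t. f t x) has_real_derivative ft t x) (at t within {0..T})"
  and x: "\<And>t x. t \<in> {0..T} \<Longrightarrow> x \<in> {0..1} \<Longrightarrow> ((\<lambda>x. f t x) has_real_derivative fx t x) (at x within {0..1})"
  and c: "continuous_on ({0..T} \<times> {0..1}) (\<lambda>p. fx (fst p) (snd p))" and p: "p \<in> {0..T} \<times> {0..1}"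
 shows "((\<lambda>p. f (fst p) (snd p)) has_derivative (\<lambda>h. fst h * ft (fst p) (snd p) + snd h * fx (fst p) (snd p))) (at p within {0..T} \<times> {0..1})"
proof -
 obtain s y where p': "p = (s, y)" "s \<in> {0..T}" "y \<in> {0..1}" using p by auto
 have "((\<lambda>(t, x). f t x) has_derivative (\<lambda>(h, k). h * ft s y + blinfun_apply (blinfun_scaleR_left (fx s y)) k)) (at (s, y) within {0..T} \<times> {0..1})"
 proof (rule has_derivative_partialsI)
  show "((\<lambda>t. f t y) has_derivative (\<lambda>h. h * ft s y)) (at s within {0..T})"
   using t[OF p'(2,3)] by (simp add: has_field_derivative_def mult.commute[of _ "ft s y"])
  show "((\<lambda>x. f t x) has_derivative blinfun_apply (blinfun_scaleR_left (fx t x))) (at x within {0..1})"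
   if "t \<in> {0..T}" "x \<in> {0..1}" for t x
   using x[OF that] by (simp add: has_field_derivative_def mult.commute[of _ "fx t x"])
  have "continuous_on ({0..T} \<times> {0..1}) (\<lambda>p. blinfun_scaleR_left (fx (fst p) (snd p)))"
   by (rule bounded_linear.continuous_on[OF bounded_linear_blinfun_scaleR_left c])
  then show "continuous (at (s, y) within {0..T} \<times> {0..1}) (\<lambda>(t, x). blinfun_scaleR_left (fx t x))"
   using p p'(1) by (simp add: continuous_on_eq_continuous_within case_prod_unfold)
 qed (use p' in auto)
 then show ?thesis by (simp add: case_prod_unfold p'(1))
qed

context wave
begin

text \<open>The \<open>t\<close>-derivative of \<open>Q j\<close> is \<open>U j\<close>, that of
  \<open>U j\<close> is a differential monomial in the \<open>Q i\<close> and \<open>U i\<close>,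
  and \<open>x\<close>-derivatives shift the index. The induction on \<open>n\<close> therefore has
  to treat all \<open>j\<close> at once.\<close>

lemma wsol_cdiff:
 assumes s: "wsol T Q U"
 shows "cdiff n ({0..T} \<times> {0..1}) (\<lambda>p. Q j (fst p) (snd p)) \<and> cdiff n ({0..T} \<times> {0..1}) (\<lambda>p. U j (fst p) (snd p))"
proof (induction n arbitrary: j)
 case 0
 then show ?case using s by (simp add: wsol_def)
next
 case (Suc n)
 let ?R = "{0..T} \<times> {0..1::real}"
 define FF where "FF j t x = - Fs j x (\<lambda>i. Q i t x) (\<lambda>i. U i t x)" for j t x
 have d: "(Q j t has_real_derivative Q (Suc j) t x) (at x within {0..1})"
   "(U j t has_real_derivative U (Suc j) t x) (at x within {0..1})"
   "((\<lambda>t. Q j t x) has_real_derivative U j t x) (at t within {0..T})"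
   "((\<lambda>t. U j t x) has_real_derivative FF j t x) (at t within {0..T})" if "t \<in> {0..T}" "x \<in> {0..1}" for t x
 proof -
  note w = s[unfolded wsol_def, THEN conjunct2, THEN conjunct2, rule_format, OF that, of j, folded FF_def]
  note w' = w[THEN conjunct2] note w'' = w'[THEN conjunct2]
  show "(Q j t has_real_derivative Q (Suc j) t x) (at x within {0..1})"
   "(U j t has_real_derivative U (Suc j) t x) (at x within {0..1})"
   "((\<lambda>t. Q j t x) has_real_derivative U j t x) (at t within {0..T})"
   "((\<lambda>t. U j t x) has_real_derivative FF j t x) (at t within {0..T})"
   by (rule w[THEN conjunct1] w'[THEN conjunct1] w''[THEN conjunct1] w''[THEN conjunct2])+
 qed
 have c: "continuous_on ?R (\<lambda>p. Q (Suc j) (fst p) (snd p))" "continuous_on ?R (\<lambda>p. U (Suc j) (fst p) (snd p))"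
  by (rule s[unfolded wsol_def, THEN conjunct1, rule_format, THEN conjunct1] s[unfolded wsol_def, THEN conjunct1, rule_format, THEN conjunct2])+
 have F: "cdiff n ?R (\<lambda>p. FF j (fst p) (snd p))"
  unfolding FF_def
 proof (intro cdiff_minus mon_cdiff[OF Fs(1)])
  show "cdiff n ?R snd" by (rule cdiff_linear[OF bounded_linear_snd])
  show "cdiff n ?R (\<lambda>p. Q i (fst p) (snd p))" "cdiff n ?R (\<lambda>p. U i (fst p) (snd p))" for i using Suc.IH by blast+
  show "jet (snd p) (\<lambda>i. Q i (fst p) (snd p)) (\<lambda>i. U i (fst p) (snd p)) \<in> S" if "p \<in> ?R" for p
  proof -
   have "fst p \<in> {0..T}" "snd p \<in> {0..1}" using that by auto
   from s[unfolded wsol_def, THEN conjunct2, THEN conjunct1, rule_format, OF this] show ?thesis using \<rho>(2) by blast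
  qed
 qed
 have basis: "b = (1, 0) \<or> b = (0, 1)" if "b \<in> Basis" for b :: "real \<times> real" using that by (auto simp: Basis_prod_def)
 show ?case
 proof (intro conjI)
  show "cdiff (Suc n) ?R (\<lambda>p. Q j (fst p) (snd p))"
   unfolding cdiff.simps
  proof (intro exI[of _ "\<lambda>p h. fst h * U j (fst p) (snd p) + snd h * Q (Suc j) (fst p) (snd p)"] conjI ballI)
   show "((\<lambda>p. Q j (fst p) (snd p)) has_derivative (\<lambda>h. fst h * U j (fst p) (snd p) + snd h * Q (Suc j) (fst p) (snd p))) (at p within ?R)" if "p \<in> ?R" for p
    by (rule rect_has_derivative[OF d(3) d(1) c(1) that])
   fix b :: "real \<times> real" assume "b \<in> Basis"
   then show "cdiff n ?R (\<lambda>p. fst b * U j (fst p) (snd p) + snd b * Q (Suc j) (fst p) (snd p))"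
    using basis[of b] Suc.IH[of j] Suc.IH[of "Suc j"] by auto
  qed
  show "cdiff (Suc n) ?R (\<lambda>p. U j (fst p) (snd p))"
   unfolding cdiff.simps
  proof (intro exI[of _ "\<lambda>p h. fst h * FF j (fst p) (snd p) + snd h * U (Suc j) (fst p) (snd p)"] conjI ballI)
   show "((\<lambda>p. U j (fst p) (snd p)) has_derivative (\<lambda>h. fst h * FF j (fst p) (snd p) + snd h * U (Suc j) (fst p) (snd p))) (at p within ?R)" if "p \<in> ?R" for p
    by (rule rect_has_derivative[OF d(4) d(2) c(2) that])
   fix b :: "real \<times> real" assume "b \<in> Basis"
   then show "cdiff n ?R (\<lambda>p. fst b * FF j (fst p) (snd p) + snd b * U (Suc j) (fst p) (snd p))"
    using basis[of b] F Suc.IH[of "Suc j"] by auto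
  qed
 qed
qed

text \<open>Half of the admissible size is reserved for the error of the polynomial approximation of
  the data. This error is at most \<open>\<epsilon> / 2 / (n + 1)\<close> up to order
  \<open>n + m0 + 1\<close>, so the approximate data are small up to order \<open>m0 + 1\<close>,
  bounded at every order, and convergent.\<close>

lemma wave_solution:
 assumes T: "0 < T"
 shows "\<exists>\<epsilon>>0. \<forall>Q0 U0. derivs Q0 \<longrightarrow> derivs U0 \<longrightarrow> (\<forall>i\<le>m0 + 1. \<forall>x\<in>{0..1}. \<bar>Q0 i x\<bar> \<le> \<epsilon> \<and> \<bar>U0 i x\<bar> \<le> \<epsilon>) \<longrightarrow>
  (\<exists>Q U. wsol T Q U \<and> (\<forall>x\<in>{0..1}. Q 0 0 x = Q0 0 x \<and> U 0 0 x = U0 0 x))"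
proof -
 obtain \<epsilon> \<eta> where \<epsilon>: "\<epsilon> > 0" and \<eta>: "\<eta> \<ge> 0" and ex: "\<forall>n q0 u0. degree q0 \<le> n \<longrightarrow> degree u0 \<le> n \<longrightarrow>
  (\<forall>i\<le>m0 + 1. \<forall>x\<in>{0..1}. \<bar>dp q0 i x\<bar> \<le> \<epsilon> \<and> \<bar>dp u0 i x\<bar> \<le> \<epsilon>) \<longrightarrow> (\<exists>q u a. gsol \<eta> n T q u a \<and> q 0 = q0 \<and> u 0 = u0)"
  using gsol_exists[OF less_imp_le[OF T]] by (elim exE conjE)
 have T0: "0 \<le> T" using T by simp
 let ?R = "{0..T} \<times> {0..1::real}"
 show ?thesis
 proof (rule exI[of _ "\<epsilon> / 2"], intro conjI[of "\<epsilon> / 2 > 0"] allI impI)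
  fix Q0 U0 :: "nat \<Rightarrow> real \<Rightarrow> real"
  assume Q0: "derivs Q0" and U0: "derivs U0" and small: "\<forall>i\<le>m0 + 1. \<forall>x\<in>{0..1}. \<bar>Q0 i x\<bar> \<le> \<epsilon> / 2 \<and> \<bar>U0 i x\<bar> \<le> \<epsilon> / 2"
  have ap: "\<exists>p. \<forall>n. True \<longrightarrow> (\<forall>i\<le>n + m0 + 1. \<forall>x\<in>{0..1}. \<bar>dp (p n) i x - f i x\<bar> \<le> \<epsilon> / 2 / (real n + 1))" if "derivs f" for f
   by (rule bounded_choice, rule poly_approx[OF that]) (use \<epsilon> in simp)
  obtain p where p0: "\<forall>n. True \<longrightarrow> (\<forall>i\<le>n + m0 + 1. \<forall>x\<in>{0..1}. \<bar>dp (p n) i x - Q0 i x\<bar> \<le> \<epsilon> / 2 / (real n + 1))"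
   using ap[OF Q0] by (elim exE)
  obtain v where v0: "\<forall>n. True \<longrightarrow> (\<forall>i\<le>n + m0 + 1. \<forall>x\<in>{0..1}. \<bar>dp (v n) i x - U0 i x\<bar> \<le> \<epsilon> / 2 / (real n + 1))"
   using ap[OF U0] by (elim exE)
  note p = p0[rule_format, OF TrueI] and v = v0[rule_format, OF TrueI]
  have en: "\<epsilon> / 2 / (real n + 1) \<le> \<epsilon> / 2" for n using \<epsilon> by (simp add: field_simps)
  \<comment> \<open>A degree that leaves room for the approximate data and tends to
    infinity.\<close>
  define dg where "dg n = n + degree (p n) + degree (v n)" for n
  have "\<bar>dp (p n) i x\<bar> \<le> \<epsilon> \<and> \<bar>dp (v n) i x\<bar> \<le> \<epsilon>" if "i \<le> m0 + 1" "x \<in> {0..1}" for n i x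
  proof -
   have i: "i \<le> n + m0 + 1" using that by simp
   show ?thesis using p[OF i that(2)] v[OF i that(2)] en[of n] small[rule_format, OF that] by linarith
  qed
  then have sm: "\<forall>i\<le>m0 + 1. \<forall>x\<in>{0..1}. \<bar>dp (p n) i x\<bar> \<le> \<epsilon> \<and> \<bar>dp (v n) i x\<bar> \<le> \<epsilon>" for n by blast
  have "\<exists>s. \<forall>n. True \<longrightarrow> (gsol \<eta> (dg n) T (fst (s n)) (fst (snd (s n))) (snd (snd (s n))) \<and> fst (s n) 0 = p n \<and> fst (snd (s n)) 0 = v n)"
  proof (rule bounded_choice)
   fix n
   have deg: "degree (p n) \<le> dg n" "degree (v n) \<le> dg n" by (simp_all add: dg_def)
   obtain q u a where "gsol \<eta> (dg n) T q u a \<and> q 0 = p n \<and> u 0 = v n"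
    using ex[rule_format, OF deg sm[rule_format]] by - (drule meta_mp, assumption, drule meta_mp, assumption, elim exE)
   then show "\<exists>s. gsol \<eta> (dg n) T (fst s) (fst (snd s)) (snd (snd s)) \<and> fst s 0 = p n \<and> fst (snd s) 0 = v n"
    by (intro exI[of _ "(q, u, a)"]) simp
  qed
  then obtain s where s: "\<forall>n. True \<longrightarrow> (gsol \<eta> (dg n) T (fst (s n)) (fst (snd (s n))) (snd (snd (s n))) \<and> fst (s n) 0 = p n \<and> fst (snd (s n)) 0 = v n)"
   by (elim exE)
  define q u a where "q n = fst (s n)" and "u n = fst (snd (s n))" and "a n = snd (snd (s n))" for n
  have g: "gsol \<eta> (dg n) T (q n) (u n) (a n)" and q0: "q n 0 = p n" and u0: "u n 0 = v n" for n
   using s[rule_format, OF TrueI, of n] by (simp_all add: q_def u_def a_def)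
  have ev: "evolves T (q n) (u n) (a n)" for n using g[of n] by (simp add: gsol_def)
  have bd: "\<exists>M. \<forall>i. True \<longrightarrow> (\<forall>n. \<forall>x\<in>{0..1}. \<bar>dp (p n) i x\<bar> \<le> M i)" "\<exists>M. \<forall>i. True \<longrightarrow> (\<forall>n. \<forall>x\<in>{0..1}. \<bar>dp (v n) i x\<bar> \<le> M i)"
  proof -
   have "\<bar>dp (p n) i x - Q0 i x\<bar> \<le> \<epsilon> / 2" "\<bar>dp (v n) i x - U0 i x\<bar> \<le> \<epsilon> / 2" if "i \<le> n" "x \<in> {0..1}" for n i x
   proof -
    have i: "i \<le> n + m0 + 1" using that by simp
    show "\<bar>dp (p n) i x - Q0 i x\<bar> \<le> \<epsilon> / 2" "\<bar>dp (v n) i x - U0 i x\<bar> \<le> \<epsilon> / 2"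
     using p[OF i that(2)] v[OF i that(2)] en[of n] by linarith+
   qed
   then show "\<exists>M. \<forall>i. True \<longrightarrow> (\<forall>n. \<forall>x\<in>{0..1}. \<bar>dp (p n) i x\<bar> \<le> M i)" "\<exists>M. \<forall>i. True \<longrightarrow> (\<forall>n. \<forall>x\<in>{0..1}. \<bar>dp (v n) i x\<bar> \<le> M i)"
    by - (rule bounded_choice, rule bounded_data[OF Q0], assumption, rule bounded_choice, rule bounded_data[OF U0], assumption)
  qed
  obtain M1 where M1: "\<forall>i. True \<longrightarrow> (\<forall>n. \<forall>x\<in>{0..1}. \<bar>dp (p n) i x\<bar> \<le> M1 i)" using bd(1) by (elim exE)
  obtain M2 where M2: "\<forall>i. True \<longrightarrow> (\<forall>n. \<forall>x\<in>{0..1}. \<bar>dp (v n) i x\<bar> \<le> M2 i)" using bd(2) by (elim exE)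
  define M where "M i = max (M1 i) (M2 i)" for i
  have db: "data_bdd M (q n 0) (u n 0)" for n
   unfolding data_bdd_def q0 u0 M_def
   by (intro allI ballI conjI max.coboundedI1[OF M1[rule_format, OF TrueI]] max.coboundedI2[OF M2[rule_format, OF TrueI]])
  have bq: "\<exists>K\<ge>0. \<forall>n. \<forall>t\<in>{0..T}. \<forall>x\<in>{0..1}. \<bar>dp (q n t) j x\<bar> \<le> K \<and> \<bar>dp (u n t) j x\<bar> \<le> K \<and> \<bar>dp (a n t) j x\<bar> \<le> K" for j
  proof -
   obtain K1 where K1: "K1 \<ge> 0" "sup_bd \<eta> T M j K1" using gsol_sup[OF \<eta> T0, of M j] by (elim exE conjE)
   obtain K2 where K2: "K2 \<ge> 0" "accel_sup_at \<eta> T M j K2" using gsol_sup_accel[OF \<eta> T0, of M j] by (elim exE conjE)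
   show ?thesis
   proof (rule exI[of _ "max K1 K2"], intro conjI[of "0 \<le> max K1 K2"] allI ballI)
    fix n t and x :: real assume t: "t \<in> {0..T}" and x: "x \<in> {0..1}"
    from K1(2)[rule_format, OF g[of n] db t x] K2(2)[rule_format, OF g[of n] db t x]
    show "\<bar>dp (q n t) j x\<bar> \<le> max K1 K2 \<and> \<bar>dp (u n t) j x\<bar> \<le> max K1 K2 \<and> \<bar>dp (a n t) j x\<bar> \<le> max K1 K2" by linarith
   qed (use K1(1) in simp)
  qed
  \<comment> \<open>Even indices list the derivatives of \<open>q\<close>, odd ones those of
    \<open>u\<close>, so that one diagonal argument covers both.\<close>
  define F where "F k n z = (if even k then dp (q n (fst z)) (k div 2) (snd z) else dp (u n (fst z)) (k div 2) (snd z))" for k n and z :: "real \<times> real"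
  have "\<exists>r. strict_mono (r :: nat \<Rightarrow> nat) \<and> (\<forall>j. \<exists>g. uniform_limit ?R (\<lambda>n. F j (r n)) g sequentially)"
  proof (rule uniform_diagonal_subsequence)
   show "compact ?R" by (intro compact_Times compact_Icc)
   fix k
   obtain K where K: "K \<ge> 0" "\<forall>n. \<forall>t\<in>{0..T}. \<forall>x\<in>{0..1}. \<bar>dp (q n t) (k div 2) x\<bar> \<le> K \<and> \<bar>dp (u n t) (k div 2) x\<bar> \<le> K \<and> \<bar>dp (a n t) (k div 2) x\<bar> \<le> K"
    using bq[of "k div 2"] by (elim exE conjE)
   obtain L where L: "L \<ge> 0" "\<forall>n. \<forall>t\<in>{0..T}. \<forall>x\<in>{0..1}. \<bar>dp (q n t) (Suc (k div 2)) x\<bar> \<le> L \<and> \<bar>dp (u n t) (Suc (k div 2)) x\<bar> \<le> L \<and> \<bar>dp (a n t) (Suc (k div 2)) x\<bar> \<le> L"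
    using bq[of "Suc (k div 2)"] by (elim exE conjE)
   show "\<exists>K. \<forall>n. \<forall>z\<in>?R. \<bar>F k n z\<bar> \<le> K"
   proof (intro exI[of _ K] allI ballI)
    fix n z assume "z \<in> ?R"
    then have "fst z \<in> {0..T}" "snd z \<in> {0..1}" by auto
    from K(2)[rule_format, OF this, of n] show "\<bar>F k n z\<bar> \<le> K" unfolding F_def by (cases "even k") simp_all
   qed
   \<comment> \<open>Lipschitz in \<open>t\<close> by the bounds on \<open>u\<close> and on the
     acceleration, in \<open>x\<close> by those on the next derivative.\<close>
   show "\<exists>L. \<forall>n. \<forall>z\<in>?R. \<forall>z'\<in>?R. \<bar>F k n z - F k n z'\<bar> \<le> L * norm (z - z')"
   proof (intro exI[of _ "2 * (max K L)"] allI ballI)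
    fix n z z' assume z: "z \<in> ?R" "z' \<in> ?R"
    have KL: "0 \<le> max K L" using K(1) by simp
    have b: "\<bar>dp (u n t) (k div 2) x\<bar> \<le> max K L" "\<bar>dp (a n t) (k div 2) x\<bar> \<le> max K L"
     "\<bar>dp (q n t) (Suc (k div 2)) x\<bar> \<le> max K L" "\<bar>dp (u n t) (Suc (k div 2)) x\<bar> \<le> max K L" if "t \<in> {0..T}" "x \<in> {0..1}" for t x
    proof -
     note k = K(2)[rule_format, OF that, of n] and l = L(2)[rule_format, OF that, of n]
     show "\<bar>dp (u n t) (k div 2) x\<bar> \<le> max K L" "\<bar>dp (a n t) (k div 2) x\<bar> \<le> max K L"
      by (rule max.coboundedI1[OF k[THEN conjunct2, THEN conjunct1]] max.coboundedI1[OF k[THEN conjunct2, THEN conjunct2]])+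
     show "\<bar>dp (q n t) (Suc (k div 2)) x\<bar> \<le> max K L" "\<bar>dp (u n t) (Suc (k div 2)) x\<bar> \<le> max K L"
      by (rule max.coboundedI2[OF l[THEN conjunct1]] max.coboundedI2[OF l[THEN conjunct2, THEN conjunct1]])+
    qed
    note lq = rect_lipschitz[where f = "\<lambda>t x. dp (q n t) (k div 2) x", OF evolvesD(1)[OF ev] b(1) derivsD[OF derivs_dp] b(3) KL z]
    note lu = rect_lipschitz[where f = "\<lambda>t x. dp (u n t) (k div 2) x", OF evolvesD(2)[OF ev] b(2) derivsD[OF derivs_dp] b(4) KL z]
    show "\<bar>F k n z - F k n z'\<bar> \<le> 2 * max K L * norm (z - z')"
    proof (cases "even k")
     case True
     then have e: "F k n z = dp (q n (fst z)) (k div 2) (snd z)" for z by (simp add: F_def)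
     show ?thesis unfolding e by (rule lq)
    next
     case False
     then have e: "F k n z = dp (u n (fst z)) (k div 2) (snd z)" for z by (simp add: F_def)
     show ?thesis unfolding e by (rule lu)
    qed
   qed
  qed
  then obtain r where r: "strict_mono (r :: nat \<Rightarrow> nat)" "\<forall>j. \<exists>g. uniform_limit ?R (\<lambda>n. F j (r n)) g sequentially"
   by (elim exE conjE)
  obtain h where h: "\<forall>j. uniform_limit ?R (\<lambda>n. F j (r n)) (h j) sequentially" using r(2) unfolding choice_iff by (elim exE)
  define Q where "Q j t x = h (2 * j) (t, x)" for j t x
  define U where "U j t x = h (2 * j + 1) (t, x)" for j t x
  have lq: "uniform_limit ?R (\<lambda>n z. dp (q (r n) (fst z)) j (snd z)) (\<lambda>z. Q j (fst z) (snd z)) sequentially" for j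
   using h[rule_format, of "2 * j"] by (simp add: F_def[abs_def] Q_def)
  have lu: "uniform_limit ?R (\<lambda>n z. dp (u (r n) (fst z)) j (snd z)) (\<lambda>z. U j (fst z) (snd z)) sequentially" for j
   using h[rule_format, of "2 * j + 1"] by (simp add: F_def[abs_def] U_def)
  have "n \<le> dg (r n)" for n using seq_suble[OF r(1), of n] by (simp add: dg_def)
  from gsol_limit[OF T g this lq lu] have ws: "wsol T Q U" .
  have ini: "Q 0 0 x = Q0 0 x \<and> U 0 0 x = U0 0 x" if x: "x \<in> {0..1}" for x
  proof -
   have "(0, x) \<in> ?R" using x T by simp
   have l: "(\<lambda>n. dp (f (r n)) 0 x) \<longlonglongrightarrow> f0 0 x" if "\<forall>n. True \<longrightarrow> (\<forall>i\<le>n + m0 + 1. \<forall>x\<in>{0..1}. \<bar>dp (f n) i x - f0 i x\<bar> \<le> \<epsilon> / 2 / (real n + 1))" for f and f0 :: "nat \<Rightarrow> real \<Rightarrow> real"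
   proof -
    have "(\<lambda>n. dp (f n) 0 x - f0 0 x) \<longlonglongrightarrow> 0"
    proof (rule Lim_null_comparison)
     show "\<forall>\<^sub>F n in sequentially. norm (dp (f n) 0 x - f0 0 x) \<le> \<epsilon> / 2 * inverse (real (Suc n))"
     proof (intro always_eventually allI)
      fix n
      have "norm (dp (f n) 0 x - f0 0 x) \<le> \<epsilon> / 2 / (real n + 1)"
       unfolding real_norm_def by (rule that[rule_format, OF TrueI _ x]) simp
      then show "norm (dp (f n) 0 x - f0 0 x) \<le> \<epsilon> / 2 * inverse (real (Suc n))"
       by (simp only: divide_inverse of_nat_Suc add.commute)
     qed
     show "(\<lambda>n. \<epsilon> / 2 * inverse (real (Suc n))) \<longlonglongrightarrow> 0"
      using tendsto_mult_right_zero[OF LIMSEQ_inverse_real_of_nat] .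
    qed
    from LIMSEQ_subseq_LIMSEQ[OF this r(1)] show ?thesis by (simp add: o_def LIM_zero_iff)
   qed
   have lim: "(\<lambda>n. dp (p (r n)) 0 x) \<longlonglongrightarrow> Q 0 0 x" "(\<lambda>n. dp (v (r n)) 0 x) \<longlonglongrightarrow> U 0 0 x"
    using tendsto_uniform_limitI[OF lq[of 0] \<open>(0, x) \<in> ?R\<close>] tendsto_uniform_limitI[OF lu[of 0] \<open>(0, x) \<in> ?R\<close>] by (simp_all only: fst_conv snd_conv q0 u0)
   show ?thesis by (rule conjI[OF LIMSEQ_unique[OF lim(1) l[OF p0]] LIMSEQ_unique[OF lim(2) l[OF v0]]])
  qed
  show "\<exists>Q U. wsol T Q U \<and> (\<forall>x\<in>{0..1}. Q 0 0 x = Q0 0 x \<and> U 0 0 x = U0 0 x)"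
   by (rule exI[of _ Q], rule exI[of _ U], rule conjI[OF ws], rule ballI, rule ini)
 qed (use \<epsilon> in simp)
qed

end

section \<open>Solution of the system\<close>

lemma rect_unique:
 fixes f :: "real \<times> real \<Rightarrow> real"
 assumes T: "0 < T" and p: "p \<in> rect T" and f: "(f has_derivative f') (at p within rect T)" "(f has_derivative f'') (at p within rect T)"
 shows "f' = f''"
proof -
 have r: "rect T = cbox (0, 0) (T, 1)" by (simp add: rect_def cbox_Pair_eq)
 show ?thesis
 proof (rule frechet_derivative_unique_within_closed_interval[of "(0 :: real, 0 :: real)" "(T, 1)"])
  show "\<And>i. i \<in> Basis \<Longrightarrow> (0 :: real, 0 :: real) \<bullet> i < (T, 1) \<bullet> i" using T by (auto simp: Basis_prod_def)
 qed (use p f in \<open>simp_all add: r\<close>)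
qed

lemma cdiff_C_infinity_on:
 assumes T: "0 < T" and "\<And>n. cdiff n (rect T) f"
 shows "C_infinity_on (rect T) f"
 unfolding C_infinity_on_def
 by (intro allI, rule cdiff_imp_C_diff_on[OF _ assms(2)]) (rule rect_unique[OF T])

lemma partial_within_rect:
 assumes "0 < T" "p \<in> rect T" "(f has_derivative D) (at p within rect T)" "\<And>z. z \<in> rect T \<Longrightarrow> g z = f z"
 shows "partial_within (rect T) b g p = D b"
proof -
 have "(g has_derivative D) (at p within rect T)"
  by (rule has_derivative_transform[OF assms(2) _ assms(3)]) (rule assms(4))
 moreover from this have "g differentiable (at p within rect T)" by (rule differentiableI)
 then have "(g has_derivative frechet_derivative g (at p within rect T)) (at p within rect T)" by (simp add: frechet_derivative_works)
 ultimately show ?thesis unfolding partial_within_def by (rule fun_cong[OF rect_unique[OF assms(1,2)], symmetric])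
qed

lemma C_infinity_on_D_x: "C_infinity_on (rect T) f \<Longrightarrow> C_infinity_on (rect T) ((D_x T ^^ k) f)"
proof (induction k)
 case (Suc k)
 have "C_diff_on (Suc n) (rect T) ((D_x T ^^ k) f)" for n using Suc unfolding C_infinity_on_def by blast
 then show ?case unfolding C_infinity_on_def by (simp add: D_x_def Basis_prod_def)
qed simp

lemma data_derivs:
 assumes T: "0 < T" and f: "C_infinity_on (rect T) f"
 shows "derivs (\<lambda>k x. (D_x T ^^ k) f (0, x))"
 unfolding derivs_def
proof (intro allI ballI)
 fix k and x :: real assume x: "x \<in> {0..1}"
 define g where "g = (D_x T ^^ k) f"
 have "C_diff_on (Suc 0) (rect T) g" using C_infinity_on_D_x[OF f, of k] unfolding g_def C_infinity_on_def by blast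
 then have "g differentiable_on rect T" by simp
 then have "(g has_derivative frechet_derivative g (at (0, x) within rect T)) (at (0, x) within rect T)"
  using x T by (simp add: differentiable_on_def frechet_derivative_works rect_def)
 note g = this
 have i: "(\<lambda>x. (0, x)) ` {0..1} \<subseteq> rect T" using T by (auto simp: rect_def)
 have "((\<lambda>x. (0, x)) has_derivative (\<lambda>h. (0, h))) (at x within {0..1})" by (intro derivative_intros)
 from has_derivative_in_compose[OF this has_derivative_subset[OF g i]]
 have "((\<lambda>x. g (0, x)) has_derivative (\<lambda>h. frechet_derivative g (at (0, x) within rect T) (0, h))) (at x within {0..1})" .
 moreover have "frechet_derivative g (at (0, x) within rect T) (0, h) = D_x T g (0, x) * h" for h
 proof -
  have "linear (frechet_derivative g (at (0, x) within rect T))"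
   using g by (rule has_derivative_linear)
  from linear_scale[OF this, of h "(0, 1)"] show ?thesis by (simp add: D_x_def partial_within_def)
 qed
 ultimately show "((\<lambda>x. (D_x T ^^ k) f (0, x)) has_real_derivative (D_x T ^^ Suc k) f (0, x)) (at x within {0..1})"
  by (simp add: has_field_derivative_def g_def)
qed

abbreviation "solvable_from N l1 L0 J H1 H2 T U ys vs \<equiv>
 \<exists>y v. C_infinity_on (rect T) y \<and> C_infinity_on (rect T) v \<and> takes_values_in T U y v \<and> solves N l1 L0 J H1 H2 T y v \<and>
  (\<forall>x\<in>{0..1}. y (0, x) = ys (0, x) \<and> v (0, x) = vs (0, x))"

context reduction
begin

lemma dom_sub: "dom \<subseteq> O5" "dom \<subseteq> O4" "dom \<subseteq> O2" "dom \<subseteq> O1"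
 using O5_sub by (auto simp: dom_def)

text \<open>The compact segment of zero jets has a neighbourhood of some radius \<open>e\<close>
  inside the open set \<open>dom\<close>. Five coordinates of size at most \<open>e / 6\<close> stay
  within it.\<close>

lemma jbox_ex: "\<exists>\<rho>>0. jbox \<rho> \<subseteq> dom"
proof -
 have c: "compact ((\<lambda>x. (x, 0)) ` {0..1} :: jet set)" by (intro compact_continuous_image compact_Icc continuous_intros)
 have "(\<lambda>x. (x, 0)) ` {0..1} \<subseteq> dom" using zero_in_dom by auto
 from compact_subset_open_imp_ball_epsilon_subset[OF c open_dom this]
 obtain e where e: "e > 0" "(\<Union>z\<in>(\<lambda>x. (x, 0)) ` {0..1}. ball z e) \<subseteq> dom" by blast
 have "p \<in> dom" if p: "p \<in> jbox (e / 6)" for p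
 proof -
  obtain x y y1 y2 u u1 where pp: "p = (x, y, y1, y2, u, u1)" by (metis prod.exhaust)
  have b: "x \<in> {0..1}" "\<bar>y\<bar> \<le> e / 6" "\<bar>y1\<bar> \<le> e / 6" "\<bar>y2\<bar> \<le> e / 6" "\<bar>u\<bar> \<le> e / 6" "\<bar>u1\<bar> \<le> e / 6"
   using p by (auto simp: pp jbox_def)
  have "dist (x, 0) p = norm (0::real, y, y1, y2, u, u1)"
   using dist_commute[of "(x, 0)" p] by (simp add: pp dist_norm zero_prod_def)
  also have "\<dots> \<le> norm (0::real) + (norm y + (norm y1 + (norm y2 + (norm u + norm u1))))"
   using norm_Pair_le[of "0::real" "(y, y1, y2, u, u1)"] norm_Pair_le[of y "(y1, y2, u, u1)"] norm_Pair_le[of y1 "(y2, u, u1)"]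
    norm_Pair_le[of y2 "(u, u1)"] norm_Pair_le[of u u1] by linarith
  also have "\<dots> < e" using b e(1) by simp
  finally have "p \<in> ball (x, 0) e" by simp
  then show ?thesis using e(2) b(1) by blast
 qed
 then show ?thesis using e(1) by (intro exI[of _ "e / 6"]) auto
qed

text \<open>Undoes the reduction along a solution: the time derivative of \<open>1 / J\<close>
  cancels the last term of \<open>G\<close>, which leaves the second equation of the system for
  \<open>v = u / J\<close>.\<close>

lemma vv_partials:
 assumes Y: "\<And>t x. t \<in> {0..T} \<Longrightarrow> x \<in> {0..1} \<Longrightarrow> jet x (\<lambda>i. Q i t x) (\<lambda>i. Y i t x) \<in> dom"
  and x: "\<And>j t x. t \<in> {0..T} \<Longrightarrow> x \<in> {0..1} \<Longrightarrow> (Q j t has_real_derivative Q (Suc j) t x) (at x within {0..1})"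
   "\<And>j t x. t \<in> {0..T} \<Longrightarrow> x \<in> {0..1} \<Longrightarrow> (Y j t has_real_derivative Y (Suc j) t x) (at x within {0..1})"
  and t: "\<And>j t x. t \<in> {0..T} \<Longrightarrow> x \<in> {0..1} \<Longrightarrow> ((\<lambda>t. Q j t x) has_real_derivative Y j t x) (at t within {0..T})"
   "\<And>t x. t \<in> {0..T} \<Longrightarrow> x \<in> {0..1} \<Longrightarrow> ((\<lambda>t. Y 0 t x) has_real_derivative - G (jet x (\<lambda>i. Q i t x) (\<lambda>i. Y i t x))) (at t within {0..T})"
  and s: "s \<in> {0..T}" and y: "y \<in> {0..1}"
 defines "p \<equiv> jet y (\<lambda>i. Q i s y) (\<lambda>i. Y i s y)"
 shows "((\<lambda>x. vv (jet x (\<lambda>i. Q i s x) (\<lambda>i. Y i s x))) has_real_derivative vv1 p) (at y within {0..1})"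
  and "((\<lambda>t. vv (jet y (\<lambda>i. Q i t y) (\<lambda>i. Y i t y))) has_real_derivative - (H1p p * Lp p + H2p p)) (at s within {0..T})"
proof -
 have v: "vv (jet x (\<lambda>i. Q i t x) (\<lambda>i. Y i t x)) = inverse (J (x, Q 0 t x, x * Q 1 t x)) * Y 0 t x" for t x
  by (simp add: vv_def ka_def Jp_def zz_def jet_def)
 have pr: "px p = y" "py p = Q 0 s y" "py1 p = Q 1 s y" "py2 p = Q 2 s y" "pu p = Y 0 s y" "pu1 p = Y 1 s y"
  by (simp_all add: p_def jet_def)
 have O4: "p \<in> O4" using Y[OF s y] dom_sub(2) by (auto simp: p_def)
 note o = O4D[OF O4]
 have inP: "(y, Q 0 s y, y * Q 1 s y) \<in> I \<times> U \<times> U" using o by (simp add: pr zz_def)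
 have Jn: "J (y, Q 0 s y, y * Q 1 s y) \<noteq> 0" using o by (simp add: Jp_def pr zz_def)
 have xQ: "(Q 0 s has_real_derivative Q 1 s y) (at y within {0..1})" "(Q 1 s has_real_derivative Q 2 s y) (at y within {0..1})"
  "(Y 0 s has_real_derivative Y 1 s y) (at y within {0..1})"
  using x(1)[OF s y, of 0] x(1)[OF s y, of 1] x(2)[OF s y, of 0] by (simp_all add: numeral_2_eq_2)
 have z: "((\<lambda>x. x * Q 1 s x) has_real_derivative 1 * Q 1 s y + Q 2 s y * y) (at y within {0..1})"
  by (intro DERIV_mult DERIV_ident xQ)
 have "((\<lambda>x. J (x, Q 0 s x, x * Q 1 s x)) has_real_derivative Jx p + Jy p * py1 p + Jz p * (py1 p + px p * py2 p)) (at y within {0..1})"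
  by (rule smooth_chain3[OF open_prods(1) sm_J inP DERIV_ident xQ(1) z, THEN DERIV_cong])
   (simp add: Jx_def Jy_def Jz_def pr zz_def algebra_simps)
 from DERIV_mult[OF DERIV_inverse'[OF this Jn] xQ(3)]
 show "((\<lambda>x. vv (jet x (\<lambda>i. Q i s x) (\<lambda>i. Y i s x))) has_real_derivative vv1 p) (at y within {0..1})"
  unfolding v by (rule DERIV_cong) (simp add: vv1_def Dka_def ka_def Jp_def pr zz_def algebra_simps)
 have z: "((\<lambda>t. y * Q 1 t y) has_real_derivative y * Y 1 s y) (at s within {0..T})"
  by (intro DERIV_cmult t s y)
 have "((\<lambda>t. J (y, Q 0 t y, y * Q 1 t y)) has_real_derivative Jy p * pu p + Jz p * px p * pu1 p) (at s within {0..T})"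
  by (rule smooth_chain3[OF open_prods(1) sm_J inP DERIV_const t(1)[OF s y] z, THEN DERIV_cong])
   (simp add: Jy_def Jz_def pr zz_def algebra_simps)
 from DERIV_mult[OF DERIV_inverse'[OF this Jn] t(2)[OF s y, folded p_def]]
 have "((\<lambda>t. vv (jet y (\<lambda>i. Q i t y) (\<lambda>i. Y i t y))) has_real_derivative
   - (ka p * (Jy p * pu p + Jz p * px p * pu1 p) * ka p) * pu p + - G p * ka p) (at s within {0..T})"
  unfolding v by (rule DERIV_cong) (simp add: ka_def Jp_def pr zz_def)
 moreover have "- (ka p * (Jy p * pu p + Jz p * px p * pu1 p) * ka p) * pu p + - G p * ka p = - (H1p p * Lp p + H2p p)"
 proof -
  have "Jp p * ka p = 1" using o by (simp add: ka_def)
  note e = arg_cong[OF this, of "\<lambda>z. z * (H1p p * Lp p + H2p p)"]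
  have "ka p * G p = H1p p * Lp p + H2p p - ka p * ka p * pu p * (Jy p * pu p + Jz p * px p * pu1 p)"
   using e by (simp add: G_def algebra_simps)
  then show ?thesis by (simp add: algebra_simps)
 qed
 ultimately show "((\<lambda>t. vv (jet y (\<lambda>i. Q i t y) (\<lambda>i. Y i t y))) has_real_derivative - (H1p p * Lp p + H2p p)) (at s within {0..T})"
  by simp
qed

text \<open>The initial value of \<open>u\<close> is \<open>J v\<close>. It is written as the
  function \<open>Jp * pu\<close> at the jet that has \<open>v\<close> in the slots of
  \<open>u\<close>; then \<open>leading_terms\<close> supplies all its derivatives as monomials
  vanishing with the jet, and \<open>mon_crude\<close> bounds them linearly in the data.\<close>

lemma initial_velocity:
 assumes \<rho>: "\<rho> > 0" "jbox \<rho> \<subseteq> dom" and \<epsilon>: "\<epsilon> > 0"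
 shows "\<exists>\<delta>>0. \<delta> \<le> \<epsilon> \<and> (\<forall>q v. derivs q \<longrightarrow> derivs v \<longrightarrow> (\<forall>k\<le>m + 7. \<forall>x\<in>{0..1}. \<bar>q k x\<bar> \<le> \<delta> \<and> \<bar>v k x\<bar> \<le> \<delta>) \<longrightarrow>
  (\<exists>u. derivs u \<and> (\<forall>i\<le>m. \<forall>x\<in>{0..1}. \<bar>u i x\<bar> \<le> \<epsilon>) \<and> (\<forall>x\<in>{0..1}. (x, q 0 x, q 1 x, q 2 x, v 0 x, v 1 x) \<in> dom \<and> u 0 x = J (x, q 0 x, x * q 1 x) * v 0 x)))"
proof -
 define \<Phi> where "\<Phi> p = Jp p * pu p" for p
 have sm: "smooth dom \<Phi>" unfolding \<Phi>_def[abs_def] by (intro smooth_intros sm_O1 dom_sub)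
 have z: "\<forall>x. (x, 0) \<in> dom \<longrightarrow> \<Phi> (x, 0) = 0" by (simp add: \<Phi>_def zero_prod_def)
 obtain F R where F: "deriv_chain dom True \<Phi> F R"
  using leading_terms[OF open_dom sm z, of True] by (elim exE)
 have "\<exists>C. \<forall>i. True \<longrightarrow> (C i \<ge> 0 \<and> (\<forall>x q u B. adm \<rho> (i + 7) (i + 7) 1 x q u B \<longrightarrow> \<bar>F i x q u\<bar> \<le> C i * (if True then B else 1)))"
  by (rule bounded_choice, rule mon_crude[OF open_dom \<rho>(2) _ _ _ _ F[THEN conjunct1, rule_format]]) simp_all
 then obtain C where C: "\<forall>i. True \<longrightarrow> (C i \<ge> 0 \<and> (\<forall>x q u B. adm \<rho> (i + 7) (i + 7) 1 x q u B \<longrightarrow> \<bar>F i x q u\<bar> \<le> C i * (if True then B else 1)))"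
  by (elim exE)
 have C0: "C i \<ge> 0" for i using C by simp
 define D where "D = 1 + (\<Sum>i\<le>m. C i)"
 have D: "D \<ge> 1" using C0 by (simp add: D_def sum_nonneg)
 define \<delta> where "\<delta> = min (min \<rho> 1) (\<epsilon> / D)"
 have "\<delta> \<le> \<epsilon> / D" by (simp add: \<delta>_def)
 then have "\<delta> * D \<le> \<epsilon>" using D by (simp add: field_simps)
 moreover have "0 < \<epsilon> / D" using \<epsilon> D by simp
 ultimately have \<delta>: "\<delta> > 0" "\<delta> \<le> \<rho>" "\<delta> \<le> 1" "\<delta> * D \<le> \<epsilon>" using \<rho>(1) by (simp_all add: \<delta>_def)
 have "\<delta> * 1 \<le> \<delta> * D" using \<delta>(1) D by (intro mult_left_mono) auto
 then have \<delta>\<epsilon>: "\<delta> \<le> \<epsilon>" using \<delta>(4) by simp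
 show ?thesis
 proof (intro exI[of _ \<delta>] conjI[of "\<delta> > 0"] conjI[of "\<delta> \<le> \<epsilon>"] allI impI)
  fix q v :: "nat \<Rightarrow> real \<Rightarrow> real" assume q: "derivs q" and v: "derivs v"
   and b: "\<forall>k\<le>m + 7. \<forall>x\<in>{0..1}. \<bar>q k x\<bar> \<le> \<delta> \<and> \<bar>v k x\<bar> \<le> \<delta>"
  have jB: "jet x (\<lambda>k. q k x) (\<lambda>k. v k x) \<in> jbox \<rho>" if x: "x \<in> {0..1}" for x
  proof -
   have "\<bar>q k x\<bar> \<le> \<rho> \<and> \<bar>v k x\<bar> \<le> \<rho>" if "k \<le> 2" for k using b[rule_format, of k x] that x \<delta>(2) by auto
   then show ?thesis unfolding jet_in_box using x by simp
  qed
  define u where "u i x = F i x (\<lambda>k. q k x) (\<lambda>k. v k x)" for i x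
  have du: "derivs u" unfolding derivs_def u_def
  proof (intro allI ballI)
   fix i and x :: real assume x: "x \<in> {0..1}"
   show "((\<lambda>x. F i x (\<lambda>k. q k x) (\<lambda>k. v k x)) has_real_derivative F (Suc i) x (\<lambda>k. q k x) (\<lambda>k. v k x)) (at x within {0..1})"
    by (rule tderD[OF F[THEN conjunct2, THEN conjunct1, rule_format] q v x]) (use jB[OF x] \<rho>(2) in blast)
  qed
  have bu: "\<bar>u i x\<bar> \<le> \<epsilon>" if i: "i \<le> m" and x: "x \<in> {0..1}" for i x
  proof (rule abs_le_closure[OF derivs_continuous[OF du] _ x])
   fix y :: real assume y: "0 < y" "y < 1"
   have "adm \<rho> (i + 7) (i + 7) 1 y (\<lambda>k. q k y) (\<lambda>k. v k y) \<delta>"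
    unfolding adm_def
   proof (intro conjI allI impI)
    fix k assume k: "k \<le> i + 7"
    then have "XX y ^ (k - (i + 7)) = 1" "k \<le> m + 7" using i by simp_all
    then show "XX y ^ (k - (i + 7)) * \<bar>q k y\<bar> \<le> \<delta>" "XX y ^ (k - (i + 7)) * \<bar>v k y\<bar> \<le> \<delta>"
     using b y by simp_all
   qed (use y \<delta> jB[of y] in auto)
   then have "\<bar>u i y\<bar> \<le> C i * \<delta>" using C unfolding u_def by simp
   also have "C i \<le> (\<Sum>i\<le>m. C i)" using i C0 by (intro member_le_sum) auto
   then have "C i * \<delta> \<le> D * \<delta>" using \<delta>(1) by (intro mult_right_mono) (auto simp: D_def)
   finally show "\<bar>u i y\<bar> \<le> \<epsilon>" using \<delta>(4) by (simp add: mult.commute)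
  qed
  have "(x, q 0 x, q 1 x, q 2 x, v 0 x, v 1 x) \<in> dom \<and> u 0 x = J (x, q 0 x, x * q 1 x) * v 0 x" if "x \<in> {0..1}" for x
   using jB[OF that] \<rho>(2) F[THEN conjunct2, THEN conjunct2, THEN conjunct1] by (auto simp: u_def \<Phi>_def jet_def Jp_def zz_def)
  then show "\<exists>u. derivs u \<and> (\<forall>i\<le>m. \<forall>x\<in>{0..1}. \<bar>u i x\<bar> \<le> \<epsilon>) \<and> (\<forall>x\<in>{0..1}. (x, q 0 x, q 1 x, q 2 x, v 0 x, v 1 x) \<in> dom \<and> u 0 x = J (x, q 0 x, x * q 1 x) * v 0 x)"
   using du bu by (intro exI[of _ u] conjI allI impI ballI) simp_all
 qed (use \<delta> \<delta>\<epsilon> in auto)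
qed

lemma solvable:
 assumes N: "N > 4" and T: "T > 0"
 shows "\<exists>\<delta>>0. \<exists>K. \<forall>ys vs. C_infinity_on (rect T) ys \<longrightarrow> C_infinity_on (rect T) vs \<longrightarrow> C_norm_le T K ys vs \<delta> \<longrightarrow>
  (solvable_from N l1 L0 J H1 H2 T U ys vs)"
proof -
 obtain \<rho> where \<rho>: "\<rho> > 0" "jbox \<rho> \<subseteq> dom" using jbox_ex by blast
 \<comment> \<open>The exponents are those with \<open>al + 1 = 5/2\<close> and
   \<open>be + 1 = N/2\<close>, so that \<open>d 0\<close> is the singular coefficient of the
   equation.\<close>
 interpret wv: wave "3 / 2" "N / 2 - 1" dom G A B C \<rho>
 proof
  show "(0::real) < 3 / 2" "0 < N / 2 - 1" using N by simp_all
  show "open dom" by (rule open_dom)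
  show "smooth dom G" "smooth dom A" "smooth dom B" "smooth dom C"
   by (rule smooth_subset[OF sm_AG(3) dom_sub(1)] smooth_subset[OF sm_AG(1) dom_sub(1)] smooth_subset[OF sm_AG(2) dom_sub(1)] smooth_subset[OF sm_C dom_sub(1)])+
  show "\<forall>x. (x, 0) \<in> dom \<longrightarrow> G (x, 0) = 0"
  proof (intro allI impI)
   fix x assume "(x, 0) \<in> dom"
   then have "(x, 0) \<in> O4" using dom_sub(2) by blast
   from O4D[OF this] show "G (x, 0) = 0" by (intro G_zero) (simp add: px_def)
  qed
  show "0 < A p" if "p \<in> dom" for p using that by (simp add: dom_def)
  have d: "weights.d (3 / 2) (N / 2 - 1) 0 x = 5 / 2 * (1 - x) - N / 2 * x" for x
  proof -
   interpret weights "3 / 2" "N / 2 - 1" by unfold_locales (use N in simp_all)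
   show ?thesis by (simp add: d_def)
  qed
  show "pd e3 G p = - (XX (px p) * A p)" if "p \<in> dom" for p
   unfolding XX_def using pd_G_y2[of p] that dom_sub(1) by blast
  show "pd e5 G p = XX (px p) * B p" if "p \<in> dom" for p
   unfolding XX_def using pd_G_u1[of p] that dom_sub(1) by blast
  show "pd e2 G p = - (weights.d (3 / 2) (N / 2 - 1) 0 (px p) * A p) + XX (px p) * C p" if "p \<in> dom" for p
   unfolding XX_def d using pd_G_y1[of p] that dom_sub(1) by blast
 qed (rule \<rho>)+
 obtain \<epsilon> where \<epsilon>: "\<epsilon> > 0" and sol: "\<forall>Q0 U0. derivs Q0 \<longrightarrow> derivs U0 \<longrightarrow> (\<forall>i\<le>wv.m0 + 1. \<forall>x\<in>{0..1}. \<bar>Q0 i x\<bar> \<le> \<epsilon> \<and> \<bar>U0 i x\<bar> \<le> \<epsilon>) \<longrightarrow>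
  (\<exists>Q Y. wv.wsol T Q Y \<and> (\<forall>x\<in>{0..1}. Q 0 0 x = Q0 0 x \<and> Y 0 0 x = U0 0 x))"
  using wv.wave_solution[OF T] by (elim exE conjE)
 obtain \<delta> where \<delta>: "\<delta> > 0" "\<delta> \<le> \<epsilon>" and vel: "\<forall>q v. derivs q \<longrightarrow> derivs v \<longrightarrow> (\<forall>k\<le>wv.m0 + 1 + 7. \<forall>x\<in>{0..1}. \<bar>q k x\<bar> \<le> \<delta> \<and> \<bar>v k x\<bar> \<le> \<delta>) \<longrightarrow>
  (\<exists>u. derivs u \<and> (\<forall>i\<le>wv.m0 + 1. \<forall>x\<in>{0..1}. \<bar>u i x\<bar> \<le> \<epsilon>) \<and> (\<forall>x\<in>{0..1}. (x, q 0 x, q 1 x, q 2 x, v 0 x, v 1 x) \<in> dom \<and> u 0 x = J (x, q 0 x, x * q 1 x) * v 0 x))"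
  using initial_velocity[OF \<rho> \<epsilon>, of "wv.m0 + 1"] by (elim exE conjE)
 show ?thesis
 proof (rule exI[of _ \<delta>], rule conjI[OF \<delta>(1)], rule exI[of _ "wv.m0 + 1 + 7"], intro allI impI)
  fix ys vs assume ys: "C_infinity_on (rect T) ys" and vs: "C_infinity_on (rect T) vs" and nb: "C_norm_le T (wv.m0 + 1 + 7) ys vs \<delta>"
  define q0 where "q0 k x = (D_x T ^^ k) ys (0, x)" for k x
  define v0 where "v0 k x = (D_x T ^^ k) vs (0, x)" for k x
  have dq: "derivs q0" "derivs v0" unfolding q0_def[abs_def] v0_def[abs_def] by (rule data_derivs[OF T ys] data_derivs[OF T vs])+
  have small: "\<bar>q0 k x\<bar> \<le> \<delta> \<and> \<bar>v0 k x\<bar> \<le> \<delta>" if "k \<le> wv.m0 + 1 + 7" "x \<in> {0..1}" for k x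
  proof -
   have "(0, x) \<in> rect T" using that T by (simp add: rect_def)
   then show ?thesis using nb[unfolded C_norm_le_def, rule_format, of 0 k "(0, x)"] that by (simp add: q0_def v0_def)
  qed
  have small': "\<forall>k\<le>wv.m0 + 1 + 7. \<forall>x\<in>{0..1}. \<bar>q0 k x\<bar> \<le> \<delta> \<and> \<bar>v0 k x\<bar> \<le> \<delta>"
   by (intro allI impI ballI small)
  obtain u0 where u0: "derivs u0" "\<forall>i\<le>wv.m0 + 1. \<forall>x\<in>{0..1}. \<bar>u0 i x\<bar> \<le> \<epsilon>"
   "\<forall>x\<in>{0..1}. (x, q0 0 x, q0 1 x, q0 2 x, v0 0 x, v0 1 x) \<in> dom \<and> u0 0 x = J (x, q0 0 x, x * q0 1 x) * v0 0 x"
   using vel[THEN spec, THEN spec, THEN mp, THEN mp, THEN mp, OF dq small'] by (elim exE conjE)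
  have sm: "\<forall>i\<le>wv.m0 + 1. \<forall>x\<in>{0..1}. \<bar>q0 i x\<bar> \<le> \<epsilon> \<and> \<bar>u0 i x\<bar> \<le> \<epsilon>"
  proof (intro allI impI ballI conjI)
   fix i and x :: real assume i: "i \<le> wv.m0 + 1" and x: "x \<in> {0..1}"
   have "i \<le> wv.m0 + 1 + 7" using i by simp
   from small[OF this x] show "\<bar>q0 i x\<bar> \<le> \<epsilon>" using \<delta>(2) by linarith
   show "\<bar>u0 i x\<bar> \<le> \<epsilon>" using u0(2) i x by blast
  qed
  obtain Q Y where QW: "wv.wsol T Q Y" and ini: "\<forall>x\<in>{0..1}. Q 0 0 x = q0 0 x \<and> Y 0 0 x = u0 0 x"
   using sol[THEN spec, THEN spec, THEN mp, THEN mp, THEN mp, OF dq(1) u0(1) sm] by (elim exE conjE)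
  define jj where "jj t x = jet x (\<lambda>i. Q i t x) (\<lambda>i. Y i t x)" for t x
  note ws = QW[unfolded wv.wsol_def]
  have cQ: "continuous_on ({0..T} \<times> {0..1}) (\<lambda>p. Q j (fst p) (snd p))" "continuous_on ({0..T} \<times> {0..1}) (\<lambda>p. Y j (fst p) (snd p))" for j
   by (rule ws[THEN conjunct1, rule_format, THEN conjunct1] ws[THEN conjunct1, rule_format, THEN conjunct2])+
  have jd: "jet x (\<lambda>i. Q i t x) (\<lambda>i. Y i t x) \<in> dom" if "t \<in> {0..T}" "x \<in> {0..1}" for t x
   using ws[THEN conjunct2, THEN conjunct1, rule_format, OF that] \<rho>(2) by blast
  note w = ws[THEN conjunct2, THEN conjunct2, rule_format]
  note xQ = w[THEN conjunct1] and xW = w[THEN conjunct2, THEN conjunct1] and tQ = w[THEN conjunct2, THEN conjunct2, THEN conjunct1]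
  have tW: "((\<lambda>t. Y 0 t x) has_real_derivative - G (jet x (\<lambda>i. Q i t x) (\<lambda>i. Y i t x))) (at t within {0..T})"
   if "t \<in> {0..T}" "x \<in> {0..1}" for t x
   using w[THEN conjunct2, THEN conjunct2, THEN conjunct2, OF that, of 0] unfolding wv.Fs(3) .
  note vp = vv_partials[OF jd xQ xW tQ tW, folded jj_def]
  have cd: "cdiff n ({0..T} \<times> {0..1}) (\<lambda>p. Q j (fst p) (snd p))" "cdiff n ({0..T} \<times> {0..1}) (\<lambda>p. Y j (fst p) (snd p))" for n j
   using wv.wsol_cdiff[OF QW, of n j] by blast+
  have smj: "cdiff n ({0..T} \<times> {0..1}) (\<lambda>p. \<Phi> (jj (fst p) (snd p)))" if "smooth dom \<Phi>" for \<Phi> n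
  proof -
   have "mon dom False 0 0 (\<lambda>x q u. \<Phi> (jet x q u))" by (rule mon.base[OF that]) simp
   then show ?thesis unfolding jj_def
    by (rule mon_cdiff[OF _ cdiff_linear[OF bounded_linear_snd] cd]) (use jd in auto)
  qed
  define y where "y p = Q 0 (fst p) (snd p)" for p
  define v where "v p = vv (jj (fst p) (snd p))" for p
  have R: "rect T = {0..T} \<times> {0..1}" by (simp add: rect_def)
  have "smooth dom vv1" "smooth dom vv" by (rule sm_O2[OF dom_sub(3)])+
  note smv = this
  have dQ: "((\<lambda>p. Q j (fst p) (snd p)) has_derivative (\<lambda>h. fst h * Y j (fst p) (snd p) + snd h * Q (Suc j) (fst p) (snd p))) (at p within rect T)" if "p \<in> rect T" for p j
   unfolding R by (rule rect_has_derivative[OF tQ xQ cQ(1)]) (use that R in auto)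
  have dv: "(v has_derivative (\<lambda>h. fst h * - (H1p (jj (fst p) (snd p)) * Lp (jj (fst p) (snd p)) + H2p (jj (fst p) (snd p))) + snd h * vv1 (jj (fst p) (snd p)))) (at p within rect T)" if "p \<in> rect T" for p
   unfolding R v_def[abs_def]
   by (rule rect_has_derivative[OF vp(2) vp(1)]) (use that R smj[OF smv(1), of 0] in auto)
  have Df: "D_t T f p = partial_within (rect T) (1, 0) f p" "D_x T f p = partial_within (rect T) (0, 1) f p" for f p
   by (simp_all add: D_t_def D_x_def)
  have Dy: "D_t T y p = Y 0 (fst p) (snd p)" "D_x T y p = Q 1 (fst p) (snd p)" if "p \<in> rect T" for p
   unfolding Df using partial_within_rect[OF T that dQ[OF that, of 0], where g = y] by (simp_all add: y_def)
  have Dyy: "D_x T (D_x T y) p = Q 2 (fst p) (snd p)" if "p \<in> rect T" for p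
   unfolding Df(2)[of "D_x T y"] using partial_within_rect[OF T that dQ[OF that, of 1], where g = "D_x T y"] Dy(2) by (simp add: numeral_2_eq_2)
  have Dv: "D_t T v p = - (H1p (jj (fst p) (snd p)) * Lp (jj (fst p) (snd p)) + H2p (jj (fst p) (snd p)))" "D_x T v p = vv1 (jj (fst p) (snd p))" if "p \<in> rect T" for p
   unfolding Df using partial_within_rect[OF T that dv[OF that], where g = v] by simp_all
  have pr: "px (jj t x) = x" "py (jj t x) = Q 0 t x" "py1 (jj t x) = Q 1 t x" "py2 (jj t x) = Q 2 t x" "pu (jj t x) = Y 0 t x" for t x
   by (simp_all add: jj_def jet_def)
  have val: "xD_x T y (t, x) = zz (jj t x)" "xD_x T v (t, x) = ww (jj t x)" if "(t, x) \<in> rect T" for t x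
   using Dy(2)[OF that] Dv(2)[OF that] by (simp_all add: xD_x_def zz_def ww_def pr)
  have O: "jj t x \<in> O4" if "(t, x) \<in> rect T" for t x using jd[of t x] that dom_sub(2) by (auto simp: R jj_def)
  have P1: "C_infinity_on (rect T) y" unfolding y_def[abs_def] by (rule cdiff_C_infinity_on[OF T]) (use cd(1) in \<open>simp add: R\<close>)
  have P2: "C_infinity_on (rect T) v" unfolding v_def[abs_def] by (rule cdiff_C_infinity_on[OF T]) (use smj[OF smv(2)] in \<open>simp add: R\<close>)
  have P3: "takes_values_in T U y v"
   unfolding takes_values_in_def
  proof
   fix p assume "p \<in> rect T"
   then obtain t x where p: "p = (t, x)" "(t, x) \<in> rect T" by (cases p) auto
   show "y p \<in> U \<and> xD_x T y p \<in> U \<and> v p \<in> U \<and> xD_x T v p \<in> U"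
    unfolding p(1) val[OF p(2)] using O4D[OF O[OF p(2)]] by (simp add: y_def v_def pr)
  qed
  have P4: "solves N l1 L0 J H1 H2 T y v"
   unfolding solves_def Let_def
  proof (intro ballI, clarsimp del: conjI)
   fix t x assume p: "(t, x) \<in> rect T"
   have "Jp (jj t x) * (ka (jj t x) * Y 0 t x) = Y 0 t x" using O4D[OF O[OF p]] by (simp add: ka_def)
   then have "D_t T y (t, x) - J (x, y (t, x), xD_x T y (t, x)) * v (t, x) = 0"
    unfolding Dy(1)[OF p] val[OF p] by (simp add: y_def v_def vv_def Jp_def pr)
   moreover have "L_op N l1 L0 T y (t, x) = Lp (jj t x)"
    using Dy[OF p] Dyy[OF p] by (simp add: L_op_def Lp_def pr y_def)
   then have "D_t T v (t, x) + H1 (x, y (t, x), xD_x T y (t, x), v (t, x)) * L_op N l1 L0 T y (t, x)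
     + H2 (x, y (t, x), xD_x T y (t, x), v (t, x), xD_x T v (t, x)) = 0"
    unfolding Dv(1)[OF p] val[OF p] by (simp add: H1p_def H2p_def pr y_def v_def)
   ultimately show "D_t T y (t, x) = J (x, y (t, x), xD_x T y (t, x)) * v (t, x) \<and>
     D_t T v (t, x) + H1 (x, y (t, x), xD_x T y (t, x), v (t, x)) * L_op N l1 L0 T y (t, x)
     + H2 (x, y (t, x), xD_x T y (t, x), v (t, x), xD_x T v (t, x)) = 0" by simp
  qed
  \<comment> \<open>Initial values are prescribed for \<open>Q 0\<close> and \<open>Y 0\<close>
    only, but \<open>J\<close> also involves the \<open>x\<close>-derivative of \<open>y\<close>; it
    is recovered at \<open>t = 0\<close> from uniqueness of derivatives.\<close>
  have P5: "y (0, x) = ys (0, x) \<and> v (0, x) = vs (0, x)" if x: "x \<in> {0..1}" for x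
  proof -
   have zT: "0 \<in> {0..T}" using T by simp
   have i0: "Q 0 0 x = q0 0 x" "Y 0 0 x = u0 0 x" using ini x by blast+
   have "(q0 0 has_real_derivative q0 1 x) (at x within {0..1})" using derivsD[OF dq(1) x, of 0] by simp
   then have "(Q 0 0 has_real_derivative q0 1 x) (at x within {0..1})"
    by (rule has_field_derivative_transform_within[OF _ zero_less_one x]) (rule ini[rule_format, THEN conjunct1, symmetric])
   from DERIV_unique_01[OF xQ[OF zT x, of 0] this x] have i1: "Q 1 0 x = q0 1 x" by simp
   have "J (x, q0 0 x, x * q0 1 x) > 0"
    using O4D[OF O[of 0 x]] x T by (simp add: rect_def Jp_def zz_def pr i0 i1 del: One_nat_def)
   then have "v (0, x) = v0 0 x" using u0(3) x by (simp add: v_def vv_def ka_def Jp_def zz_def pr i0 i1 del: One_nat_def)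
   then show ?thesis using i0(1) by (simp add: y_def q0_def v0_def)
  qed
  show "solvable_from N l1 L0 J H1 H2 T U ys vs"
   by (rule exI[of _ y], rule exI[of _ v]) (intro conjI[OF P1] conjI[OF P2] conjI[OF P3] conjI[OF P4] ballI P5)
 qed
qed

end

lemma analytic_class_smooth:
 assumes "f \<in> analytic_class q U"
 shows "\<exists>I. open I \<and> {0..1} \<subseteq> I \<and> smooth (I \<times> cube U) f"
proof -
 obtain I where "open I" "{0..1} \<subseteq> I" "real_analytic_on f (I \<times> cube U)"
  using assms unfolding analytic_class_def mem_Collect_eq by (elim exE conjE)
 then show ?thesis using real_analytic_on_imp_smooth by (intro exI[of _ I] conjI)
qed

text \<open>All terms of the expansion have positive degree and vanish at the origin.\<close>

lemma analytic_class_zero: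
 assumes "f \<in> analytic_class q U" "q > 0" "(0 :: 'a::euclidean_space) \<in> cube U"
 shows "\<exists>I. open I \<and> {0..1} \<subseteq> I \<and> (\<forall>x\<in>I. f (x, 0 :: 'a) = 0)"
proof -
 obtain I a where I: "open I" "{0..1} \<subseteq> I"
  "\<forall>x\<in>I. \<forall>u\<in>cube U. ((\<lambda>k. a k x * mi_power u k) has_sum f (x, u)) {k \<in> multi_indices. q \<le> mi_degree k}"
  using assms(1) unfolding analytic_class_def mem_Collect_eq by (elim exE conjE)
 have "f (x, 0) = 0" if "x \<in> I" for x
 proof -
  have z: "a k x * mi_power (0 :: 'a) k = 0" if "k \<in> {k \<in> multi_indices. q \<le> mi_degree k}" for k
  proof -
   have "mi_degree k \<noteq> 0" using that assms(2) by simp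
   then obtain b where "b \<in> Basis" "k b \<noteq> 0" unfolding mi_degree_def by (meson sum.neutral)
   then have "mi_power (0 :: 'a) k = 0" unfolding mi_power_def by (intro prod_zero) (auto intro!: bexI[of _ b])
   then show ?thesis by simp
  qed
  have "((\<lambda>k. a k x * mi_power (0 :: 'a) k) has_sum f (x, 0)) {k \<in> multi_indices. q \<le> mi_degree k}"
   by (rule I(3)[rule_format, OF that assms(3)])
  then show ?thesis by (rule has_sum_unique) (rule has_sum_0[OF z])
 qed
 then show ?thesis using I(1,2) by (intro exI[of _ I] conjI ballI)
qed

lemma vanishes_as_x_to_1_smooth:
 assumes "vanishes_as_x_to_1 f"
 shows "\<exists>V \<Omega>. open V \<and> (1, 0) \<in> V \<and> smooth V \<Omega> \<and> (\<forall>p\<in>V. f p = (1 - fst p) * \<Omega> p)"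
proof -
 obtain V \<Omega> where "open V" "(1, 0) \<in> V" "real_analytic_on \<Omega> V" "\<forall>(x, u)\<in>V. f (x, u) = (1 - x) * \<Omega> (x, u)"
  using assms unfolding vanishes_as_x_to_1_def by (elim exE conjE)
 moreover from this(4) have "\<forall>p\<in>V. f p = (1 - fst p) * \<Omega> p" by auto
 ultimately show ?thesis using real_analytic_on_imp_smooth by (intro exI[of _ V] exI[of _ \<Omega>] conjI)
qed

theorem theorem1:
  fixes N T :: real and l\<^sub>1 L\<^sub>0 :: "real \<Rightarrow> real" and U :: "real set"
    and J :: "real \<times> real \<times> real \<Rightarrow> real"
    and H\<^sub>1 :: "real \<times> real \<times> real \<times> real \<Rightarrow> real"
    and H\<^sub>2 :: "real \<times> real \<times> real \<times> real \<times> real \<Rightarrow> real"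
  assumes N: "N > 4"
    and l1: "analytic_near_unit_interval l\<^sub>1"
    and L0: "analytic_near_unit_interval L\<^sub>0"
    and U: "0 \<in> interior U"
    and J: "J \<in> analytic_class 0 U"
    and H1: "H\<^sub>1 \<in> analytic_class 0 U"
    and H2: "H\<^sub>2 \<in> analytic_class 2 U"
    and i: "\<exists>I. open I \<and> {0..1} \<subseteq> I \<and>
              (\<forall>x\<in>I. H\<^sub>1 (x, 0, 0, 0) = inverse (J (x, 0, 0))) \<and>
              (\<exists>C>1. \<forall>x\<in>I. 1 / C < J (x, 0, 0) \<and> J (x, 0, 0) < C)"
    and ii_J: "vanishes_as_x_to_1
          (\<lambda>(x::real, y::real, Dy::real, D2y::real, v::real, Dv::real).
             deriv (\<lambda>z. J (x, y, z)) (x * Dy))"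
    and ii_H: "vanishes_as_x_to_1
          (\<lambda>(x::real, y::real, Dy::real, D2y::real, v::real, Dv::real).
             deriv (\<lambda>z. H\<^sub>1 (x, y, z, v)) (x * Dy) * L_sym N l\<^sub>1 L\<^sub>0 x y Dy D2y
             + deriv (\<lambda>z. H\<^sub>2 (x, y, z, v, x * Dv)) (x * Dy))"
    and ii_w: "vanishes_as_x_to_1
          (\<lambda>(x::real, y::real, Dy::real, D2y::real, v::real, Dv::real).
             deriv (\<lambda>w. H\<^sub>2 (x, y, x * Dy, v, w)) (x * Dv))"
    and T: "T > 0"
  shows "\<exists>\<delta>>0. \<exists>K::nat. \<forall>y\<^sub>s v\<^sub>s.
           C_infinity_on (rect T) y\<^sub>s \<and> C_infinity_on (rect T) v\<^sub>s \<and>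
           takes_values_in T U y\<^sub>s v\<^sub>s \<and> C_norm_le T K y\<^sub>s v\<^sub>s \<delta> \<longrightarrow>
           (\<exists>y v y\<^sub>d v\<^sub>d.
              C_infinity_on (rect T) y \<and> C_infinity_on (rect T) v \<and>
              takes_values_in T U y v \<and>
              solves N l\<^sub>1 L\<^sub>0 J H\<^sub>1 H\<^sub>2 T y v \<and>
              (\<forall>p\<in>rect T. y p = y\<^sub>s p + y\<^sub>d p \<and> v p = v\<^sub>s p + v\<^sub>d p) \<and>
              (\<forall>x\<in>{0..1}. y\<^sub>d (0, x) = 0 \<and> v\<^sub>d (0, x) = 0))"
proof -
 obtain I1 where I1: "open I1" "{0..1} \<subseteq> I1" "real_analytic_on l\<^sub>1 I1"
  using l1 unfolding analytic_near_unit_interval_def by (elim exE conjE)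
 obtain I2 where I2: "open I2" "{0..1} \<subseteq> I2" "real_analytic_on L\<^sub>0 I2"
  using L0 unfolding analytic_near_unit_interval_def by (elim exE conjE)
 obtain I3 where I3: "open I3" "{0..1} \<subseteq> I3" "smooth (I3 \<times> cube U) J" using analytic_class_smooth[OF J] by (elim exE conjE)
 obtain I4 where I4: "open I4" "{0..1} \<subseteq> I4" "smooth (I4 \<times> cube U) H\<^sub>1" using analytic_class_smooth[OF H1] by (elim exE conjE)
 obtain I5 where I5: "open I5" "{0..1} \<subseteq> I5" "smooth (I5 \<times> cube U) H\<^sub>2" using analytic_class_smooth[OF H2] by (elim exE conjE)
 have U0: "0 \<in> U" using U interior_subset by blast
 obtain I6 where I6: "open I6" "{0..1} \<subseteq> I6" "\<forall>x\<in>I6. H\<^sub>2 (x, 0) = 0"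
  using analytic_class_zero[OF H2] U0 by (auto simp: cube_def)
 obtain I7 c where I7: "open I7" "{0..1} \<subseteq> I7" "\<forall>x\<in>I7. H\<^sub>1 (x, 0, 0, 0) = inverse (J (x, 0, 0))"
  "c > 1" "\<forall>x\<in>I7. 1 / c < J (x, 0, 0) \<and> J (x, 0, 0) < c" using i by (elim exE conjE)
 from vanishes_as_x_to_1_smooth[OF ii_J]
 obtain V1 \<Omega>1 where V1: "open V1" "(1, 0) \<in> V1" "smooth V1 \<Omega>1" and E1: "\<forall>p\<in>V1. (\<lambda>(x::real, y::real, Dy::real, D2y::real, v::real, Dv::real). deriv (\<lambda>z. J (x, y, z)) (x * Dy)) p = (1 - fst p) * \<Omega>1 p"
  by (elim exE conjE)
 from vanishes_as_x_to_1_smooth[OF ii_H]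
 obtain V2 \<Omega>2 where V2: "open V2" "(1, 0) \<in> V2" "smooth V2 \<Omega>2" and E2: "\<forall>p\<in>V2. (\<lambda>(x::real, y::real, Dy::real, D2y::real, v::real, Dv::real). deriv (\<lambda>z. H\<^sub>1 (x, y, z, v)) (x * Dy) * L_sym N l\<^sub>1 L\<^sub>0 x y Dy D2y + deriv (\<lambda>z. H\<^sub>2 (x, y, z, v, x * Dv)) (x * Dy)) p = (1 - fst p) * \<Omega>2 p"
  by (elim exE conjE)
 from vanishes_as_x_to_1_smooth[OF ii_w]
 obtain V3 \<Omega>3 where V3: "open V3" "(1, 0) \<in> V3" "smooth V3 \<Omega>3" and E3: "\<forall>p\<in>V3. (\<lambda>(x::real, y::real, Dy::real, D2y::real, v::real, Dv::real). deriv (\<lambda>w. H\<^sub>2 (x, y, x * Dy, v, w)) (x * Dv)) p = (1 - fst p) * \<Omega>3 p"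
  by (elim exE conjE)
 define I where "I = I1 \<inter> I2 \<inter> I3 \<inter> I4 \<inter> I5 \<inter> I6 \<inter> I7"
 \<comment> \<open>The reduction works with an open set; values in the interior are values in
   \<open>U\<close>.\<close>
 define W where "W = interior U"
 have W: "open W" "0 \<in> W" "W \<subseteq> U" using U by (simp_all add: W_def interior_subset)
 have I: "open I" "{0..1} \<subseteq> I" unfolding I_def
  by (intro open_Int Int_greatest I1(1,2) I2(1,2) I3(1,2) I4(1,2) I5(1,2) I6(1,2) I7(1,2))+
 have sJ: "smooth (I \<times> W \<times> W) J"
  by (rule smooth_subset[OF I3(3)]) (use W(3) in \<open>auto simp: I_def cube_def Basis_prod_def\<close>)
 have sH1: "smooth (I \<times> W \<times> W \<times> W) H\<^sub>1"
  by (rule smooth_subset[OF I4(3)]) (use W(3) in \<open>auto simp: I_def cube_def Basis_prod_def\<close>)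
 have sH2: "smooth (I \<times> W \<times> W \<times> W \<times> W) H\<^sub>2"
  by (rule smooth_subset[OF I5(3)]) (use W(3) in \<open>auto simp: I_def cube_def Basis_prod_def\<close>)
 have o: "open (I \<times> W \<times> W)" "open (I \<times> W \<times> W \<times> W)" "open (I \<times> W \<times> W \<times> W \<times> W)"
  using I W by (auto intro!: open_Times)
 \<comment> \<open>The one-variable \<open>deriv\<close> in hypothesis (ii) is identified with the
   partial derivative \<open>pd\<close> used in the reduction, at points where the functions are
   smooth.\<close>
 have dJ: "deriv (\<lambda>z. J (x, y, z)) z = pd (0,0,1) J (x, y, z)" if "x \<in> I" "y \<in> W" "z \<in> W" for x y z
  by (rule DERIV_imp_deriv[OF smooth_chain3[OF o(1) sJ _ DERIV_const DERIV_const DERIV_ident, THEN DERIV_cong]]) (use that in auto)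
 have dH1: "deriv (\<lambda>z. H\<^sub>1 (x, y, z, v)) z = pd (0,0,1,0) H\<^sub>1 (x, y, z, v)" if "x \<in> I" "y \<in> W" "z \<in> W" "v \<in> W" for x y z v
  by (rule DERIV_imp_deriv[OF smooth_chain4[OF o(2) sH1 _ DERIV_const DERIV_const DERIV_ident DERIV_const, THEN DERIV_cong]]) (use that in auto)
 have dH2: "deriv (\<lambda>z. H\<^sub>2 (x, y, z, v, w)) z = pd (0,0,1,0) H\<^sub>2 (x, y, z, v, w)" if "x \<in> I" "y \<in> W" "z \<in> W" "v \<in> W" "w \<in> W" for x y z v w
  by (rule DERIV_imp_deriv[OF smooth_chain5[OF o(3) sH2 _ DERIV_const DERIV_const DERIV_ident DERIV_const DERIV_const, THEN DERIV_cong]]) (use that in auto)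
 have dH2w: "deriv (\<lambda>w. H\<^sub>2 (x, y, z, v, w)) w = pd (0,0,0,0,1) H\<^sub>2 (x, y, z, v, w)" if "x \<in> I" "y \<in> W" "z \<in> W" "v \<in> W" "w \<in> W" for x y z v w
  by (rule DERIV_imp_deriv[OF smooth_chain5[OF o(3) sH2 _ DERIV_const DERIV_const DERIV_const DERIV_const DERIV_ident, THEN DERIV_cong]]) (use that in auto)
 have Jp: "0 < J (x, 0, 0)" if "x \<in> I" for x
 proof -
  have "0 < 1 / c" "1 / c < J (x, 0, 0)" using I7(4,5) that by (auto simp: I_def)
  then show ?thesis by linarith
 qed
 interpret red: reduction N l\<^sub>1 L\<^sub>0 I W J H\<^sub>1 H\<^sub>2 "V1 \<inter> V2 \<inter> V3" \<Omega>1 \<Omega>2 \<Omega>3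
 proof
  show "smooth I l\<^sub>1" "smooth I L\<^sub>0" by (rule smooth_subset[OF real_analytic_on_imp_smooth[OF I1(3)]] smooth_subset[OF real_analytic_on_imp_smooth[OF I2(3)]]; force simp: I_def)+
  show "smooth (V1 \<inter> V2 \<inter> V3) \<Omega>1" "smooth (V1 \<inter> V2 \<inter> V3) \<Omega>2" "smooth (V1 \<inter> V2 \<inter> V3) \<Omega>3"
   by (rule smooth_subset[OF V1(3)] smooth_subset[OF V2(3)] smooth_subset[OF V3(3)]; force)+
  show "H\<^sub>2 (x, 0, 0, 0, 0) = 0" if "x \<in> I" for x using I6(3) that by (simp add: I_def zero_prod_def)
  show "0 < J (x, 0, 0)" if "x \<in> I" for x by (rule Jp[OF that])
  show "0 < H\<^sub>1 (x, 0, 0, 0)" if "x \<in> I" for x using I7(3) Jp[OF that] that by (simp add: I_def)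
  show "pd (0,0,1) J (x, y, x * y1) = (1 - x) * \<Omega>1 (x, y, y1, y2, v, v1)"
   if "(x, y, y1, y2, v, v1) \<in> V1 \<inter> V2 \<inter> V3" "x \<in> I" "y \<in> W" "x * y1 \<in> W" for x y y1 y2 v v1
   using E1[rule_format, of "(x, y, y1, y2, v, v1)"] that dJ by simp
  show "pd (0,0,1,0) H\<^sub>1 (x, y, x * y1, v) * L_sym N l\<^sub>1 L\<^sub>0 x y y1 y2 + pd (0,0,1,0) H\<^sub>2 (x, y, x * y1, v, x * v1) = (1 - x) * \<Omega>2 (x, y, y1, y2, v, v1)"
   if "(x, y, y1, y2, v, v1) \<in> V1 \<inter> V2 \<inter> V3" "x \<in> I" "y \<in> W" "x * y1 \<in> W" "v \<in> W" "x * v1 \<in> W" for x y y1 y2 v v1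
   using E2[rule_format, of "(x, y, y1, y2, v, v1)"] that dH1 dH2 by simp
  show "pd (0,0,0,0,1) H\<^sub>2 (x, y, x * y1, v, x * v1) = (1 - x) * \<Omega>3 (x, y, y1, y2, v, v1)"
   if "(x, y, y1, y2, v, v1) \<in> V1 \<inter> V2 \<inter> V3" "x \<in> I" "y \<in> W" "x * y1 \<in> W" "v \<in> W" "x * v1 \<in> W" for x y y1 y2 v v1
   using E3[rule_format, of "(x, y, y1, y2, v, v1)"] that dH2w by simp
 qed (rule I W sJ sH1 sH2 open_Int IntI V1(1,2) V2(1,2) V3(1,2) | assumption)+
 obtain \<delta> K where \<delta>: "\<delta> > 0" and K: "\<forall>ys vs. C_infinity_on (rect T) ys \<longrightarrow> C_infinity_on (rect T) vs \<longrightarrow> C_norm_le T K ys vs \<delta> \<longrightarrow>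
  (solvable_from N l\<^sub>1 L\<^sub>0 J H\<^sub>1 H\<^sub>2 T W ys vs)"
  using red.solvable[OF N T] by (elim exE conjE)
 show ?thesis
 proof (rule exI[of _ \<delta>], rule conjI[OF \<delta>], rule exI[of _ K], intro allI impI, elim conjE)
  fix y\<^sub>s v\<^sub>s assume s: "C_infinity_on (rect T) y\<^sub>s" "C_infinity_on (rect T) v\<^sub>s" "C_norm_le T K y\<^sub>s v\<^sub>s \<delta>"
  obtain y v where yv: "C_infinity_on (rect T) y" "C_infinity_on (rect T) v" "takes_values_in T W y v" "solves N l\<^sub>1 L\<^sub>0 J H\<^sub>1 H\<^sub>2 T y v"
   "\<forall>x\<in>{0..1}. y (0, x) = y\<^sub>s (0, x) \<and> v (0, x) = v\<^sub>s (0, x)"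
   using K[THEN spec, THEN spec, THEN mp, THEN mp, THEN mp, OF s] by (elim exE conjE)
  have tv: "takes_values_in T U y v" using yv(3) W(3) unfolding takes_values_in_def by blast
  \<comment> \<open>The perturbations are the differences to the given functions, so the
    decomposition holds by construction and only the initial values have to be compared.\<close>
  show "\<exists>y v y\<^sub>d v\<^sub>d. C_infinity_on (rect T) y \<and> C_infinity_on (rect T) v \<and> takes_values_in T U y v \<and> solves N l\<^sub>1 L\<^sub>0 J H\<^sub>1 H\<^sub>2 T y v \<and>
    (\<forall>p\<in>rect T. y p = y\<^sub>s p + y\<^sub>d p \<and> v p = v\<^sub>s p + v\<^sub>d p) \<and> (\<forall>x\<in>{0..1}. y\<^sub>d (0, x) = 0 \<and> v\<^sub>d (0, x) = 0)"
   by (rule exI[of _ y], rule exI[of _ v], rule exI[of _ "\<lambda>p. y p - y\<^sub>s p"], rule exI[of _ "\<lambda>p. v p - v\<^sub>s p"],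
     intro conjI[OF yv(1)] conjI[OF yv(2)] conjI[OF tv] conjI[OF yv(4)]) (use yv(5) in simp)
 qed
qed

end
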